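(* Let $f:\mathbb{D}\to\mathbb{C}$ be quasiregular with $f(0)=0$. Suppose that for some $p,q>0$ there is a constant $C$ such that for all sufficiently small $\epsilon>0$, $$\int_{\mathbb{D}(0,\epsilon)}|f(z)|^p\,dm(z)\le C\,\epsilon^{2+q}.$$ Then the family of quasiregular maps of $\mathbb{D}$ $$\mathcal{F}=\left\{z\mapsto\frac{1}{\lambda^{q/p}}f(\lambda z):\lambda\in\mathbb{D}\setminus\{0\}\right\}$$ is precompact: every sequence from $\mathcal{F}$ contains a subsequence converging locally uniformly in $\mathbb{D}$ to a quasiregular mapping, or to a constant (possibly $\infty$).
   Context: $\mathbb{D}=\{z\in\mathbb{C}:|z|<1\}$, $\mathbb{D}(0,\epsilon)=\{z\in\mathbb{C}:|z|<\epsilon\}$, and $m$ is Lebesgue area measure. For each $\lambda\in\mathbb{D}\setminus\{0\}$, $\lambda^{q/p}$ denotes a chosen value of the complex power (so $|\lambda^{q/p}|=|\lambda|^{q/p}$). A mapping $f$ of a planar domain into $\mathbb{C}$ is quasiregular if, for some $K\ge1$, it is continuous, belongs to $W^{1,2}_{\mathrm{loc}}$, and satisfies $|f_{\bar z}|\le\frac{K-1}{K+1}|f_z|$ almost everywhere, where $f_z=\frac12(f_x-if_y)$, $f_{\bar z}=\frac12(f_x+if_y)$. *)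

theory Defs
  imports "HOL-Analysis.Analysis"
begin

primrec times_cont_diff :: "nat \<Rightarrow> (complex \<Rightarrow> real) \<Rightarrow> bool" where
  "times_cont_diff 0 \<phi> \<longleftrightarrow> continuous_on UNIV \<phi>"
| "times_cont_diff (Suc k) \<phi> \<longleftrightarrow>
     (\<forall>z. \<phi> differentiable (at z)) \<and>
     (\<forall>v. times_cont_diff k (\<lambda>z. frechet_derivative \<phi> (at z) v))"

definition test_function :: "complex set \<Rightarrow> (complex \<Rightarrow> real) \<Rightarrow> bool" where
  "test_function \<Omega> \<phi> \<longleftrightarrow>
     (\<forall>k. times_cont_diff k \<phi>) \<and>
     compact (closure {z. \<phi> z \<noteq> 0}) \<and> closure {z. \<phi> z \<noteq> 0} \<subseteq> \<Omega>"

definition L2_loc :: "complex set \<Rightarrow> (complex \<Rightarrow> complex) \<Rightarrow> bool" where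
  "L2_loc \<Omega> g \<longleftrightarrow>
     set_borel_measurable lebesgue \<Omega> g \<and>
     (\<forall>K. compact K \<and> K \<subseteq> \<Omega> \<longrightarrow> set_integrable lebesgue K (\<lambda>z. (norm (g z))\<^sup>2))"

text \<open>\<open>g\<close> is the weak derivative of \<open>f\<close> in the direction \<open>v\<close>; the directions
  \<open>1\<close> and \<open>\<i>\<close> give the weak partial derivatives in \<open>x\<close> and \<open>y\<close>. The integrals are
  Bochner integrals, so this is meaningful only for locally integrable \<open>f\<close> and \<open>g\<close>;
  it is used below only together with \<open>L2_loc\<close>.\<close>

definition weak_deriv ::
    "complex set \<Rightarrow> complex \<Rightarrow> (complex \<Rightarrow> complex) \<Rightarrow> (complex \<Rightarrow> complex) \<Rightarrow> bool" where
  "weak_deriv \<Omega> v f g \<longleftrightarrow>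
     (\<forall>\<phi>. test_function \<Omega> \<phi> \<longrightarrow>
        (LINT z:\<Omega>|lebesgue. frechet_derivative \<phi> (at z) v *\<^sub>R f z) =
        - (LINT z:\<Omega>|lebesgue. \<phi> z *\<^sub>R g z))"

text \<open>\<open>f\<close> belongs to $W^{1,2}_{loc}$ with weak partial derivatives \<open>fx\<close> and \<open>fy\<close>,
  which are determined only up to null sets.\<close>

definition W12_loc ::
    "complex set \<Rightarrow> (complex \<Rightarrow> complex) \<Rightarrow> (complex \<Rightarrow> complex) \<Rightarrow> (complex \<Rightarrow> complex) \<Rightarrow> bool" where
  "W12_loc \<Omega> f fx fy \<longleftrightarrow>
     L2_loc \<Omega> f \<and> L2_loc \<Omega> fx \<and> L2_loc \<Omega> fy \<and>
     weak_deriv \<Omega> 1 f fx \<and> weak_deriv \<Omega> \<i> f fy"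

definition K_quasiregular_on :: "real \<Rightarrow> complex set \<Rightarrow> (complex \<Rightarrow> complex) \<Rightarrow> bool" where
  "K_quasiregular_on K \<Omega> f \<longleftrightarrow>
     open \<Omega> \<and> connected \<Omega> \<and> \<Omega> \<noteq> {} \<and> continuous_on \<Omega> f \<and>
     (\<exists>fx fy. W12_loc \<Omega> f fx fy \<and>
        (AE z in lebesgue. z \<in> \<Omega> \<longrightarrow>
           norm ((fx z + \<i> * fy z) / 2) \<le> (K - 1) / (K + 1) * norm ((fx z - \<i> * fy z) / 2)))"

definition quasiregular_on :: "complex set \<Rightarrow> (complex \<Rightarrow> complex) \<Rightarrow> bool" where
  "quasiregular_on \<Omega> f \<longleftrightarrow> (\<exists>K\<ge>1. K_quasiregular_on K \<Omega> f)"

definition locally_uniform_limit ::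
    "complex set \<Rightarrow> (nat \<Rightarrow> complex \<Rightarrow> complex) \<Rightarrow> (complex \<Rightarrow> complex) \<Rightarrow> bool" where
  "locally_uniform_limit \<Omega> F h \<longleftrightarrow>
     (\<forall>K. compact K \<and> K \<subseteq> \<Omega> \<longrightarrow> uniform_limit K F h sequentially)"

definition locally_uniform_infinity ::
    "complex set \<Rightarrow> (nat \<Rightarrow> complex \<Rightarrow> complex) \<Rightarrow> bool" where
  "locally_uniform_infinity \<Omega> F \<longleftrightarrow>
     (\<forall>K. compact K \<and> K \<subseteq> \<Omega> \<longrightarrow>
        (\<forall>M::real. \<forall>\<^sub>F n in sequentially. \<forall>z\<in>K. M < norm (F n z)))"

definition precompact_quasiregular :: "complex set \<Rightarrow> (complex \<Rightarrow> complex) set \<Rightarrow> bool" where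
  "precompact_quasiregular \<Omega> \<F> \<longleftrightarrow>
     (\<forall>F. (\<forall>n. F n \<in> \<F>) \<longrightarrow>
        (\<exists>r::nat \<Rightarrow> nat. strict_mono r \<and>
           ((\<exists>h. quasiregular_on \<Omega> h \<and> locally_uniform_limit \<Omega> (F \<circ> r) h) \<or>
            (\<exists>c. locally_uniform_limit \<Omega> (F \<circ> r) (\<lambda>_. c)) \<or>
            locally_uniform_infinity \<Omega> (F \<circ> r))))"

definition cpow_values :: "complex \<Rightarrow> real \<Rightarrow> complex set" where
  "cpow_values z a = {exp (of_real a * w) | w. exp w = z}"

end

(* A map is K-quasiregular iff |f_x|^2 + |f_y|^2 <= (K + 1/K) J_f almost everywhere. Since the
   Jacobian is a null Lagrangian, testing with eta^2 (1+|f|^2)^(p/2-1) f yields a Caccioppoli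
   inequality that bounds the weighted energy of f by its local L^p norm, for every p > 0, and
   testing with max(0, Re f - M) yields the maximum principle. Hence the oscillation of f on a
   square is attained on the boundary, and averaging over concentric squares gives a local
   sup bound and a logarithmic modulus of continuity, both depending only on K, p and the local
   L^p norm. A change of variables turns the growth hypothesis into an L^p bound for
   lambda^(-q/p) f(lambda z) that is uniform in lambda, so Arzela-Ascoli applies to the family.
   The distortion inequality passes to a locally uniform limit because the energy is convex and
   the integrated Jacobian is affine in the gradient once one factor converges uniformly. *)

theory Submission
  imports Defs "HOL-Complex_Analysis.Great_Picard" "HOL-Library.Diagonal_Subsequence"
begin

section \<open>Differential calculus and test functions\<close>

text \<open>The estimates must be uniform over maps of which only an L^p norm is controlled,
  possibly with p < 1. The weight (1+|w|^2)^(p/2-1) meets this: multiplied by w it gives a planar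
  field whose divergence is at least min(2,p) times the weight, so the Caccioppoli constant is
  finite for every p > 0. Sobolev functions are never differentiated pointwise: an integral identity
  is proved for C2 functions, where it comes from the equality of mixed partials, and is then
  carried to limits that are uniform for the functions and L2 for the gradients. Both mollified
  functions and sequences of quasiregular maps come only with bounded L2 gradients; strong
  convergence is produced by iterated midpoints of tails, so whatever is to survive must be stable
  under midpoints. The Jacobian is quadratic and not convex, which is the obstacle behind the
  closure argument. Squares are used in place of discs because their sides are parallel to the axes:
  the oscillation on the boundary is then controlled by one partial derivative at a time and Fubini
  applies in Cartesian coordinates.\<close>

definition C1p :: "(complex \<Rightarrow> 'a::real_normed_vector) \<Rightarrow> (complex \<Rightarrow> 'a) \<Rightarrow> (complex \<Rightarrow> 'a) \<Rightarrow> bool" where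
  "C1p g gx gy \<longleftrightarrow>
     (\<forall>z. (g has_derivative (\<lambda>h. Re h *\<^sub>R gx z + Im h *\<^sub>R gy z)) (at z)) \<and>
     continuous_on UNIV gx \<and> continuous_on UNIV gy"

text \<open>The function \<open>gxy\<close> occurs twice, as the y-derivative of \<open>gx\<close>
  and as the x-derivative of \<open>gy\<close>. This equality of the mixed partials is the source of
  the cancellation in \<open>integral_det_zero\<close>.\<close>

definition C2p :: "(complex \<Rightarrow> 'a::real_normed_vector) \<Rightarrow> (complex \<Rightarrow> 'a) \<Rightarrow> (complex \<Rightarrow> 'a) \<Rightarrow> bool" where
  "C2p g gx gy \<longleftrightarrow> C1p g gx gy \<and> (\<exists>gxx gxy gyy. C1p gx gxx gxy \<and> C1p gy gxy gyy)"

lemma C1p_D: "C1p g gx gy \<Longrightarrow> (g has_derivative (\<lambda>h. Re h *\<^sub>R gx z + Im h *\<^sub>R gy z)) (at z)"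
  by (simp add: C1p_def)

lemma C1p_continuous:
  assumes "C1p g gx gy"
  shows "continuous_on S g" "continuous_on S gx" "continuous_on S gy"
proof -
  have "continuous_on UNIV g"
    by (meson C1p_D assms continuous_at_imp_continuous_on has_derivative_continuous)
  then show "continuous_on S g" "continuous_on S gx" "continuous_on S gy"
    using assms continuous_on_subset unfolding C1p_def by blast+
qed

lemma C1p_const: "C1p (\<lambda>_. c) (\<lambda>_. 0) (\<lambda>_. 0)"
  by (simp add: C1p_def)

lemma C1p_Re: "C1p Re (\<lambda>_. 1) (\<lambda>_. 0)" and C1p_Im: "C1p Im (\<lambda>_. 0) (\<lambda>_. 1)"
  and C1p_id: "C1p (\<lambda>z. z) (\<lambda>_. 1) (\<lambda>_. \<i>)"
proof -
  have *: "(\<lambda>h. Re h *\<^sub>R 1 + Im h *\<^sub>R \<i>) = (\<lambda>h. h)"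
    by (auto simp: complex_eq_iff fun_eq_iff)
  show "C1p Re (\<lambda>_. 1) (\<lambda>_. 0)" "C1p Im (\<lambda>_. 0) (\<lambda>_. 1)"
    by (auto simp: C1p_def intro!: derivative_eq_intros)
  show "C1p (\<lambda>z. z) (\<lambda>_. 1) (\<lambda>_. \<i>)"
    by (simp add: C1p_def *)
qed

lemma C1p_add:
  assumes "C1p f fx fy" "C1p g gx gy"
  shows "C1p (\<lambda>z. f z + g z) (\<lambda>z. fx z + gx z) (\<lambda>z. fy z + gy z)"
  unfolding C1p_def
proof (intro conjI allI)
  fix z
  show "((\<lambda>z. f z + g z) has_derivative (\<lambda>h. Re h *\<^sub>R (fx z + gx z) + Im h *\<^sub>R (fy z + gy z))) (at z)"
    by (rule has_derivative_eq_rhs[OF has_derivative_add[OF C1p_D[OF assms(1)] C1p_D[OF assms(2)]]])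
       (simp add: algebra_simps)
qed (use C1p_continuous[OF assms(1)] C1p_continuous[OF assms(2)] in \<open>auto intro!: continuous_intros\<close>)

lemma (in bounded_bilinear) C1p_prod:
  assumes "C1p f fx fy" "C1p g gx gy"
  shows "C1p (\<lambda>z. prod (f z) (g z)) (\<lambda>z. prod (fx z) (g z) + prod (f z) (gx z))
           (\<lambda>z. prod (fy z) (g z) + prod (f z) (gy z))"
  unfolding C1p_def
proof (intro conjI allI)
  fix z
  show "((\<lambda>z. prod (f z) (g z)) has_derivative
     (\<lambda>h. Re h *\<^sub>R (prod (fx z) (g z) + prod (f z) (gx z)) + Im h *\<^sub>R (prod (fy z) (g z) + prod (f z) (gy z)))) (at z)"
    by (rule has_derivative_eq_rhs[OF FDERIV[OF C1p_D[OF assms(1)] C1p_D[OF assms(2)]]])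
       (simp add: algebra_simps add_left add_right scaleR_left scaleR_right)
qed (use C1p_continuous[OF assms(1)] C1p_continuous[OF assms(2)] in \<open>auto intro!: continuous_on_add continuous_on\<close>)

lemmas C1p_mult = bounded_bilinear.C1p_prod[OF bounded_bilinear_mult]
lemmas C1p_scaleR = bounded_bilinear.C1p_prod[OF bounded_bilinear_scaleR]

lemma (in bounded_linear) C1p_apply:
  assumes "C1p g gx gy"
  shows "C1p (\<lambda>z. f (g z)) (\<lambda>z. f (gx z)) (\<lambda>z. f (gy z))"
  unfolding C1p_def
proof (intro conjI allI)
  fix z
  show "((\<lambda>z. f (g z)) has_derivative (\<lambda>h. Re h *\<^sub>R f (gx z) + Im h *\<^sub>R f (gy z))) (at z)"
    by (rule has_derivative_eq_rhs[OF has_derivative[OF C1p_D[OF assms]]]) (simp add: add scaleR)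
qed (use C1p_continuous[OF assms] in \<open>auto intro!: continuous_on\<close>)

lemma C1p_real_compose_at:
  assumes "\<And>z. (s has_real_derivative s' (f z)) (at (f z))" "continuous_on UNIV (\<lambda>z. s' (f z))" "C1p f fx fy"
  shows "C1p (\<lambda>z. s (f z)) (\<lambda>z. s' (f z) * fx z) (\<lambda>z. s' (f z) * fy z)"
  unfolding C1p_def
proof (intro conjI allI)
  fix z
  show "((\<lambda>z. s (f z)) has_derivative (\<lambda>h. Re h *\<^sub>R (s' (f z) * fx z) + Im h *\<^sub>R (s' (f z) * fy z))) (at z)"
    by (rule has_derivative_eq_rhs[OF DERIV_compose_FDERIV[OF assms(1) C1p_D[OF assms(3)]]])
       (simp add: algebra_simps)
qed (use C1p_continuous[OF assms(3)] in \<open>auto intro!: continuous_intros assms(2)\<close>)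

lemma C1p_real_compose:
  assumes "\<And>t. (s has_real_derivative s' t) (at t)" "continuous_on UNIV s'" "C1p f fx fy"
  shows "C1p (\<lambda>z. s (f z)) (\<lambda>z. s' (f z) * fx z) (\<lambda>z. s' (f z) * fy z)"
  by (rule C1p_real_compose_at[of s s' f, OF assms(1) _ assms(3)])
     (intro continuous_on_compose2[OF assms(2) C1p_continuous(1)[OF assms(3)]] subset_UNIV)

lemma C1p_compose:
  assumes "C1p A Ax Ay" "C1p f fx fy"
  shows "C1p (\<lambda>z. A (f z)) (\<lambda>z. Re (fx z) *\<^sub>R Ax (f z) + Im (fx z) *\<^sub>R Ay (f z))
           (\<lambda>z. Re (fy z) *\<^sub>R Ax (f z) + Im (fy z) *\<^sub>R Ay (f z))"
  unfolding C1p_def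
proof (intro conjI allI)
  fix z
  show "((\<lambda>z. A (f z)) has_derivative (\<lambda>h. Re h *\<^sub>R (Re (fx z) *\<^sub>R Ax (f z) + Im (fx z) *\<^sub>R Ay (f z))
      + Im h *\<^sub>R (Re (fy z) *\<^sub>R Ax (f z) + Im (fy z) *\<^sub>R Ay (f z)))) (at z)"
    by (rule has_derivative_eq_rhs[OF has_derivative_compose[OF C1p_D[OF assms(2)] C1p_D[OF assms(1)]]])
       (simp add: algebra_simps)
qed (use C1p_continuous[OF assms(2)] in
     \<open>auto intro!: continuous_intros continuous_on_compose2[OF C1p_continuous(2)[OF assms(1)]]
        continuous_on_compose2[OF C1p_continuous(3)[OF assms(1)]]\<close>)

lemma C1p_cong:
  assumes "C1p f fx fy" "\<And>z. f z = g z" "\<And>z. fx z = gx z" "\<And>z. fy z = gy z"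
  shows "C1p g gx gy"
proof -
  have "f = g" "fx = gx" "fy = gy" using assms by auto
  with assms(1) show ?thesis by simp
qed

lemma C1p_zero_outside:
  assumes "C1p g gx gy" "closed K" "\<And>z. z \<notin> K \<Longrightarrow> g z = 0" "z \<notin> K"
  shows "gx z = 0" "gy z = 0"
proof -
  have "(g has_derivative (\<lambda>_. 0)) (at z)"
  proof (rule has_derivative_transform_within_open[where s="-K" and f="\<lambda>_. 0"])
    show "((\<lambda>_. 0) has_derivative (\<lambda>_. 0)) (at z)" by simp
    show "open (-K)" using assms by auto
  qed (use assms in auto)
  then have "(\<lambda>h. Re h *\<^sub>R gx z + Im h *\<^sub>R gy z) = (\<lambda>_. 0)"
    using C1p_D[OF assms(1)] has_derivative_unique by blast
  from fun_cong[OF this, of 1] fun_cong[OF this, of \<i>]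
  show "gx z = 0" "gy z = 0" by auto
qed

lemma C2p_C1p: "C2p g gx gy \<Longrightarrow> C1p g gx gy"
  by (simp add: C2p_def)

lemma C2p_midpoint:
  assumes "C2p f fx fy" "C2p g gx gy"
  shows "C2p (\<lambda>z. (1/2) *\<^sub>R (f z + g z)) (\<lambda>z. (1/2) *\<^sub>R (fx z + gx z)) (\<lambda>z. (1/2) *\<^sub>R (fy z + gy z))"
proof -
  have *: "C1p (\<lambda>z. (1/2) *\<^sub>R (f z + g z)) (\<lambda>z. (1/2) *\<^sub>R (fx z + gx z)) (\<lambda>z. (1/2) *\<^sub>R (fy z + gy z))"
    if "C1p f fx fy" "C1p g gx gy" for f g fx fy gx gy :: "complex \<Rightarrow> 'a"
    by (rule bounded_linear.C1p_apply[OF bounded_linear_scaleR_right C1p_add[OF that]])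
  from assms show ?thesis unfolding C2p_def by (blast intro: *)
qed

section \<open>Smooth compactly supported functions\<close>

definition flat :: "nat \<Rightarrow> real \<Rightarrow> real" where
  "flat n t = (if t > 0 then inverse t ^ n * exp (- inverse t) else 0)"

lemma flat_tendsto_0: "(flat n \<longlongrightarrow> 0) (at 0)"
proof -
  have "((\<lambda>t. inverse t ^ n * exp (- inverse t)) \<longlongrightarrow> 0) (at_right (0::real))"
    using filterlim_compose[OF tendsto_power_div_exp_0 filterlim_inverse_at_top_right, of n]
    by (simp add: exp_minus field_simps)
  then have "(flat n \<longlongrightarrow> 0) (at_right 0)"
    by (rule Lim_transform_eventually) (auto simp: flat_def eventually_at_filter)
  moreover have "(flat n \<longlongrightarrow> 0) (at_left 0)"
    by (rule tendsto_eventually) (auto simp: flat_def eventually_at_filter)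
  ultimately show ?thesis
    by (simp add: filterlim_split_at)
qed

text \<open>The powers of 1/t are built into \<open>flat\<close> so that the family is closed under
  differentiation up to linear combinations; \<open>flat 0\<close> is the classical exp(-1/t). At 0
  the difference quotient of \<open>flat n\<close> is \<open>flat (Suc n)\<close>, which tends to
  0.\<close>

lemma DERIV_flat: "(flat n has_real_derivative flat (n+2) t - real n * flat (n+1) t) (at t)"
proof -
  consider "t > 0" | "t < 0" | "t = 0" by linarith
  then show ?thesis
  proof cases
    case 1
    have d1: "(inverse has_real_derivative - (inverse t ^ 2)) (at t)"
      using DERIV_inverse[of t] 1 by (simp add: power2_eq_square)
    have d2: "((\<lambda>t. inverse t ^ n) has_real_derivative real n * (- (inverse t ^ 2) * inverse t ^ (n - Suc 0))) (at t)"
      by (rule DERIV_power[OF d1])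
    have d3: "((\<lambda>t. exp (- inverse t)) has_real_derivative exp (- inverse t) * (- (- (inverse t ^ 2)))) (at t)"
      by (rule DERIV_fun_exp[OF DERIV_minus[OF d1]])
    have e: "real n * (- (inverse t ^ 2) * inverse t ^ (n - Suc 0)) = - real n * inverse t ^ (n + 1)"
      by (cases n) (simp_all add: power2_eq_square algebra_simps)
    have "((\<lambda>t. inverse t ^ n * exp (- inverse t)) has_real_derivative
       flat (n+2) t - real n * flat (n+1) t) (at t)"
      using DERIV_mult[OF d2 d3] 1 unfolding e
      by (simp add: flat_def power_add power2_eq_square mult_ac)
    then show ?thesis
      by (rule has_field_derivative_transform_within_open[where S="{0<..}"]) (use 1 in \<open>auto simp: flat_def\<close>)
  next
    case 2
    have "((\<lambda>t. 0) has_real_derivative 0) (at t)" by simp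
    then have "(flat n has_real_derivative 0) (at t)"
      by (rule has_field_derivative_transform_within_open[where S="{..<0}"]) (use 2 in \<open>auto simp: flat_def\<close>)
    then show ?thesis using 2 by (simp add: flat_def)
  next
    case 3
    have "(\<lambda>h. (flat n (0 + h) - flat n 0) / h) = flat (Suc n)"
      by (auto simp: flat_def fun_eq_iff field_simps)
    then have "(flat n has_real_derivative 0) (at 0)"
      using flat_tendsto_0[of "Suc n"] by (simp add: DERIV_def)
    then show ?thesis using 3 by (simp add: flat_def)
  qed
qed

text \<open>A class closed under partial derivatives, so that smoothness of all orders is a single
  induction. The rule \<open>exp\<close> is there for the functions 1 - exp(-m e) with a nonnegative
  member e: as m grows they increase to the indicator of the set where e is positive, and they
  vanish off that set.\<close>

inductive_set bump_alg :: "(complex \<Rightarrow> real) set" where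
  flat: "(\<lambda>z. flat n (c + a * Re z + b * Im z)) \<in> bump_alg"
| const: "(\<lambda>z. c) \<in> bump_alg"
| add: "f \<in> bump_alg \<Longrightarrow> g \<in> bump_alg \<Longrightarrow> (\<lambda>z. f z + g z) \<in> bump_alg"
| mult: "f \<in> bump_alg \<Longrightarrow> g \<in> bump_alg \<Longrightarrow> (\<lambda>z. f z * g z) \<in> bump_alg"
| exp: "f \<in> bump_alg \<Longrightarrow> (\<lambda>z. exp (f z)) \<in> bump_alg"

lemma C1p_flat: "C1p (\<lambda>z. flat n (c + a * Re z + b * Im z))
     (\<lambda>z. (flat (n+2) (c + a * Re z + b * Im z) + (- real n) * flat (n+1) (c + a * Re z + b * Im z)) * a)
     (\<lambda>z. (flat (n+2) (c + a * Re z + b * Im z) + (- real n) * flat (n+1) (c + a * Re z + b * Im z)) * b)"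
proof -
  have cont: "continuous_on UNIV (flat n)" for n
    using DERIV_isCont[OF DERIV_flat] by (simp add: continuous_at_imp_continuous_on)
  have 1: "C1p (\<lambda>z. c + a * Re z + b * Im z) (\<lambda>_. a) (\<lambda>_. b)"
    by (rule C1p_cong[OF C1p_add[OF C1p_add[OF C1p_const[of c] C1p_mult[OF C1p_const[of a] C1p_Re]]
          C1p_mult[OF C1p_const[of b] C1p_Im]]]) auto
  define s' where "s' = (\<lambda>t. flat (n+2) t - real n * flat (n+1) t)"
  have 2: "(flat n has_real_derivative s' t) (at t)" for t
    unfolding s'_def by (rule DERIV_flat)
  have 3: "continuous_on UNIV s'"
    unfolding s'_def by (intro continuous_on_diff continuous_on_mult continuous_on_const cont)
  have 4: "s' t = flat (n+2) t + (- real n) * flat (n+1) t" for t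
    by (simp add: s'_def)
  show ?thesis
    unfolding 4[symmetric] by (rule C1p_real_compose[OF 2 3 1])
qed

lemma bump_alg_C2I:
  assumes "C1p f fx fy" "C1p fx fxx fxy" "C1p fy fxy fyy"
    and "fx \<in> bump_alg" "fy \<in> bump_alg" "fxx \<in> bump_alg" "fxy \<in> bump_alg" "fyy \<in> bump_alg"
  shows "\<exists>fx\<in>bump_alg. \<exists>fy\<in>bump_alg. \<exists>fxx\<in>bump_alg. \<exists>fxy\<in>bump_alg. \<exists>fyy\<in>bump_alg.
           C1p f fx fy \<and> C1p fx fxx fxy \<and> C1p fy fxy fyy"
  by (rule bexI[where x=fx], rule bexI[where x=fy], rule bexI[where x=fxx], rule bexI[where x=fxy],
      rule bexI[where x=fyy], intro conjI) (rule assms)+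

text \<open>That the derivatives lie in the algebra again lets \<open>bump_alg_smooth\<close>
  iterate the statement. The second order is recorded because mollifiers have to satisfy
  \<open>C2p\<close>.\<close>

lemma bump_alg_C2:
  assumes "f \<in> bump_alg"
  shows "\<exists>fx\<in>bump_alg. \<exists>fy\<in>bump_alg. \<exists>fxx\<in>bump_alg. \<exists>fxy\<in>bump_alg. \<exists>fyy\<in>bump_alg.
           C1p f fx fy \<and> C1p fx fxx fxy \<and> C1p fy fxy fyy"
  using assms
proof induction
  case (flat n c a b)
  define F where "F n = (\<lambda>z. flat n (c + a * Re z + b * Im z))" for n
  define G where "G n = (\<lambda>z. F (n+2) z + (- real n) * F (n+1) z)" for n
  have F: "C1p (F n) (\<lambda>z. G n z * a) (\<lambda>z. G n z * b)" for n
    unfolding F_def G_def using C1p_flat by simp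
  define H where "H = (\<lambda>z. G (n+2) z + (- real n) * G (n+1) z)"
  have G: "C1p (G n) (\<lambda>z. H z * a) (\<lambda>z. H z * b)"
    unfolding H_def
    by (rule C1p_cong[OF C1p_add[OF F[of "n+2"] C1p_mult[OF C1p_const[of "- real n"] F[of "n+1"]]]])
       (auto simp: G_def[of n] algebra_simps)
  have G': "C1p (\<lambda>z. G n z * d) (\<lambda>z. H z * a * d) (\<lambda>z. H z * b * d)" for d
    by (rule C1p_cong[OF C1p_mult[OF G C1p_const]]) auto
  have Fin: "F n \<in> bump_alg" for n unfolding F_def by (rule bump_alg.flat)
  have Gin: "G n \<in> bump_alg" for n unfolding G_def by (intro bump_alg.intros(2-) Fin)
  have Hin: "H \<in> bump_alg" unfolding H_def by (intro bump_alg.intros(2-) Gin)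
  have d: "C1p (F n) (\<lambda>z. G n z * a) (\<lambda>z. G n z * b)"
    "C1p (\<lambda>z. G n z * a) (\<lambda>z. H z * a * a) (\<lambda>z. H z * a * b)"
    "C1p (\<lambda>z. G n z * b) (\<lambda>z. H z * a * b) (\<lambda>z. H z * b * b)"
    using F G'[of a] G'[of b] by (simp_all add: mult_ac)
  have "(\<lambda>z. G n z * d) \<in> bump_alg" "(\<lambda>z. H z * d * e) \<in> bump_alg" for d e
    by (intro bump_alg.intros(2-) Gin Hin)+
  then show ?case unfolding F_def[symmetric] by (intro bump_alg_C2I[OF d])
next
  case (const c)
  show ?case
    by (rule bump_alg_C2I[OF C1p_const C1p_const C1p_const]) (rule bump_alg.const)+
next
  case (add f g)
  then obtain fx fy fxx fxy fyy gx gy gxx gxy gyy where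
    in1: "fx\<in>bump_alg" "fy\<in>bump_alg" "fxx\<in>bump_alg" "fxy\<in>bump_alg" "fyy\<in>bump_alg"
    "gx\<in>bump_alg" "gy\<in>bump_alg" "gxx\<in>bump_alg" "gxy\<in>bump_alg" "gyy\<in>bump_alg"
    and d: "C1p f fx fy" "C1p fx fxx fxy" "C1p fy fxy fyy" "C1p g gx gy" "C1p gx gxx gxy" "C1p gy gxy gyy"
    by (elim bexE conjE) (rule that; assumption)
  show ?case
    by (rule bump_alg_C2I[OF C1p_add[OF d(1,4)] C1p_add[OF d(2,5)] C1p_add[OF d(3,6)]])
       (intro bump_alg.add in1)+
next
  case (mult f g)
  then obtain fx fy fxx fxy fyy gx gy gxx gxy gyy where
    in1: "fx\<in>bump_alg" "fy\<in>bump_alg" "fxx\<in>bump_alg" "fxy\<in>bump_alg" "fyy\<in>bump_alg"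
    "gx\<in>bump_alg" "gy\<in>bump_alg" "gxx\<in>bump_alg" "gxy\<in>bump_alg" "gyy\<in>bump_alg"
    and d: "C1p f fx fy" "C1p fx fxx fxy" "C1p fy fxy fyy" "C1p g gx gy" "C1p gx gxx gxy" "C1p gy gxy gyy"
    by (elim bexE conjE) (rule that; assumption)
  have in0: "f \<in> bump_alg" "g \<in> bump_alg" using mult by auto
  \<comment> \<open>The product rule produces the two mixed partials as differently ordered sums;
    \<open>bump_alg_C2I\<close> wants one function for both.\<close>
  define hxy where "hxy = (\<lambda>z. fxy z * g z + fx z * gy z + (fy z * gx z + f z * gxy z))"
  have 2: "C1p (\<lambda>z. fx z * g z + f z * gx z)
     (\<lambda>z. fxx z * g z + fx z * gx z + (fx z * gx z + f z * gxx z)) hxy"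
    unfolding hxy_def by (rule C1p_add[OF C1p_mult[OF d(2,4)] C1p_mult[OF d(1,5)]])
  have 3: "C1p (\<lambda>z. fy z * g z + f z * gy z) hxy
     (\<lambda>z. fyy z * g z + fy z * gy z + (fy z * gy z + f z * gyy z))"
    unfolding hxy_def by (rule C1p_cong[OF C1p_add[OF C1p_mult[OF d(3,4)] C1p_mult[OF d(1,6)]]]) auto
  have ins: "(\<lambda>z. fx z * g z + f z * gx z) \<in> bump_alg" "(\<lambda>z. fy z * g z + f z * gy z) \<in> bump_alg"
    "hxy \<in> bump_alg" "(\<lambda>z. fxx z * g z + fx z * gx z + (fx z * gx z + f z * gxx z)) \<in> bump_alg"
    "(\<lambda>z. fyy z * g z + fy z * gy z + (fy z * gy z + f z * gyy z)) \<in> bump_alg"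
    unfolding hxy_def by (intro bump_alg.add bump_alg.mult in0 in1)+
  show ?case by (rule bump_alg_C2I[OF C1p_mult[OF d(1,4)] 2 3 ins(1,2,4,3,5)])
next
  case (exp f)
  then obtain fx fy fxx fxy fyy where
    in1: "fx\<in>bump_alg" "fy\<in>bump_alg" "fxx\<in>bump_alg" "fxy\<in>bump_alg" "fyy\<in>bump_alg"
    and d: "C1p f fx fy" "C1p fx fxx fxy" "C1p fy fxy fyy"
    by (elim bexE conjE) (rule that; assumption)
  have in0: "(\<lambda>z. exp (f z)) \<in> bump_alg" using exp bump_alg.exp by auto
  have 1: "C1p (\<lambda>z. exp (f z)) (\<lambda>z. exp (f z) * fx z) (\<lambda>z. exp (f z) * fy z)"
    by (rule C1p_real_compose[OF _ _ d(1)]) (auto intro!: derivative_eq_intros continuous_intros)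
  define hxy where "hxy = (\<lambda>z. exp (f z) * fy z * fx z + exp (f z) * fxy z)"
  have 2: "C1p (\<lambda>z. exp (f z) * fx z) (\<lambda>z. exp (f z) * fx z * fx z + exp (f z) * fxx z) hxy"
    unfolding hxy_def by (rule C1p_mult[OF 1 d(2)])
  have 3: "C1p (\<lambda>z. exp (f z) * fy z) hxy (\<lambda>z. exp (f z) * fy z * fy z + exp (f z) * fyy z)"
    unfolding hxy_def by (rule C1p_cong[OF C1p_mult[OF 1 d(3)]]) auto
  have ins: "(\<lambda>z. exp (f z) * fx z) \<in> bump_alg" "(\<lambda>z. exp (f z) * fy z) \<in> bump_alg"
    "hxy \<in> bump_alg" "(\<lambda>z. exp (f z) * fx z * fx z + exp (f z) * fxx z) \<in> bump_alg"
    "(\<lambda>z. exp (f z) * fy z * fy z + exp (f z) * fyy z) \<in> bump_alg"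
    unfolding hxy_def by (intro bump_alg.add bump_alg.mult in0 in1)+
  show ?case by (rule bump_alg_C2I[OF 1 2 3 ins(1,2,4,3,5)])
qed

lemma frechet_derivative_C1p:
  assumes "C1p g gx gy"
  shows "frechet_derivative g (at z) v = Re v *\<^sub>R gx z + Im v *\<^sub>R gy z"
  by (metis (no_types, lifting) C1p_D[OF assms] frechet_derivative_at)

lemma bump_alg_smooth: "f \<in> bump_alg \<Longrightarrow> times_cont_diff k f"
proof (induction k arbitrary: f)
  case 0
  then show ?case using bump_alg_C2 C1p_continuous(1) by fastforce
next
  case (Suc k)
  obtain fx fy where f: "fx \<in> bump_alg" "fy \<in> bump_alg" "C1p f fx fy"
    using bump_alg_C2[OF Suc.prems] by blast
  have "(\<lambda>z. Re v * fx z + Im v * fy z) \<in> bump_alg" for v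
    by (intro bump_alg.add bump_alg.mult bump_alg.const f)
  then show ?case
    using Suc.IH C1p_D[OF f(3)] by (auto simp: frechet_derivative_C1p[OF f(3)] differentiable_def)
qed

lemma test_function_C1p:
  assumes "test_function \<Omega> \<phi>"
  shows "C1p \<phi> (\<lambda>z. frechet_derivative \<phi> (at z) 1) (\<lambda>z. frechet_derivative \<phi> (at z) \<i>)"
proof -
  have d: "times_cont_diff (Suc 0) \<phi>" using assms unfolding test_function_def by blast
  have "(\<phi> has_derivative (\<lambda>h. Re h *\<^sub>R frechet_derivative \<phi> (at z) 1 + Im h *\<^sub>R frechet_derivative \<phi> (at z) \<i>)) (at z)" for z
  proof (rule has_derivative_eq_rhs)
    show D: "(\<phi> has_derivative frechet_derivative \<phi> (at z)) (at z)"
      using d frechet_derivative_works by auto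
    interpret bounded_linear "frechet_derivative \<phi> (at z)" using D by (rule has_derivative_bounded_linear)
    show "frechet_derivative \<phi> (at z) = (\<lambda>h. Re h *\<^sub>R frechet_derivative \<phi> (at z) 1 + Im h *\<^sub>R frechet_derivative \<phi> (at z) \<i>)"
    proof
      fix h
      have "h = Re h *\<^sub>R 1 + Im h *\<^sub>R \<i>" by (simp add: complex_eq_iff)
      then show "frechet_derivative \<phi> (at z) h = Re h *\<^sub>R frechet_derivative \<phi> (at z) 1 + Im h *\<^sub>R frechet_derivative \<phi> (at z) \<i>"
        by (metis add scaleR)
    qed
  qed
  then show ?thesis using d by (simp add: C1p_def)
qed

text \<open>A smooth function whose positivity set is exactly the open box, with one factor for each
  side. The trivial coefficients \<open>1 *\<close> and \<open>0 *\<close> make every factor a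
  literal instance of the rule \<open>flat\<close> of \<open>bump_alg\<close>.\<close>

definition bx :: "complex \<Rightarrow> complex \<Rightarrow> complex \<Rightarrow> real" where
  "bx a b z = flat 0 (- Re a + 1 * Re z + 0 * Im z) * flat 0 (Re b + (-1) * Re z + 0 * Im z) *
     (flat 0 (- Im a + 0 * Re z + 1 * Im z) * flat 0 (Im b + 0 * Re z + (-1) * Im z))"

lemma bx_alg: "bx a b \<in> bump_alg"
  unfolding bx_def by (intro bump_alg.mult bump_alg.flat)

lemma bx_nonneg: "0 \<le> bx a b z"
  by (simp add: bx_def flat_def)

lemma bx_pos_iff: "0 < bx a b z \<longleftrightarrow> z \<in> box a b"
  by (auto simp: bx_def flat_def in_box_complex_iff zero_less_mult_iff)

lemma bx_eq_0: "z \<notin> box a b \<Longrightarrow> bx a b z = 0"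
  using bx_pos_iff bx_nonneg by (metis less_eq_real_def)

lemma bump_alg_sum: "finite I \<Longrightarrow> (\<And>i. i \<in> I \<Longrightarrow> f i \<in> bump_alg) \<Longrightarrow> (\<lambda>z. \<Sum>i\<in>I. f i z) \<in> bump_alg"
  by (induction rule: finite_induct) (auto intro: bump_alg.intros)

lemma test_functionI:
  assumes "f \<in> bump_alg" "compact K" "K \<subseteq> \<Omega>" "\<And>z. z \<notin> K \<Longrightarrow> f z = 0"
  shows "test_function \<Omega> f"
proof -
  have "closure {z. f z \<noteq> 0} \<subseteq> K"
    using assms by (intro closure_minimal) (auto simp: compact_imp_closed)
  moreover have "compact (closure {z. f z \<noteq> 0})"
    using assms(2) bounded_subset calculation closed_closure compact_eq_bounded_closed by blast
  ultimately show ?thesis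
    using assms bump_alg_smooth unfolding test_function_def by auto
qed

section \<open>Limits in $L^1$ and $L^2$\<close>

definition sqint :: "'a measure \<Rightarrow> ('a \<Rightarrow> 'b::euclidean_space) \<Rightarrow> bool" where
  "sqint M g \<longleftrightarrow> g \<in> borel_measurable M \<and> integrable M (\<lambda>z. (norm (g z))\<^sup>2)"

definition L1lim :: "'a measure \<Rightarrow> (nat \<Rightarrow> 'a \<Rightarrow> 'b::euclidean_space) \<Rightarrow> ('a \<Rightarrow> 'b) \<Rightarrow> bool" where
  "L1lim M X Y \<longleftrightarrow> (\<forall>n. integrable M (X n)) \<and> integrable M Y \<and>
     (\<lambda>n. LINT z|M. norm (X n z - Y z)) \<longlonglongrightarrow> 0"

definition L2lim :: "'a measure \<Rightarrow> (nat \<Rightarrow> 'a \<Rightarrow> 'b::euclidean_space) \<Rightarrow> ('a \<Rightarrow> 'b) \<Rightarrow> bool" where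
  "L2lim M X Y \<longleftrightarrow> (\<forall>n. sqint M (X n)) \<and> sqint M Y \<and>
     (\<lambda>n. LINT z|M. (norm (X n z - Y z))\<^sup>2) \<longlonglongrightarrow> 0"

text \<open>Uniform convergence together with boundedness of every term: this is what a coefficient
  needs so that multiplying by it preserves L1 convergence, see
  \<open>L1lim_bilinear_uconv\<close>.\<close>

definition uconv :: "'a measure \<Rightarrow> (nat \<Rightarrow> 'a \<Rightarrow> 'b::euclidean_space) \<Rightarrow> ('a \<Rightarrow> 'b) \<Rightarrow> bool" where
  "uconv M X Y \<longleftrightarrow> (\<forall>n. X n \<in> borel_measurable M \<and> bounded (X n ` space M)) \<and>
     Y \<in> borel_measurable M \<and> bounded (Y ` space M) \<and> uniform_limit (space M) X Y sequentially"

lemma norm_add_sq_le: "(norm (a + b :: 'b::real_normed_vector))\<^sup>2 \<le> 2 * (norm a)\<^sup>2 + 2 * (norm b)\<^sup>2"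
proof -
  have "(norm (a + b))\<^sup>2 \<le> (norm a + norm b)\<^sup>2"
    by (intro power_mono norm_triangle_ineq) auto
  also have "\<dots> \<le> 2 * (norm a)\<^sup>2 + 2 * (norm b)\<^sup>2"
    using zero_le_power2[of "norm a - norm b"] by (simp add: power2_eq_square algebra_simps)
  finally show ?thesis .
qed

lemma sqint_add:
  assumes "sqint M f" "sqint M g"
  shows "sqint M (\<lambda>z. f z + g z)"
proof -
  have [measurable]: "f \<in> borel_measurable M" "g \<in> borel_measurable M"
    and "integrable M (\<lambda>z. (norm (f z))\<^sup>2)" "integrable M (\<lambda>z. (norm (g z))\<^sup>2)"
    using assms by (auto simp: sqint_def)
  then have "integrable M (\<lambda>z. 2 * (norm (f z))\<^sup>2 + 2 * (norm (g z))\<^sup>2)" by auto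
  then have "integrable M (\<lambda>z. (norm (f z + g z))\<^sup>2)"
    by (rule Bochner_Integration.integrable_bound) (use norm_add_sq_le in auto)
  then show ?thesis by (simp add: sqint_def)
qed

lemma sqint_linear:
  fixes f :: "'a::euclidean_space \<Rightarrow> 'b::euclidean_space"
  assumes "bounded_linear f" "sqint M g"
  shows "sqint M (\<lambda>z. f (g z))"
proof -
  interpret f: bounded_linear f by fact
  obtain K where K: "\<And>x. norm (f x) \<le> norm x * K" using f.bounded by blast
  have [measurable]: "g \<in> borel_measurable M" "f \<in> borel_measurable borel"
    using assms by (auto simp: sqint_def linear_continuous_on intro!: borel_measurable_continuous_onI)
  have "integrable M (\<lambda>z. K\<^sup>2 * (norm (g z))\<^sup>2)"
    using assms by (auto simp: sqint_def)
  then have "integrable M (\<lambda>z. (norm (f (g z)))\<^sup>2)"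
  proof (rule Bochner_Integration.integrable_bound)
    show "AE z in M. norm ((norm (f (g z)))\<^sup>2) \<le> norm (K\<^sup>2 * (norm (g z))\<^sup>2)"
      using K by (auto intro!: AE_I2 power_mono[of _ _ 2, simplified] simp: power_mult_distrib[symmetric] mult.commute)
  qed measurable
  then show ?thesis by (simp add: sqint_def)
qed

lemma sqint_scaleR: "sqint M g \<Longrightarrow> sqint M (\<lambda>z. c *\<^sub>R g z)"
  by (rule sqint_linear[OF bounded_linear_scaleR_right])

lemma sqint_diff:
  assumes "sqint M f" "sqint M g"
  shows "sqint M (\<lambda>z. f z - g z)"
  using sqint_add[OF assms(1) sqint_scaleR[OF assms(2), of "-1"]] by simp

lemma sqint_norm: "sqint M g \<Longrightarrow> sqint M (\<lambda>z. norm (g z))"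
  by (auto simp: sqint_def)

lemma integrable_norm_mult_sqint:
  assumes "sqint M f" "sqint M g"
  shows "integrable M (\<lambda>z. norm (f z) * norm (g z))"
proof -
  have [measurable]: "f \<in> borel_measurable M" "g \<in> borel_measurable M"
    and "integrable M (\<lambda>z. (norm (f z))\<^sup>2)" "integrable M (\<lambda>z. (norm (g z))\<^sup>2)"
    using assms by (auto simp: sqint_def)
  then have "integrable M (\<lambda>z. (norm (f z))\<^sup>2 + (norm (g z))\<^sup>2)" by auto
  then show ?thesis
  proof (rule Bochner_Integration.integrable_bound)
    have "\<bar>a\<bar> * \<bar>b\<bar> \<le> a\<^sup>2 + b\<^sup>2" for a b :: real
    proof -
      have "2 * \<bar>a\<bar> * \<bar>b\<bar> \<le> a\<^sup>2 + b\<^sup>2" "0 \<le> \<bar>a\<bar> * \<bar>b\<bar>"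
        using sum_squares_bound[of "\<bar>a\<bar>" "\<bar>b\<bar>"] by auto
      then show ?thesis by linarith
    qed
    from this[of "norm (f _)" "norm (g _)"]
    show "AE z in M. norm (norm (f z) * norm (g z)) \<le> norm ((norm (f z))\<^sup>2 + (norm (g z))\<^sup>2)"
      by (auto simp: abs_mult)
  qed measurable
qed

lemma integrable_bilinear_sqint:
  fixes f :: "'m \<Rightarrow> 'x::euclidean_space" and g :: "'m \<Rightarrow> 'y::euclidean_space"
    and pr :: "'x \<Rightarrow> 'y \<Rightarrow> 'z::euclidean_space"
  assumes "bounded_bilinear pr" "sqint M f" "sqint M g"
  shows "integrable M (\<lambda>z. pr (f z) (g z))"
proof -
  interpret p: bounded_bilinear pr by fact
  obtain K where K: "K > 0" "\<And>a b. norm (pr a b) \<le> norm a * norm b * K" using p.pos_bounded by blast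
  have [measurable]: "f \<in> borel_measurable M" "g \<in> borel_measurable M"
    using assms by (auto simp: sqint_def)
  have [measurable]: "(\<lambda>z. pr (f z) (g z)) \<in> borel_measurable M"
    by (rule borel_measurable_continuous_Pair) (auto intro!: p.continuous_on continuous_intros)
  have "integrable M (\<lambda>z. norm (f z) * norm (g z) * K)"
    using integrable_norm_mult_sqint[OF assms(2,3)] by auto
  then show ?thesis
    by (rule Bochner_Integration.integrable_bound) (use K in \<open>auto simp: abs_mult\<close>)
qed

lemma sqint_Cauchy_Schwarz:
  assumes "sqint M f" "sqint M g"
  shows "(LINT z|M. norm (f z) * norm (g z))\<^sup>2 \<le> (LINT z|M. (norm (f z))\<^sup>2) * (LINT z|M. (norm (g z))\<^sup>2)"
proof -
  have [measurable]: "f \<in> borel_measurable M" "g \<in> borel_measurable M"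
    and i: "integrable M (\<lambda>z. (norm (f z))\<^sup>2)" "integrable M (\<lambda>z. (norm (g z))\<^sup>2)"
    using assms by (auto simp: sqint_def)
  note i2 = integrable_norm_mult_sqint[OF assms]
  have "(\<integral>\<^sup>+z. ennreal (norm (f z)) * ennreal (norm (g z)) \<partial>M)\<^sup>2
     \<le> (\<integral>\<^sup>+z. (ennreal (norm (f z)))\<^sup>2 \<partial>M) * (\<integral>\<^sup>+z. (ennreal (norm (g z)))\<^sup>2 \<partial>M)"
    by (rule Cauchy_Schwarz_nn_integral) auto
  then have "(ennreal (LINT z|M. norm (f z) * norm (g z)))\<^sup>2
     \<le> ennreal (LINT z|M. (norm (f z))\<^sup>2) * ennreal (LINT z|M. (norm (g z))\<^sup>2)"
    by (simp add: nn_integral_eq_integral[OF i(1), symmetric] nn_integral_eq_integral[OF i(2), symmetric]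
        nn_integral_eq_integral[OF i2, symmetric] ennreal_mult ennreal_power)
  then show ?thesis
    by (simp add: ennreal_power ennreal_mult[symmetric] integral_nonneg_AE)
qed

lemma sqint_Cauchy_Schwarz_sqrt:
  assumes "sqint M f" "sqint M g"
  shows "(LINT z|M. norm (f z) * norm (g z)) \<le> sqrt (LINT z|M. (norm (f z))\<^sup>2) * sqrt (LINT z|M. (norm (g z))\<^sup>2)"
  using real_le_rsqrt[OF sqint_Cauchy_Schwarz[OF assms]] by (simp add: real_sqrt_mult)

lemma uconvD:
  assumes "uconv M X Y"
  shows "X n \<in> borel_measurable M" "Y \<in> borel_measurable M"
    and "e > 0 \<Longrightarrow> \<forall>\<^sub>F n in sequentially. \<forall>z\<in>space M. norm (X n z - Y z) < e"
  using assms unfolding uconv_def by (auto simp: uniform_limit_iff dist_norm)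

lemma uconv_const:
  assumes "f \<in> borel_measurable M" "bounded (f ` space M)"
  shows "uconv M (\<lambda>_. f) f"
  using assms by (auto simp: uconv_def uniform_limit_iff)

lemma uconv_lebesgue_on:
  assumes "compact K" "\<And>n. continuous_on K (X n)" "uniform_limit K X Y sequentially"
  shows "uconv (lebesgue_on K) X Y"
proof -
  have "continuous_on K Y"
    by (rule uniform_limit_theorem[OF _ assms(3)]) (use assms(2) in auto)
  then show ?thesis using assms
    by (auto simp: uconv_def compact_imp_bounded compact_continuous_image compact_imp_closed
        intro!: continuous_imp_measurable_on_sets_lebesgue borel_compact)
qed

lemma L1lim_integral:
  assumes "L1lim M X Y"
  shows "(\<lambda>n. LINT z|M. X n z) \<longlonglongrightarrow> (LINT z|M. Y z)"
proof (rule Lim_null_comparison[THEN Lim_transform2[OF tendsto_const]])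
  have i: "integrable M (X n)" "integrable M Y" for n using assms by (auto simp: L1lim_def)
  have "norm ((LINT z|M. Y z) - (LINT z|M. X n z)) \<le> (LINT z|M. norm (X n z - Y z))" for n
  proof -
    have "norm (LINT z|M. X n z - Y z) \<le> (LINT z|M. norm (X n z - Y z))"
      by (rule integral_norm_bound)
    then show ?thesis using i by (simp add: norm_minus_commute)
  qed
  then show "\<forall>\<^sub>F n in sequentially. norm ((LINT z|M. Y z) - (LINT z|M. X n z)) \<le> (LINT z|M. norm (X n z - Y z))"
    by simp
qed (use assms in \<open>simp add: L1lim_def\<close>)

lemma L1lim_norm:
  assumes "L1lim M X Y"
  shows "L1lim M (\<lambda>n z. norm (X n z)) (\<lambda>z. norm (Y z))"
proof -
  have i: "integrable M (X n)" "integrable M Y" for n using assms by (auto simp: L1lim_def)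
  have "(\<lambda>n. LINT z|M. norm (norm (X n z) - norm (Y z))) \<longlonglongrightarrow> 0"
  proof (rule tendsto_sandwich[OF _ _ tendsto_const])
    show "(\<lambda>n. LINT z|M. norm (X n z - Y z)) \<longlonglongrightarrow> 0" using assms by (simp add: L1lim_def)
    show "\<forall>\<^sub>F n in sequentially. (LINT z|M. norm (norm (X n z) - norm (Y z))) \<le> (LINT z|M. norm (X n z - Y z))"
      by (intro always_eventually allI integral_mono) (use i norm_triangle_ineq3 in auto)
  qed (auto intro!: integral_nonneg_AE)
  then show ?thesis using i by (simp add: L1lim_def)
qed

lemma L1lim_add:
  assumes "L1lim M X Y" "L1lim M X' Y'"
  shows "L1lim M (\<lambda>n z. X n z + X' n z) (\<lambda>z. Y z + Y' z)"
proof -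
  have i: "integrable M (X n)" "integrable M Y" "integrable M (X' n)" "integrable M Y'" for n
    using assms by (auto simp: L1lim_def)
  have "(\<lambda>n. LINT z|M. norm (X n z + X' n z - (Y z + Y' z))) \<longlonglongrightarrow> 0"
  proof (rule tendsto_sandwich[OF _ _ tendsto_const])
    show "(\<lambda>n. (LINT z|M. norm (X n z - Y z)) + (LINT z|M. norm (X' n z - Y' z))) \<longlonglongrightarrow> 0"
      using assms tendsto_add[of _ 0 _ _ 0] by (auto simp: L1lim_def)
    have "norm (a + b - (c + d)) \<le> norm (a - c) + norm (b - d)" for a b c d :: 'b
      by norm
    then have "(LINT z|M. norm (X n z + X' n z - (Y z + Y' z))) \<le> (LINT z|M. norm (X n z - Y z) + norm (X' n z - Y' z))" for n
      by (intro integral_mono) (use i in auto)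
    then show "\<forall>\<^sub>F n in sequentially. (LINT z|M. norm (X n z + X' n z - (Y z + Y' z))) \<le>
        (LINT z|M. norm (X n z - Y z)) + (LINT z|M. norm (X' n z - Y' z))"
      using i by (intro always_eventually) (auto simp: Bochner_Integration.integral_add)
  qed (auto intro!: integral_nonneg_AE)
  then show ?thesis using i by (simp add: L1lim_def)
qed

lemma L2lim_linear:
  fixes f :: "'a::euclidean_space \<Rightarrow> 'b::euclidean_space"
  assumes "bounded_linear f" "L2lim M X Y"
  shows "L2lim M (\<lambda>n z. f (X n z)) (\<lambda>z. f (Y z))"
proof -
  interpret bounded_linear f by fact
  obtain K where K: "\<And>x. norm (f x) \<le> norm x * K" using bounded by blast
  have s: "sqint M (X n)" "sqint M Y" for n using assms by (auto simp: L2lim_def)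
  have s': "sqint M (\<lambda>z. f (X n z))" "sqint M (\<lambda>z. f (Y z))" for n using s assms(1) sqint_linear by auto
  have "(\<lambda>n. LINT z|M. (norm (f (X n z) - f (Y z)))\<^sup>2) \<longlonglongrightarrow> 0"
  proof (rule tendsto_sandwich[OF _ _ tendsto_const])
    show "(\<lambda>n. K\<^sup>2 * (LINT z|M. (norm (X n z - Y z))\<^sup>2)) \<longlonglongrightarrow> 0"
      using assms by (auto simp: L2lim_def intro!: tendsto_mult_right_zero)
    have "(norm (f a - f b))\<^sup>2 \<le> K\<^sup>2 * (norm (a - b))\<^sup>2" for a b
      using power_mono[OF K[of "a - b"], of 2] by (simp add: diff power_mult_distrib mult.commute)
    then have "(LINT z|M. (norm (f (X n z) - f (Y z)))\<^sup>2) \<le> (LINT z|M. K\<^sup>2 * (norm (X n z - Y z))\<^sup>2)" for n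
      by (intro integral_mono) (use sqint_diff[OF s'(1)[of n] s'(2)] sqint_diff[OF s(1)[of n] s(2)] in \<open>auto simp: sqint_def\<close>)
    then show "\<forall>\<^sub>F n in sequentially. (LINT z|M. (norm (f (X n z) - f (Y z)))\<^sup>2) \<le> K\<^sup>2 * (LINT z|M. (norm (X n z - Y z))\<^sup>2)"
      by simp
  qed (auto intro!: integral_nonneg_AE)
  then show ?thesis using s' by (simp add: L2lim_def)
qed

text \<open>The difference of the products is expanded around the limit and Cauchy-Schwarz is
  applied to each of the three terms. The main use is \<open>Jac\<close>, which is bilinear in the
  two partial derivatives.\<close>

lemma L1lim_bilinear_L2lim:
  fixes pr :: "'a::euclidean_space \<Rightarrow> 'b::euclidean_space \<Rightarrow> 'c::euclidean_space"
  assumes "bounded_bilinear pr" "L2lim M X Y" "L2lim M X' Y'"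
  shows "L1lim M (\<lambda>n z. pr (X n z) (X' n z)) (\<lambda>z. pr (Y z) (Y' z))"
proof -
  interpret bounded_bilinear pr by fact
  obtain K where K: "K > 0" "\<And>a b. norm (pr a b) \<le> norm a * norm b * K" using pos_bounded by blast
  have s: "sqint M (X n)" "sqint M Y" "sqint M (X' n)" "sqint M Y'" for n
    using assms by (auto simp: L2lim_def)
  have i: "integrable M (\<lambda>z. pr (X n z) (X' n z))" "integrable M (\<lambda>z. pr (Y z) (Y' z))" for n
    by (rule integrable_bilinear_sqint; use s assms(1) in auto)+
  note d = sqint_diff[OF s(1,2)] and d' = sqint_diff[OF s(3,4)]
  note i1 = integrable_norm_mult_sqint[OF d d'] integrable_norm_mult_sqint[OF d s(4)] integrable_norm_mult_sqint[OF s(2) d']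
  define a where "a n = sqrt (LINT z|M. (norm (X n z - Y z))\<^sup>2)" for n
  define b where "b n = sqrt (LINT z|M. (norm (X' n z - Y' z))\<^sup>2)" for n
  define A where "A = sqrt (LINT z|M. (norm (Y z))\<^sup>2)"
  define B where "B = sqrt (LINT z|M. (norm (Y' z))\<^sup>2)"
  have ab: "a \<longlonglongrightarrow> 0" "b \<longlonglongrightarrow> 0"
    using assms(2,3) tendsto_real_sqrt[of _ 0] unfolding a_def b_def L2lim_def by auto
  have le: "(LINT z|M. norm (pr (X n z) (X' n z) - pr (Y z) (Y' z))) \<le> K * (a n * b n + a n * B + A * b n)" for n
  proof -
    have "norm (pr x x' - pr y y') \<le> K * (norm (x - y) * norm (x' - y') + norm (x - y) * norm y' + norm y * norm (x' - y'))" for x x' y y'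
    proof -
      have "pr x x' - pr y y' = pr (x - y) (x' - y') + pr (x - y) y' + pr y (x' - y')"
        by (simp add: diff_left diff_right)
      also have "norm \<dots> \<le> norm (pr (x - y) (x' - y')) + norm (pr (x - y) y') + norm (pr y (x' - y'))"
        by norm
      also have "\<dots> \<le> norm (x - y) * norm (x' - y') * K + norm (x - y) * norm y' * K + norm y * norm (x' - y') * K"
        by (intro add_mono K)
      finally show ?thesis by (simp add: algebra_simps)
    qed
    then have "(LINT z|M. norm (pr (X n z) (X' n z) - pr (Y z) (Y' z))) \<le>
      (LINT z|M. K * (norm (X n z - Y z) * norm (X' n z - Y' z) + norm (X n z - Y z) * norm (Y' z) + norm (Y z) * norm (X' n z - Y' z)))"
      by (intro integral_mono) (use i i1 in auto)
    also have "\<dots> = K * ((LINT z|M. norm (X n z - Y z) * norm (X' n z - Y' z)) + (LINT z|M. norm (X n z - Y z) * norm (Y' z)) + (LINT z|M. norm (Y z) * norm (X' n z - Y' z)))"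
      by (simp add: i1)
    also have "\<dots> \<le> K * (a n * b n + a n * B + A * b n)"
      unfolding a_def b_def A_def B_def
      using K(1) by (intro mult_left_mono add_mono sqint_Cauchy_Schwarz_sqrt d d' s) auto
    finally show ?thesis .
  qed
  have "(\<lambda>n. LINT z|M. norm (pr (X n z) (X' n z) - pr (Y z) (Y' z))) \<longlonglongrightarrow> 0"
  proof (rule tendsto_sandwich[OF _ _ tendsto_const])
    have "(\<lambda>n. K * (a n * b n + a n * B + A * b n)) \<longlonglongrightarrow> K * (0 * 0 + 0 * B + A * 0)"
      by (intro tendsto_intros ab)
    then show "(\<lambda>n. K * (a n * b n + a n * B + A * b n)) \<longlonglongrightarrow> 0" by simp
  qed (use le in \<open>auto intro!: integral_nonneg_AE\<close>)
  then show ?thesis using i by (simp add: L1lim_def)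
qed

text \<open>Only one factor converges in L1 here; the other is a uniformly convergent coefficient,
  such as a fixed cutoff or a continuous function of the approximants.\<close>

lemma L1lim_bilinear_uconv:
  fixes pr :: "'a::euclidean_space \<Rightarrow> 'b::euclidean_space \<Rightarrow> 'c::euclidean_space"
  assumes "bounded_bilinear pr" "uconv M X Y" "L1lim M X' Y'"
  shows "L1lim M (\<lambda>n z. pr (X n z) (X' n z)) (\<lambda>z. pr (Y z) (Y' z))"
proof -
  interpret bounded_bilinear pr by fact
  obtain K where K: "K > 0" "\<And>a b. norm (pr a b) \<le> norm a * norm b * K" using pos_bounded by blast
  have i: "integrable M (X' n)" "integrable M Y'" for n
    using assms by (auto simp: L1lim_def)
  have int: "integrable M (\<lambda>z. pr (U z) (V z))"
    if [measurable]: "U \<in> borel_measurable M" and b: "bounded (U ` space M)" and V: "integrable M V" for U V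
  proof -
    obtain B where B: "\<And>z. z \<in> space M \<Longrightarrow> norm (U z) \<le> B" using b by (auto simp: bounded_iff)
    have [measurable]: "V \<in> borel_measurable M" using V by auto
    have [measurable]: "(\<lambda>z. pr (U z) (V z)) \<in> borel_measurable M"
      by (rule borel_measurable_continuous_Pair) (auto intro!: continuous_on continuous_intros)
    have "integrable M (\<lambda>z. \<bar>B\<bar> * norm (V z) * K)" using V by auto
    then show ?thesis
    proof (rule Bochner_Integration.integrable_bound)
      show "AE z in M. norm (pr (U z) (V z)) \<le> norm (\<bar>B\<bar> * norm (V z) * K)"
      proof (rule AE_I2)
        fix z assume "z \<in> space M"
        then have "norm (U z) * norm (V z) * K \<le> \<bar>B\<bar> * norm (V z) * K"
          using B K(1) by (intro mult_right_mono) force+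
        then show "norm (pr (U z) (V z)) \<le> norm (\<bar>B\<bar> * norm (V z) * K)"
          using K order_trans by (fastforce simp: abs_mult)
      qed
    qed measurable
  qed
  have iX: "integrable M (\<lambda>z. pr (X n z) (X' n z))" "integrable M (\<lambda>z. pr (Y z) (Y' z))" for n
    using assms(2) i by (auto simp: uconv_def intro!: int)
  obtain B where B: "\<And>z. z \<in> space M \<Longrightarrow> norm (Y z) \<le> B" "B \<ge> 0"
    using assms(2) by (force simp: bounded_pos uconv_def)
  define a where "a n = (LINT z|M. norm (X' n z - Y' z))" for n
  define c where "c = (LINT z|M. norm (Y' z))"
  have a: "a \<longlonglongrightarrow> 0" using assms(3) by (simp add: L1lim_def a_def[abs_def])
  have c: "c \<ge> 0" by (simp add: c_def)
  have "(\<lambda>n. LINT z|M. norm (pr (X n z) (X' n z) - pr (Y z) (Y' z))) \<longlonglongrightarrow> 0"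
  proof (rule LIMSEQ_I)
    fix e :: real assume e: "e > 0"
    \<comment> \<open>The cap 1 bounds \<open>X n\<close> by \<open>B + 1\<close>. The other entry
      makes \<open>K * (\<delta> * c)\<close> at most e/2, with \<open>c + 1\<close> in place of
      \<open>c\<close> to avoid division by 0.\<close>
    define \<delta> where "\<delta> = min 1 (e / (2 * K * (c + 1)))"
    have \<delta>: "\<delta> > 0" "\<delta> \<le> 1" "K * (\<delta> * c) < e/2 + e/4"
    proof -
      show "\<delta> > 0" "\<delta> \<le> 1" using e K c by (auto simp: \<delta>_def)
      have "K * (\<delta> * c) \<le> K * (e / (2 * K * (c + 1)) * c)"
        using K c by (intro mult_left_mono mult_right_mono) (auto simp: \<delta>_def)
      also have "K * (e / (2 * K * (c + 1)) * c) = (K / K) * (e/2 * (c / (c + 1)))"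
        by (simp add: mult_ac)
      also have "\<dots> = e/2 * (c / (c + 1))" using K by simp
      also have "\<dots> \<le> e/2 * 1" using c e by (intro mult_left_mono) auto
      finally show "K * (\<delta> * c) < e/2 + e/4" using e by simp
    qed
    have "(\<lambda>n. K * ((B + 1) * a n)) \<longlonglongrightarrow> K * ((B + 1) * 0)" by (intro tendsto_intros a)
    then have "\<forall>\<^sub>F n in sequentially. K * ((B + 1) * a n) < e/4"
      using e by (intro order_tendstoD(2)) auto
    with uconvD(3)[OF assms(2) \<delta>(1)]
    have "\<forall>\<^sub>F n in sequentially. norm ((LINT z|M. norm (pr (X n z) (X' n z) - pr (Y z) (Y' z))) - 0) < e"
    proof eventually_elim
      case (elim n)
      have "(LINT z|M. norm (pr (X n z) (X' n z) - pr (Y z) (Y' z))) \<le>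
         (LINT z|M. K * ((B + 1) * norm (X' n z - Y' z) + \<delta> * norm (Y' z)))"
      proof (intro integral_mono)
        fix z assume z: "z \<in> space M"
        have "pr (X n z) (X' n z) - pr (Y z) (Y' z) = pr (X n z) (X' n z - Y' z) + pr (X n z - Y z) (Y' z)"
          by (simp add: diff_left diff_right)
        also have "norm \<dots> \<le> norm (pr (X n z) (X' n z - Y' z)) + norm (pr (X n z - Y z) (Y' z))"
          by (rule norm_triangle_ineq)
        also have "\<dots> \<le> norm (X n z) * norm (X' n z - Y' z) * K + norm (X n z - Y z) * norm (Y' z) * K"
          by (intro add_mono K)
        also have "\<dots> \<le> (B + 1) * norm (X' n z - Y' z) * K + \<delta> * norm (Y' z) * K"
        proof (intro add_mono mult_right_mono)
          have "norm (X n z) \<le> norm (Y z) + norm (X n z - Y z)" by norm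
          then show "norm (X n z) \<le> B + 1" using B(1)[OF z] elim(1) z \<delta>(2) by fastforce
        qed (use elim z K in \<open>auto intro: less_imp_le\<close>)
        finally show "norm (pr (X n z) (X' n z) - pr (Y z) (Y' z)) \<le> K * ((B + 1) * norm (X' n z - Y' z) + \<delta> * norm (Y' z))"
          by (simp add: algebra_simps)
      qed (use iX i in auto)
      also have "\<dots> = K * ((B + 1) * a n + \<delta> * c)"
        using i by (simp add: a_def c_def)
      also have "\<dots> < e" using \<delta>(3) elim(2) by (simp add: algebra_simps)
      finally show ?case by (simp add: integral_nonneg_AE)
    qed
    then show "\<exists>N. \<forall>n\<ge>N. norm ((LINT z|M. norm (pr (X n z) (X' n z) - pr (Y z) (Y' z))) - 0) < e"
      by (simp add: eventually_sequentially)
  qed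
  then show ?thesis using iX by (simp add: L1lim_def)
qed

lemma L1lim_const: "integrable M Y \<Longrightarrow> L1lim M (\<lambda>_. Y) Y"
  by (simp add: L1lim_def)

lemma L2lim_const: "sqint M Y \<Longrightarrow> L2lim M (\<lambda>_. Y) Y"
  by (simp add: L2lim_def)

lemma L2lim_imp_L1lim:
  assumes "finite_measure M" "L2lim M X Y"
  shows "L1lim M X Y"
proof -
  interpret finite_measure M by fact
  have "sqint M (\<lambda>_. 1::real)" by (simp add: sqint_def)
  from L1lim_bilinear_L2lim[OF bounded_bilinear_scaleR L2lim_const[OF this] assms(2)]
  show ?thesis by simp
qed

lemma uconv_imp_L1lim:
  assumes "finite_measure M" "uconv M X Y"
  shows "L1lim M X Y"
proof -
  interpret finite_measure M by fact
  have "integrable M (\<lambda>_. 1::real)" by simp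
  from L1lim_bilinear_uconv[OF bounded_bilinear.flip[OF bounded_bilinear_scaleR] assms(2) L1lim_const[OF this]]
  show ?thesis by simp
qed

lemma uconv_continuous_compose:
  assumes "uconv M X Y" "continuous_on UNIV A"
  shows "uconv M (\<lambda>n z. A (X n z)) (\<lambda>z. A (Y z))"
proof -
  have [measurable]: "A \<in> borel_measurable borel"
    using assms(2) by (rule borel_measurable_continuous_onI)
  have bnd: "bounded ((\<lambda>z. A (U z)) ` space M)" if "bounded (U ` space M)" for U
  proof -
    have "compact (A ` closure (U ` space M))"
      using that assms(2) by (intro compact_continuous_image) (auto intro: continuous_on_subset simp: compact_closure)
    then show ?thesis
      using closure_subset[of "U ` space M"] by (auto intro!: bounded_subset[OF compact_imp_bounded])
  qed
  obtain B where B: "\<And>z. z \<in> space M \<Longrightarrow> norm (Y z) \<le> B"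
    using assms(1) by (force simp: bounded_iff uconv_def)
  \<comment> \<open>The radius \<open>B + 1\<close> holds the values of \<open>Y\<close> and, as
    soon as the uniform distance is below 1, those of \<open>X n\<close> too.\<close>
  have u: "uniformly_continuous_on (cball 0 (B + 1)) A"
    using assms(2) by (intro compact_uniformly_continuous) (auto intro: continuous_on_subset)
  have "uniform_limit (space M) (\<lambda>n z. A (X n z)) (\<lambda>z. A (Y z)) sequentially"
    unfolding uniform_limit_iff
  proof (intro allI impI)
    fix e :: real assume "e > 0"
    with u obtain d where d: "d > 0" "\<And>x x'. x \<in> cball 0 (B+1) \<Longrightarrow> x' \<in> cball 0 (B+1) \<Longrightarrow> dist x' x < d \<Longrightarrow> dist (A x') (A x) < e"
      unfolding uniformly_continuous_on_def by metis
    have "min d 1 > 0" using d by auto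
    from uconvD(3)[OF assms(1) this]
    show "\<forall>\<^sub>F n in sequentially. \<forall>z\<in>space M. dist (A (X n z)) (A (Y z)) < e"
    proof eventually_elim
      case (elim n)
      show ?case
      proof
        fix z assume z: "z \<in> space M"
        have "norm (X n z) \<le> norm (Y z) + norm (X n z - Y z)" by norm
        then have "norm (X n z) \<le> B + 1" "norm (Y z) \<le> B + 1" using B[OF z] elim z by force+
        then show "dist (A (X n z)) (A (Y z)) < e"
          using elim z by (intro d(2)) (auto simp: dist_norm)
      qed
    qed
  qed
  moreover have "(\<lambda>z. A (U z)) \<in> borel_measurable M" if "U \<in> borel_measurable M" for U
    using that by measurable
  ultimately show ?thesis using assms(1) bnd unfolding uconv_def by blast
qed

text \<open>Finite dyadic averages of the tail from index n, a discrete form of the convex hulls in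
  Mazur's lemma. A property of all terms passes to them by induction once it is stable under
  midpoints, without any bookkeeping of weights.\<close>

inductive_set mids :: "(nat \<Rightarrow> 'a \<Rightarrow> 'b::real_vector) \<Rightarrow> nat \<Rightarrow> ('a \<Rightarrow> 'b) set"
  for X :: "nat \<Rightarrow> 'a \<Rightarrow> 'b" and n :: nat where
  base: "n \<le> k \<Longrightarrow> X k \<in> mids X n"
| mid: "u \<in> mids X n \<Longrightarrow> v \<in> mids X n \<Longrightarrow> (\<lambda>z. (1/2) *\<^sub>R (u z + v z)) \<in> mids X n"

lemma mids_mono:
  assumes "u \<in> mids X m" "n \<le> m"
  shows "u \<in> mids X n"
  using assms(1) by induction (use assms(2) in \<open>auto intro: mids.intros\<close>)

text \<open>Riesz-Fischer. Along a subsequence with geometrically decreasing L2 steps the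
  telescoping series converges absolutely almost everywhere, and Fatou's lemma turns the pointwise
  limit into an L2 limit.\<close>

lemma L2_complete:
  fixes g :: "nat \<Rightarrow> 'a \<Rightarrow> 'b::euclidean_space"
  assumes "finite_measure M" and g: "\<And>n. sqint M (g n)"
    and Cauchy: "\<And>e. e > 0 \<Longrightarrow> \<exists>N. \<forall>m\<ge>N. \<forall>n\<ge>N. (LINT z|M. (norm (g m z - g n z))\<^sup>2) < e"
  shows "\<exists>r G. strict_mono (r::nat\<Rightarrow>nat) \<and> L2lim M (\<lambda>n. g (r n)) G"
proof -
  interpret finite_measure M by fact
  have "\<forall>k. \<exists>N. \<forall>m\<ge>N. \<forall>n\<ge>N. (LINT z|M. (norm (g m z - g n z))\<^sup>2) < (1/4)^k"
    using Cauchy by simp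
  then obtain N where N: "\<And>k m n. m \<ge> N k \<Longrightarrow> n \<ge> N k \<Longrightarrow> (LINT z|M. (norm (g m z - g n z))\<^sup>2) < (1/4)^k"
    by metis
  define r where "r k = (\<Sum>i\<le>k. N i) + k" for k
  have r: "strict_mono r" unfolding r_def by (rule strict_monoI_Suc) simp
  have rN: "N k \<le> r k" for k unfolding r_def
    using member_le_sum[of k "{..k}" N] by auto
  have r': "N k \<le> r m" if "k \<le> m" for k m
    using rN[of k] monoD[OF strict_mono_mono[OF r] that] by linarith
  have d: "(LINT z|M. (norm (g (r m) z - g (r k) z))\<^sup>2) < (1/4)^k" if "k \<le> m" for k m
    using N r' that by auto
  have [measurable]: "g n \<in> borel_measurable M" for n using g by (auto simp: sqint_def)
  define h where "h k z = norm (g (r (Suc k)) z - g (r k) z)" for k z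
  have [measurable]: "h k \<in> borel_measurable M" for k unfolding h_def by measurable
  have h0: "0 \<le> h k z" for k z by (simp add: h_def)
  define c where "c = sqrt (measure M (space M))"
  have sq: "sqint M (\<lambda>z. g m z - g n z)" for m n by (intro sqint_diff g)
  have one: "sqint M (\<lambda>_. 1::real)" by (simp add: sqint_def)
  have hint: "integrable M (h k)" for k
    using integrable_norm_mult_sqint[OF sq one] by (simp add: h_def[abs_def])
  \<comment> \<open>Cauchy-Schwarz against the constant 1, whose L2 norm is \<open>c\<close>, turns
    the L2 steps into summable L1 steps.\<close>
  have hle: "(LINT z|M. h k z) \<le> (1/2)^k * c" for k
  proof -
    have "(LINT z|M. h k z) \<le> sqrt (LINT z|M. (norm (g (r (Suc k)) z - g (r k) z))\<^sup>2) * c"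
      using sqint_Cauchy_Schwarz_sqrt[OF sq one] by (simp add: h_def c_def)
    also have "\<dots> \<le> sqrt ((1/4)^k) * c"
      using d[of k "Suc k"] by (intro mult_right_mono real_sqrt_le_mono) (auto simp: c_def)
    also have "sqrt ((1/4)^k) = (1/2::real)^k"
      by (rule real_sqrt_unique) (auto simp: power_mult_distrib[symmetric] power2_eq_square)
    finally show ?thesis .
  qed
  have "(\<integral>\<^sup>+z. (\<Sum>k. ennreal (h k z)) \<partial>M) = (\<Sum>k. \<integral>\<^sup>+z. ennreal (h k z) \<partial>M)"
    by (rule nn_integral_suminf) measurable
  also have "\<dots> = (\<Sum>k. ennreal (LINT z|M. h k z))"
    using hint h0 by (intro suminf_cong nn_integral_eq_integral) auto
  also have "\<dots> \<le> (\<Sum>k. ennreal ((1/2)^k * c))"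
    using hle by (intro suminf_le) (auto intro!: ennreal_leI)
  also have "\<dots> = ennreal (\<Sum>k. (1/2)^k * c)"
    by (intro suminf_ennreal2 summable_mult2 summable_geometric) (auto simp: c_def)
  finally have "(\<integral>\<^sup>+z. (\<Sum>k. ennreal (h k z)) \<partial>M) \<noteq> \<infinity>"
    by (auto simp: top_unique)
  then have "AE z in M. (\<Sum>k. ennreal (h k z)) \<noteq> \<infinity>"
    by (intro nn_integral_noteq_infinite) auto
  then have conv: "AE z in M. convergent (\<lambda>k. g (r k) z)"
  proof eventually_elim
    case (elim z)
    then have "summable (\<lambda>k. h k z)"
      by (intro summable_suminf_not_top) (auto simp: h_def)
    then have "summable (\<lambda>k. g (r (Suc k)) z - g (r k) z)"
      unfolding h_def by (rule summable_norm_cancel)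
    then have "convergent (\<lambda>n. \<Sum>k<n. g (r (Suc k)) z - g (r k) z)"
      by (simp add: summable_iff_convergent)
    from convergent_add[OF this convergent_const[of "g (r 0) z"]]
    show ?case by (simp add: sum_lessThan_telescope[of "\<lambda>n. g (r n) z"])
  qed
  define G where "G z = lim (\<lambda>k. g (r k) z)" for z
  have [measurable]: "G \<in> borel_measurable M"
    unfolding G_def by (rule borel_measurable_lim_metric) measurable
  have Fatou: "(\<integral>\<^sup>+z. ennreal ((norm (g (r k) z - G z))\<^sup>2) \<partial>M) \<le> ennreal ((1/4)^k)" for k
  proof -
    have "AE z in M. ennreal ((norm (g (r k) z - G z))\<^sup>2) = liminf (\<lambda>m. ennreal ((norm (g (r m) z - g (r k) z))\<^sup>2))"
      using conv
    proof eventually_elim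
      case (elim z)
      then have "(\<lambda>m. g (r m) z) \<longlonglongrightarrow> G z" by (simp add: G_def convergent_LIMSEQ_iff)
      then have "(\<lambda>m. ennreal ((norm (g (r m) z - g (r k) z))\<^sup>2)) \<longlonglongrightarrow> ennreal ((norm (G z - g (r k) z))\<^sup>2)"
        by (intro tendsto_intros)
      from lim_imp_Liminf[OF _ this]
      show ?case by (simp add: norm_minus_commute[of "g (r k) z" "G z"])
    qed
    then have "(\<integral>\<^sup>+z. ennreal ((norm (g (r k) z - G z))\<^sup>2) \<partial>M) = (\<integral>\<^sup>+z. liminf (\<lambda>m. ennreal ((norm (g (r m) z - g (r k) z))\<^sup>2)) \<partial>M)"
      by (rule nn_integral_cong_AE)
    also have "\<dots> \<le> liminf (\<lambda>m. \<integral>\<^sup>+z. ennreal ((norm (g (r m) z - g (r k) z))\<^sup>2) \<partial>M)"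
      by (rule nn_integral_liminf) measurable
    also have "\<dots> \<le> ennreal ((1/4)^k)"
    proof (rule Liminf_le)
      show "\<forall>\<^sub>F m in sequentially. (\<integral>\<^sup>+z. ennreal ((norm (g (r m) z - g (r k) z))\<^sup>2) \<partial>M) \<le> ennreal ((1/4)^k)"
        using eventually_ge_at_top[of k]
      proof eventually_elim
        case (elim m)
        have "(\<integral>\<^sup>+z. ennreal ((norm (g (r m) z - g (r k) z))\<^sup>2) \<partial>M) = ennreal (LINT z|M. (norm (g (r m) z - g (r k) z))\<^sup>2)"
          using sq by (intro nn_integral_eq_integral) (auto simp: sqint_def)
        then show ?case using d[OF elim] by (simp add: ennreal_leI)
      qed
    qed simp
    finally show ?thesis .
  qed
  have sG: "sqint M (\<lambda>z. g (r k) z - G z)" for k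
  proof -
    have "integrable M (\<lambda>z. (norm (g (r k) z - G z))\<^sup>2)"
      by (rule integrableI_nonneg) (use le_less_trans[OF Fatou ennreal_less_top] in auto)
    then show ?thesis by (simp add: sqint_def)
  qed
  have sG': "sqint M G"
    using sqint_diff[OF g[of "r 0"] sG[of 0]] by simp
  have "(LINT z|M. (norm (g (r k) z - G z))\<^sup>2) \<le> (1/4)^k" for k
  proof -
    have "ennreal (LINT z|M. (norm (g (r k) z - G z))\<^sup>2) \<le> ennreal ((1/4)^k)"
      using Fatou sG by (subst nn_integral_eq_integral[symmetric]) (auto simp: sqint_def)
    then show ?thesis by (simp add: ennreal_le_iff)
  qed
  then have "(\<lambda>k. LINT z|M. (norm (g (r k) z - G z))\<^sup>2) \<longlonglongrightarrow> 0"
    by (intro Lim_null_comparison[OF _ LIMSEQ_realpow_zero[of "1/4"]]) (auto intro!: always_eventually)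
  then show ?thesis using r g sG' unfolding L2lim_def by (intro exI[of _ r] exI[of _ G]) auto
qed

text \<open>Substitute for weak compactness: near-minimizers of the $L^2$ norm among the iterated
  midpoints of the tails form a Cauchy sequence, by the parallelogram law.\<close>

lemma L2_midpoint_compactness:
  fixes X :: "nat \<Rightarrow> 'a \<Rightarrow> 'b::real_vector" and P :: "'b \<Rightarrow> 'c::euclidean_space"
  assumes fin: "finite_measure M" and lin: "linear P"
    and s: "\<And>k. sqint M (\<lambda>z. P (X k z))" and B: "\<And>k. (LINT z|M. (norm (P (X k z)))\<^sup>2) \<le> B"
  shows "\<exists>Y G. (\<forall>n. Y n \<in> mids X n) \<and> L2lim M (\<lambda>n z. P (Y n z)) G"
proof -
  interpret linear P by fact
  define E where "E u = (LINT z|M. (norm (P (u z)))\<^sup>2)" for u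
  have Pmid: "P ((1/2) *\<^sub>R (a + b)) = (1/2) *\<^sub>R (P a + P b)" for a b
    by (simp add: scale add)
  have sm: "sqint M (\<lambda>z. P (u z))" if "u \<in> mids X n" for u n
    using that by induction (auto simp: Pmid intro!: s sqint_scaleR sqint_add)
  have par: "(LINT z|M. (norm (P (u z) - P (v z)))\<^sup>2) = 2 * E u + 2 * E v - 4 * E (\<lambda>z. (1/2) *\<^sub>R (u z + v z))"
    if "sqint M (\<lambda>z. P (u z))" "sqint M (\<lambda>z. P (v z))" for u v
  proof -
    have 1: "(norm (a - b))\<^sup>2 = 2 * (norm a)\<^sup>2 + 2 * (norm b)\<^sup>2 - 4 * (norm ((1/2) *\<^sub>R (a + b)))\<^sup>2" for a b :: 'c
    proof -
      have "(norm ((1/2) *\<^sub>R (a + b)))\<^sup>2 = (norm (a + b))\<^sup>2 / 4"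
        by (simp add: power_divide)
      then show ?thesis by (simp add: power2_norm_eq_inner inner_simps inner_commute)
    qed
    have "(LINT z|M. (norm (P (u z) - P (v z)))\<^sup>2) = (LINT z|M. 2 * (norm (P (u z)))\<^sup>2 + 2 * (norm (P (v z)))\<^sup>2 - 4 * (norm ((1/2) *\<^sub>R (P (u z) + P (v z))))\<^sup>2)"
      by (simp only: 1)
    also have "\<dots> = 2 * E u + 2 * E v - 4 * E (\<lambda>z. (1/2) *\<^sub>R (u z + v z))"
      using that sqint_scaleR[OF sqint_add[OF that], of "1/2"] unfolding E_def Pmid sqint_def by simp
    finally show ?thesis .
  qed
  have E0: "0 \<le> E u" for u unfolding E_def by (simp add: integral_nonneg_AE)
  have EB: "E u \<le> B" if "u \<in> mids X n" for u n
    using that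
  proof induction
    case (base k) then show ?case using B by (simp add: E_def)
  next
    case (mid u v)
    have "0 \<le> (LINT z|M. (norm (P (u z) - P (v z)))\<^sup>2)" by (simp add: integral_nonneg_AE)
    then show ?case using mid par[OF sm[OF mid(1)] sm[OF mid(2)]] by simp
  qed
  define d where "d n = Inf (E ` mids X n)" for n
  have bb: "bdd_below (E ` mids X n)" for n using E0 by (auto intro!: bdd_belowI[of _ 0])
  have ne: "E ` mids X n \<noteq> {}" for n using mids.base[of n n X] by auto
  have dle: "d n \<le> E u" if "u \<in> mids X n" for u n
    unfolding d_def using bb that by (auto intro: cInf_lower)
  have dB: "d n \<le> B" for n
  proof -
    have "X n \<in> mids X n" by (rule mids.base) simp
    from order_trans[OF dle[OF this] EB[OF this]] show ?thesis .
  qed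
  have dmono: "incseq d"
    unfolding incseq_def
  proof (intro allI impI)
    fix m n :: nat assume "m \<le> n"
    then have "mids X n \<subseteq> mids X m" by (auto intro: mids_mono)
    then show "d m \<le> d n"
      unfolding d_def by (rule cInf_superset_mono[OF ne bb image_mono])
  qed
  obtain D where D: "d \<longlonglongrightarrow> D" "\<And>n. d n \<le> D"
    using incseq_convergent[OF dmono] dB by blast
  have "\<exists>u\<in>mids X n. E u < d n + 1 / real (Suc n)" for n
  proof -
    have "Inf (E ` mids X n) < d n + 1 / real (Suc n)" by (simp add: d_def)
    from cInf_lessD[OF ne this] show ?thesis by auto
  qed
  then obtain y where y: "\<And>n. y n \<in> mids X n" "\<And>n. E (y n) < d n + 1 / real (Suc n)" by metis
  have le: "(LINT z|M. (norm (P (y n z) - P (y m z)))\<^sup>2) \<le> 4 * (D - d k) + 4 / real (Suc k)"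
    if "k \<le> n" "k \<le> m" for k n m
  proof -
    \<comment> \<open>The midpoint belongs to the same tail, so its energy is at least
      \<open>d k\<close>; in the parallelogram identity \<open>par\<close> it enters with
      coefficient -4.\<close>
    have "d k \<le> E (\<lambda>z. (1/2) *\<^sub>R (y n z + y m z))"
      by (rule dle) (use mids_mono[OF y(1) that(1)] mids_mono[OF y(1) that(2)] in \<open>auto intro: mids.mid\<close>)
    moreover have "E (y n) \<le> D + 1 / real (Suc k)" if "k \<le> n" for n
    proof -
      have "1 / real (Suc n) \<le> 1 / real (Suc k)" using that by (intro divide_left_mono) auto
      then show ?thesis using y(2)[of n] D(2)[of n] by linarith
    qed
    from this[OF that(1)] this[OF that(2)]
    have "2 * E (y n) + 2 * E (y m) \<le> 4 * D + 4 * (1 / real (Suc k))" by linarith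
    ultimately show ?thesis unfolding par[OF sm[OF y(1)] sm[OF y(1)]] by simp
  qed
  have "(\<lambda>k. 4 * (D - d k) + 4 * (1 / real (Suc k))) \<longlonglongrightarrow> 4 * (D - D) + 4 * 0"
    by (intro tendsto_intros D LIMSEQ_Suc[OF lim_1_over_n])
  then have lim: "(\<lambda>k. 4 * (D - d k) + 4 / real (Suc k)) \<longlonglongrightarrow> 0" by simp
  have "\<exists>r G. strict_mono (r::nat\<Rightarrow>nat) \<and> L2lim M (\<lambda>n z. P (y (r n) z)) G"
  proof (rule L2_complete[OF fin])
    fix e :: real assume "e > 0"
    then obtain k where "4 * (D - d k) + 4 / real (Suc k) < e"
      using order_tendstoD(2)[OF lim] by (auto simp: eventually_sequentially)
    then show "\<exists>N. \<forall>m\<ge>N. \<forall>n\<ge>N. (LINT z|M. (norm (P (y m z) - P (y n z)))\<^sup>2) < e"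
      by (intro exI[of _ k] allI impI) (rule le_less_trans[OF le])
  qed (rule sm[OF y(1)])
  then obtain r G where r: "strict_mono (r::nat\<Rightarrow>nat)" "L2lim M (\<lambda>n z. P (y (r n) z)) G" by blast
  have "y (r n) \<in> mids X n" for n
    by (rule mids_mono[OF y(1) seq_suble[OF r(1)]])
  with r(2) show ?thesis by (intro exI[of _ "\<lambda>n. y (r n)"] exI[of _ G] conjI allI)
qed

section \<open>Integration over compact sets\<close>

lemma finite_measure_lebesgue_on_compact:
  fixes K :: "'a::euclidean_space set"
  assumes "compact K" shows "finite_measure (lebesgue_on K)"
proof (rule finite_measureI)
  have "K \<in> sets lebesgue" "emeasure lebesgue K < \<infinity>"
    using assms lmeasurable_compact[of K] by (auto simp: fmeasurable_def)
  then show "emeasure (lebesgue_on K) (space (lebesgue_on K)) \<noteq> \<infinity>"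
    by (simp add: emeasure_restrict_space space_restrict_space)
qed

lemma compact_sets_lebesgue: "compact K \<Longrightarrow> (K::'a::euclidean_space set) \<in> sets lebesgue"
  using lmeasurable_compact[of K] by (auto simp: fmeasurable_def)

lemma continuous_on_compact_measurable:
  fixes f :: "'a::euclidean_space \<Rightarrow> 'b::euclidean_space"
  shows "compact K \<Longrightarrow> continuous_on K f \<Longrightarrow> f \<in> borel_measurable (lebesgue_on K)"
  by (simp add: continuous_imp_measurable_on_sets_lebesgue compact_sets_lebesgue)

lemma continuous_on_compact_integrable:
  fixes f :: "'a::euclidean_space \<Rightarrow> 'b::euclidean_space"
  assumes "compact K" "continuous_on K f"
  shows "integrable (lebesgue_on K) f"
proof -
  interpret finite_measure "lebesgue_on K" using assms(1) by (rule finite_measure_lebesgue_on_compact)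
  obtain B where "\<And>z. z \<in> K \<Longrightarrow> norm (f z) \<le> B"
    using compact_imp_bounded[OF compact_continuous_image[OF assms(2,1)]] by (auto simp: bounded_iff)
  then show ?thesis
    by (intro integrable_const_bound[of _ B] AE_I2 continuous_on_compact_measurable assms) simp
qed

lemma continuous_on_compact_sqint:
  fixes f :: "'a::euclidean_space \<Rightarrow> 'b::euclidean_space"
  assumes "compact K" "continuous_on K f"
  shows "sqint (lebesgue_on K) f"
  unfolding sqint_def using assms
  by (auto intro!: continuous_on_compact_measurable continuous_on_compact_integrable continuous_intros)

lemma integral_lebesgue_on_vanishing:
  fixes f :: "'a::euclidean_space \<Rightarrow> 'b::euclidean_space"
  assumes "S \<in> sets lebesgue" "\<And>z. z \<notin> S \<Longrightarrow> f z = 0"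
  shows "(LINT z|lebesgue_on S. f z) = (LINT z|lebesgue. f z)"
proof -
  have "(LINT z|lebesgue_on S. f z) = (LINT z|lebesgue. indicator S z *\<^sub>R f z)"
    using assms(1) by (intro integral_restrict_space) simp
  also have "\<dots> = (LINT z|lebesgue. f z)"
    by (intro Bochner_Integration.integral_cong refl) (use assms(2) in \<open>auto simp: indicator_def\<close>)
  finally show ?thesis .
qed

text \<open>Used with \<open>m = 1\<close> for translations and with \<open>m = -1\<close> for the
  reflection w -> z - w inside a convolution.\<close>

lemma lebesgue_integral_reflect_shift:
  fixes u :: "'a::euclidean_space \<Rightarrow> 'b::euclidean_space"
  assumes "continuous_on UNIV u" "\<bar>m\<bar> = 1"
  shows "(LINT z|lebesgue. u (c + m *\<^sub>R z)) = (LINT z|lebesgue. u z)"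
proof -
  have [measurable]: "u \<in> borel_measurable borel" using assms(1) by (rule borel_measurable_continuous_onI)
  have "lborel = distr lborel borel (\<lambda>x. c + m *\<^sub>R x)"
    using lborel_affine[of m c] assms(2) by (auto simp: density_1)
  then have "(LINT z|lborel. u z) = (LINT z|distr lborel borel (\<lambda>x. c + m *\<^sub>R x). u z)" by simp
  also have "\<dots> = (LINT z|lborel. u (c + m *\<^sub>R z))"
    by (rule integral_distr) measurable
  finally show ?thesis by (simp add: integral_completion)
qed

text \<open>By translation invariance the integral of g(z + t v) does not depend on t;
  differentiating under the integral sign at t = 0 gives the integral of the derivative in direction
  v.\<close>

lemma C1p_integral_zero:
  fixes g :: "complex \<Rightarrow> 'a::euclidean_space"
  assumes g: "C1p g gx gy" and K: "compact K" "\<And>z. z \<notin> K \<Longrightarrow> g z = 0"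
  shows "(LINT z|lebesgue_on K. gx z) = 0" "(LINT z|lebesgue_on K. gy z) = 0"
proof -
  have *: "(LINT z|lebesgue_on K. Re v *\<^sub>R gx z + Im v *\<^sub>R gy z) = 0" if v: "norm v = 1" for v
  proof -
    let ?D = "\<lambda>z. Re v *\<^sub>R gx z + Im v *\<^sub>R gy z"
    obtain R where R: "K \<subseteq> ball 0 R" using compact_imp_bounded[OF K(1)] bounded_subset_ballD by blast
    \<comment> \<open>The margin 1 keeps the support of every shift with |t| < 1 inside the
      box.\<close>
    obtain b where b: "ball (0::complex) (R + 1) \<subseteq> cbox (-b) b"
      using bounded_subset_cbox_symmetric[OF bounded_ball] by blast
    have KB: "K \<subseteq> cbox (-b) b" using R b by (force simp: subset_iff)
    define I where "I t = integral (cbox (-b) b) (\<lambda>z. g (z + of_real t * v))" for t :: real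
    have cont: "continuous_on S (\<lambda>z. g (z + of_real t * v))" for t S
      by (intro continuous_on_compose2[OF C1p_continuous(1)[OF g, of UNIV]] continuous_intros) auto
    have Iconst: "I t = (LINT z|lebesgue. g z)" if "t \<in> {-1<..<1}" for t
    proof -
      have out: "g (z + of_real t * v) = 0" if "z \<notin> cbox (-b) b" for z
      proof (rule K(2))
        have "z \<notin> ball 0 (R + 1)" using that b by auto
        moreover have "norm z \<le> norm (z + of_real t * v) + norm (of_real t * v)" by norm
        ultimately have "norm (z + of_real t * v) \<ge> R"
          using v \<open>t \<in> {-1<..<1}\<close> by (auto simp: norm_mult)
        then show "z + of_real t * v \<notin> K" using R by auto
      qed
      have "I t = (LINT z|lebesgue_on (cbox (-b) b). g (z + of_real t * v))"
        unfolding I_def by (rule lebesgue_integral_eq_integral[symmetric]) (auto intro!: continuous_on_compact_integrable cont)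
      also have "\<dots> = (LINT z|lebesgue. g (z + of_real t * v))"
        by (rule integral_lebesgue_on_vanishing) (use out in auto)
      also have "\<dots> = (LINT z|lebesgue. g z)"
        using lebesgue_integral_reflect_shift[OF C1p_continuous(1)[OF g], of 1 "of_real t * v"] by (simp add: add.commute)
      finally show ?thesis .
    qed
    have deriv: "(I has_vector_derivative integral (cbox (-b) b) (\<lambda>z. ?D (z + of_real 0 * v))) (at 0 within {-1<..<1})"
      unfolding I_def
    proof (rule leibniz_rule_vector_derivative)
      fix t :: real and z
      have "((\<lambda>t. z + of_real t * v) has_derivative (\<lambda>h. of_real h * v)) (at t within {-1<..<1})"
        by (auto intro!: derivative_eq_intros)
      from has_derivative_compose[OF this C1p_D[OF g]]
      show "((\<lambda>t. g (z + of_real t * v)) has_vector_derivative ?D (z + of_real t * v)) (at t within {-1<..<1})"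
        unfolding has_vector_derivative_def by (rule has_derivative_eq_rhs) (simp add: scaleR_add_right)
      show "(\<lambda>z. g (z + of_real t * v)) integrable_on cbox (-b) b"
        by (intro integrable_continuous cont)
    next
      show "continuous_on ({- 1<..<1} \<times> cbox (- b) b) (\<lambda>(t, z). ?D (z + of_real t * v))"
        unfolding case_prod_unfold
        by (intro continuous_intros continuous_on_compose2[OF C1p_continuous(2)[OF g, of UNIV]]
            continuous_on_compose2[OF C1p_continuous(3)[OF g, of UNIV]]) auto
    qed auto
    have "(I has_vector_derivative 0) (at 0 within {-1<..<1})"
      by (rule has_vector_derivative_transform[of _ _ _ "\<lambda>_. LINT z|lebesgue. g z"]) (use Iconst in auto)
    then have "integral (cbox (-b) b) ?D = 0"
      using vector_derivative_unique_within[OF _ deriv] by (force simp: at_within_open[of _ "{-1<..<1::real}"])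
    moreover have cD: "continuous_on S ?D" for S
      by (intro continuous_intros C1p_continuous[OF g])
    then have "(LINT z|lebesgue_on (cbox (-b) b). ?D z) = integral (cbox (-b) b) ?D"
      by (intro lebesgue_integral_eq_integral continuous_on_compact_integrable) auto
    moreover have z: "?D z = 0" if "z \<notin> K" for z
      using C1p_zero_outside[OF g compact_imp_closed[OF K(1)] K(2) that] by simp
    then have "(LINT z|lebesgue_on (cbox (-b) b). ?D z) = (LINT z|lebesgue. ?D z)"
      using KB by (intro integral_lebesgue_on_vanishing) auto
    moreover have "(LINT z|lebesgue_on K. ?D z) = (LINT z|lebesgue. ?D z)"
      using z K(1) by (intro integral_lebesgue_on_vanishing compact_sets_lebesgue) auto
    ultimately show ?thesis by simp
  qed
  from *[of 1] *[of \<i>] show "(LINT z|lebesgue_on K. gx z) = 0" "(LINT z|lebesgue_on K. gy z) = 0" by auto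
qed

text \<open>The integrand is a divergence: the x-derivative of \<open>\<phi> z * vy z\<close> minus
  the y-derivative of \<open>\<phi> z * vx z\<close>. The two terms with the mixed partial of
  \<open>v\<close> cancel.\<close>

lemma integral_det_zero:
  assumes \<phi>: "C1p \<phi> \<phi>x \<phi>y" and K: "compact K" "\<And>z. z \<notin> K \<Longrightarrow> \<phi> z = 0" and v: "C2p v vx vy"
  shows "(LINT z|lebesgue_on K. \<phi>x z * vy z - \<phi>y z * vx z) = (0::real)"
proof -
  obtain vxx vxy vyy where v2: "C1p vx vxx vxy" "C1p vy vxy vyy" using v by (auto simp: C2p_def)
  note 1 = C1p_mult[OF \<phi> v2(2)] and 2 = C1p_mult[OF \<phi> v2(1)]
  have i: "integrable (lebesgue_on K) (\<lambda>z. \<phi>x z * vy z + \<phi> z * vxy z)"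
     "integrable (lebesgue_on K) (\<lambda>z. \<phi>y z * vx z + \<phi> z * vxy z)"
    by (intro continuous_on_compact_integrable K C1p_continuous[OF 1] C1p_continuous[OF 2])+
  have "(LINT z|lebesgue_on K. \<phi>x z * vy z - \<phi>y z * vx z) =
    (LINT z|lebesgue_on K. (\<phi>x z * vy z + \<phi> z * vxy z) - (\<phi>y z * vx z + \<phi> z * vxy z))" by simp
  also have "\<dots> = (LINT z|lebesgue_on K. \<phi>x z * vy z + \<phi> z * vxy z) - (LINT z|lebesgue_on K. \<phi>y z * vx z + \<phi> z * vxy z)"
    using i by (rule Bochner_Integration.integral_diff)
  also have "\<dots> = 0"
    using C1p_integral_zero[OF 1 K(1)] C1p_integral_zero[OF 2 K(1)] K(2) by simp
  finally show ?thesis .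
qed

text \<open>The test class is enlarged step by step, from bumps to finite unions of boxes, to open
  sets, to G_delta sets. The set where g is negative differs from a G_delta set by a null set, so
  the integral of g over its part in the open box is nonnegative, which forces that part to be
  null.\<close>

lemma AE_nonneg_box_of_test:
  fixes g :: "complex \<Rightarrow> real"
  assumes g: "integrable (lebesgue_on (cbox a b)) g"
    and test: "\<And>\<phi>. \<phi> \<in> bump_alg \<Longrightarrow> (\<And>z. 0 \<le> \<phi> z) \<Longrightarrow> (\<And>z. z \<notin> cbox a b \<Longrightarrow> \<phi> z = 0) \<Longrightarrow>
       0 \<le> (LINT z|lebesgue_on (cbox a b). \<phi> z * g z)"
  shows "AE z in lebesgue_on (cbox a b). z \<in> box a b \<longrightarrow> 0 \<le> g z"
proof -
  define M where "M = lebesgue_on (cbox a b)"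
  have gM: "integrable M g" using g by (simp add: M_def)
  then have [measurable]: "g \<in> borel_measurable M" by auto
  have lim: "0 \<le> (LINT z|M. indicator S z * g z)"
    if s: "\<And>n. 0 \<le> (LINT z|M. s n z * g z)" and m: "\<And>n. s n \<in> borel_measurable M"
      and S: "\<And>z. (\<lambda>n. s n z) \<longlonglongrightarrow> indicator S z" and le: "\<And>n z. \<bar>s n z\<bar> \<le> 1" for s :: "nat \<Rightarrow> complex \<Rightarrow> real" and S
  proof (rule LIMSEQ_le_const)
    show "(\<lambda>n. LINT z|M. s n z * g z) \<longlonglongrightarrow> (LINT z|M. indicator S z * g z)"
    proof (rule integral_dominated_convergence[where w="\<lambda>z. norm (g z)"])
      have "(indicator S :: complex \<Rightarrow> real) \<in> borel_measurable M"
        by (rule borel_measurable_LIMSEQ_metric[where f=s]) (use S m in auto)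
      then show "(\<lambda>z. indicator S z * g z) \<in> borel_measurable M" by measurable
      show "AE z in M. (\<lambda>n. s n z * g z) \<longlonglongrightarrow> indicator S z * g z"
        by (intro AE_I2 tendsto_intros S)
      show "AE z in M. norm (s n z * g z) \<le> norm (g z)" for n
        using le by (auto simp: abs_mult intro!: mult_left_le_one_le)
    qed (use gM m in auto)
  qed (use s in auto)
  have open1: "0 \<le> (LINT z|M. indicator V z * g z)" if V: "open V" "V \<subseteq> box a b" for V
  proof -
    obtain I :: "(complex \<Rightarrow> real \<times> real) set" and c d where I: "countable I" "V = (\<Union>f\<in>I. box (c f) (d f))"
    proof -
      let ?a = "\<lambda>f :: complex \<Rightarrow> real \<times> real. (\<Sum>(i::complex)\<in>Basis. fst (f i) *\<^sub>R i)"
      let ?b = "\<lambda>f :: complex \<Rightarrow> real \<times> real. (\<Sum>(i::complex)\<in>Basis. snd (f i) *\<^sub>R i)"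
      let ?I = "{f\<in>Basis \<rightarrow>\<^sub>E \<rat> \<times> \<rat>. box (?a f) (?b f) \<subseteq> V}"
      have "countable ?I"
        by (rule countable_subset[of _ "Basis \<rightarrow>\<^sub>E \<rat> \<times> \<rat>"]) (auto intro!: countable_PiE countable_rat)
      with that[of ?I ?a ?b] open_UNION_box[OF V(1)] show ?thesis by simp
    qed
    \<comment> \<open>The boxes of the countable family with number below n: finitely many, so their
      bumps can be added inside \<open>bump_alg\<close>.\<close>
    define J where "J n = (to_nat_on I) -` {..<n} \<inter> I" for n :: nat
    have finJ: "finite (J n)" for n
      unfolding J_def using I(1) by (intro finite_vimage_IntI) auto
    define e where "e n z = (\<Sum>f\<in>J n. bx (c f) (d f) z)" for n z
    have ein: "e n \<in> bump_alg" for n unfolding e_def by (intro bump_alg_sum finJ bx_alg)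
    have e0: "0 \<le> e n z" for n z unfolding e_def by (intro sum_nonneg bx_nonneg)
    have epos: "0 < e n z \<longleftrightarrow> z \<in> (\<Union>f\<in>J n. box (c f) (d f))" for n z
    proof -
      have "e n z = 0 \<longleftrightarrow> (\<forall>f\<in>J n. bx (c f) (d f) z = 0)"
        unfolding e_def by (intro sum_nonneg_eq_0_iff finJ bx_nonneg)
      moreover have "bx (c f) (d f) z = 0 \<longleftrightarrow> z \<notin> box (c f) (d f)" for f
        using bx_pos_iff[of "c f" "d f" z] bx_eq_0[of z "c f" "d f"] by linarith
      moreover have "0 < e n z \<longleftrightarrow> e n z \<noteq> 0" using e0[of n z] by linarith
      ultimately show ?thesis by simp
    qed
    \<comment> \<open>The functions 1 - exp(-m e) belong to \<open>bump_alg\<close>, take values in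
      [0, 1) and tend to 1 exactly where e is positive, that is, on the finite union.\<close>
    have fin: "0 \<le> (LINT z|M. indicator (\<Union>f\<in>J n. box (c f) (d f)) z * g z)" for n
    proof (rule lim[of "\<lambda>m z. 1 - exp (- real m * e n z)"])
      fix m
      have alg: "(\<lambda>z. 1 + (-1) * exp ((- real m) * e n z)) \<in> bump_alg"
        by (intro bump_alg.intros(2-) ein)
      have out: "e n z = 0" if "z \<notin> cbox a b" for z
        using that epos[of n z] e0[of n z] I(2) V(2) box_subset_cbox[of a b] unfolding J_def by force
      show "0 \<le> (LINT z|M. (1 - exp (- real m * e n z)) * g z)"
        using test[OF alg] out e0 by (simp add: M_def)
      show "(\<lambda>z. 1 - exp (- real m * e n z)) \<in> borel_measurable M"
        unfolding M_def using bump_alg_C2[OF alg] C1p_continuous(1)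
        by (intro continuous_on_compact_measurable) fastforce+
      show "\<bar>1 - exp (- real m * e n z)\<bar> \<le> 1" for z
      proof -
        have "exp (- real m * e n z) \<le> 1" using e0[of n z] by simp
        then show ?thesis using exp_gt_zero[of "- real m * e n z"] by linarith
      qed
    next
      fix z
      show "(\<lambda>m. 1 - exp (- real m * e n z)) \<longlonglongrightarrow> indicator (\<Union>f\<in>J n. box (c f) (d f)) z"
      proof (cases "e n z = 0")
        case True
        then show ?thesis using epos[of n z] by simp
      next
        case False
        then have p: "e n z > 0" using e0[of n z] by simp
        have "(\<lambda>m. exp (- e n z) ^ m) \<longlonglongrightarrow> 0" by (rule LIMSEQ_realpow_zero) (use p in auto)
        then have "(\<lambda>m. 1 - exp (- real m * e n z)) \<longlonglongrightarrow> 1 - 0"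
          by (intro tendsto_intros) (simp add: exp_of_nat_mult[symmetric])
        then show ?thesis using epos[of n z] p by simp
      qed
    qed
    show ?thesis
    proof (rule lim[of "\<lambda>n. indicator (\<Union>f\<in>J n. box (c f) (d f))"])
      show "indicator (\<Union>f\<in>J n. box (c f) (d f)) \<in> borel_measurable M" for n
        unfolding M_def by (intro measurable_restrict_space1 borel_measurable_indicator) (auto intro!: sets_completionI_sets borel_open open_UN)
      fix z
      show "(\<lambda>n. indicator (\<Union>f\<in>J n. box (c f) (d f)) z :: real) \<longlonglongrightarrow> indicator V z"
      proof (cases "z \<in> V")
        case True
        then obtain f where f: "f \<in> I" "z \<in> box (c f) (d f)" using I(2) by auto
        show ?thesis
        proof (rule tendsto_eventually, rule eventually_sequentiallyI[of "Suc (to_nat_on I f)"])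
          fix n assume "Suc (to_nat_on I f) \<le> n"
          then have "f \<in> J n" using f by (auto simp: J_def)
          then show "indicator (\<Union>f\<in>J n. box (c f) (d f)) z = (indicator V z::real)"
            using f True by (auto simp: indicator_def)
        qed
      next
        case False
        then have "z \<notin> (\<Union>f\<in>J n. box (c f) (d f))" for n using I(2) by (auto simp: J_def)
        then show ?thesis using False by simp
      qed
    qed (use fin in \<open>auto simp: indicator_def\<close>)
  qed
  define N where "N = {z \<in> cbox a b. g z < 0}"
  have "N \<in> sets (lebesgue_on (cbox a b))"
    unfolding N_def using \<open>g \<in> borel_measurable M\<close> by (auto simp: M_def borel_measurable_iff_less)
  then have NL: "N \<in> sets lebesgue" by (simp add: sets_restrict_space_iff)
  \<comment> \<open>Outer regularity: \<open>C\<close> is a G_delta set that contains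
    \<open>N\<close> and exceeds it by the null set \<open>T\<close>, so the integrals over
    \<open>C\<close> and over \<open>N\<close> agree.\<close>
  obtain C T where C: "gdelta C" "T \<in> null_sets lebesgue" "N \<union> T = C" "disjnt N T"
    using lebesgue_set_almost_gdelta[OF NL] by blast
  obtain F where F: "\<And>n::nat. open (F n)" "C = \<Inter> (range F)" using C(1) by (auto elim: gdelta.cases)
  have "0 \<le> (LINT z|M. indicator (C \<inter> box a b) z * g z)"
  proof (rule lim[of "\<lambda>n. indicator ((\<Inter>i\<le>n. F i) \<inter> box a b)"])
    have op: "open ((\<Inter>i\<le>n. F i) \<inter> box a b)" for n using F(1) by (intro open_Int open_INT) auto
    then show "0 \<le> (LINT z|M. indicator ((\<Inter>i\<le>n. F i) \<inter> box a b) z * g z)" for n by (intro open1) auto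
    show "indicator ((\<Inter>i\<le>n. F i) \<inter> box a b) \<in> borel_measurable M" for n
      unfolding M_def using op by (intro measurable_restrict_space1 borel_measurable_indicator) (auto intro!: sets_completionI_sets)
    fix z
    show "(\<lambda>n. indicator ((\<Inter>i\<le>n. F i) \<inter> box a b) z :: real) \<longlonglongrightarrow> indicator (C \<inter> box a b) z"
    proof (cases "z \<in> C")
      case True
      then have "z \<in> (\<Inter>i\<le>n. F i)" for n using F(2) by auto
      then show ?thesis using True by (simp add: indicator_def)
    next
      case False
      then obtain k where "z \<notin> F k" using F(2) by auto
      then have "\<forall>\<^sub>F n in sequentially. (indicator ((\<Inter>i\<le>n. F i) \<inter> box a b) z :: real) = indicator (C \<inter> box a b) z"
        using False by (intro eventually_sequentiallyI[of k]) (auto simp: indicator_def)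
      then show ?thesis by (rule tendsto_eventually)
    qed
  qed (auto simp: indicator_def)
  moreover have T: "AE z in M. z \<notin> T"
  proof -
    have "AE z in lebesgue. z \<notin> T" using C(2) by (rule AE_not_in)
    then show ?thesis unfolding M_def by (subst AE_restrict_space_iff) auto
  qed
  have mN: "(indicator (N \<inter> box a b) :: complex \<Rightarrow> real) \<in> borel_measurable M"
    unfolding M_def using NL by (intro measurable_restrict_space1 borel_measurable_indicator) auto
  have "(LINT z|M. indicator (C \<inter> box a b) z * g z) = (LINT z|M. indicator (N \<inter> box a b) z * g z)"
  proof (rule integral_cong_AE)
    show "AE z in M. indicator (C \<inter> box a b) z * g z = indicator (N \<inter> box a b) z * g z"
      using T by eventually_elim (use C(3) in \<open>auto simp: indicator_def\<close>)
    have "C \<in> sets lebesgue" using C(2,3) NL by auto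
    then have "(indicator (C \<inter> box a b) :: complex \<Rightarrow> real) \<in> borel_measurable M"
      unfolding M_def by (intro measurable_restrict_space1 borel_measurable_indicator) auto
    then show "(\<lambda>z. indicator (C \<inter> box a b) z * g z) \<in> borel_measurable M" by measurable
    show "(\<lambda>z. indicator (N \<inter> box a b) z * g z) \<in> borel_measurable M" using mN by measurable
  qed
  ultimately have ge: "0 \<le> (LINT z|M. indicator (N \<inter> box a b) z * g z)" by simp
  have iN: "integrable M (\<lambda>z. indicator (N \<inter> box a b) z * g z)"
  proof (rule Bochner_Integration.integrable_bound[OF gM])
    show "(\<lambda>z. indicator (N \<inter> box a b) z * g z) \<in> borel_measurable M" using mN by measurable
  qed (auto simp: indicator_def)
  have le: "indicator (N \<inter> box a b) z * g z \<le> 0" for z by (auto simp: N_def indicator_def)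
  have "(LINT z|M. - (indicator (N \<inter> box a b) z * g z)) = 0"
  proof -
    have "0 \<le> (LINT z|M. - (indicator (N \<inter> box a b) z * g z))"
      by (rule integral_nonneg_AE) (use le in auto)
    with ge show ?thesis by simp
  qed
  then have "AE z in M. - (indicator (N \<inter> box a b) z * g z) = 0"
    using iN le by (subst (asm) integral_nonneg_eq_0_iff_AE) auto
  then show ?thesis
    unfolding M_def[symmetric] using AE_space
    by eventually_elim (auto simp: N_def M_def indicator_def space_restrict_space split: if_splits)
qed

text \<open>Lindelof reduces the open set to countably many boxes, so that the exceptional null sets
  can be united.\<close>

lemma AE_nonneg_of_test:
  fixes g :: "complex \<Rightarrow> real"
  assumes "open \<Omega>" and g: "\<And>K. compact K \<Longrightarrow> K \<subseteq> \<Omega> \<Longrightarrow> integrable (lebesgue_on K) g"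
    and test: "\<And>\<phi> K. \<phi> \<in> bump_alg \<Longrightarrow> (\<And>z. 0 \<le> \<phi> z) \<Longrightarrow> compact K \<Longrightarrow> K \<subseteq> \<Omega> \<Longrightarrow> (\<And>z. z \<notin> K \<Longrightarrow> \<phi> z = 0) \<Longrightarrow>
       0 \<le> (LINT z|lebesgue_on K. \<phi> z * g z)"
  shows "AE z in lebesgue. z \<in> \<Omega> \<longrightarrow> 0 \<le> g z"
proof -
  define \<D> where "\<D> = {box a b |a b. cbox a b \<subseteq> \<Omega>}"
  have U: "\<Union>\<D> = \<Omega>"
  proof
    show "\<Union>\<D> \<subseteq> \<Omega>" unfolding \<D>_def using order_trans[OF box_subset_cbox] by blast
    show "\<Omega> \<subseteq> \<Union>\<D>"
    proof
      fix z assume "z \<in> \<Omega>"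
      with assms(1) obtain a b where "cbox a b \<subseteq> \<Omega>" "z \<in> box a b"
        using open_contains_cbox by metis
      then show "z \<in> \<Union>\<D>" by (auto simp: \<D>_def)
    qed
  qed
  obtain \<D>' where D': "\<D>' \<subseteq> \<D>" "countable \<D>'" "\<Union>\<D>' = \<Union>\<D>"
    by (rule Lindelof[of \<D>]) (auto simp: \<D>_def)
  have "AE z in lebesgue. z \<in> D \<longrightarrow> 0 \<le> g z" if D: "D \<in> \<D>'" for D
  proof -
    obtain a b where ab: "D = box a b" "cbox a b \<subseteq> \<Omega>" using D D'(1) by (auto simp: \<D>_def)
    have "AE z in lebesgue_on (cbox a b). z \<in> box a b \<longrightarrow> 0 \<le> g z"
      by (rule AE_nonneg_box_of_test) (use ab in \<open>auto intro!: g test\<close>)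
    then have "AE z in lebesgue. z \<in> cbox a b \<longrightarrow> z \<in> box a b \<longrightarrow> 0 \<le> g z"
      by (subst (asm) AE_restrict_space_iff) auto
    then show ?thesis unfolding ab(1) by eventually_elim (use box_subset_cbox[of a b] in auto)
  qed
  then have "AE z in lebesgue. \<forall>D\<in>\<D>'. z \<in> D \<longrightarrow> 0 \<le> g z"
    using D'(2) by (rule AE_ball_countable')
  then show ?thesis by eventually_elim (use U D'(3) in auto)
qed

text \<open>The real statement is applied to the inner products of g with 1, -1, \<i> and -\<i>,
  which detect both signs of both coordinates.\<close>

lemma AE_zero_of_test:
  fixes g :: "complex \<Rightarrow> complex"
  assumes "open \<Omega>" and g: "\<And>K. compact K \<Longrightarrow> K \<subseteq> \<Omega> \<Longrightarrow> integrable (lebesgue_on K) g"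
    and test: "\<And>\<phi> K. \<phi> \<in> bump_alg \<Longrightarrow> compact K \<Longrightarrow> K \<subseteq> \<Omega> \<Longrightarrow> (\<And>z. z \<notin> K \<Longrightarrow> \<phi> z = 0) \<Longrightarrow>
       (LINT z|lebesgue_on K. \<phi> z *\<^sub>R g z) = 0"
  shows "AE z in lebesgue. z \<in> \<Omega> \<longrightarrow> g z = 0"
proof -
  have "AE z in lebesgue. z \<in> \<Omega> \<longrightarrow> 0 \<le> g z \<bullet> c" for c
  proof (rule AE_nonneg_of_test[OF assms(1)])
    fix \<phi> K assume *: "\<phi> \<in> bump_alg" "compact K" "K \<subseteq> \<Omega>" "\<And>z. z \<notin> K \<Longrightarrow> \<phi> z = (0::real)"
    have "continuous_on K \<phi>" using bump_alg_C2[OF *(1)] C1p_continuous(1) by blast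
    then have "bounded (\<phi> ` K)" and m: "\<phi> \<in> borel_measurable (lebesgue_on K)"
      using compact_imp_bounded[OF compact_continuous_image[OF _ *(2)]] continuous_on_compact_measurable[OF *(2)]
      by auto
    then obtain B where B: "\<And>z. z \<in> K \<Longrightarrow> norm (\<phi> z) \<le> B"
      by (auto simp: bounded_iff)
    have i: "integrable (lebesgue_on K) (\<lambda>z. \<phi> z *\<^sub>R g z)"
    proof (rule Bochner_Integration.integrable_bound)
      show "integrable (lebesgue_on K) (\<lambda>z. B * norm (g z))" using g * by auto
      show "AE z in lebesgue_on K. norm (\<phi> z *\<^sub>R g z) \<le> norm (B * norm (g z))"
      proof (rule AE_I2)
        fix z assume "z \<in> space (lebesgue_on K)"
        then have "\<bar>\<phi> z\<bar> \<le> \<bar>B\<bar>" using B[of z] by simp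
        then show "norm (\<phi> z *\<^sub>R g z) \<le> norm (B * norm (g z))" by (simp add: abs_mult mult_right_mono)
      qed
      show "(\<lambda>z. \<phi> z *\<^sub>R g z) \<in> borel_measurable (lebesgue_on K)"
        using m borel_measurable_integrable[OF g[OF *(2,3)]] by measurable
    qed
    have "(LINT z|lebesgue_on K. \<phi> z * (g z \<bullet> c)) = (LINT z|lebesgue_on K. (\<phi> z *\<^sub>R g z) \<bullet> c)" by simp
    also have "\<dots> = (LINT z|lebesgue_on K. \<phi> z *\<^sub>R g z) \<bullet> c" by (rule integral_inner_left) (use i in auto)
    finally show "0 \<le> (LINT z|lebesgue_on K. \<phi> z * (g z \<bullet> c))" using test * by simp
  qed (use g in auto)
  from this[of 1] this[of "-1"] this[of \<i>] this[of "-\<i>"]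
  show ?thesis by eventually_elim (auto simp: complex_eq_iff inner_complex_def)
qed

section \<open>Restriction to smaller sets and localized weak derivatives\<close>

lemma lebesgue_on_subset_integrable:
  fixes f :: "'a::euclidean_space \<Rightarrow> 'b::euclidean_space"
  assumes "integrable (lebesgue_on S) f" "S \<in> sets lebesgue" "K \<in> sets lebesgue" "K \<subseteq> S"
  shows "integrable (lebesgue_on K) f"
proof -
  have "integrable lebesgue (\<lambda>x. indicator S x *\<^sub>R f x)"
    using assms by (simp add: integrable_restrict_space)
  from integrable_mult_indicator[OF _ this, of K]
  have "integrable lebesgue (\<lambda>x. indicator K x *\<^sub>R indicator S x *\<^sub>R f x)" using assms by simp
  moreover have "(\<lambda>x. indicator K x *\<^sub>R indicator S x *\<^sub>R f x) = (\<lambda>x. indicator K x *\<^sub>R f x)"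
    using assms(4) by (auto simp: indicator_def fun_eq_iff)
  ultimately have "integrable lebesgue (\<lambda>x. indicator K x *\<^sub>R f x)" by (simp only:)
  then show ?thesis using assms by (simp add: integrable_restrict_space)
qed

lemma lebesgue_on_subset_integral_le:
  fixes f :: "'a::euclidean_space \<Rightarrow> real"
  assumes "integrable (lebesgue_on S) f" "S \<in> sets lebesgue" "K \<in> sets lebesgue" "K \<subseteq> S" "\<And>z. 0 \<le> f z"
  shows "(LINT z|lebesgue_on K. f z) \<le> (LINT z|lebesgue_on S. f z)"
proof -
  note 1 = lebesgue_on_subset_integrable[OF assms(1-4)]
  have "(LINT z|lebesgue. indicator K z *\<^sub>R f z) \<le> (LINT z|lebesgue. indicator S z *\<^sub>R f z)"
    using assms 1 by (intro integral_mono) (auto simp: integrable_restrict_space indicator_def)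
  then show ?thesis using assms by (simp add: integral_restrict_space)
qed

lemma sqint_subset:
  fixes f :: "'a::euclidean_space \<Rightarrow> 'b::euclidean_space"
  assumes "sqint (lebesgue_on S) f" "S \<in> sets lebesgue" "K \<in> sets lebesgue" "K \<subseteq> S"
  shows "sqint (lebesgue_on K) f"
  unfolding sqint_def
proof
  show "f \<in> borel_measurable (lebesgue_on K)"
    by (rule measurable_restrict_mono[OF _ assms(4)]) (use assms(1) in \<open>simp add: sqint_def\<close>)
  show "integrable (lebesgue_on K) (\<lambda>z. (norm (f z))\<^sup>2)"
    by (rule lebesgue_on_subset_integrable[OF _ assms(2-4)]) (use assms(1) in \<open>simp add: sqint_def\<close>)
qed

lemma L2lim_subset:
  fixes X :: "nat \<Rightarrow> 'a::euclidean_space \<Rightarrow> 'b::euclidean_space"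
  assumes "L2lim (lebesgue_on S) X Y" "S \<in> sets lebesgue" "K \<in> sets lebesgue" "K \<subseteq> S"
  shows "L2lim (lebesgue_on K) X Y"
proof -
  have s: "sqint (lebesgue_on S) (X n)" "sqint (lebesgue_on S) Y" for n using assms by (auto simp: L2lim_def)
  have lim: "(\<lambda>n. LINT z|lebesgue_on S. (norm (X n z - Y z))\<^sup>2) \<longlonglongrightarrow> 0" using assms by (auto simp: L2lim_def)
  have "(LINT z|lebesgue_on K. (norm (X n z - Y z))\<^sup>2) \<le> (LINT z|lebesgue_on S. (norm (X n z - Y z))\<^sup>2)" for n
    by (rule lebesgue_on_subset_integral_le) (use sqint_diff[OF s(1)[of n] s(2)] assms in \<open>auto simp: sqint_def\<close>)
  then have "(\<lambda>n. LINT z|lebesgue_on K. (norm (X n z - Y z))\<^sup>2) \<longlonglongrightarrow> 0"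
    by (intro Lim_null_comparison[OF _ lim]) (auto intro!: always_eventually)
  then show ?thesis using sqint_subset[OF _ assms(2-4)] s by (auto simp: L2lim_def)
qed

lemma sqint_cong_AE:
  assumes "sqint M Y" "Z \<in> borel_measurable M" "AE z in M. Y z = Z z"
  shows "sqint M Z"
proof -
  have "Y \<in> borel_measurable M" "integrable M (\<lambda>z. (norm (Y z))\<^sup>2)" using assms(1) by (auto simp: sqint_def)
  moreover have "AE z in M. (norm (Y z))\<^sup>2 = (norm (Z z))\<^sup>2" using assms(3) by eventually_elim simp
  ultimately have "integrable M (\<lambda>z. (norm (Z z))\<^sup>2)"
    using assms(2) by (subst integrable_cong_AE[where g="\<lambda>z. (norm (Y z))\<^sup>2"]) (auto elim!: eventually_mono)
  then show ?thesis using assms(2) by (simp add: sqint_def)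
qed

lemma L2lim_cong_AE:
  assumes "L2lim M X Y" "Z \<in> borel_measurable M" "AE z in M. Y z = Z z"
  shows "L2lim M X Z"
proof -
  have s: "sqint M (X n)" "sqint M Y" for n using assms by (auto simp: L2lim_def)
  then have m: "X n \<in> borel_measurable M" "Y \<in> borel_measurable M" for n by (auto simp: sqint_def)
  have "(LINT z|M. (norm (X n z - Z z))\<^sup>2) = (LINT z|M. (norm (X n z - Y z))\<^sup>2)" for n
    by (rule integral_cong_AE) (use m assms in \<open>auto elim!: eventually_mono\<close>)
  then show ?thesis using assms(1) s(1) sqint_cong_AE[OF s(2) assms(2,3)] by (simp add: L2lim_def)
qed

lemma L2_loc_sqint:
  assumes "L2_loc \<Omega> g" "compact K" "K \<subseteq> \<Omega>"
  shows "sqint (lebesgue_on K) g"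
proof -
  have m: "(\<lambda>z. indicator \<Omega> z *\<^sub>R g z) \<in> borel_measurable lebesgue"
    and "set_integrable lebesgue K (\<lambda>z. (norm (g z))\<^sup>2)"
    using assms by (auto simp: L2_loc_def set_borel_measurable_def)
  then have "integrable (lebesgue_on K) (\<lambda>z. (norm (g z))\<^sup>2)"
    using compact_sets_lebesgue[OF assms(2)] by (simp add: set_integrable_def integrable_restrict_space)
  moreover have "(\<lambda>z. indicator \<Omega> z *\<^sub>R g z) \<in> borel_measurable (lebesgue_on K)"
    using m by (rule measurable_restrict_space1)
  then have "g \<in> borel_measurable (lebesgue_on K)"
    by (rule measurable_cong[THEN iffD1, rotated]) (use assms(3) in auto)
  ultimately show ?thesis by (simp add: sqint_def)
qed

lemma set_integral_vanishing:
  fixes u :: "complex \<Rightarrow> real" and h :: "complex \<Rightarrow> complex"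
  assumes "compact K" "K \<subseteq> \<Omega>" "\<And>z. z \<notin> K \<Longrightarrow> u z = 0"
  shows "(LINT z:\<Omega>|lebesgue. u z *\<^sub>R h z) = (LINT z|lebesgue_on K. u z *\<^sub>R h z)"
proof -
  have "(LINT z|lebesgue_on K. u z *\<^sub>R h z) = (LINT z|lebesgue. u z *\<^sub>R h z)"
    using assms by (intro integral_lebesgue_on_vanishing compact_sets_lebesgue) auto
  moreover have "(LINT z:\<Omega>|lebesgue. u z *\<^sub>R h z) = (LINT z|lebesgue. u z *\<^sub>R h z)"
    unfolding set_lebesgue_integral_def
    by (intro Bochner_Integration.integral_cong refl) (use assms in \<open>auto simp: indicator_def\<close>)
  ultimately show ?thesis by simp
qed

text \<open>Moves the defining identity from \<Omega> to a compact set that holds the support, with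
  named partial derivatives in place of \<open>frechet_derivative\<close>. On compact sets the rules
  for L1 and L2 limits apply.\<close>

lemma weak_deriv_test:
  assumes "weak_deriv \<Omega> v f g" "test_function \<Omega> \<phi>" "C1p \<phi> \<phi>x \<phi>y" "compact K" "K \<subseteq> \<Omega>" "\<And>z. z \<notin> K \<Longrightarrow> \<phi> z = 0"
  shows "(LINT z|lebesgue_on K. (Re v * \<phi>x z + Im v * \<phi>y z) *\<^sub>R f z) = - (LINT z|lebesgue_on K. \<phi> z *\<^sub>R g z)"
proof -
  have "(LINT z:\<Omega>|lebesgue. frechet_derivative \<phi> (at z) v *\<^sub>R f z) = - (LINT z:\<Omega>|lebesgue. \<phi> z *\<^sub>R g z)"
    using assms(1,2) by (simp add: weak_deriv_def)
  with set_integral_vanishing[OF assms(4,5), of \<phi> g]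
    set_integral_vanishing[OF assms(4,5), of "\<lambda>z. Re v * \<phi>x z + Im v * \<phi>y z" f] show ?thesis
    using C1p_zero_outside[OF assms(3) compact_imp_closed[OF assms(4)] assms(6)] assms(6)
    by (simp add: frechet_derivative_C1p[OF assms(3)])
qed

section \<open>Mollification\<close>

lemma C1p_reflect:
  assumes "C1p g gx gy"
  shows "C1p (\<lambda>w. g (z - w)) (\<lambda>w. - gx (z - w)) (\<lambda>w. - gy (z - w))"
  unfolding C1p_def
proof (intro conjI allI)
  fix w
  have "((\<lambda>w. z - w) has_derivative (\<lambda>h. - h)) (at w)"
    by (auto intro!: derivative_eq_intros)
  from has_derivative_compose[OF this C1p_D[OF assms]]
  show "((\<lambda>w. g (z - w)) has_derivative (\<lambda>h. Re h *\<^sub>R - gx (z - w) + Im h *\<^sub>R - gy (z - w))) (at w)"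
    by (rule has_derivative_eq_rhs) simp
qed (intro continuous_intros continuous_on_compose2[OF C1p_continuous(2)[OF assms, of UNIV]]
   continuous_on_compose2[OF C1p_continuous(3)[OF assms, of UNIV]]; simp)+

text \<open>All derivatives fall on the kernel, so continuity of \<open>F\<close> is enough. The
  integral runs over a fixed box, as the Leibniz rule wants.\<close>

lemma C1p_convolution:
  fixes F :: "complex \<Rightarrow> complex"
  assumes F: "continuous_on (cbox a b) F" and \<rho>: "C1p \<rho> \<rho>x \<rho>y"
  shows "C1p (\<lambda>z. integral (cbox a b) (\<lambda>w. \<rho> (z - w) *\<^sub>R F w))
     (\<lambda>z. integral (cbox a b) (\<lambda>w. \<rho>x (z - w) *\<^sub>R F w))
     (\<lambda>z. integral (cbox a b) (\<lambda>w. \<rho>y (z - w) *\<^sub>R F w))"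
proof -
  \<comment> \<open>\<open>T\<close> packs a pair of partial derivatives into a bounded linear map,
    the form of a derivative that \<open>leibniz_rule\<close> works with.\<close>
  define T :: "complex \<times> complex \<Rightarrow> complex \<Rightarrow>\<^sub>L complex"
    where "T = (\<lambda>pq. Blinfun (\<lambda>h. Re h *\<^sub>R fst pq + Im h *\<^sub>R snd pq))"
  have T: "blinfun_apply (T pq) = (\<lambda>h. Re h *\<^sub>R fst pq + Im h *\<^sub>R snd pq)" for pq
    unfolding T_def
    by (rule bounded_linear_Blinfun_apply)
       (intro bounded_linear_add bounded_linear_scaleR_const bounded_linear_Re bounded_linear_Im)
  have "linear T"
    by (rule linearI; rule blinfun_eqI) (simp_all add: T blinfun.add_left blinfun.scaleR_left algebra_simps)
  then have "bounded_linear T" by (simp add: linear_conv_bounded_linear)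
  note T_cont = bounded_linear.continuous_on[OF this]
  have comp: "continuous_on S (\<lambda>p. u (fst p - snd p))" if "continuous_on UNIV u" for S and u :: "complex \<Rightarrow> real"
    by (intro continuous_on_compose2[OF that] continuous_intros) auto
  note c = comp[OF C1p_continuous(1)[OF \<rho>]] comp[OF C1p_continuous(2)[OF \<rho>]] comp[OF C1p_continuous(3)[OF \<rho>]]
  have F2: "continuous_on (UNIV \<times> cbox a b) (\<lambda>p. F (snd p))"
    by (intro continuous_on_compose2[OF F] continuous_intros) auto
  define L where "L z w = T (\<rho>x (z - w) *\<^sub>R F w, \<rho>y (z - w) *\<^sub>R F w)" for z w
  have L_cont: "continuous_on (UNIV \<times> cbox a b) (\<lambda>(z, w). L z w)"
    unfolding case_prod_unfold L_def
    by (intro T_cont continuous_intros c F2)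
  have Lz_cont: "continuous_on (cbox a b) (L z)" for z
    unfolding L_def
    by (intro T_cont continuous_intros F continuous_on_compose2[OF C1p_continuous(2)[OF \<rho>, of UNIV]]
        continuous_on_compose2[OF C1p_continuous(3)[OF \<rho>, of UNIV]]) auto
  have D: "((\<lambda>z. integral (cbox a b) (\<lambda>w. \<rho> (z - w) *\<^sub>R F w)) has_derivative blinfun_apply (integral (cbox a b) (L z))) (at z within UNIV)" for z
  proof (rule leibniz_rule)
    fix z w :: complex
    have "((\<lambda>z. z - w) has_derivative (\<lambda>h. h)) (at z)"
      by (auto intro!: derivative_eq_intros)
    from has_derivative_scaleR_left[OF has_derivative_compose[OF this C1p_D[OF \<rho>]], of "F w"]
    show "((\<lambda>z. \<rho> (z - w) *\<^sub>R F w) has_derivative blinfun_apply (L z w)) (at z within UNIV)"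
      by (rule has_derivative_eq_rhs) (simp add: L_def T algebra_simps)
    show "(\<lambda>w. \<rho> (z - w) *\<^sub>R F w) integrable_on cbox a b"
      by (intro integrable_continuous continuous_intros F continuous_on_compose2[OF C1p_continuous(1)[OF \<rho>, of UNIV]]) auto
  qed (use L_cont in auto)
  have int: "(\<lambda>w. u (z - w) *\<^sub>R F w) integrable_on cbox a b" if "continuous_on UNIV u" for z and u :: "complex \<Rightarrow> real"
    by (intro integrable_continuous continuous_intros F continuous_on_compose2[OF that]) auto
  note c0 = C1p_continuous[OF \<rho>]
  have app: "blinfun_apply (integral (cbox a b) (L z)) h =
      Re h *\<^sub>R integral (cbox a b) (\<lambda>w. \<rho>x (z - w) *\<^sub>R F w) + Im h *\<^sub>R integral (cbox a b) (\<lambda>w. \<rho>y (z - w) *\<^sub>R F w)" for z h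
  proof -
    have "blinfun_apply (integral (cbox a b) (L z)) h = integral (cbox a b) (\<lambda>w. L z w h)"
      by (intro blinfun_apply_integral integrable_continuous Lz_cont)
    also have "\<dots> = integral (cbox a b) (\<lambda>w. Re h *\<^sub>R (\<rho>x (z - w) *\<^sub>R F w) + Im h *\<^sub>R (\<rho>y (z - w) *\<^sub>R F w))"
      by (simp add: L_def T)
    also have "\<dots> = integral (cbox a b) (\<lambda>w. Re h *\<^sub>R (\<rho>x (z - w) *\<^sub>R F w)) + integral (cbox a b) (\<lambda>w. Im h *\<^sub>R (\<rho>y (z - w) *\<^sub>R F w))"
      by (intro Henstock_Kurzweil_Integration.integral_add integrable_cmul int c0)
    also have "\<dots> = Re h *\<^sub>R integral (cbox a b) (\<lambda>w. \<rho>x (z - w) *\<^sub>R F w) + Im h *\<^sub>R integral (cbox a b) (\<lambda>w. \<rho>y (z - w) *\<^sub>R F w)"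
      by (simp only: Henstock_Kurzweil_Integration.integral_cmul)
    finally show ?thesis .
  qed
  have cont: "continuous_on UNIV (\<lambda>z. integral (cbox a b) (\<lambda>w. u (z - w) *\<^sub>R F w))" if "continuous_on UNIV u" for u :: "complex \<Rightarrow> real"
    by (rule integral_continuous_on_param) (auto simp: case_prod_unfold intro!: continuous_intros comp that F2)
  show ?thesis
    unfolding C1p_def
  proof (intro conjI allI)
    show "((\<lambda>z. integral (cbox a b) (\<lambda>w. \<rho> (z - w) *\<^sub>R F w)) has_derivative
       (\<lambda>h. Re h *\<^sub>R integral (cbox a b) (\<lambda>w. \<rho>x (z - w) *\<^sub>R F w) + Im h *\<^sub>R integral (cbox a b) (\<lambda>w. \<rho>y (z - w) *\<^sub>R F w))) (at z)" for z
      by (rule has_derivative_eq_rhs[OF D]) (rule ext, rule app)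
  qed (intro cont c0)+
qed

text \<open>The normalized bump lives on the square where |Re z| and |Im z| are below \<epsilon>,
  and |z| <= |Re z| + |Im z| explains the radius 2\<epsilon>. The last clause makes the reflected
  kernel w -> \<rho>(z - w) eligible as a test function.\<close>

lemma mollifier_exists:
  assumes "\<epsilon> > 0"
  shows "\<exists>\<rho> \<rho>x \<rho>y. C2p \<rho> \<rho>x \<rho>y \<and> (\<forall>z. 0 \<le> \<rho> z) \<and> (\<forall>z. 2 * \<epsilon> \<le> norm z \<longrightarrow> \<rho> z = 0) \<and>
           (LINT z|lebesgue. \<rho> z) = (1::real) \<and> (\<forall>z. (\<lambda>w. \<rho> (z - w)) \<in> bump_alg)"
proof -
  define s where "s = Complex \<epsilon> \<epsilon>"
  define c where "c = (LINT z|lebesgue. bx (-s) s z)"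
  obtain bxx bxy where C: "C2p (bx (-s) s) bxx bxy" using bump_alg_C2[OF bx_alg] unfolding C2p_def by blast
  have cont: "continuous_on S (bx (-s) s)" for S using C1p_continuous(1)[OF C2p_C1p[OF C]] .
  have "bx (-s) s z = 0" if "z \<notin> cbox (-s) s" for z
    using that box_subset_cbox[of "-s" s] by (intro bx_eq_0) auto
  then have c_on: "c = (LINT z|lebesgue_on (cbox (-s) s). bx (-s) s z)"
    unfolding c_def by (intro integral_lebesgue_on_vanishing[symmetric]) auto
  have i: "integrable (lebesgue_on (cbox (-s) s)) (bx (-s) s)"
    by (intro continuous_on_compact_integrable cont compact_cbox)
  have "c \<noteq> 0"
  proof
    assume "c = 0"
    then have "AE z in lebesgue_on (cbox (-s) s). bx (-s) s z = 0"
      using integral_nonneg_eq_0_iff_AE[OF i] bx_nonneg unfolding c_on by simp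
    then have "AE z in lebesgue. z \<in> cbox (-s) s \<longrightarrow> bx (-s) s z = 0"
      by (subst (asm) AE_restrict_space_iff) auto
    then have "AE z in lebesgue. z \<notin> box (-s) s"
      by eventually_elim (use bx_pos_iff[of "-s" s] box_subset_cbox[of "-s" s] in force)
    then have "negligible (box (-s) s)"
      by (simp add: AE_iff_null_sets negligible_iff_null_sets)
    moreover have "0 \<in> box (-s) s" using assms by (simp add: in_box_complex_iff s_def)
    ultimately show False using open_not_negligible[OF open_box] by blast
  qed
  moreover have "0 \<le> c" unfolding c_def by (simp add: integral_nonneg_AE bx_nonneg)
  ultimately have cpos: "c > 0" by simp
  define \<rho> where "\<rho> z = (1/c) * bx (-s) s z" for z
  have scale: "C1p (\<lambda>z. (1/c) * u z) (\<lambda>z. (1/c) * ux z) (\<lambda>z. (1/c) * uy z)" if "C1p u ux uy" for u ux uy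
    by (rule C1p_cong[OF C1p_mult[OF C1p_const[of "1/c"] that]]) auto
  have f1: "C2p \<rho> (\<lambda>z. (1/c) * bxx z) (\<lambda>z. (1/c) * bxy z)"
    using C unfolding C2p_def \<rho>_def by (blast intro: scale)
  have f2: "\<rho> z = 0" if "2 * \<epsilon> \<le> norm z" for z
  proof -
    have "norm z \<le> \<bar>Re z\<bar> + \<bar>Im z\<bar>" by (rule cmod_le)
    then have "z \<notin> box (-s) s" using that by (auto simp: in_box_complex_iff s_def)
    then show ?thesis by (simp add: \<rho>_def bx_eq_0)
  qed
  have f3: "(LINT z|lebesgue. \<rho> z) = 1"
    using cpos unfolding \<rho>_def c_def by simp
  have f4: "(\<lambda>w. \<rho> (z - w)) \<in> bump_alg" for z
  proof -
    have "bx (-s) s (z - w) = bx (z - s) (z + s) w" for w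
      by (simp add: bx_def algebra_simps)
    then have "(\<lambda>w. \<rho> (z - w)) = (\<lambda>w. (1/c) * bx (z - s) (z + s) w)" by (simp add: \<rho>_def)
    then show ?thesis by (simp only:) (intro bump_alg.mult bump_alg.const bx_alg)
  qed
  have f5: "0 \<le> \<rho> z" for z using bx_nonneg cpos by (simp add: \<rho>_def)
  show ?thesis
    by (rule exI[of _ \<rho>], rule exI, rule exI, intro conjI allI impI) (rule f1 f2 f3 f4 f5; assumption?)+
qed

text \<open>Young's inequality for a kernel of mass 1: \<rho> |g| is split as sqrt \<rho> times sqrt
  \<rho> |g|, Cauchy-Schwarz is applied in w, and the integrals are exchanged. Restricting either
  variable to a compact set can only lower the mass of the kernel.\<close>

lemma convolution_L2_bound:
  fixes g H :: "complex \<Rightarrow> complex"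
  assumes K: "compact K1" "compact K2" and \<rho>: "continuous_on UNIV \<rho>" "\<And>z. 0 \<le> \<rho> z" "(LINT z|lebesgue. \<rho> z) = (1::real)"
    and g: "sqint (lebesgue_on K2) g" and H: "continuous_on K1 H"
    and eq: "\<And>z. z \<in> K1 \<Longrightarrow> H z = (LINT w|lebesgue_on K2. \<rho> (z - w) *\<^sub>R g w)"
  shows "(LINT z|lebesgue_on K1. (norm (H z))\<^sup>2) \<le> (LINT w|lebesgue_on K2. (norm (g w))\<^sup>2)"
proof -
  define M1 where "M1 = lebesgue_on K1"
  define M2 where "M2 = lebesgue_on K2"
  interpret M1: finite_measure M1 unfolding M1_def using K(1) by (rule finite_measure_lebesgue_on_compact)
  interpret M2: finite_measure M2 unfolding M2_def using K(2) by (rule finite_measure_lebesgue_on_compact)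
  interpret pair_sigma_finite M1 M2 ..
  have [measurable]: "g \<in> borel_measurable M2" "\<rho> \<in> borel_measurable borel"
    using g \<rho>(1) by (auto simp: sqint_def M2_def borel_measurable_continuous_onI)
  have [measurable]: "(\<lambda>z. z) \<in> borel_measurable M1" "(\<lambda>z. z) \<in> borel_measurable M2"
    unfolding M1_def M2_def using K by (auto intro!: continuous_on_compact_measurable continuous_intros)
  have one: "(\<integral>\<^sup>+z. ennreal (\<rho> (c + m *\<^sub>R z)) \<partial>lebesgue) = 1" if "\<bar>m\<bar> = 1" for c m
  proof -
    have L: "(LINT z|lebesgue. \<rho> (c + m *\<^sub>R z)) = 1"
      using lebesgue_integral_reflect_shift[OF \<rho>(1) that] \<rho>(3) by simp
    \<comment> \<open>The Bochner integral of a nonintegrable function is 0, so the value 1 forces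
      integrability.\<close>
    then have "integrable lebesgue (\<lambda>z. \<rho> (c + m *\<^sub>R z))"
      using not_integrable_integral_eq by force
    then show ?thesis using L \<rho>(2) by (simp add: nn_integral_eq_integral)
  qed
  have sub: "(\<integral>\<^sup>+z. u z \<partial>lebesgue_on K) \<le> (\<integral>\<^sup>+z. u z \<partial>lebesgue)" if "compact K" for K :: "complex set" and u
    using compact_sets_lebesgue[OF that]
    by (simp add: nn_integral_restrict_space) (intro nn_integral_mono, auto simp: indicator_def)
  have le1: "(\<integral>\<^sup>+w. ennreal (\<rho> (z - w)) \<partial>M2) \<le> 1" for z
    using sub[OF K(2), of "\<lambda>w. ennreal (\<rho> (z - w))"] one[of "-1" z] by (simp add: M2_def)
  have le2: "(\<integral>\<^sup>+z. ennreal (\<rho> (z - w)) \<partial>M1) \<le> 1" for w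
    using sub[OF K(1), of "\<lambda>z. ennreal (\<rho> (z - w))"] one[of 1 "-w"] by (simp add: M1_def)
  have pt: "ennreal ((norm (H z))\<^sup>2) \<le> (\<integral>\<^sup>+w. ennreal (\<rho> (z - w) * (norm (g w))\<^sup>2) \<partial>M2)" if "z \<in> K1" for z
  proof -
    have "ennreal (norm (H z)) \<le> (\<integral>\<^sup>+w. ennreal (norm (\<rho> (z - w) *\<^sub>R g w)) \<partial>M2)"
    proof (cases "integrable M2 (\<lambda>w. \<rho> (z - w) *\<^sub>R g w)")
      case True
      then show ?thesis using integral_norm_bound_ennreal[OF True] eq[OF that] by (simp add: M2_def)
    next
      \<comment> \<open>The default value of the integral makes \<open>H z\<close> equal to 0
        here.\<close>
      case False
      then show ?thesis using eq[OF that] by (simp add: M2_def not_integrable_integral_eq)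
    qed
    also have "\<dots> = (\<integral>\<^sup>+w. ennreal (sqrt (\<rho> (z - w))) * ennreal (sqrt (\<rho> (z - w)) * norm (g w)) \<partial>M2)"
      by (intro nn_integral_cong)
         (simp add: ennreal_mult[symmetric] \<rho>(2) mult.assoc[symmetric])
    finally have "ennreal ((norm (H z))\<^sup>2) \<le> (\<integral>\<^sup>+w. ennreal (sqrt (\<rho> (z - w))) * ennreal (sqrt (\<rho> (z - w)) * norm (g w)) \<partial>M2)\<^sup>2"
      by (simp add: ennreal_power[symmetric] power_mono)
    also have "\<dots> \<le> (\<integral>\<^sup>+w. (ennreal (sqrt (\<rho> (z - w))))\<^sup>2 \<partial>M2) * (\<integral>\<^sup>+w. (ennreal (sqrt (\<rho> (z - w)) * norm (g w)))\<^sup>2 \<partial>M2)"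
      by (rule Cauchy_Schwarz_nn_integral) measurable
    also have "\<dots> = (\<integral>\<^sup>+w. ennreal (\<rho> (z - w)) \<partial>M2) * (\<integral>\<^sup>+w. ennreal (\<rho> (z - w) * (norm (g w))\<^sup>2) \<partial>M2)"
      by (simp add: ennreal_power \<rho>(2) power_mult_distrib)
    also have "\<dots> \<le> 1 * (\<integral>\<^sup>+w. ennreal (\<rho> (z - w) * (norm (g w))\<^sup>2) \<partial>M2)"
      by (intro mult_right_mono le1) simp
    finally show ?thesis by simp
  qed
  have "(\<integral>\<^sup>+z. ennreal ((norm (H z))\<^sup>2) \<partial>M1) \<le> (\<integral>\<^sup>+z. (\<integral>\<^sup>+w. ennreal (\<rho> (z - w) * (norm (g w))\<^sup>2) \<partial>M2) \<partial>M1)"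
    by (rule nn_integral_mono) (use pt in \<open>simp add: M1_def\<close>)
  also have "\<dots> = (\<integral>\<^sup>+w. (\<integral>\<^sup>+z. ennreal (\<rho> (z - w) * (norm (g w))\<^sup>2) \<partial>M1) \<partial>M2)"
    by (rule Fubini'[symmetric]) measurable
  also have "\<dots> \<le> (\<integral>\<^sup>+w. ennreal ((norm (g w))\<^sup>2) \<partial>M2)"
  proof (rule nn_integral_mono)
    fix w
    have "(\<integral>\<^sup>+z. ennreal (\<rho> (z - w) * (norm (g w))\<^sup>2) \<partial>M1) = (\<integral>\<^sup>+z. ennreal (\<rho> (z - w)) \<partial>M1) * ennreal ((norm (g w))\<^sup>2)"
      by (subst nn_integral_multc[symmetric]) (simp_all add: ennreal_mult \<rho>(2))
    also have "\<dots> \<le> 1 * ennreal ((norm (g w))\<^sup>2)" by (intro mult_right_mono le2) simp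
    finally show "(\<integral>\<^sup>+z. ennreal (\<rho> (z - w) * (norm (g w))\<^sup>2) \<partial>M1) \<le> ennreal ((norm (g w))\<^sup>2)" by simp
  qed
  also have "\<dots> = ennreal (LINT w|M2. (norm (g w))\<^sup>2)"
    using g by (intro nn_integral_eq_integral) (auto simp: sqint_def M2_def)
  finally have "(\<integral>\<^sup>+z. ennreal ((norm (H z))\<^sup>2) \<partial>M1) \<le> ennreal (LINT w|M2. (norm (g w))\<^sup>2)" .
  moreover have "(\<integral>\<^sup>+z. ennreal ((norm (H z))\<^sup>2) \<partial>M1) = ennreal (LINT z|M1. (norm (H z))\<^sup>2)"
    using continuous_on_compact_sqint[OF K(1) H] by (intro nn_integral_eq_integral) (auto simp: sqint_def M1_def)
  ultimately show ?thesis by (simp add: M1_def M2_def integral_nonneg_AE)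
qed

text \<open>The working form of Sobolev regularity on a compact set: identities are proved for the
  approximants and passed to the limit. The approximants have to be C2 because
  \<open>integral_det_zero\<close> differentiates a gradient once more.\<close>

definition appr :: "complex set \<Rightarrow> (complex \<Rightarrow> complex) \<Rightarrow> (complex \<Rightarrow> complex) \<Rightarrow> (complex \<Rightarrow> complex) \<Rightarrow> bool" where
  "appr K f fx fy \<longleftrightarrow> (\<exists>h hx hy. (\<forall>n::nat. C2p (h n) (hx n) (hy n)) \<and> uniform_limit K h f sequentially \<and>
     L2lim (lebesgue_on K) hx fx \<and> L2lim (lebesgue_on K) hy fy)"

text \<open>Delivers uniform closeness and L2 bounds of the gradients on \<open>K1\<close>, not yet
  their convergence. \<open>K2\<close> contains the closed 2\<epsilon>-neighbourhood of
  \<open>K1\<close>, so for z in \<open>K1\<close> the convolution sees \<open>f\<close> and its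
  weak derivatives on \<open>K2\<close> only.\<close>

lemma mollify_step:
  fixes f F :: "complex \<Rightarrow> complex"
  assumes K: "compact K1" "compact K2" "K2 \<subseteq> \<Omega>" and \<epsilon>: "\<epsilon> > 0"
    and near: "\<And>z w. z \<in> K1 \<Longrightarrow> dist z w \<le> 2 * \<epsilon> \<Longrightarrow> w \<in> K2"
    and F: "continuous_on UNIV F" "\<And>z. z \<in> K2 \<Longrightarrow> F z = f z" and box: "K2 \<subseteq> cbox a b"
    and W: "W12_loc \<Omega> f fx fy"
  shows "\<exists>h hx hy. C2p h hx hy \<and>
      (\<forall>z\<in>K1. \<forall>\<eta>. (\<forall>w. dist z w < 2 * \<epsilon> \<longrightarrow> norm (F w - F z) \<le> \<eta>) \<longrightarrow> norm (h z - F z) \<le> \<eta>) \<and>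
      (LINT z|lebesgue_on K1. (norm (hx z))\<^sup>2) \<le> (LINT w|lebesgue_on K2. (norm (fx w))\<^sup>2) \<and>
      (LINT z|lebesgue_on K1. (norm (hy z))\<^sup>2) \<le> (LINT w|lebesgue_on K2. (norm (fy w))\<^sup>2)"
proof -
  obtain \<rho> \<rho>x \<rho>y where \<rho>: "C2p \<rho> \<rho>x \<rho>y" "\<And>z. 0 \<le> \<rho> z" "\<And>z. 2 * \<epsilon> \<le> norm z \<Longrightarrow> \<rho> z = 0"
    "(LINT z|lebesgue. \<rho> z) = (1::real)" "\<And>z. (\<lambda>w. \<rho> (z - w)) \<in> bump_alg"
    using mollifier_exists[OF \<epsilon>] by metis
  obtain \<rho>xx \<rho>xy \<rho>yy where \<rho>1: "C1p \<rho> \<rho>x \<rho>y" and \<rho>2: "C1p \<rho>x \<rho>xx \<rho>xy" "C1p \<rho>y \<rho>xy \<rho>yy"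
    using \<rho>(1) by (auto simp: C2p_def)
  define cv where "cv u z = integral (cbox a b) (\<lambda>w. u (z - w) *\<^sub>R F w)" for u :: "complex \<Rightarrow> real" and z
  have FB: "continuous_on (cbox a b) F" using F(1) continuous_on_subset by blast
  have cv: "C1p (cv u) (cv ux) (cv uy)" if "C1p u ux uy" for u ux uy
    unfolding cv_def by (rule C1p_convolution[OF FB that])
  have C2: "C2p (cv \<rho>) (cv \<rho>x) (cv \<rho>y)"
    unfolding C2p_def using cv[OF \<rho>1] cv[OF \<rho>2(1)] cv[OF \<rho>2(2)] by blast
  have out: "\<rho> (z - w) = 0" if "z \<in> K1" "w \<notin> K2" for z w
  proof (rule \<rho>(3))
    have "\<not> dist z w \<le> 2 * \<epsilon>" using near[OF that(1), of w] that(2) by blast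
    then show "2 * \<epsilon> \<le> norm (z - w)" by (simp add: dist_norm)
  qed
  have r: "C1p (\<lambda>w. \<rho> (z - w)) (\<lambda>w. - \<rho>x (z - w)) (\<lambda>w. - \<rho>y (z - w))" for z
    by (rule C1p_reflect[OF \<rho>1])
  have one: "(LINT w|lebesgue. \<rho> (z - w)) = 1" for z
    using lebesgue_integral_reflect_shift[OF C1p_continuous(1)[OF \<rho>1], of "-1" z] \<rho>(4) by simp
  have cvK2: "cv u z = (LINT w|lebesgue_on K2. u (z - w) *\<^sub>R f w)"
    if z: "z \<in> K1" and u: "continuous_on UNIV u" "\<And>w. w \<notin> K2 \<Longrightarrow> u (z - w) = 0" for u :: "complex \<Rightarrow> real" and z
  proof -
    have c: "continuous_on S (\<lambda>w. u (z - w) *\<^sub>R F w)" for S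
      by (intro continuous_intros continuous_on_compose2[OF u(1)] continuous_on_subset[OF F(1)]) auto
    have "cv u z = (LINT w|lebesgue_on (cbox a b). u (z - w) *\<^sub>R F w)"
      unfolding cv_def by (intro lebesgue_integral_eq_integral[symmetric] continuous_on_compact_integrable c) auto
    also have "\<dots> = (LINT w|lebesgue. u (z - w) *\<^sub>R F w)"
      using box u(2) by (intro integral_lebesgue_on_vanishing) auto
    also have "\<dots> = (LINT w|lebesgue_on K2. u (z - w) *\<^sub>R F w)"
      using u(2) by (intro integral_lebesgue_on_vanishing[symmetric] compact_sets_lebesgue K) auto
    also have "\<dots> = (LINT w|lebesgue_on K2. u (z - w) *\<^sub>R f w)"
      by (rule Bochner_Integration.integral_cong) (use F(2) in auto)
    finally show ?thesis .
  qed
  \<comment> \<open>For fixed z the function w -> \<rho>(z - w) is a test function supported in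
    \<open>K2\<close>. The weak derivative moves from the kernel to \<open>f\<close>, and the minus
    sign of this step cancels against the one from the reflection.\<close>
  have cvx: "cv \<rho>x z = (LINT w|lebesgue_on K2. \<rho> (z - w) *\<^sub>R fx w)" and cvy: "cv \<rho>y z = (LINT w|lebesgue_on K2. \<rho> (z - w) *\<^sub>R fy w)"
    if z: "z \<in> K1" for z
  proof -
    have 0: "\<rho>x (z - w) = 0" "\<rho>y (z - w) = 0" if "w \<notin> K2" for w
      using C1p_zero_outside[OF r compact_imp_closed[OF K(2)] out[OF z] that] by auto
    have wd: "weak_deriv \<Omega> 1 f fx" "weak_deriv \<Omega> \<i> f fy" using W by (auto simp: W12_loc_def)
    show "cv \<rho>x z = (LINT w|lebesgue_on K2. \<rho> (z - w) *\<^sub>R fx w)"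
      using weak_deriv_test[OF wd(1) test_functionI[OF \<rho>(5) K(2,3) out[OF z]] r K(2,3) out[OF z]] cvK2[OF z C1p_continuous(2)[OF \<rho>1] 0(1)] by simp
    show "cv \<rho>y z = (LINT w|lebesgue_on K2. \<rho> (z - w) *\<^sub>R fy w)"
      using weak_deriv_test[OF wd(2) test_functionI[OF \<rho>(5) K(2,3) out[OF z]] r K(2,3) out[OF z]] cvK2[OF z C1p_continuous(3)[OF \<rho>1] 0(2)] by simp
  qed
  have s: "sqint (lebesgue_on K2) fx" "sqint (lebesgue_on K2) fy"
    using W L2_loc_sqint[OF _ K(2,3)] by (auto simp: W12_loc_def)
  have cc: "continuous_on K1 (cv \<rho>x)" "continuous_on K1 (cv \<rho>y)"
    using C1p_continuous[OF C2p_C1p[OF C2]] by auto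
  \<comment> \<open>The kernel has mass 1 on \<open>K2\<close>, so \<open>cv \<rho> z - F z\<close>
    is a weighted mean of the differences \<open>F w - F z\<close> over the points w with \<rho>(z -
    w) > 0.\<close>
  have near_F: "norm (cv \<rho> z - F z) \<le> \<eta>" if z: "z \<in> K1" and \<eta>: "\<And>w. dist z w < 2 * \<epsilon> \<Longrightarrow> norm (F w - F z) \<le> \<eta>" for z \<eta>
  proof -
    have c: "continuous_on S (\<lambda>w. \<rho> (z - w))" for S
      by (intro continuous_intros continuous_on_compose2[OF C1p_continuous(1)[OF \<rho>1]]) auto
    have cF: "continuous_on S F" for S using F(1) continuous_on_subset by blast
    have i: "integrable (lebesgue_on K2) (\<lambda>w. \<rho> (z - w))" by (intro continuous_on_compact_integrable K c)
    have iF: "integrable (lebesgue_on K2) (\<lambda>w. \<rho> (z - w) *\<^sub>R F w)" "integrable (lebesgue_on K2) (\<lambda>w. \<rho> (z - w) *\<^sub>R (F w - F z))"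
      by (intro continuous_on_compact_integrable K c continuous_intros cF)+
    have 1: "(LINT w|lebesgue_on K2. \<rho> (z - w)) = 1"
      using one[of z] out[OF z] integral_lebesgue_on_vanishing[OF compact_sets_lebesgue[OF K(2)], of "\<lambda>w. \<rho> (z - w)"] by simp
    have "cv \<rho> z = (LINT w|lebesgue_on K2. \<rho> (z - w) *\<^sub>R f w)"
      by (rule cvK2[OF z C1p_continuous(1)[OF \<rho>1] out[OF z]])
    also have "\<dots> = (LINT w|lebesgue_on K2. \<rho> (z - w) *\<^sub>R F w)"
      by (rule Bochner_Integration.integral_cong) (use F(2) in auto)
    finally have "cv \<rho> z - F z = (LINT w|lebesgue_on K2. \<rho> (z - w) *\<^sub>R F w) - (LINT w|lebesgue_on K2. \<rho> (z - w)) *\<^sub>R F z"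
      by (simp add: 1)
    also have "\<dots> = (LINT w|lebesgue_on K2. \<rho> (z - w) *\<^sub>R (F w - F z))"
      using i iF by (simp add: scaleR_diff_right)
    finally have "norm (cv \<rho> z - F z) \<le> (LINT w|lebesgue_on K2. norm (\<rho> (z - w) *\<^sub>R (F w - F z)))"
      using integral_norm_bound[of "lebesgue_on K2" "\<lambda>w. \<rho> (z - w) *\<^sub>R (F w - F z)"] by (simp only:)
    also have "\<dots> \<le> (LINT w|lebesgue_on K2. \<rho> (z - w) * \<eta>)"
    proof (rule integral_mono)
      fix w
      show "norm (\<rho> (z - w) *\<^sub>R (F w - F z)) \<le> \<rho> (z - w) * \<eta>"
      proof (cases "dist z w < 2 * \<epsilon>")
        case True
        then show ?thesis using \<eta> \<rho>(2) by (simp add: mult_left_mono)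
      next
        case False
        then show ?thesis using \<rho>(3)[of "z - w"] by (simp add: dist_norm)
      qed
    qed (use i integrable_norm[OF iF(2)] in simp_all)
    also have "\<dots> = \<eta>" using 1 by simp
    finally show ?thesis .
  qed
  have "(LINT z|lebesgue_on K1. (norm (cv \<rho>x z))\<^sup>2) \<le> (LINT w|lebesgue_on K2. (norm (fx w))\<^sup>2)"
    by (rule convolution_L2_bound[OF K(1,2) C1p_continuous(1)[OF \<rho>1] \<rho>(2,4) s(1) cc(1) cvx])
  moreover have "(LINT z|lebesgue_on K1. (norm (cv \<rho>y z))\<^sup>2) \<le> (LINT w|lebesgue_on K2. (norm (fy w))\<^sup>2)"
    by (rule convolution_L2_bound[OF K(1,2) C1p_continuous(1)[OF \<rho>1] \<rho>(2,4) s(2) cc(2) cvy])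
  ultimately show ?thesis using C2 near_F
    by (intro exI[of _ "cv \<rho>"] exI[of _ "cv \<rho>x"] exI[of _ "cv \<rho>y"]) blast
qed

lemma sqint_Pair:
  fixes f :: "'m \<Rightarrow> 'a::euclidean_space" and g :: "'m \<Rightarrow> 'b::euclidean_space"
  assumes "sqint M f" "sqint M g" shows "sqint M (\<lambda>z. (f z, g z))"
proof -
  have "f \<in> borel_measurable M" "g \<in> borel_measurable M" using assms by (auto simp: sqint_def)
  then have "(\<lambda>z. (f z, g z)) \<in> borel_measurable M" by (rule borel_measurable_Pair)
  then show ?thesis using assms by (simp add: sqint_def norm_Pair)
qed

text \<open>Mollified functions at shrinking scales have gradients bounded in L2, so midpoints of
  their tails converge in L2. Testing against bumps identifies the limit with the given weak
  derivatives on the interior of \<open>K1\<close>, which contains \<open>K\<close>.\<close>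

theorem W12_loc_appr:
  fixes f :: "complex \<Rightarrow> complex"
  assumes \<Omega>: "open \<Omega>" and f: "continuous_on \<Omega> f" and W: "W12_loc \<Omega> f fx fy" and K: "compact K" "K \<subseteq> \<Omega>"
  shows "appr K f fx fy"
proof -
  obtain e where e: "e > 0" "(\<Union>x\<in>K. ball x e) \<subseteq> \<Omega>"
    using compact_subset_open_imp_ball_epsilon_subset[OF K(1) \<Omega> K(2)] by blast
  \<comment> \<open>\<open>K1\<close> and \<open>K2\<close> will be the closed neighbourhoods of
    \<open>K\<close> of radii \<delta> and 2\<delta>, both within the e-neighbourhood of
    \<open>K\<close>.\<close>
  define \<delta> where "\<delta> = e / 4"
  have \<delta>: "\<delta> > 0" using e by (simp add: \<delta>_def)
  define Kt where "Kt t = {x + y |x y. x \<in> K \<and> y \<in> cball 0 t}" for t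
  have Kt_iff: "w \<in> Kt t \<longleftrightarrow> (\<exists>x\<in>K. dist x w \<le> t)" for w t
  proof
    assume "w \<in> Kt t"
    then obtain x y where "w = x + y" "x \<in> K" "norm y \<le> t" by (auto simp: Kt_def)
    then show "\<exists>x\<in>K. dist x w \<le> t" by (intro bexI[of _ x]) (auto simp: dist_norm)
  next
    assume "\<exists>x\<in>K. dist x w \<le> t"
    then obtain x where "x \<in> K" "dist x w \<le> t" by blast
    then have "w = x + (w - x)" "x \<in> K" "w - x \<in> cball 0 t" by (auto simp: dist_norm norm_minus_commute)
    then show "w \<in> Kt t" unfolding Kt_def by blast
  qed
  have Kt: "compact (Kt t)" for t unfolding Kt_def by (rule compact_sums[OF K(1) compact_cball])
  define K1 where "K1 = Kt \<delta>"
  define K2 where "K2 = Kt (2 * \<delta>)"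
  have K12: "compact K1" "compact K2" using Kt by (auto simp: K1_def K2_def)
  have K2\<Omega>: "K2 \<subseteq> \<Omega>"
  proof
    fix w assume "w \<in> K2"
    then obtain x where "x \<in> K" "dist x w \<le> 2 * \<delta>" by (auto simp: K2_def Kt_iff)
    then have "w \<in> (\<Union>x\<in>K. ball x e)" using e(1) by (auto simp: \<delta>_def intro!: bexI[of _ x])
    then show "w \<in> \<Omega>" using e by blast
  qed
  have near: "w \<in> K2" if zw: "z \<in> K1" "dist z w \<le> \<delta>" for z w
  proof -
    obtain x where "x \<in> K" "dist x z \<le> \<delta>" using zw(1) by (auto simp: K1_def Kt_iff)
    then show ?thesis using zw(2) dist_triangle[of x w z] by (auto simp: K2_def Kt_iff intro!: bexI[of _ x])
  qed
  have K1K2: "K1 \<subseteq> K2" using near \<delta> by auto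
  have Kint: "K \<subseteq> interior K1"
  proof
    fix x assume "x \<in> K"
    then have "ball x \<delta> \<subseteq> K1" by (auto simp: K1_def Kt_iff intro!: bexI[of _ x])
    then show "x \<in> interior K1" using \<delta> by (meson centre_in_ball interior_maximal open_ball subset_iff)
  qed
  \<comment> \<open>The Tietze extension supplies a continuous function on the whole box over which
    the convolution integrates; on \<open>K2\<close> it is \<open>f\<close>.\<close>
  obtain F where F: "continuous_on UNIV F" "\<And>z. z \<in> K2 \<Longrightarrow> F z = f z"
    using Tietze_unbounded[of K2 f UNIV] continuous_on_subset[OF f K2\<Omega>] compact_imp_closed[OF K12(2)] by auto
  obtain b where b: "K2 \<subseteq> cbox (-b) b" using bounded_subset_cbox_symmetric[OF compact_imp_bounded[OF K12(2)]] by blast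
  define \<epsilon> where "\<epsilon> n = \<delta> / (2 * real (Suc n))" for n
  have \<epsilon>: "\<epsilon> n > 0" "2 * \<epsilon> n \<le> \<delta>" "2 * \<epsilon> n = \<delta> * (1 / real (Suc n))" for n using \<delta> by (auto simp: \<epsilon>_def field_simps)
  have "\<forall>n. \<exists>h hx hy. C2p h hx hy \<and>
      (\<forall>z\<in>K1. \<forall>\<eta>. (\<forall>w. dist z w < 2 * \<epsilon> n \<longrightarrow> norm (F w - F z) \<le> \<eta>) \<longrightarrow> norm (h z - F z) \<le> \<eta>) \<and>
      (LINT z|lebesgue_on K1. (norm (hx z))\<^sup>2) \<le> (LINT w|lebesgue_on K2. (norm (fx w))\<^sup>2) \<and>
      (LINT z|lebesgue_on K1. (norm (hy z))\<^sup>2) \<le> (LINT w|lebesgue_on K2. (norm (fy w))\<^sup>2)"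
  proof
    fix n
    show "\<exists>h hx hy. C2p h hx hy \<and>
      (\<forall>z\<in>K1. \<forall>\<eta>. (\<forall>w. dist z w < 2 * \<epsilon> n \<longrightarrow> norm (F w - F z) \<le> \<eta>) \<longrightarrow> norm (h z - F z) \<le> \<eta>) \<and>
      (LINT z|lebesgue_on K1. (norm (hx z))\<^sup>2) \<le> (LINT w|lebesgue_on K2. (norm (fx w))\<^sup>2) \<and>
      (LINT z|lebesgue_on K1. (norm (hy z))\<^sup>2) \<le> (LINT w|lebesgue_on K2. (norm (fy w))\<^sup>2)"
      by (rule mollify_step[OF K12 K2\<Omega> \<epsilon>(1) _ F b W]) (use near \<epsilon>(2)[of n] in force)+
  qed
  then obtain h hx hy where h: "\<And>n. C2p (h n) (hx n) (hy n)"
    and hF: "\<And>n z \<eta>. z \<in> K1 \<Longrightarrow> (\<And>w. dist z w < 2 * \<epsilon> n \<Longrightarrow> norm (F w - F z) \<le> \<eta>) \<Longrightarrow> norm (h n z - F z) \<le> \<eta>"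
    and hB: "\<And>n. (LINT z|lebesgue_on K1. (norm (hx n z))\<^sup>2) \<le> (LINT w|lebesgue_on K2. (norm (fx w))\<^sup>2)"
      "\<And>n. (LINT z|lebesgue_on K1. (norm (hy n z))\<^sup>2) \<le> (LINT w|lebesgue_on K2. (norm (fy w))\<^sup>2)"
    by metis
  define X where "X n z = (h n z, hx n z, hy n z)" for n z
  have s: "sqint (lebesgue_on K1) (hx n)" "sqint (lebesgue_on K1) (hy n)" for n
    using C1p_continuous[OF C2p_C1p[OF h]] by (auto intro!: continuous_on_compact_sqint K12)
  have sX: "sqint (lebesgue_on K1) (\<lambda>z. snd (X n z))" for n
    using sqint_Pair[OF s] by (simp add: X_def)
  have BX: "(LINT z|lebesgue_on K1. (norm (snd (X n z)))\<^sup>2) \<le> (LINT w|lebesgue_on K2. (norm (fx w))\<^sup>2) + (LINT w|lebesgue_on K2. (norm (fy w))\<^sup>2)" for n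
    using hB[of n] s[of n] by (simp add: X_def norm_Pair sqint_def)
  \<comment> \<open>Midpoints are formed of the triples (function, x-derivative, y-derivative), so
    each midpoint carries its own derivatives, while the energy to be minimized looks at the last
    two entries.\<close>
  obtain Y G where Y: "\<And>n. Y n \<in> mids X n" and G: "L2lim (lebesgue_on K1) (\<lambda>n z. snd (Y n z)) G"
    using L2_midpoint_compactness[where X=X and P=snd, OF finite_measure_lebesgue_on_compact[OF K12(1)] linear_snd sX BX] by blast
  have midC: "C2p (\<lambda>z. fst (u z)) (\<lambda>z. fst (snd (u z))) (\<lambda>z. snd (snd (u z)))" if "u \<in> mids X n" for u n
    using that
  proof induction
    case (base k) then show ?case using h[of k] by (simp add: X_def)
  next
    case (mid u v) then show ?case using C2p_midpoint by fastforce
  qed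
  have unif: "uniform_limit K1 (\<lambda>n z. fst (Y n z)) f sequentially"
    unfolding uniform_limit_iff
  proof (intro allI impI)
    fix \<eta> :: real assume \<eta>: "\<eta> > 0"
    have "uniformly_continuous_on K2 F"
      by (rule compact_uniformly_continuous[OF continuous_on_subset[OF F(1)] K12(2)]) simp
    then obtain d where d: "d > 0" "\<And>z w. z \<in> K2 \<Longrightarrow> w \<in> K2 \<Longrightarrow> dist w z < d \<Longrightarrow> dist (F w) (F z) < \<eta>/2"
      using \<eta> unfolding uniformly_continuous_on_def by (metis half_gt_zero)
    have "(\<lambda>n. \<delta> * (1 / real (Suc n))) \<longlonglongrightarrow> \<delta> * 0" by (intro tendsto_intros LIMSEQ_Suc[OF lim_1_over_n])
    then have "\<forall>\<^sub>F n in sequentially. 2 * \<epsilon> n < d" unfolding \<epsilon>(3) using d(1) by (intro order_tendstoD(2)) auto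
    then obtain N where N: "\<And>n. n \<ge> N \<Longrightarrow> 2 * \<epsilon> n < d" by (auto simp: eventually_sequentially)
    have base: "norm (h n z - F z) \<le> \<eta>/2" if "n \<ge> N" "z \<in> K1" for n z
    proof (rule hF[OF that(2)])
      fix w assume w: "dist z w < 2 * \<epsilon> n"
      have "w \<in> K2" using near[OF that(2)] w \<epsilon>(2)[of n] by auto
      then show "norm (F w - F z) \<le> \<eta>/2"
        using d(2)[of z w] that K1K2 w N[OF that(1)] by (auto simp: dist_commute dist_norm[symmetric])
    qed
    \<comment> \<open>Closeness to \<open>F\<close> is a convex condition, hence it passes to all
      midpoints of the tail from \<open>N\<close>.\<close>
    have "norm (fst (u z) - F z) \<le> \<eta>/2" if "u \<in> mids X N" "z \<in> K1" for u z
      using that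
    proof induction
      case (base k) then show ?case using \<open>\<And>n z. N \<le> n \<Longrightarrow> z \<in> K1 \<Longrightarrow> norm (h n z - F z) \<le> \<eta>/2\<close> by (simp add: X_def)
    next
      case (mid u v)
      have "fst ((1/2) *\<^sub>R (u z + v z)) - F z = (1/2) *\<^sub>R ((fst (u z) - F z) + (fst (v z) - F z))"
        by (simp add: algebra_simps scaleR_2[symmetric])
      also have "norm \<dots> \<le> (1/2) * (norm (fst (u z) - F z) + norm (fst (v z) - F z))"
        using norm_triangle_ineq[of "fst (u z) - F z" "fst (v z) - F z"] by (simp only: norm_scaleR) simp
      also have "\<dots> \<le> \<eta>/2" using mid by simp
      finally show ?case .
    qed
    then have "dist (fst (Y n z)) (f z) < \<eta>" if "n \<ge> N" "z \<in> K1" for n z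
      using mids_mono[OF Y that(1)] that(2) F(2)[of z] K1K2 \<eta> by (force simp: dist_norm)
    then show "\<forall>\<^sub>F n in sequentially. \<forall>z\<in>K1. dist (fst (Y n z)) (f z) < \<eta>"
      by (auto simp: eventually_sequentially)
  qed
  have L: "L2lim (lebesgue_on K1) (\<lambda>n z. fst (snd (Y n z))) (\<lambda>z. fst (G z))"
    "L2lim (lebesgue_on K1) (\<lambda>n z. snd (snd (Y n z))) (\<lambda>z. snd (G z))"
    using L2lim_linear[OF bounded_linear_fst G] L2lim_linear[OF bounded_linear_snd G] by auto
  have fin: "finite_measure (lebesgue_on K1)" by (rule finite_measure_lebesgue_on_compact[OF K12(1)])
  have sf: "sqint (lebesgue_on K1) fx" "sqint (lebesgue_on K1) fy"
    using W L2_loc_sqint[OF _ K12(1)] K1K2 K2\<Omega> by (auto simp: W12_loc_def)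
  \<comment> \<open>For a bump supported in the interior of \<open>K1\<close>, integration by parts
    in the approximants and the weak derivative of \<open>f\<close> lead to the same integral, so
    \<open>H\<close> and \<open>g\<close> cannot be told apart by testing.\<close>
  have ident: "AE z in lebesgue. z \<in> interior K1 \<longrightarrow> H z - g z = 0"
    if H: "L2lim (lebesgue_on K1) Hn H" and g: "sqint (lebesgue_on K1) g" "weak_deriv \<Omega> v f g"
      and Hn: "\<And>n z. Hn n z = Re v *\<^sub>R fst (snd (Y n z)) + Im v *\<^sub>R snd (snd (Y n z))" for v H g and Hn :: "nat \<Rightarrow> complex \<Rightarrow> complex"
  proof (rule AE_zero_of_test[OF open_interior])
    have gi: "integrable (lebesgue_on K1) g" using L2lim_imp_L1lim[OF fin L2lim_const[OF g(1)]] by (simp add: L1lim_def)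
    note HL = L2lim_imp_L1lim[OF fin H]
    then have Hi: "integrable (lebesgue_on K1) H" by (simp add: L1lim_def)
    have HG: "integrable (lebesgue_on K1) (\<lambda>z. H z - g z)" using Hi gi by simp
    show "integrable (lebesgue_on S) (\<lambda>z. H z - g z)" if "compact S" "S \<subseteq> interior K1" for S
      by (rule lebesgue_on_subset_integrable[OF HG]) (use that K12 interior_subset[of K1] in \<open>auto intro!: compact_sets_lebesgue\<close>)
    fix \<phi> S assume \<phi>: "\<phi> \<in> bump_alg" "compact S" "S \<subseteq> interior K1" "\<And>z. z \<notin> S \<Longrightarrow> \<phi> z = 0"
    obtain \<phi>x \<phi>y where C: "C1p \<phi> \<phi>x \<phi>y" using bump_alg_C2[OF \<phi>(1)] by blast
    have out: "\<phi> z = 0" if "z \<notin> K1" for z using \<phi>(3,4) interior_subset[of K1] that by blast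
    have ub: "uconv (lebesgue_on K1) (\<lambda>_. u) u" if "continuous_on K1 u" for u :: "complex \<Rightarrow> real"
      by (rule uconv_lebesgue_on[OF K12(1)]) (use that in \<open>auto simp: uniform_limit_iff\<close>)
    have lim1: "(\<lambda>n. LINT z|lebesgue_on K1. \<phi> z *\<^sub>R Hn n z) \<longlonglongrightarrow> (LINT z|lebesgue_on K1. \<phi> z *\<^sub>R H z)"
      by (rule L1lim_integral[OF L1lim_bilinear_uconv[OF bounded_bilinear_scaleR ub HL]])
         (rule C1p_continuous[OF C])
    have fc: "continuous_on K1 (\<lambda>z. fst (Y n z))" for n
      by (rule C1p_continuous(1)[OF C2p_C1p[OF midC[OF Y]]])
    have uf: "L1lim (lebesgue_on K1) (\<lambda>n z. fst (Y n z)) f"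
      by (rule uconv_imp_L1lim[OF fin uconv_lebesgue_on[OF K12(1) fc unif]])
    let ?d = "\<lambda>z. Re v * \<phi>x z + Im v * \<phi>y z"
    have cd: "continuous_on K1 ?d" by (intro continuous_intros C1p_continuous[OF C])
    have lim2: "(\<lambda>n. LINT z|lebesgue_on K1. ?d z *\<^sub>R fst (Y n z)) \<longlonglongrightarrow> (LINT z|lebesgue_on K1. ?d z *\<^sub>R f z)"
      by (rule L1lim_integral[OF L1lim_bilinear_uconv[OF bounded_bilinear_scaleR ub[OF cd] uf]])
    have "(LINT z|lebesgue_on K1. \<phi> z *\<^sub>R Hn n z) = - (LINT z|lebesgue_on K1. ?d z *\<^sub>R fst (Y n z))" for n
    proof -
      note P = C1p_scaleR[OF C C2p_C1p[OF midC[OF Y[of n]]]]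
      have "\<phi> z *\<^sub>R fst (Y n z) = 0" if "z \<notin> K1" for z using out[OF that] by simp
      note Z = C1p_integral_zero[OF P K12(1) this]
      have ci: "continuous_on K1 (\<lambda>z. \<phi>x z *\<^sub>R fst (Y n z) + \<phi> z *\<^sub>R fst (snd (Y n z)))" "continuous_on K1 (\<lambda>z. \<phi>y z *\<^sub>R fst (Y n z) + \<phi> z *\<^sub>R snd (snd (Y n z)))"
        by (rule C1p_continuous[OF P])+
      have ci': "continuous_on K1 (\<lambda>z. \<phi> z *\<^sub>R Hn n z)" "continuous_on K1 (\<lambda>z. ?d z *\<^sub>R fst (Y n z))"
        unfolding Hn by (intro continuous_intros C1p_continuous[OF C] C1p_continuous[OF C2p_C1p[OF midC[OF Y]]])+
      have "(LINT z|lebesgue_on K1. \<phi> z *\<^sub>R Hn n z) + (LINT z|lebesgue_on K1. ?d z *\<^sub>R fst (Y n z)) =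
         (LINT z|lebesgue_on K1. \<phi> z *\<^sub>R Hn n z + ?d z *\<^sub>R fst (Y n z))"
        using ci' by (intro Bochner_Integration.integral_add[symmetric] continuous_on_compact_integrable K12)
      also have "\<dots> = (LINT z|lebesgue_on K1. Re v *\<^sub>R (\<phi>x z *\<^sub>R fst (Y n z) + \<phi> z *\<^sub>R fst (snd (Y n z))) + Im v *\<^sub>R (\<phi>y z *\<^sub>R fst (Y n z) + \<phi> z *\<^sub>R snd (snd (Y n z))))"
        by (intro Bochner_Integration.integral_cong refl) (simp add: Hn algebra_simps)
      also have "\<dots> = Re v *\<^sub>R (LINT z|lebesgue_on K1. \<phi>x z *\<^sub>R fst (Y n z) + \<phi> z *\<^sub>R fst (snd (Y n z))) + Im v *\<^sub>R (LINT z|lebesgue_on K1. \<phi>y z *\<^sub>R fst (Y n z) + \<phi> z *\<^sub>R snd (snd (Y n z)))"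
        using ci[THEN continuous_on_compact_integrable[OF K12(1)]]
        by (subst Bochner_Integration.integral_add) (simp_all only: integrable_scaleR_right integral_scaleR_right)
      also have "\<dots> = 0" using Z by simp
      finally show ?thesis by (simp add: eq_neg_iff_add_eq_0)
    qed
    then have "(LINT z|lebesgue_on K1. \<phi> z *\<^sub>R H z) = - (LINT z|lebesgue_on K1. ?d z *\<^sub>R f z)"
      using LIMSEQ_unique[OF lim1] tendsto_minus[OF lim2] by simp
    also have "\<dots> = (LINT z|lebesgue_on K1. \<phi> z *\<^sub>R g z)"
      using weak_deriv_test[OF g(2) test_functionI[OF \<phi>(1) K12(1) _ out] C K12(1) _ out] K1K2 K2\<Omega> by auto
    finally have eq: "(LINT z|lebesgue_on K1. \<phi> z *\<^sub>R H z) = (LINT z|lebesgue_on K1. \<phi> z *\<^sub>R g z)" .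
    have i1: "integrable (lebesgue_on K1) (\<lambda>z. \<phi> z *\<^sub>R u z)" if "integrable (lebesgue_on K1) u" for u :: "complex \<Rightarrow> complex"
      using L1lim_bilinear_uconv[OF bounded_bilinear_scaleR ub[OF C1p_continuous(1)[OF C]] L1lim_const[OF that]] by (simp add: L1lim_def)
    have "(LINT z|lebesgue_on K1. \<phi> z *\<^sub>R (H z - g z)) = (LINT z|lebesgue_on K1. \<phi> z *\<^sub>R H z) - (LINT z|lebesgue_on K1. \<phi> z *\<^sub>R g z)"
      unfolding scaleR_diff_right by (intro Bochner_Integration.integral_diff i1 Hi gi)
    then have "(LINT z|lebesgue_on K1. \<phi> z *\<^sub>R (H z - g z)) = 0" using eq by simp
    moreover have "(LINT z|lebesgue_on K1. \<phi> z *\<^sub>R (H z - g z)) = (LINT z|lebesgue. \<phi> z *\<^sub>R (H z - g z))"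
      by (rule integral_lebesgue_on_vanishing[OF compact_sets_lebesgue[OF K12(1)]]) (simp add: out)
    moreover have "(LINT z|lebesgue_on S. \<phi> z *\<^sub>R (H z - g z)) = (LINT z|lebesgue. \<phi> z *\<^sub>R (H z - g z))"
      by (rule integral_lebesgue_on_vanishing[OF compact_sets_lebesgue[OF \<phi>(2)]]) (simp add: \<phi>(4))
    ultimately show "(LINT z|lebesgue_on S. \<phi> z *\<^sub>R (H z - g z)) = 0" by simp
  qed
  have sub: "K \<subseteq> K1" using Kint interior_subset by blast
  have ae: "AE z in lebesgue_on K. H z = g z" if "AE z in lebesgue. z \<in> interior K1 \<longrightarrow> H z - g z = 0" for H g :: "complex \<Rightarrow> complex"
    using that Kint compact_sets_lebesgue[OF K(1)]
    by (subst AE_restrict_space_iff) (auto elim!: eventually_mono)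
  have wd: "weak_deriv \<Omega> 1 f fx" "weak_deriv \<Omega> \<i> f fy" using W by (auto simp: W12_loc_def)
  have sfK: "sqint (lebesgue_on K) fx" "sqint (lebesgue_on K) fy"
    using W L2_loc_sqint[OF _ K] by (auto simp: W12_loc_def)
  have "L2lim (lebesgue_on K) (\<lambda>n z. fst (snd (Y n z))) fx"
    by (rule L2lim_cong_AE[OF L2lim_subset[OF L(1)]])
       (use K K12 sub sfK ae[OF ident[OF L(1) sf(1) wd(1)]] in \<open>auto simp: sqint_def intro!: compact_sets_lebesgue\<close>)
  moreover have "L2lim (lebesgue_on K) (\<lambda>n z. snd (snd (Y n z))) fy"
    by (rule L2lim_cong_AE[OF L2lim_subset[OF L(2)]])
       (use K K12 sub sfK ae[OF ident[OF L(2) sf(2) wd(2)]] in \<open>auto simp: sqint_def intro!: compact_sets_lebesgue\<close>)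
  ultimately show ?thesis
    unfolding appr_def using midC[OF Y] uniform_limit_on_subset[OF unif sub] by fast
qed

section \<open>The Jacobian and the Caccioppoli inequality\<close>

definition Jac :: "complex \<Rightarrow> complex \<Rightarrow> real" where
  "Jac a b = Re a * Im b - Im a * Re b"

lemma bounded_bilinear_Jac: "bounded_bilinear Jac"
proof
  show "\<exists>K. \<forall>a b. norm (Jac a b) \<le> norm a * norm b * K"
  proof (intro exI[of _ 2] allI)
    fix a b
    have "\<bar>Re a * Im b\<bar> \<le> norm a * norm b" "\<bar>Im a * Re b\<bar> \<le> norm a * norm b"
      unfolding abs_mult by (intro mult_mono abs_Re_le_cmod abs_Im_le_cmod; simp)+
    then show "norm (Jac a b) \<le> norm a * norm b * 2" by (simp add: Jac_def)
  qed
qed (simp_all add: Jac_def algebra_simps)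

lemma Jac_mult: "Jac (c * a) (c * b) = (norm c)\<^sup>2 * Jac a b"
  by (simp add: Jac_def cmod_power2) algebra

lemma C2p_linear:
  assumes "bounded_linear T" "C2p h hx hy"
  shows "C2p (\<lambda>z. T (h z)) (\<lambda>z. T (hx z)) (\<lambda>z. T (hy z))"
  using assms(2) bounded_linear.C1p_apply[OF assms(1)] unfolding C2p_def by blast

lemma appr_continuous:
  assumes "appr K f fx fy"
  shows "continuous_on K f"
proof -
  obtain h hx hy where h: "\<And>n::nat. C2p (h n) (hx n) (hy n)" "uniform_limit K h f sequentially"
    using assms unfolding appr_def by blast
  show ?thesis
    by (rule uniform_limit_theorem[OF _ h(2)]) (use C1p_continuous(1)[OF C2p_C1p[OF h(1)]] in auto)
qed

lemma appr_sqint: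
  assumes "appr K f fx fy"
  shows "sqint (lebesgue_on K) fx" "sqint (lebesgue_on K) fy"
  using assms unfolding appr_def L2lim_def by blast+

lemma appr_linear:
  fixes T :: "complex \<Rightarrow> complex"
  assumes "bounded_linear T" "appr K f fx fy"
  shows "appr K (\<lambda>z. T (f z)) (\<lambda>z. T (fx z)) (\<lambda>z. T (fy z))"
proof -
  obtain h hx hy where h: "\<And>n::nat. C2p (h n) (hx n) (hy n)" "uniform_limit K h f sequentially"
     "L2lim (lebesgue_on K) hx fx" "L2lim (lebesgue_on K) hy fy"
    using assms(2) unfolding appr_def by blast
  show ?thesis unfolding appr_def
    using C2p_linear[OF assms(1) h(1)] bounded_linear.uniform_limit[OF assms(1) h(2)]
      L2lim_linear[OF assms(1) h(3)] L2lim_linear[OF assms(1) h(4)] by fast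
qed

lemma integrable_continuous_scaleR:
  fixes u :: "complex \<Rightarrow> real" and g :: "complex \<Rightarrow> 'a::euclidean_space"
  assumes "compact K" "continuous_on K u" "integrable (lebesgue_on K) g"
  shows "integrable (lebesgue_on K) (\<lambda>z. u z *\<^sub>R g z)"
proof -
  have "uconv (lebesgue_on K) (\<lambda>_. u) u"
    by (rule uconv_lebesgue_on[OF assms(1)]) (use assms in \<open>auto simp: uniform_limit_iff\<close>)
  from L1lim_bilinear_uconv[OF bounded_bilinear_scaleR this L1lim_const[OF assms(3)]]
  show ?thesis by (simp add: L1lim_def)
qed

lemma integrable_continuous_mult:
  fixes u g :: "complex \<Rightarrow> real"
  assumes "compact K" "continuous_on K u" "integrable (lebesgue_on K) g"
  shows "integrable (lebesgue_on K) (\<lambda>z. u z * g z)"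
  using integrable_continuous_scaleR[OF assms] by simp

text \<open>With f = u + i v this is Stokes' theorem for the form \<phi> A(u, v) dv, where
  \<open>Au (f z) * Jac (fx z) (fy z)\<close> is the pull-back of A_u du dv. The terms with A_v drop
  out because they carry dv twice.\<close>

lemma Jac_identity:
  assumes K: "compact K" and f: "appr K f fx fy" and A: "C1p A Au Av"
    and \<phi>: "C1p \<phi> \<phi>x \<phi>y" "\<And>z. z \<notin> K \<Longrightarrow> \<phi> z = 0"
  shows "(LINT z|lebesgue_on K. \<phi> z * (Au (f z) * Jac (fx z) (fy z))) =
         - (LINT z|lebesgue_on K. A (f z) * (\<phi>x z * Im (fy z) - \<phi>y z * Im (fx z)))"
    and "integrable (lebesgue_on K) (\<lambda>z. \<phi> z * (Au (f z) * Jac (fx z) (fy z)))"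
    and "integrable (lebesgue_on K) (\<lambda>z. A (f z) * (\<phi>x z * Im (fy z) - \<phi>y z * Im (fx z)))"
proof -
  let ?M = "lebesgue_on K"
  obtain h hx hy where h: "\<And>n::nat. C2p (h n) (hx n) (hy n)" "uniform_limit K h f sequentially"
     "L2lim ?M hx fx" "L2lim ?M hy fy"
    using f unfolding appr_def by blast
  note hc = C1p_continuous[OF C2p_C1p[OF h(1)]]
  have fin: "finite_measure ?M" by (rule finite_measure_lebesgue_on_compact[OF K])
  have uh: "uconv ?M h f" by (rule uconv_lebesgue_on[OF K _ h(2)]) (rule hc)
  have uc: "uconv ?M (\<lambda>_. u) u" if "continuous_on K u" for u :: "complex \<Rightarrow> real"
    by (rule uconv_lebesgue_on[OF K]) (use that in \<open>auto simp: uniform_limit_iff\<close>)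
  note uA = uconv_continuous_compose[OF uh C1p_continuous(1)[OF A]]
    and uAu = uconv_continuous_compose[OF uh C1p_continuous(2)[OF A]]
  note Im1 = L2lim_imp_L1lim[OF fin L2lim_linear[OF bounded_linear_Im h(3)]]
    and Im2 = L2lim_imp_L1lim[OF fin L2lim_linear[OF bounded_linear_Im h(4)]]
  note m = L1lim_bilinear_uconv[OF bounded_bilinear_mult]
  have T1: "L1lim ?M (\<lambda>n z. \<phi> z * (Au (h n z) * Jac (hx n z) (hy n z))) (\<lambda>z. \<phi> z * (Au (f z) * Jac (fx z) (fy z)))"
    by (intro m uc uAu L1lim_bilinear_L2lim[OF bounded_bilinear_Jac] h C1p_continuous[OF \<phi>(1)])
  have T2: "L1lim ?M (\<lambda>n z. \<phi>x z * Im (hy n z) + (- \<phi>y z) * Im (hx n z)) (\<lambda>z. \<phi>x z * Im (fy z) + (- \<phi>y z) * Im (fx z))"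
    by (intro L1lim_add m uc Im1 Im2 C1p_continuous[OF \<phi>(1)] continuous_intros)
  have T3: "L1lim ?M (\<lambda>n z. A (h n z) * (\<phi>x z * Im (hy n z) - \<phi>y z * Im (hx n z))) (\<lambda>z. A (f z) * (\<phi>x z * Im (fy z) - \<phi>y z * Im (fx z)))"
    using m[OF uA T2] by simp
  have zero: "(LINT z|?M. \<phi> z * (Au (h n z) * Jac (hx n z) (hy n z)) + A (h n z) * (\<phi>x z * Im (hy n z) - \<phi>y z * Im (hx n z))) = 0" for n
  proof -
    note P = C1p_mult[OF \<phi>(1) C1p_compose[OF A C2p_C1p[OF h(1)[of n]]]]
    have v: "C2p (\<lambda>z. Im (h n z)) (\<lambda>z. Im (hx n z)) (\<lambda>z. Im (hy n z))"
      by (rule C2p_linear[OF bounded_linear_Im h(1)])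
    have "\<phi> z * A (h n z) = 0" if "z \<notin> K" for z using \<phi>(2)[OF that] by simp
    from integral_det_zero[OF P K this v] show ?thesis
      by (simp add: Jac_def algebra_simps)
  qed
  have "(LINT z|?M. \<phi> z * (Au (f z) * Jac (fx z) (fy z)) + A (f z) * (\<phi>x z * Im (fy z) - \<phi>y z * Im (fx z))) = 0"
    using LIMSEQ_unique[OF L1lim_integral[OF L1lim_add[OF T1 T3]]] unfolding zero by simp
  moreover show i: "integrable ?M (\<lambda>z. \<phi> z * (Au (f z) * Jac (fx z) (fy z)))"
    "integrable ?M (\<lambda>z. A (f z) * (\<phi>x z * Im (fy z) - \<phi>y z * Im (fx z)))"
    using T1 T3 by (auto simp: L1lim_def)
  ultimately show "(LINT z|?M. \<phi> z * (Au (f z) * Jac (fx z) (fy z))) =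
         - (LINT z|?M. A (f z) * (\<phi>x z * Im (fy z) - \<phi>y z * Im (fx z)))"
    using Bochner_Integration.integral_add[OF i] by simp
qed

text \<open>The x-derivative of \<psi> times A(f) integrates to zero, the chain rule being justified
  by approximation. In the maximum principle this takes the place of a Poincare inequality.\<close>

lemma chain_identity:
  assumes K: "compact K" and f: "appr K f fx fy" and A: "C1p A Au Av"
    and \<psi>: "C1p \<psi> \<psi>x \<psi>y" "\<And>z. z \<notin> K \<Longrightarrow> \<psi> z = 0"
  shows "(LINT z|lebesgue_on K. \<psi>x z * A (f z) + \<psi> z * (Au (f z) * Re (fx z) + Av (f z) * Im (fx z))) = (0::real)"
proof -
  let ?M = "lebesgue_on K"
  obtain h hx hy where h: "\<And>n::nat. C2p (h n) (hx n) (hy n)" "uniform_limit K h f sequentially"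
     "L2lim ?M hx fx" "L2lim ?M hy fy"
    using f unfolding appr_def by blast
  note hc = C1p_continuous[OF C2p_C1p[OF h(1)]]
  have fin: "finite_measure ?M" by (rule finite_measure_lebesgue_on_compact[OF K])
  have uh: "uconv ?M h f" by (rule uconv_lebesgue_on[OF K _ h(2)]) (rule hc)
  have uc: "uconv ?M (\<lambda>_. u) u" if "continuous_on K u" for u :: "complex \<Rightarrow> real"
    by (rule uconv_lebesgue_on[OF K]) (use that in \<open>auto simp: uniform_limit_iff\<close>)
  note uA = uconv_continuous_compose[OF uh C1p_continuous(1)[OF A]]
    and uAu = uconv_continuous_compose[OF uh C1p_continuous(2)[OF A]]
    and uAv = uconv_continuous_compose[OF uh C1p_continuous(3)[OF A]]
  note R1 = L2lim_imp_L1lim[OF fin L2lim_linear[OF bounded_linear_Re h(3)]]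
    and Im1 = L2lim_imp_L1lim[OF fin L2lim_linear[OF bounded_linear_Im h(3)]]
  note m = L1lim_bilinear_uconv[OF bounded_bilinear_mult]
  have T: "L1lim ?M (\<lambda>n z. \<psi>x z * A (h n z) + \<psi> z * (Au (h n z) * Re (hx n z) + Av (h n z) * Im (hx n z)))
     (\<lambda>z. \<psi>x z * A (f z) + \<psi> z * (Au (f z) * Re (fx z) + Av (f z) * Im (fx z)))"
    by (intro L1lim_add m uc uAu uAv uconv_imp_L1lim[OF fin uA] R1 Im1 C1p_continuous[OF \<psi>(1)])
  have "(LINT z|?M. \<psi>x z * A (h n z) + \<psi> z * (Au (h n z) * Re (hx n z) + Av (h n z) * Im (hx n z))) = 0" for n
  proof -
    note P = C1p_mult[OF \<psi>(1) C1p_compose[OF A C2p_C1p[OF h(1)[of n]]]]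
    have "\<psi> z * A (h n z) = 0" if "z \<notin> K" for z using \<psi>(2)[OF that] by simp
    from C1p_integral_zero(1)[OF P K this] show ?thesis by (simp add: mult.commute)
  qed
  then show ?thesis using LIMSEQ_unique[OF L1lim_integral[OF T]] by simp
qed

lemma C1p_cmod_sq: "C1p (\<lambda>w. (cmod w)\<^sup>2) (\<lambda>w. 2 * Re w) (\<lambda>w. 2 * Im w)"
proof -
  have e: "Re z * Re z + Im z * Im z = (cmod z)\<^sup>2" for z
    by (simp add: cmod_power2 flip: power2_eq_square)
  show ?thesis
    by (rule C1p_cong[OF C1p_add[OF C1p_mult[OF C1p_Re C1p_Re] C1p_mult[OF C1p_Im C1p_Im]]]) (simp_all add: e)
qed

lemma C1p_powr_cmod:
  "C1p (\<lambda>w. (1 + (cmod w)\<^sup>2) powr a) (\<lambda>w. a * (1 + (cmod w)\<^sup>2) powr (a - 1) * (2 * Re w))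
     (\<lambda>w. a * (1 + (cmod w)\<^sup>2) powr (a - 1) * (2 * Im w))"
proof -
  have pos: "1 + (cmod w)\<^sup>2 > 0" for w by (simp add: add_pos_nonneg)
  have pos0: "1 + (cmod w)\<^sup>2 \<noteq> 0" for w using pos[of w] by linarith
  have "((\<lambda>t. (1 + t) powr a) has_real_derivative (a * (1 + (cmod w)\<^sup>2) powr (a - 1))) (at ((cmod w)\<^sup>2))" for w
    using pos[of w] by (auto intro!: derivative_eq_intros)
  moreover have "continuous_on UNIV (\<lambda>w. a * (1 + (cmod w)\<^sup>2) powr (a - 1))"
    by (intro continuous_intros ballI) (rule pos0)
  ultimately show ?thesis
    by (rule C1p_real_compose_at[where s="\<lambda>t. (1 + t) powr a" and s'="\<lambda>t. a * (1 + t) powr (a - 1)", OF _ _ C1p_cmod_sq])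
qed

text \<open>The planar field w -> b(w) w has divergence 2 b + 2 |w|^2 d, where 2 d w is the gradient
  of b, and this is at least min(2, p) b. Multiplied by \<eta>^2 and the Jacobian it integrates by
  parts to terms with \<eta> times its gradient; Young's inequality absorbs their energy
  part.\<close>

lemma Caccioppoli:
  fixes p L :: real
  assumes K: "compact K" and f: "appr K f fx fy" and p: "p > 0" and L: "L > 0"
    and dist: "AE z in lebesgue_on K. (norm (fx z))\<^sup>2 + (norm (fy z))\<^sup>2 \<le> L * Jac (fx z) (fy z)"
    and \<eta>: "C1p \<eta> \<eta>x \<eta>y" "\<And>z. z \<notin> K \<Longrightarrow> \<eta> z = (0::real)"
  defines "b \<equiv> \<lambda>w. (1 + (cmod w)\<^sup>2) powr (p/2 - 1)" and "c \<equiv> min 2 p"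
  shows "(LINT z|lebesgue_on K. (\<eta> z)\<^sup>2 * (b (f z) * ((norm (fx z))\<^sup>2 + (norm (fy z))\<^sup>2)))
     \<le> 4 * L\<^sup>2 / c\<^sup>2 * (LINT z|lebesgue_on K. b (f z) * (cmod (f z))\<^sup>2 * ((\<eta>x z)\<^sup>2 + (\<eta>y z)\<^sup>2))"
    and "integrable (lebesgue_on K) (\<lambda>z. (\<eta> z)\<^sup>2 * (b (f z) * ((norm (fx z))\<^sup>2 + (norm (fy z))\<^sup>2)))"
proof -
  let ?M = "lebesgue_on K"
  let ?D = "\<lambda>z. (norm (fx z))\<^sup>2 + (norm (fy z))\<^sup>2"
  let ?J = "\<lambda>z. Jac (fx z) (fy z)"
  define d where "d w = (p/2 - 1) * (1 + (cmod w)\<^sup>2) powr (p/2 - 2)" for w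
  have b: "C1p b (\<lambda>w. d w * (2 * Re w)) (\<lambda>w. d w * (2 * Im w))"
    using C1p_powr_cmod[of "p/2 - 1"] unfolding b_def d_def by simp
  note A = C1p_mult[OF b C1p_Re]
  \<comment> \<open>The identity for f treats only the component b(w) Re w of the field.
    Multiplication by -\<i> leaves the Jacobian unchanged and turns Re into Im, which supplies the
    other component; the two identities are added.\<close>
  define g where "g z = - \<i> * f z" for z
  have g: "appr K g (\<lambda>z. - \<i> * fx z) (\<lambda>z. - \<i> * fy z)"
    unfolding g_def by (rule appr_linear[OF bounded_linear_mult_right f])
  have fc: "continuous_on K f" by (rule appr_continuous[OF f])
  have bc: "continuous_on K (\<lambda>z. b (f z))"
    by (rule continuous_on_compose2[OF C1p_continuous(1)[OF b, of UNIV] fc]) simp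
  have \<eta>c: "continuous_on K \<eta>" "continuous_on K \<eta>x" "continuous_on K \<eta>y" by (rule C1p_continuous[OF \<eta>(1)])+
  note \<eta>2 = C1p_mult[OF \<eta>(1) \<eta>(1)]
  have \<eta>20: "\<eta> z * \<eta> z = 0" if "z \<notin> K" for z using \<eta>(2)[OF that] by simp
  note F = Jac_identity[OF K f A \<eta>2 \<eta>20] and G = Jac_identity[OF K g A \<eta>2 \<eta>20]
  have bpos: "b w > 0" for w
  proof -
    have "1 + (cmod w)\<^sup>2 \<noteq> 0" using zero_le_power2[of "cmod w"] by linarith
    then show ?thesis unfolding b_def by (simp only: powr_gt_zero) simp
  qed
  have cpos: "c > 0" using p by (simp add: c_def)
  have bd: "c * b w \<le> 2 * b w + 2 * (cmod w)\<^sup>2 * d w" for w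
  proof -
    define x where "x = 1 + (cmod w)\<^sup>2"
    have x: "x \<ge> 1" by (simp add: x_def)
    have bx: "b w = x * x powr (p/2 - 2)"
    proof -
      have "x powr (p/2 - 2 + 1) = x powr (p/2 - 2) * x powr 1" by (rule powr_add)
      then show ?thesis using x by (simp add: b_def x_def mult.commute)
    qed
    \<comment> \<open>The right-hand side is \<open>p * (x - 1) + 2\<close>, and \<open>c\<close> is
      at most p and at most 2.\<close>
    have "c * x \<le> 2 * x + 2 * (x - 1) * (p/2 - 1)"
    proof -
      have "c * x = c * (x - 1) + c" by (simp add: algebra_simps)
      also have "\<dots> \<le> p * (x - 1) + 2" using x by (intro add_mono mult_right_mono) (auto simp: c_def)
      finally show ?thesis by (simp add: algebra_simps)
    qed
    from mult_right_mono[OF this, of "x powr (p/2 - 2)"]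
    show ?thesis unfolding bx d_def by (simp add: x_def[symmetric] algebra_simps) (simp add: x_def algebra_simps)
  qed
  have Dint: "integrable ?M ?D" using appr_sqint[OF f] by (auto simp: sqint_def)
  have iD: "integrable ?M (\<lambda>z. (\<eta> z)\<^sup>2 * (b (f z) * ?D z))"
    by (intro integrable_continuous_mult K \<eta>c bc Dint continuous_intros)
  then show "integrable ?M (\<lambda>z. (\<eta> z)\<^sup>2 * (b (f z) * ?D z))" .
  have iR: "integrable ?M (\<lambda>z. b (f z) * (cmod (f z))\<^sup>2 * ((\<eta>x z)\<^sup>2 + (\<eta>y z)\<^sup>2))"
    by (intro continuous_on_compact_integrable K continuous_intros bc fc \<eta>c)
  \<comment> \<open>The divergence of the field b(w) w, evaluated at \<open>f z\<close>.\<close>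
  define W where "W z = (2 * b (f z) + 2 * (cmod (f z))\<^sup>2 * d (f z))" for z
  have sumL: "(\<eta> z)\<^sup>2 * (W z * ?J z) = (\<eta> z * \<eta> z) * ((d (f z) * (2 * Re (f z)) * Re (f z) + b (f z) * 1) * ?J z)
      + (\<eta> z * \<eta> z) * ((d (g z) * (2 * Re (g z)) * Re (g z) + b (g z) * 1) * Jac (- \<i> * fx z) (- \<i> * fy z))" for z
  proof -
    have "d (g z) = d (f z)" "b (g z) = b (f z)" by (simp_all add: d_def b_def g_def norm_mult)
    moreover have "Jac (- \<i> * fx z) (- \<i> * fy z) = ?J z" by (simp only: Jac_mult) simp
    ultimately show ?thesis
      by (simp add: W_def g_def cmod_power2) (simp add: power2_eq_square algebra_simps)
  qed
  \<comment> \<open>The cutoff terms of both identities combined. Collected into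
    \<open>Jac (f z)\<close> they obey |Jac a e| <= |a| |e|, which makes Young's inequality
    applicable.\<close>
  define E where "E z = b (f z) * (2 * \<eta> z * (\<eta>x z * Jac (f z) (fy z) - \<eta>y z * Jac (f z) (fx z)))" for z
  have sumR: "E z = b (f z) * Re (f z) * ((\<eta>x z * \<eta> z + \<eta> z * \<eta>x z) * Im (fy z) - (\<eta>y z * \<eta> z + \<eta> z * \<eta>y z) * Im (fx z))
     + b (g z) * Re (g z) * ((\<eta>x z * \<eta> z + \<eta> z * \<eta>x z) * Im (- \<i> * fy z) - (\<eta>y z * \<eta> z + \<eta> z * \<eta>y z) * Im (- \<i> * fx z))" for z
  proof -
    have "b (g z) = b (f z)" by (simp add: b_def g_def norm_mult)
    then show ?thesis by (simp add: E_def g_def Jac_def algebra_simps)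
  qed
  have iW: "integrable ?M (\<lambda>z. (\<eta> z)\<^sup>2 * (W z * ?J z))"
    unfolding sumL by (intro Bochner_Integration.integrable_add F(2) G(2))
  have iE: "integrable ?M E"
    unfolding sumR[abs_def] by (intro Bochner_Integration.integrable_add F(3) G(3))
  have eq: "(LINT z|?M. (\<eta> z)\<^sup>2 * (W z * ?J z)) = - (LINT z|?M. E z)"
    using Bochner_Integration.integral_add[OF F(2) G(2)] Bochner_Integration.integral_add[OF F(3) G(3)] F(1) G(1)
    unfolding sumL sumR by linarith
  \<comment> \<open>Half of the coefficient c/L in the lower bound, so that the same amount remains
    after absorption; 1/s^2 is the constant 4 L^2 / c^2.\<close>
  define s where "s = c / (2 * L)"
  have s: "s > 0" using cpos L by (simp add: s_def)
  have lower: "(LINT z|?M. (c / L) * ((\<eta> z)\<^sup>2 * (b (f z) * ?D z))) \<le> (LINT z|?M. (\<eta> z)\<^sup>2 * (W z * ?J z))"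
  proof (rule integral_mono_AE)
    show "AE z in ?M. (c / L) * ((\<eta> z)\<^sup>2 * (b (f z) * ?D z)) \<le> (\<eta> z)\<^sup>2 * (W z * ?J z)"
      using dist
    proof eventually_elim
      case (elim z)
      have J0: "0 \<le> ?J z"
      proof -
        have "0 \<le> L * ?J z"
          by (rule order_trans[OF _ elim]) simp
        then show ?thesis using L by (simp add: zero_le_mult_iff)
      qed
      have "(c / L) * (b (f z) * ?D z) \<le> (c / L) * (b (f z) * (L * ?J z))"
        using elim cpos L bpos[of "f z"] by (intro mult_left_mono) auto
      also have "\<dots> = c * b (f z) * ?J z" using L by simp
      also have "\<dots> \<le> W z * ?J z" unfolding W_def by (intro mult_right_mono bd J0)
      finally have "(\<eta> z)\<^sup>2 * ((c / L) * (b (f z) * ?D z)) \<le> (\<eta> z)\<^sup>2 * (W z * ?J z)"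
        by (intro mult_left_mono) auto
      then show ?case by (simp add: mult_ac)
    qed
  qed (use iD iW in auto)
  have upper: "- (LINT z|?M. E z) \<le> (LINT z|?M. s * ((\<eta> z)\<^sup>2 * (b (f z) * ?D z)) + (1/s) * (b (f z) * (cmod (f z))\<^sup>2 * ((\<eta>x z)\<^sup>2 + (\<eta>y z)\<^sup>2)))"
  proof -
    have "- E z \<le> s * ((\<eta> z)\<^sup>2 * (b (f z) * ?D z)) + (1/s) * (b (f z) * (cmod (f z))\<^sup>2 * ((\<eta>x z)\<^sup>2 + (\<eta>y z)\<^sup>2))" for z
    proof -
      have young: "2 * x * y \<le> s * x\<^sup>2 + (1/s) * y\<^sup>2" for x y :: real
      proof -
        have "0 \<le> (s * x - y)\<^sup>2 / s" using s by simp
        also have "\<dots> = s * x\<^sup>2 + (1/s) * y\<^sup>2 - 2 * x * y"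
          using s by (simp add: power2_diff field_simps power2_eq_square)
        finally show ?thesis by simp
      qed
      have Jle: "\<bar>Jac a e\<bar> \<le> cmod a * cmod e" for a e
      proof -
        have "Jac a e = Im (cnj a * e)" by (simp add: Jac_def)
        then show ?thesis using abs_Im_le_cmod[of "cnj a * e"] by (simp add: norm_mult)
      qed
      have 1: "2 * \<eta> z * t * Jac (f z) e \<le> s * ((\<eta> z)\<^sup>2 * (cmod e)\<^sup>2) + (1/s) * ((cmod (f z))\<^sup>2 * t\<^sup>2)" for t e
      proof -
        have "2 * \<eta> z * t * Jac (f z) e \<le> \<bar>2 * \<eta> z * t * Jac (f z) e\<bar>" by simp
        also have "\<dots> = 2 * \<bar>\<eta> z\<bar> * \<bar>t\<bar> * \<bar>Jac (f z) e\<bar>" by (simp add: abs_mult)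
        also have "\<dots> \<le> 2 * \<bar>\<eta> z\<bar> * \<bar>t\<bar> * (cmod (f z) * cmod e)" by (intro mult_left_mono Jle) auto
        also have "\<dots> = 2 * (\<bar>\<eta> z\<bar> * cmod e) * (cmod (f z) * \<bar>t\<bar>)" by simp
        also have "\<dots> \<le> s * (\<bar>\<eta> z\<bar> * cmod e)\<^sup>2 + (1/s) * (cmod (f z) * \<bar>t\<bar>)\<^sup>2" by (rule young)
        finally show ?thesis by (simp add: power_mult_distrib)
      qed
      have "- E z = b (f z) * (2 * \<eta> z * (- \<eta>x z) * Jac (f z) (fy z) + 2 * \<eta> z * \<eta>y z * Jac (f z) (fx z))"
        by (simp add: E_def algebra_simps)
      also have "\<dots> \<le> b (f z) * ((s * ((\<eta> z)\<^sup>2 * (cmod (fy z))\<^sup>2) + (1/s) * ((cmod (f z))\<^sup>2 * (- \<eta>x z)\<^sup>2)) +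
           (s * ((\<eta> z)\<^sup>2 * (cmod (fx z))\<^sup>2) + (1/s) * ((cmod (f z))\<^sup>2 * (\<eta>y z)\<^sup>2)))"
        using bpos[of "f z"] by (intro mult_left_mono add_mono 1) auto
      finally show ?thesis by (simp add: algebra_simps)
    qed
    then have "(LINT z|?M. - E z) \<le> (LINT z|?M. s * ((\<eta> z)\<^sup>2 * (b (f z) * ?D z)) + (1/s) * (b (f z) * (cmod (f z))\<^sup>2 * ((\<eta>x z)\<^sup>2 + (\<eta>y z)\<^sup>2)))"
      using iE iD iR by (intro integral_mono) auto
    then show ?thesis by simp
  qed
  define X where "X = (LINT z|?M. (\<eta> z)\<^sup>2 * (b (f z) * ?D z))"
  define Y where "Y = (LINT z|?M. b (f z) * (cmod (f z))\<^sup>2 * ((\<eta>x z)\<^sup>2 + (\<eta>y z)\<^sup>2))"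
  have "(c / L) * X \<le> s * X + (1/s) * Y"
    using lower upper eq iD iR unfolding X_def Y_def by simp
  then have "s * X \<le> (1/s) * Y" by (simp add: s_def field_simps)
  then have "X \<le> (1/s) * ((1/s) * Y)" using s by (simp add: field_simps)
  also have "\<dots> = 4 * L\<^sup>2 / c\<^sup>2 * Y" by (simp add: s_def field_simps power2_eq_square)
  finally show "X \<le> 4 * L\<^sup>2 / c\<^sup>2 * Y" .
qed

section \<open>The maximum principle\<close>

text \<open>The square of the positive part is C1 while the positive part is not, so truncations by
  it stay within \<open>C1p\<close>.\<close>

lemma DERIV_max_0_sq: "((\<lambda>s::real. (max 0 s)\<^sup>2) has_real_derivative 2 * max 0 s) (at s)"
proof -
  consider "s > 0" | "s < 0" | "s = 0" by linarith
  then show ?thesis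
  proof cases
    case 1
    have "((\<lambda>s::real. s\<^sup>2) has_real_derivative 2 * max 0 s) (at s)"
      using 1 by (auto intro!: derivative_eq_intros)
    then show ?thesis
      by (rule has_field_derivative_transform_within_open[where S="{0<..}"]) (use 1 in \<open>auto simp: max_def\<close>)
  next
    case 2
    have "((\<lambda>s::real. 0) has_real_derivative 2 * max 0 s) (at s)" using 2 by simp
    then show ?thesis
      by (rule has_field_derivative_transform_within_open[where S="{..<0}"]) (use 2 in \<open>auto simp: max_def\<close>)
  next
    case 3
    have "(\<lambda>h::real. ((max 0 (0 + h))\<^sup>2 - (max 0 0)\<^sup>2) / h) = (\<lambda>h. max 0 h)"
      by (auto simp: fun_eq_iff max_def power2_eq_square)
    moreover have "((\<lambda>h::real. max 0 h) \<longlongrightarrow> max 0 0) (at 0)" by (intro tendsto_intros)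
    ultimately show ?thesis using 3 by (simp add: DERIV_def)
  qed
qed

lemma C1p_bx: "\<exists>ex ey. C1p (bx a b) ex ey"
  using bump_alg_C2[OF bx_alg] by blast

lemma AE_lebesgue_on_open_continuous:
  fixes u :: "complex \<Rightarrow> real"
  assumes ae: "AE z in lebesgue_on K. u z = 0" and K: "K \<in> sets lebesgue" and u: "continuous_on K u"
    and U: "open U" "U \<subseteq> K" "z0 \<in> U"
  shows "u z0 = 0"
proof (rule ccontr)
  assume "u z0 \<noteq> 0"
  define V where "V = {z \<in> U. u z \<in> -{0}}"
  have cU: "continuous_on U u" by (rule continuous_on_subset[OF u U(2)])
  have "open (U \<inter> u -` (-{0}))"
    by (rule continuous_open_preimage[OF cU U(1)]) auto
  moreover have "V = U \<inter> u -` (-{0})" by (auto simp: V_def)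
  ultimately have V: "open V" by simp
  have "AE z in lebesgue. z \<in> K \<longrightarrow> u z = 0"
    using ae K by (subst (asm) AE_restrict_space_iff) auto
  then have "AE z in lebesgue. z \<notin> V"
    by eventually_elim (use U(2) in \<open>auto simp: V_def\<close>)
  then have "negligible V" by (simp add: AE_iff_null_sets V negligible_iff_null_sets)
  moreover have "z0 \<in> V" using \<open>u z0 \<noteq> 0\<close> U(3) by (simp add: V_def)
  ultimately show False using open_not_negligible[OF V] by blast
qed

text \<open>The part of Re f above a level M' > M lives away from the boundary, so its integrated
  Jacobian vanishes; the distortion inequality then makes the gradient vanish there. A truncation
  with zero gradient and compact support is zero, which contradicts Re (f z0) > M'.\<close>

lemma max_principle_Re:
  fixes L M :: real and a b :: complex
  defines "K \<equiv> cbox a b"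
  assumes f: "appr K f fx fy" and L: "L > 0"
    and dist: "AE z in lebesgue_on K. (norm (fx z))\<^sup>2 + (norm (fy z))\<^sup>2 \<le> L * Jac (fx z) (fy z)"
    and bdry: "\<And>z. z \<in> K - box a b \<Longrightarrow> Re (f z) \<le> M" and z0: "z0 \<in> K"
  shows "Re (f z0) \<le> M"
proof (rule ccontr)
  assume "\<not> Re (f z0) \<le> M"
  \<comment> \<open>A level strictly above \<open>M\<close> keeps the set {Re f >= M'} off the
    boundary, so it is a compact subset of the open box.\<close>
  define M' where "M' = (M + Re (f z0)) / 2"
  have M': "M < M'" "M' < Re (f z0)" using \<open>\<not> Re (f z0) \<le> M\<close> by (auto simp: M'_def)
  have K: "compact K" by (simp add: K_def)
  have fc: "continuous_on K f" by (rule appr_continuous[OF f])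
  then have Rc: "continuous_on K (\<lambda>z. Re (f z))" by (intro continuous_intros)
  define N where "N = {z \<in> K. M' \<le> Re (f z)}"
  have Ncl: "compact N"
  proof -
    have "closed (K \<inter> (\<lambda>z. Re (f z)) -` {M'..})"
      by (rule continuous_closed_preimage[OF Rc]) (use K in \<open>auto simp: compact_imp_closed\<close>)
    moreover have "N = K \<inter> (\<lambda>z. Re (f z)) -` {M'..}" by (auto simp: N_def)
    ultimately have "closed N" by simp
    moreover have "N = K \<inter> N" by (auto simp: N_def)
    ultimately show ?thesis using compact_Int_closed[OF K] by metis
  qed
  have z0N: "z0 \<in> N" using z0 M' by (simp add: N_def)
  have Nbox: "N \<subseteq> box a b" using bdry M' by (force simp: N_def)
  obtain ex ey where e: "C1p (bx a b) ex ey" using C1p_bx by blast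
  obtain z1 where z1: "z1 \<in> N" "\<And>z. z \<in> N \<Longrightarrow> bx a b z1 \<le> bx a b z"
    using continuous_attains_inf[OF Ncl _ C1p_continuous(1)[OF e]] z0N by blast
  define m where "m = bx a b z1"
  have m: "m > 0" using z1(1) Nbox bx_pos_iff by (auto simp: m_def)
  \<comment> \<open>\<open>g\<close> is C1, vanishes at 0 and equals 1 from \<open>m\<close> on.
    Since \<open>bx a b\<close> is at least \<open>m\<close> on \<open>N\<close>, the cutoff \<phi>
    is 1 on \<open>N\<close>.\<close>
  define g where "g t = 1 - (max 0 (1 - t / m))\<^sup>2" for t
  define g' where "g' t = 2 * max 0 (1 - t / m) / m" for t
  have gD: "(g has_real_derivative g' t) (at t)" for t
  proof -
    have "((\<lambda>t. 1 - t / m) has_real_derivative (- 1 / m)) (at t)"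
      using m by (auto intro!: derivative_eq_intros)
    from DERIV_chain2[OF DERIV_max_0_sq this]
    have "((\<lambda>t. (max 0 (1 - t / m))\<^sup>2) has_real_derivative - g' t) (at t)" by (simp add: g'_def)
    from DERIV_diff[OF DERIV_const[of 1] this] show ?thesis by (simp add: g_def[abs_def])
  qed
  have g'c: "continuous_on UNIV g'" unfolding g'_def by (intro continuous_intros) (use m in auto)
  define \<phi> where "\<phi> z = g (bx a b z)" for z
  define \<phi>x where "\<phi>x z = g' (bx a b z) * ex z" for z
  define \<phi>y where "\<phi>y z = g' (bx a b z) * ey z" for z
  have \<phi>: "C1p \<phi> \<phi>x \<phi>y"
    unfolding \<phi>_def \<phi>x_def \<phi>y_def by (rule C1p_real_compose[OF gD g'c e])
  have \<phi>out: "\<phi> z = 0" if "z \<notin> K" for z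
  proof -
    have "z \<notin> box a b" using that box_subset_cbox[of a b] by (auto simp: K_def)
    then show ?thesis by (simp add: \<phi>_def g_def bx_eq_0)
  qed
  have \<phi>0: "0 \<le> \<phi> z" for z
    using bx_nonneg[of a b z] m by (auto simp: \<phi>_def g_def power_le_one abs_le_square_iff)
  define A where "A w = (max 0 (Re w + (- M')))\<^sup>2" for w
  define Au where "Au w = 2 * max 0 (Re w + (- M'))" for w
  have A: "C1p A Au (\<lambda>_. 0)"
    unfolding A_def Au_def
    by (rule C1p_cong[OF C1p_real_compose[OF DERIV_max_0_sq _ C1p_add[OF C1p_Re C1p_const[of "-M'"]]]])
       (auto intro!: continuous_intros)
  \<comment> \<open>On \<open>N\<close> the cutoff is stationary and off \<open>N\<close> the
    truncation vanishes, so no derivative of \<phi> survives.\<close>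
  have zero: "A (f z) * \<phi>x z = 0 \<and> A (f z) * \<phi>y z = 0" if "z \<in> K" for z
  proof (cases "z \<in> N")
    case True
    then have "g' (bx a b z) = 0" using z1(2)[OF True] m by (simp add: g'_def m_def[symmetric] divide_simps)
    then show ?thesis by (simp add: \<phi>x_def \<phi>y_def)
  next
    case False
    then show ?thesis using that by (simp add: A_def N_def)
  qed
  let ?M = "lebesgue_on K"
  note JI = Jac_identity[OF K f A \<phi> \<phi>out]
  have "(LINT z|?M. A (f z) * (\<phi>x z * Im (fy z) - \<phi>y z * Im (fx z))) = (LINT z|?M. 0)"
  proof (rule Bochner_Integration.integral_cong)
    fix z assume "z \<in> space ?M"
    then have zz: "A (f z) * \<phi>x z = 0" "A (f z) * \<phi>y z = 0" using zero[of z] by auto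
    have e: "A (f z) * (\<phi>x z * Im (fy z) - \<phi>y z * Im (fx z)) = (A (f z) * \<phi>x z) * Im (fy z) - (A (f z) * \<phi>y z) * Im (fx z)"
      by (simp add: algebra_simps)
    show "A (f z) * (\<phi>x z * Im (fy z) - \<phi>y z * Im (fx z)) = 0" unfolding e zz by simp
  qed simp
  then have J0: "(LINT z|?M. \<phi> z * (Au (f z) * Jac (fx z) (fy z))) = 0" using JI(1) by simp
  have Jpos: "AE z in ?M. 0 \<le> Jac (fx z) (fy z)"
    using dist
  proof eventually_elim
    case (elim z)
    have "0 \<le> L * Jac (fx z) (fy z)" by (rule order_trans[OF _ elim]) simp
    then show ?case using L by (simp add: zero_le_mult_iff)
  qed
  have Au0: "0 \<le> Au w" for w by (simp add: Au_def)
  have "AE z in ?M. 0 \<le> \<phi> z * (Au (f z) * Jac (fx z) (fy z))"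
    using Jpos by eventually_elim (intro mult_nonneg_nonneg \<phi>0 Au0)
  then have "AE z in ?M. \<phi> z * (Au (f z) * Jac (fx z) (fy z)) = 0"
    using J0 JI(2) by (subst (asm) integral_nonneg_eq_0_iff_AE) auto
  \<comment> \<open>Where \<open>\<phi> z * Au (f z)\<close> is nonzero the Jacobian must vanish,
    and the distortion inequality bounds the whole gradient by it.\<close>
  then have grad0: "AE z in ?M. \<phi> z * Au (f z) * Re (fx z) = 0"
    using dist
  proof eventually_elim
    case (elim z)
    show ?case
    proof (cases "\<phi> z * Au (f z) = 0")
      case False
      then have "Jac (fx z) (fy z) = 0" using elim(1) by simp
      then have "(norm (fx z))\<^sup>2 + (norm (fy z))\<^sup>2 \<le> 0" using elim(2) by simp
      then have "(norm (fx z))\<^sup>2 \<le> 0" using zero_le_power2[of "norm (fy z)"] by linarith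
      then show ?thesis by simp
    qed simp
  qed
  \<comment> \<open>Multiplying the cutoff by Re z creates the term \<phi> A(f) in the x-derivative;
    every other term of \<open>chain_identity\<close> vanishes almost everywhere.\<close>
  have \<psi>: "C1p (\<lambda>z. Re z * \<phi> z) (\<lambda>z. 1 * \<phi> z + Re z * \<phi>x z) (\<lambda>z. 0 * \<phi> z + Re z * \<phi>y z)"
    by (rule C1p_mult[OF C1p_Re \<phi>])
  have \<psi>out: "Re z * \<phi> z = 0" if "z \<notin> K" for z using \<phi>out[OF that] by simp
  have \<phi>c: "continuous_on K \<phi>" by (rule C1p_continuous(1)[OF \<phi>])
  have Ac: "continuous_on K (\<lambda>z. A (f z))"
    by (rule continuous_on_compose2[OF C1p_continuous(1)[OF A, of UNIV] fc]) simp
  have "(LINT z|?M. \<phi> z * A (f z)) = (LINT z|?M. (1 * \<phi> z + Re z * \<phi>x z) * A (f z) + Re z * \<phi> z * (Au (f z) * Re (fx z) + 0 * Im (fx z)))"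
  proof (rule integral_cong_AE)
    have fm: "fx \<in> borel_measurable ?M" using appr_sqint(1)[OF f] by (simp add: sqint_def)
    show "(\<lambda>z. \<phi> z * A (f z)) \<in> borel_measurable ?M"
      by (intro continuous_on_compact_measurable K continuous_intros \<phi>c Ac)
    have c1: "continuous_on K (\<lambda>z. (1 * \<phi> z + Re z * \<phi>x z) * A (f z))"
      by (intro continuous_intros Ac C1p_continuous[OF \<phi>])
    have c2: "continuous_on K (\<lambda>z. Re z * \<phi> z * Au (f z))"
      by (intro continuous_intros \<phi>c continuous_on_compose2[OF C1p_continuous(2)[OF A, of UNIV] fc]) simp
    have "(\<lambda>z. Re (fx z)) \<in> borel_measurable ?M" using fm by measurable
    then have "(\<lambda>z. (1 * \<phi> z + Re z * \<phi>x z) * A (f z) + Re z * \<phi> z * Au (f z) * Re (fx z)) \<in> borel_measurable ?M"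
      by (rule borel_measurable_add[OF continuous_on_compact_measurable[OF K c1]
            borel_measurable_times[OF continuous_on_compact_measurable[OF K c2]]])
    then show "(\<lambda>z. (1 * \<phi> z + Re z * \<phi>x z) * A (f z) + Re z * \<phi> z * (Au (f z) * Re (fx z) + 0 * Im (fx z))) \<in> borel_measurable ?M"
      by (simp add: mult.assoc)
    show "AE z in ?M. \<phi> z * A (f z) = (1 * \<phi> z + Re z * \<phi>x z) * A (f z) + Re z * \<phi> z * (Au (f z) * Re (fx z) + 0 * Im (fx z))"
      using grad0 AE_space
    proof eventually_elim
      case (elim z)
      have 1: "\<phi>x z * A (f z) = 0" using zero[of z] elim(2) by (simp add: mult.commute)
      have "(1 * \<phi> z + Re z * \<phi>x z) * A (f z) + Re z * \<phi> z * (Au (f z) * Re (fx z) + 0 * Im (fx z)) =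
         \<phi> z * A (f z) + Re z * (\<phi>x z * A (f z)) + Re z * (\<phi> z * Au (f z) * Re (fx z))"
        by (simp add: algebra_simps)
      then show ?case unfolding 1 elim(1) by simp
    qed
  qed
  also have "\<dots> = 0" by (rule chain_identity[OF K f A \<psi> \<psi>out])
  finally have "(LINT z|?M. \<phi> z * A (f z)) = 0" .
  moreover have "integrable ?M (\<lambda>z. \<phi> z * A (f z))"
    by (intro continuous_on_compact_integrable K continuous_intros \<phi>c Ac)
  moreover have "0 \<le> \<phi> z * A (f z)" for z using \<phi>0 by (simp add: A_def)
  ultimately have "AE z in ?M. \<phi> z * A (f z) = 0"
    by (subst (asm) integral_nonneg_eq_0_iff_AE) auto
  then have "\<phi> z0 * A (f z0) = 0"
    by (rule AE_lebesgue_on_open_continuous[where U="box a b"])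
       (use z0N Nbox box_subset_cbox[of a b] in \<open>auto simp: K_def intro!: continuous_intros \<phi>c[unfolded K_def] Ac[unfolded K_def]\<close>)
  moreover have "\<phi> z0 = 1" using z1(2)[OF z0N] m by (simp add: \<phi>_def g_def m_def[symmetric] divide_simps)
  moreover have "A (f z0) > 0" using M' by (simp add: A_def)
  ultimately show False by simp
qed

text \<open>Multiplication by a unimodular constant preserves the distortion inequality, so the
  maximum principle holds for every Re (c f). Rotating f z - f w, or f z, onto the positive axis
  reduces moduli to real parts.\<close>

lemma osc_principle:
  fixes L :: real and a b :: complex
  defines "K \<equiv> cbox a b"
  assumes f: "appr K f fx fy" and L: "L > 0"
    and dist: "AE z in lebesgue_on K. (norm (fx z))\<^sup>2 + (norm (fy z))\<^sup>2 \<le> L * Jac (fx z) (fy z)"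
    and z: "z \<in> K" "w \<in> K"
  shows "\<exists>x\<in>K - box a b. \<exists>y\<in>K - box a b. norm (f z - f w) \<le> norm (f x - f y)"
    and "\<exists>x\<in>K - box a b. norm (f z) \<le> norm (f x)"
proof -
  have cp: "compact (K - box a b)" unfolding K_def by (rule compact_diff[OF compact_cbox open_box])
  have ne: "K - box a b \<noteq> {}"
  proof -
    have "a \<in> cbox a b" using z(1) by (auto simp: K_def in_cbox_complex_iff)
    moreover have "a \<notin> box a b" by (simp add: in_box_complex_iff)
    ultimately show ?thesis by (auto simp: K_def)
  qed
  have max: "\<exists>x\<in>K - box a b. \<forall>z\<in>K. Re (c * f z) \<le> Re (c * f x)" if c: "norm c = 1" for c
  proof -
    have f': "appr (cbox a b) (\<lambda>z. c * f z) (\<lambda>z. c * fx z) (\<lambda>z. c * fy z)"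
      using appr_linear[OF bounded_linear_mult_right f] by (simp add: K_def)
    have cont: "continuous_on (K - box a b) (\<lambda>z. Re (c * f z))"
      by (intro continuous_intros continuous_on_subset[OF appr_continuous[OF f]]) auto
    obtain x where x: "x \<in> K - box a b" "\<And>y. y \<in> K - box a b \<Longrightarrow> Re (c * f y) \<le> Re (c * f x)"
      using continuous_attains_sup[OF cp ne cont] by blast
    have d: "AE z in lebesgue_on (cbox a b). (norm (c * fx z))\<^sup>2 + (norm (c * fy z))\<^sup>2 \<le> L * Jac (c * fx z) (c * fy z)"
      using dist unfolding K_def by (simp add: norm_mult c Jac_mult)
    have "\<forall>z\<in>K. Re (c * f z) \<le> Re (c * f x)"
      using max_principle_Re[OF f' L d, of "Re (c * f x)"] x(2) by (auto simp: K_def)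
    then show ?thesis using x(1) by blast
  qed
  have dir: "\<exists>c. norm c = 1 \<and> Re (c * v) = norm v" for v :: complex
  proof (cases "v = 0")
    case True then show ?thesis by (intro exI[of _ 1]) simp
  next
    case False
    have "cnj v / of_real (norm v) * v = (of_real (norm v) * of_real (norm v)) / of_real (norm v)"
      using complex_norm_square[of v] by (simp add: mult.commute power2_eq_square)
    also have "\<dots> = of_real (norm v)" using False by simp
    finally have "cnj v / of_real (norm v) * v = of_real (norm v)" .
    then show ?thesis using False by (intro exI[of _ "cnj v / of_real (norm v)"]) (simp add: norm_divide)
  qed
  obtain c where c: "norm c = 1" "Re (c * (f z - f w)) = norm (f z - f w)" using dir by blast
  obtain x where x: "x \<in> K - box a b" "\<forall>z\<in>K. Re (c * f z) \<le> Re (c * f x)" using max[OF c(1)] by blast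
  obtain y where y: "y \<in> K - box a b" "\<forall>z\<in>K. Re (- c * f z) \<le> Re (- c * f y)" using max[of "-c"] c(1) by auto
  have "norm (f z - f w) = Re (c * f z) - Re (c * f w)" using c(2) by (simp add: algebra_simps)
  also have "\<dots> \<le> Re (c * f x) - Re (c * f y)" using x(2) y(2) z by fastforce
  also have "\<dots> = Re (c * (f x - f y))" by (simp add: algebra_simps)
  also have "\<dots> \<le> norm (c * (f x - f y))" by (rule complex_Re_le_cmod)
  also have "\<dots> = norm (f x - f y)" using c(1) by (simp add: norm_mult)
  finally show "\<exists>x\<in>K - box a b. \<exists>y\<in>K - box a b. norm (f z - f w) \<le> norm (f x - f y)" using x(1) y(1) by blast
  obtain c' where c': "norm c' = 1" "Re (c' * f z) = norm (f z)" using dir by blast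
  obtain x' where x': "x' \<in> K - box a b" "\<forall>z\<in>K. Re (c' * f z) \<le> Re (c' * f x')" using max[OF c'(1)] by blast
  have "norm (f z) \<le> norm (c' * f x')" using c'(2) x'(2) z(1) complex_Re_le_cmod[of "c' * f x'"] by fastforce
  then show "\<exists>x\<in>K - box a b. norm (f z) \<le> norm (f x)" using x'(1) c'(1) by (auto simp: norm_mult)
qed

section \<open>Square annuli\<close>

text \<open>The sup norm of the plane. Along each side of its spheres only one partial derivative
  acts, and letting the sphere grow sweeps out area in Cartesian coordinates.\<close>

definition sn :: "complex \<Rightarrow> real" where "sn z = max \<bar>Re z\<bar> \<bar>Im z\<bar>"

definition ann :: "complex \<Rightarrow> real \<Rightarrow> complex set" where
  "ann a r = {z. r \<le> sn (z - a) \<and> sn (z - a) < 2 * r}"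

lemma sn_continuous [continuous_intros]:
  "continuous_on S f \<Longrightarrow> continuous_on S (\<lambda>z. sn (f z))"
  unfolding sn_def by (intro continuous_intros)

lemma ann_borel [measurable]: "ann a r \<in> sets borel"
proof -
  have "(\<lambda>z. sn (z - a)) \<in> borel_measurable borel"
    by (intro borel_measurable_continuous_onI continuous_intros)
  then show ?thesis unfolding ann_def by measurable
qed

lemma borel_measurable_Complex [measurable]:
  assumes "f \<in> borel_measurable M" "g \<in> borel_measurable M"
  shows "(\<lambda>x. Complex (f x) (g x)) \<in> borel_measurable M"
  using assms unfolding Complex_eq by measurable

section \<open>Iterated integrals in the plane\<close>

lemma lborel_complex_eq: "lborel = distr (lborel \<Otimes>\<^sub>M lborel) borel (\<lambda>(x, y). Complex x y)"
proof (rule lborel_eqI)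
  fix l u :: complex
  assume le: "\<And>b. b \<in> Basis \<Longrightarrow> l \<bullet> b \<le> u \<bullet> b"
  have le': "Re l \<le> Re u" "Im l \<le> Im u" using le[of 1] le[of \<i>] by (auto simp: Basis_complex_def)
  have "(\<lambda>(x, y). Complex x y) -` box l u \<inter> space (lborel \<Otimes>\<^sub>M lborel) = {Re l<..<Re u} \<times> {Im l<..<Im u}"
    by (auto simp: in_box_complex_iff space_pair_measure)
  moreover have "emeasure (lborel \<Otimes>\<^sub>M lborel) ({Re l<..<Re u} \<times> {Im l<..<Im u}) = ennreal (Re u - Re l) * ennreal (Im u - Im l)"
    using le' by (subst lborel.emeasure_pair_measure_Times) auto
  ultimately show "emeasure (distr (lborel \<Otimes>\<^sub>M lborel) borel (\<lambda>(x, y). Complex x y)) (box l u) = (\<Prod>b\<in>Basis. (u - l) \<bullet> b)"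
    using le' by (subst emeasure_distr) (auto simp: Basis_complex_def ennreal_mult case_prod_beta)
qed simp

lemma nn_integral_complex:
  fixes h :: "complex \<Rightarrow> ennreal"
  assumes [measurable]: "h \<in> borel_measurable borel"
  shows "(\<integral>\<^sup>+z. h z \<partial>lborel) = (\<integral>\<^sup>+y. (\<integral>\<^sup>+x. h (Complex x y) \<partial>lborel) \<partial>lborel)"
    and "(\<integral>\<^sup>+z. h z \<partial>lborel) = (\<integral>\<^sup>+x. (\<integral>\<^sup>+y. h (Complex x y) \<partial>lborel) \<partial>lborel)"
proof -
  have e: "(\<integral>\<^sup>+z. h z \<partial>lborel) = (\<integral>\<^sup>+p. h (case p of (x, y) \<Rightarrow> Complex x y) \<partial>(lborel \<Otimes>\<^sub>M lborel))"
    by (subst lborel_complex_eq, subst nn_integral_distr) (auto simp: case_prod_beta)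
  show "(\<integral>\<^sup>+z. h z \<partial>lborel) = (\<integral>\<^sup>+y. (\<integral>\<^sup>+x. h (Complex x y) \<partial>lborel) \<partial>lborel)"
    unfolding e by (subst lborel_pair.nn_integral_snd[symmetric]) (auto simp: case_prod_beta)
  show "(\<integral>\<^sup>+z. h z \<partial>lborel) = (\<integral>\<^sup>+x. (\<integral>\<^sup>+y. h (Complex x y) \<partial>lborel) \<partial>lborel)"
    unfolding e by (subst lborel.nn_integral_fst[symmetric]) (auto simp: case_prod_beta)
qed

lemma nn_integral_uminus_real:
  fixes h :: "real \<Rightarrow> ennreal"
  assumes [measurable]: "h \<in> borel_measurable borel"
  shows "(\<integral>\<^sup>+t. h (- t) \<partial>lborel) = (\<integral>\<^sup>+t. h t \<partial>lborel)"
  using nn_integral_real_affine[of h "-1" 0] by simp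

text \<open>The bound does not mention the endpoints, so it serves for any two points of a side of
  the square at once.\<close>

lemma norm_diff_le_nn_integral:
  fixes g g' :: "real \<Rightarrow> complex"
  assumes g: "\<And>s. (g has_vector_derivative g' s) (at s)" "continuous_on UNIV g'"
    and s: "s1 \<in> {-t..t}" "s2 \<in> {-t..t}"
  shows "ennreal (norm (g s1 - g s2)) \<le> (\<integral>\<^sup>+s. indicator {-t..t} s * ennreal (norm (g' s)) \<partial>lborel)"
proof -
  have *: "ennreal (norm (g s1 - g s2)) \<le> (\<integral>\<^sup>+s. indicator {-t..t} s * ennreal (norm (g' s)) \<partial>lborel)"
    if s: "s1 \<in> {-t..t}" "s2 \<in> {-t..t}" "s1 \<le> s2" for s1 s2
  proof -
    have "has_bochner_integral lborel (\<lambda>x. indicator {s1..s2} x *\<^sub>R g' x) (g s2 - g s1)"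
      by (rule has_bochner_integral_FTC_Icc[OF s(3)])
         (use g in \<open>auto intro: has_vector_derivative_at_within continuous_on_subset\<close>)
    then have "integrable lborel (\<lambda>x. indicator {s1..s2} x *\<^sub>R g' x)" "(LINT x|lborel. indicator {s1..s2} x *\<^sub>R g' x) = g s2 - g s1"
      by (auto simp: has_bochner_integral_iff)
    then have "ennreal (norm (g s2 - g s1)) \<le> (\<integral>\<^sup>+x. ennreal (norm (indicator {s1..s2} x *\<^sub>R g' x)) \<partial>lborel)"
      using integral_norm_bound_ennreal by metis
    also have "\<dots> \<le> (\<integral>\<^sup>+s. indicator {-t..t} s * ennreal (norm (g' s)) \<partial>lborel)"
      by (rule nn_integral_mono) (use s in \<open>auto simp: indicator_def\<close>)
    finally show ?thesis by (simp add: norm_minus_commute)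
  qed
  show ?thesis
    using *[OF s] *[OF s(2,1)] by (cases "s1 \<le> s2") (auto simp: norm_minus_commute)
qed

lemma square_estimate_nn:
  fixes G :: "complex \<Rightarrow> complex"
  assumes G: "C1p G Gx Gy" and r: "r > 0" "m \<ge> 0"
    and osc: "\<And>t. r \<le> t \<Longrightarrow> t < 2 * r \<Longrightarrow> \<exists>x y. sn x = t \<and> sn y = t \<and> m \<le> norm (G x - G y)"
  shows "ennreal (r * m) \<le> 4 * (\<integral>\<^sup>+z. indicator (ann 0 r) z * ennreal (norm (Gx z) + norm (Gy z)) \<partial>lborel)"
proof -
  have [measurable]: "Gx \<in> borel_measurable borel" "Gy \<in> borel_measurable borel"
    using C1p_continuous[OF G] by (auto intro: borel_measurable_continuous_onI)
  define u where "u z = indicator (ann 0 r) z * ennreal (norm (Gx z))" for z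
  define w where "w z = indicator (ann 0 r) z * ennreal (norm (Gy z))" for z
  have [measurable]: "u \<in> borel_measurable borel" "w \<in> borel_measurable borel"
    unfolding u_def w_def by measurable
  \<comment> \<open>The integral runs along the whole line at height \<tau>, cut down to the annulus
    by the indicator. For r <= |\<tau>| < 2r it covers the side of the square at this
    height.\<close>
  define U where "U \<tau> = (\<integral>\<^sup>+s. u (Complex s \<tau>) \<partial>lborel)" for \<tau>
  define W where "W \<tau> = (\<integral>\<^sup>+s. w (Complex \<tau> s) \<partial>lborel)" for \<tau>
  have [measurable]: "U \<in> borel_measurable borel" "W \<in> borel_measurable borel"
    unfolding U_def W_def by measurable
  have hor: "ennreal (norm (G (Complex s1 \<tau>) - G (Complex s2 \<tau>))) \<le> U \<tau>"
    if "\<bar>\<tau>\<bar> = t" "r \<le> t" "t < 2 * r" "\<bar>s1\<bar> \<le> t" "\<bar>s2\<bar> \<le> t" for s1 s2 \<tau> t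
  proof -
    have c: "continuous_on UNIV (\<lambda>s. Complex s \<tau>)" unfolding Complex_eq by (intro continuous_intros)
    have d: "((\<lambda>s. Complex s \<tau>) has_derivative (\<lambda>h. of_real h)) (at s)" for s
      unfolding Complex_eq by (auto intro!: derivative_eq_intros)
    have "((\<lambda>s. G (Complex s \<tau>)) has_vector_derivative Gx (Complex s \<tau>)) (at s)" for s
      unfolding has_vector_derivative_def
      by (rule has_derivative_eq_rhs[OF has_derivative_compose[OF d C1p_D[OF G]]]) simp
    then have "ennreal (norm (G (Complex s1 \<tau>) - G (Complex s2 \<tau>))) \<le> (\<integral>\<^sup>+s. indicator {-t..t} s * ennreal (norm (Gx (Complex s \<tau>))) \<partial>lborel)"
      by (rule norm_diff_le_nn_integral[where g="\<lambda>s. G (Complex s \<tau>)"])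
         (use that in \<open>auto intro!: continuous_on_compose2[OF C1p_continuous(2)[OF G, of UNIV] c]\<close>)
    also have "\<dots> \<le> U \<tau>"
    proof -
      have "Complex s \<tau> \<in> ann 0 r" if "s \<in> {-t..t}" for s
      proof -
        have "\<bar>s\<bar> \<le> t" using that by auto
        then have "sn (Complex s \<tau>) = t" using \<open>\<bar>\<tau>\<bar> = t\<close> by (simp add: sn_def max_def)
        then show ?thesis using \<open>r \<le> t\<close> \<open>t < 2 * r\<close> by (simp add: ann_def)
      qed
      then show ?thesis
        unfolding U_def u_def by (intro nn_integral_mono) (auto simp: indicator_def)
    qed
    finally show ?thesis .
  qed
  have ver: "ennreal (norm (G (Complex \<tau> s1) - G (Complex \<tau> s2))) \<le> W \<tau>"
    if "\<bar>\<tau>\<bar> = t" "r \<le> t" "t < 2 * r" "\<bar>s1\<bar> \<le> t" "\<bar>s2\<bar> \<le> t" for s1 s2 \<tau> t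
  proof -
    have c: "continuous_on UNIV (\<lambda>s. Complex \<tau> s)" unfolding Complex_eq by (intro continuous_intros)
    have d: "((\<lambda>s. Complex \<tau> s) has_derivative (\<lambda>h. \<i> * of_real h)) (at s)" for s
      unfolding Complex_eq by (auto intro!: derivative_eq_intros)
    have "((\<lambda>s. G (Complex \<tau> s)) has_vector_derivative Gy (Complex \<tau> s)) (at s)" for s
      unfolding has_vector_derivative_def
      by (rule has_derivative_eq_rhs[OF has_derivative_compose[OF d C1p_D[OF G]]]) simp
    then have "ennreal (norm (G (Complex \<tau> s1) - G (Complex \<tau> s2))) \<le> (\<integral>\<^sup>+s. indicator {-t..t} s * ennreal (norm (Gy (Complex \<tau> s))) \<partial>lborel)"
      by (rule norm_diff_le_nn_integral[where g="\<lambda>s. G (Complex \<tau> s)"])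
         (use that in \<open>auto intro!: continuous_on_compose2[OF C1p_continuous(3)[OF G, of UNIV] c]\<close>)
    also have "\<dots> \<le> W \<tau>"
      unfolding W_def w_def by (rule nn_integral_mono) (use that in \<open>auto simp: indicator_def ann_def sn_def max_def\<close>)
    finally show ?thesis .
  qed
  define I where "I t = U t + U (- t) + (W t + W (- t))" for t
  have tri: "ennreal (norm (x - z)) \<le> ennreal (norm (x - y)) + ennreal (norm (y - z))" for x y z :: complex
    using norm_triangle_ineq[of "x - y" "y - z"] by (simp add: ennreal_plus[symmetric] del: ennreal_plus)
  \<comment> \<open>From the top and the right side one segment suffices; from the bottom and the
    left side a second one leads through the corner t - \<i> t or -t + \<i> t.\<close>
  have corner: "ennreal (norm (G x - G (Complex t t))) \<le> I t"
    if x: "sn x = t" and t: "r \<le> t" "t < 2 * r" for x t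
  proof -
    have xc: "x = Complex (Re x) (Im x)" by simp
    have t0: "t > 0" using r t by simp
    have b: "\<bar>Re x\<bar> \<le> t" "\<bar>Im x\<bar> \<le> t" using x by (auto simp: sn_def)
    have le: "U t \<le> I t" "W t \<le> I t" "U (-t) + W t \<le> I t" "W (-t) + U t \<le> I t"
      unfolding I_def by (simp_all add: add_increasing add_increasing2 add_mono algebra_simps add_left_mono)
    consider "Im x = t" | "Im x = - t" | "Re x = t" | "Re x = - t" using x unfolding sn_def by linarith
    then show ?thesis
    proof cases
      case 1
      then show ?thesis using hor[of t t "Re x" t] t t0 b le(1) by (subst xc) (auto intro: order_trans)
    next
      case 2
      have "ennreal (norm (G x - G (Complex t t))) \<le> ennreal (norm (G (Complex (Re x) (- t)) - G (Complex t (- t)))) + ennreal (norm (G (Complex t (- t)) - G (Complex t t)))"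
        using tri[of "G x" "G (Complex t t)" "G (Complex t (- t))"] 2 xc by metis
      also have "\<dots> \<le> U (-t) + W t"
        by (intro add_mono hor[of _ t] ver[of _ t]) (use t t0 b in auto)
      finally show ?thesis using le(3) by (rule order_trans)
    next
      case 3
      then show ?thesis using ver[of t t "Im x" t] t t0 b le(2) by (subst xc) (auto intro: order_trans)
    next
      case 4
      have "ennreal (norm (G x - G (Complex t t))) \<le> ennreal (norm (G (Complex (- t) (Im x)) - G (Complex (- t) t))) + ennreal (norm (G (Complex (- t) t) - G (Complex t t)))"
        using tri[of "G x" "G (Complex t t)" "G (Complex (- t) t)"] 4 xc by metis
      also have "\<dots> \<le> W (-t) + U t"
        by (intro add_mono hor[of _ t] ver[of _ t]) (use t t0 b in auto)
      finally show ?thesis using le(4) by (rule order_trans)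
    qed
  qed
  have mI: "ennreal m \<le> 2 * I t" if t: "r \<le> t" "t < 2 * r" for t
  proof -
    obtain x y where xy: "sn x = t" "sn y = t" "m \<le> norm (G x - G y)" using osc[OF t] by blast
    have "ennreal m \<le> ennreal (norm (G x - G y))" using xy(3) by (rule ennreal_leI)
    also have "\<dots> \<le> ennreal (norm (G x - G (Complex t t))) + ennreal (norm (G (Complex t t) - G y))" by (rule tri)
    also have "\<dots> \<le> I t + I t"
      using corner[OF xy(1) t] corner[OF xy(2) t] by (intro add_mono) (auto simp: norm_minus_commute)
    finally show ?thesis by (simp add: mult_2)
  qed
  have "ennreal (r * m) = (\<integral>\<^sup>+t. indicator {r..<2*r} t * ennreal m \<partial>lborel)"
    using r by (simp add: nn_integral_multc ennreal_mult)
  also have "\<dots> \<le> (\<integral>\<^sup>+t. 2 * I t \<partial>lborel)"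
    by (rule nn_integral_mono) (use mI in \<open>auto simp: indicator_def\<close>)
  \<comment> \<open>\<open>U\<close> and \<open>W\<close> each occur at t and at -t with equal
    integrals by reflection; together with the factor 2 for the two points this is the constant
    4.\<close>
  also have "\<dots> = 2 * ((\<integral>\<^sup>+t. U t \<partial>lborel) + (\<integral>\<^sup>+t. U (- t) \<partial>lborel) + ((\<integral>\<^sup>+t. W t \<partial>lborel) + (\<integral>\<^sup>+t. W (- t) \<partial>lborel)))"
    unfolding I_def by (simp add: nn_integral_cmult nn_integral_add)
  also have "\<dots> = 2 * (2 * (\<integral>\<^sup>+z. u z \<partial>lborel) + 2 * (\<integral>\<^sup>+z. w z \<partial>lborel))"
    by (simp add: nn_integral_uminus_real mult_2 nn_integral_complex(1)[of u] nn_integral_complex(2)[of w] U_def[symmetric] W_def[symmetric])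
  also have "\<dots> = 4 * (\<integral>\<^sup>+z. u z + w z \<partial>lborel)"
    by (simp add: nn_integral_add distrib_left mult.assoc[symmetric])
  also have "(\<integral>\<^sup>+z. u z + w z \<partial>lborel) = (\<integral>\<^sup>+z. indicator (ann 0 r) z * ennreal (norm (Gx z) + norm (Gy z)) \<partial>lborel)"
    by (simp add: u_def w_def distrib_left)
  finally show ?thesis .
qed

lemma C1p_translate:
  assumes "C1p g gx gy"
  shows "C1p (\<lambda>w. g (a + w)) (\<lambda>w. gx (a + w)) (\<lambda>w. gy (a + w))"
  unfolding C1p_def
proof (intro conjI allI)
  fix w
  have "((\<lambda>w. a + w) has_derivative (\<lambda>h. h)) (at w)"
    by (auto intro!: derivative_eq_intros)
  from has_derivative_compose[OF this C1p_D[OF assms]]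
  show "((\<lambda>w. g (a + w)) has_derivative (\<lambda>h. Re h *\<^sub>R gx (a + w) + Im h *\<^sub>R gy (a + w))) (at w)" .
qed (intro continuous_intros continuous_on_compose2[OF C1p_continuous(2)[OF assms, of UNIV]]
   continuous_on_compose2[OF C1p_continuous(3)[OF assms, of UNIV]]; simp)+

text \<open>The version with centre \<open>a\<close> and with an integral over a compact set, the
  setting in which L1 limits are taken.\<close>

lemma square_estimate:
  fixes G :: "complex \<Rightarrow> complex"
  assumes G: "C1p G Gx Gy" and r: "r > 0" "m \<ge> 0" and K: "compact K" "ann a r \<subseteq> K"
    and osc: "\<And>t. r \<le> t \<Longrightarrow> t < 2 * r \<Longrightarrow> \<exists>x y. sn (x - a) = t \<and> sn (y - a) = t \<and> m \<le> norm (G x - G y)"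
  shows "r * m \<le> 4 * (LINT z|lebesgue_on K. indicator (ann a r) z * (norm (Gx z) + norm (Gy z)))"
proof -
  have [measurable]: "Gx \<in> borel_measurable borel" "Gy \<in> borel_measurable borel"
    using C1p_continuous[OF G] by (auto intro: borel_measurable_continuous_onI)
  define v where "v z = indicator (ann a r) z * (norm (Gx z) + norm (Gy z))" for z
  have vm [measurable]: "v \<in> borel_measurable borel" unfolding v_def by measurable
  have v0: "0 \<le> v z" for z by (simp add: v_def)
  have iK: "integrable (lebesgue_on K) v"
  proof (rule Bochner_Integration.integrable_bound)
    show "integrable (lebesgue_on K) (\<lambda>z. norm (Gx z) + norm (Gy z))"
      by (intro continuous_on_compact_integrable K continuous_intros C1p_continuous[OF G])
    show "v \<in> borel_measurable (lebesgue_on K)"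
      by (intro measurable_restrict_space1 measurable_completion) simp
  qed (auto simp: v_def indicator_def)
  have vK: "v z = 0" if "z \<notin> K" for z
  proof -
    have "z \<notin> ann a r" using that K(2) by blast
    then show ?thesis by (simp add: v_def)
  qed
  have ind: "(\<lambda>z. indicator K z *\<^sub>R v z) = v" using vK by (auto simp: indicator_def fun_eq_iff)
  have "integrable lebesgue (\<lambda>z. indicator K z *\<^sub>R v z)"
    using iK compact_sets_lebesgue[OF K(1)] by (subst (asm) integrable_restrict_space) auto
  then have il: "integrable lebesgue v" unfolding ind .
  have eq: "(LINT z|lebesgue_on K. v z) = (LINT z|lebesgue. v z)"
    by (rule integral_lebesgue_on_vanishing[OF compact_sets_lebesgue[OF K(1)] vK])
  have osc': "\<exists>x y. sn x = t \<and> sn y = t \<and> m \<le> norm (G (a + x) - G (a + y))" if t: "r \<le> t" "t < 2 * r" for t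
  proof -
    obtain x y where "sn (x - a) = t" "sn (y - a) = t" "m \<le> norm (G x - G y)" using osc[OF t] by blast
    then show ?thesis by (intro exI[of _ "x - a"] exI[of _ "y - a"]) simp
  qed
  have "ennreal (r * m) \<le> 4 * (\<integral>\<^sup>+z. indicator (ann 0 r) z * ennreal (norm (Gx (a + z)) + norm (Gy (a + z))) \<partial>lborel)"
    by (rule square_estimate_nn[OF C1p_translate[OF G] r osc'])
  also have "(\<integral>\<^sup>+z. indicator (ann 0 r) z * ennreal (norm (Gx (a + z)) + norm (Gy (a + z))) \<partial>lborel) = (\<integral>\<^sup>+z. ennreal (v (a + z)) \<partial>lborel)"
    by (rule nn_integral_cong) (auto simp: v_def indicator_def ann_def)
  also have "\<dots> = (\<integral>\<^sup>+z. ennreal (v z) \<partial>distr lborel borel ((+) a))"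
    by (subst nn_integral_distr) auto
  also have "\<dots> = (\<integral>\<^sup>+z. ennreal (v z) \<partial>lebesgue)"
    by (simp add: lborel_distr_plus nn_integral_completion)
  also have "\<dots> = ennreal (LINT z|lebesgue. v z)"
    by (rule nn_integral_eq_integral[OF il]) (simp add: v0)
  finally have "ennreal (r * m) \<le> ennreal (4 * (LINT z|lebesgue. v z))"
    using v0 by (simp add: ennreal_mult integral_nonneg_AE)
  then show ?thesis
    unfolding v_def[symmetric] eq using v0 by (simp add: integral_nonneg_AE)
qed

text \<open>The gradient of \<open>G\<close> is known only as an L1 limit. The approximants inherit
  the oscillation hypothesis with \<open>m\<close> lowered by twice their uniform distance to
  \<open>G\<close>, and this loss can be made arbitrarily small.\<close>

lemma square_estimate_limit:
  fixes G :: "complex \<Rightarrow> complex"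
  assumes Gn: "\<And>n::nat. C1p (Gn n) (Gnx n) (Gny n)" and u: "uniform_limit K Gn G sequentially"
    and L: "L1lim (lebesgue_on K) Gnx Gx" "L1lim (lebesgue_on K) Gny Gy"
    and r: "r > 0" and K: "compact K" "\<And>z. sn (z - a) < 2 * r \<Longrightarrow> z \<in> K"
    and osc: "\<And>t. r \<le> t \<Longrightarrow> t < 2 * r \<Longrightarrow> \<exists>x y. sn (x - a) = t \<and> sn (y - a) = t \<and> m \<le> norm (G x - G y)"
  shows "r * m \<le> 4 * (LINT z|lebesgue_on K. indicator (ann a r) z * (norm (Gx z) + norm (Gy z)))"
proof (rule field_le_epsilon)
  fix e :: real assume e: "e > 0"
  \<comment> \<open>Lowering \<open>m\<close> by 2\<delta> costs r * 2\<delta> = e in the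
    estimate.\<close>
  define \<delta> where "\<delta> = e / (2 * r)"
  have \<delta>: "\<delta> > 0" using e r by (simp add: \<delta>_def)
  let ?M = "lebesgue_on K"
  let ?i = "indicator (ann a r) :: complex \<Rightarrow> real"
  have im: "?i \<in> borel_measurable ?M"
    by (intro measurable_restrict_space1 measurable_completion) simp
  have "bounded (?i ` space ?M)"
    unfolding bounded_iff by (intro exI[of _ 1]) (auto simp: indicator_def)
  then have ui: "uconv ?M (\<lambda>_. ?i) ?i" using im by (rule uconv_const[rotated])
  have lim: "(\<lambda>n. LINT z|?M. ?i z * (norm (Gnx n z) + norm (Gny n z))) \<longlonglongrightarrow> (LINT z|?M. ?i z * (norm (Gx z) + norm (Gy z)))"
    by (rule L1lim_integral[OF L1lim_bilinear_uconv[OF bounded_bilinear_mult ui L1lim_add[OF L1lim_norm[OF L(1)] L1lim_norm[OF L(2)]]]])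
  have "ann a r \<subseteq> K" using K(2) by (auto simp: ann_def)
  note sq = square_estimate[OF Gn r _ K(1) this]
  have "\<forall>\<^sub>F n in sequentially. r * (m - 2 * \<delta>) \<le> 4 * (LINT z|?M. ?i z * (norm (Gnx n z) + norm (Gny n z)))"
    using uniform_limitD[OF u \<delta>]
  proof eventually_elim
    case (elim n)
    have "r * max 0 (m - 2 * \<delta>) \<le> 4 * (LINT z|?M. ?i z * (norm (Gnx n z) + norm (Gny n z)))"
    proof (rule sq)
      fix t assume t: "r \<le> t" "t < 2 * r"
      then obtain x y where xy: "sn (x - a) = t" "sn (y - a) = t" "m \<le> norm (G x - G y)" using osc by blast
      have "x \<in> K" "y \<in> K" using xy t K(2) by auto
      then have "norm (Gn n x - G x) < \<delta>" "norm (Gn n y - G y) < \<delta>" using elim by (auto simp: dist_norm)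
      moreover have "norm (G x - G y) \<le> norm (Gn n x - Gn n y) + norm (Gn n x - G x) + norm (Gn n y - G y)" by norm
      ultimately have "max 0 (m - 2 * \<delta>) \<le> norm (Gn n x - Gn n y)" using xy(3) by simp
      then show "\<exists>x y. sn (x - a) = t \<and> sn (y - a) = t \<and> max 0 (m - 2 * \<delta>) \<le> norm (Gn n x - Gn n y)" using xy by blast
    qed simp
    moreover have "r * (m - 2 * \<delta>) \<le> r * max 0 (m - 2 * \<delta>)" using r by (intro mult_left_mono) auto
    ultimately show ?case by linarith
  qed
  then have "r * (m - 2 * \<delta>) \<le> 4 * (LINT z|?M. ?i z * (norm (Gx z) + norm (Gy z)))"
    by (intro tendsto_lowerbound[OF tendsto_mult_left[OF lim]]) auto
  moreover have "r * (m - 2 * \<delta>) = r * m - e" using r by (simp add: \<delta>_def field_simps)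
  ultimately show "r * m \<le> 4 * (LINT z|?M. ?i z * (norm (Gx z) + norm (Gy z))) + e" by linarith
qed

section \<open>Interior estimates\<close>

text \<open>The two facts about a quasiregular map that enter the estimates: smooth approximation on
  compact sets and the distortion inequality in Jacobian form. \<open>L\<close> stands for K + 1/K,
  see \<open>distortion_iff\<close>.\<close>

definition qr_data :: "real \<Rightarrow> complex set \<Rightarrow> (complex \<Rightarrow> complex) \<Rightarrow> (complex \<Rightarrow> complex) \<Rightarrow> (complex \<Rightarrow> complex) \<Rightarrow> bool" where
  "qr_data L \<Omega> f fx fy \<longleftrightarrow> (\<forall>K. compact K \<longrightarrow> K \<subseteq> \<Omega> \<longrightarrow> appr K f fx fy) \<and>
     (AE z in lebesgue. z \<in> \<Omega> \<longrightarrow> (norm (fx z))\<^sup>2 + (norm (fy z))\<^sup>2 \<le> L * Jac (fx z) (fy z))"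

lemma qr_dataD:
  assumes "qr_data L \<Omega> f fx fy" "compact K" "K \<subseteq> \<Omega>"
  shows "appr K f fx fy"
    and "AE z in lebesgue_on K. (norm (fx z))\<^sup>2 + (norm (fy z))\<^sup>2 \<le> L * Jac (fx z) (fy z)"
proof -
  show "appr K f fx fy" using assms by (auto simp: qr_data_def)
  have "AE z in lebesgue. z \<in> \<Omega> \<longrightarrow> (norm (fx z))\<^sup>2 + (norm (fy z))\<^sup>2 \<le> L * Jac (fx z) (fy z)"
    using assms by (auto simp: qr_data_def)
  then have "AE z in lebesgue. z \<in> K \<longrightarrow> (norm (fx z))\<^sup>2 + (norm (fy z))\<^sup>2 \<le> L * Jac (fx z) (fy z)"
    by eventually_elim (use assms(3) in auto)
  then show "AE z in lebesgue_on K. (norm (fx z))\<^sup>2 + (norm (fy z))\<^sup>2 \<le> L * Jac (fx z) (fy z)"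
    using compact_sets_lebesgue[OF assms(2)] by (subst AE_restrict_space_iff) auto
qed

lemma le_one_plus_sq: "(x::real) \<le> 1 + x\<^sup>2"
proof -
  have "(x - 1)\<^sup>2 = x\<^sup>2 - 2 * x + 1" by (simp add: power2_diff)
  with zero_le_power2[of "x - 1"] zero_le_power2[of x] show ?thesis by linarith
qed

definition sq :: "complex \<Rightarrow> real \<Rightarrow> complex set" where
  "sq a t = cbox (a - Complex t t) (a + Complex t t)"

lemma sq_iff: "z \<in> sq a t \<longleftrightarrow> sn (z - a) \<le> t"
  by (auto simp: sq_def sn_def in_cbox_complex_iff abs_le_iff)

lemma sq_boundary: "z \<in> sq a t - box (a - Complex t t) (a + Complex t t) \<Longrightarrow> sn (z - a) = t"
  by (auto simp: sq_def sn_def in_cbox_complex_iff in_box_complex_iff max_def abs_if split: if_splits)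

lemma compact_sq: "compact (sq a t)"
  by (simp add: sq_def)

lemma sn_bounds: "sn z \<le> cmod z" "(cmod z)\<^sup>2 \<le> 2 * (sn z)\<^sup>2" "cmod z \<le> 2 * sn z"
proof -
  show "sn z \<le> cmod z" by (simp add: sn_def abs_Re_le_cmod abs_Im_le_cmod)
  have "(Re z)\<^sup>2 \<le> (sn z)\<^sup>2" "(Im z)\<^sup>2 \<le> (sn z)\<^sup>2"
    by (auto simp: sn_def abs_le_square_iff[symmetric])
  then show "(cmod z)\<^sup>2 \<le> 2 * (sn z)\<^sup>2" by (simp add: cmod_power2)
  show "cmod z \<le> 2 * sn z" using cmod_le[of z] by (simp add: sn_def)
qed

lemma measure_sq: "t \<ge> 0 \<Longrightarrow> measure lebesgue (sq a t) = 4 * t\<^sup>2"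
  by (simp add: sq_def measure_completion measure_lborel_cbox_eq Basis_complex_def power2_eq_square)

text \<open>A radial cutoff with explicit gradient; the outer square makes it C1 across the circle
  of radius R.\<close>

lemma cutoff_C1p:
  "C1p (\<lambda>z. (max 0 (R\<^sup>2 - (cmod (z - a))\<^sup>2))\<^sup>2)
     (\<lambda>z. - 4 * max 0 (R\<^sup>2 - (cmod (z - a))\<^sup>2) * Re (z - a))
     (\<lambda>z. - 4 * max 0 (R\<^sup>2 - (cmod (z - a))\<^sup>2) * Im (z - a))"
proof -
  have 1: "C1p (\<lambda>z. R\<^sup>2 + (-1) * (cmod (- a + z))\<^sup>2) (\<lambda>z. - 2 * Re (- a + z)) (\<lambda>z. - 2 * Im (- a + z))"
    by (rule C1p_cong[OF C1p_add[OF C1p_const[of "R\<^sup>2"] C1p_mult[OF C1p_const[of "-1"] C1p_translate[OF C1p_cmod_sq, of "-a"]]]]) simp_all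
  show ?thesis
    by (rule C1p_cong[OF C1p_real_compose[OF DERIV_max_0_sq _ 1]]) (auto intro!: continuous_intros simp: algebra_simps)
qed

lemma bound_factor_le:
  fixes p :: real
  shows "(1 + (cmod w)\<^sup>2) powr (p/2 - 1) * (cmod w)\<^sup>2 \<le> (1 + (cmod w)\<^sup>2) powr (p/2)"
proof -
  have x: "1 + (cmod w)\<^sup>2 > 0" by (simp add: add_pos_nonneg)
  have "(1 + (cmod w)\<^sup>2) powr (p/2 - 1) * (cmod w)\<^sup>2 \<le> (1 + (cmod w)\<^sup>2) powr (p/2 - 1) * (1 + (cmod w)\<^sup>2)"
    by (intro mult_left_mono) auto
  also have "\<dots> = (1 + (cmod w)\<^sup>2) powr (p/2 - 1) * (1 + (cmod w)\<^sup>2) powr 1" using x by simp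
  also have "\<dots> = (1 + (cmod w)\<^sup>2) powr (p/2)" by (simp only: powr_add[symmetric]) simp
  finally show ?thesis .
qed

text \<open>Caccioppoli with \<eta> = s^2, where s is the positive part of R^2 - |z - a|^2. On the
  square \<eta>^2 is at least R^8/16, and the squared gradient of \<eta> is at most 16 R^6
  everywhere; 4 * 16 * 16 gives 1024.\<close>

lemma energy_bound:
  fixes p L R V :: real
  assumes f: "qr_data L \<Omega> f fx fy" and p: "p > 0" and L: "L > 0" and R: "R > 0" "cball a R \<subseteq> \<Omega>"
    and V: "(LINT z|lebesgue_on (cball a R). (1 + (cmod (f z))\<^sup>2) powr (p/2)) \<le> V"
  defines "b \<equiv> \<lambda>w. (1 + (cmod w)\<^sup>2) powr (p/2 - 1)"
  shows "(LINT z|lebesgue_on (sq a (R/2)). b (f z) * ((norm (fx z))\<^sup>2 + (norm (fy z))\<^sup>2))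
     \<le> 1024 * L\<^sup>2 / (R\<^sup>2 * (min 2 p)\<^sup>2) * V"
    and "integrable (lebesgue_on (sq a (R/2))) (\<lambda>z. b (f z) * ((norm (fx z))\<^sup>2 + (norm (fy z))\<^sup>2))"
proof -
  define K where "K = cball a R"
  have K: "compact K" "K \<subseteq> \<Omega>" using R by (auto simp: K_def)
  let ?D = "\<lambda>z. (norm (fx z))\<^sup>2 + (norm (fy z))\<^sup>2"
  define \<eta> where "\<eta> z = (max 0 (R\<^sup>2 - (cmod (z - a))\<^sup>2))\<^sup>2" for z
  define \<eta>x where "\<eta>x z = - 4 * max 0 (R\<^sup>2 - (cmod (z - a))\<^sup>2) * Re (z - a)" for z
  define \<eta>y where "\<eta>y z = - 4 * max 0 (R\<^sup>2 - (cmod (z - a))\<^sup>2) * Im (z - a)" for z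
  have \<eta>: "C1p \<eta> \<eta>x \<eta>y" unfolding \<eta>_def \<eta>x_def \<eta>y_def by (rule cutoff_C1p)
  have \<eta>0: "\<eta> z = 0" if "z \<notin> K" for z
  proof -
    have "R < cmod (z - a)" using that by (simp add: K_def dist_norm norm_minus_commute)
    then have "R\<^sup>2 \<le> (cmod (z - a))\<^sup>2" using R by (intro power_mono) auto
    then show ?thesis by (simp add: \<eta>_def)
  qed
  note fK = qr_dataD[OF f K]
  have C: "(LINT z|lebesgue_on K. (\<eta> z)\<^sup>2 * (b (f z) * ?D z))
     \<le> 4 * L\<^sup>2 / (min 2 p)\<^sup>2 * (LINT z|lebesgue_on K. b (f z) * (cmod (f z))\<^sup>2 * ((\<eta>x z)\<^sup>2 + (\<eta>y z)\<^sup>2))"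
    unfolding b_def by (rule Caccioppoli(1)[OF K(1) fK(1) p L fK(2) \<eta> \<eta>0])
  have C2: "integrable (lebesgue_on K) (\<lambda>z. (\<eta> z)\<^sup>2 * (b (f z) * ?D z))"
    unfolding b_def by (rule Caccioppoli(2)[OF K(1) fK(1) p L fK(2) \<eta> \<eta>0])
  have fc: "continuous_on K f" by (rule appr_continuous[OF fK(1)])
  have bpos: "b w > 0" for w
  proof -
    have "1 + (cmod w)\<^sup>2 \<noteq> 0" using zero_le_power2[of "cmod w"] by linarith
    then show ?thesis unfolding b_def by (simp only: powr_gt_zero) simp
  qed
  have pc: "continuous_on UNIV (\<lambda>w. (1 + (cmod w)\<^sup>2) powr q)" for q
    by (rule C1p_continuous(1)[OF C1p_powr_cmod])
  have bc: "continuous_on K (\<lambda>z. b (f z))" unfolding b_def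
    by (rule continuous_on_compose2[OF pc fc]) simp
  have Dint: "integrable (lebesgue_on K) ?D" using appr_sqint[OF fK(1)] by (auto simp: sqint_def)
  have bD: "integrable (lebesgue_on K) (\<lambda>z. b (f z) * ?D z)"
    by (rule integrable_continuous_mult[OF K(1) bc Dint])
  have sqK: "sq a (R/2) \<subseteq> K"
  proof
    fix z assume "z \<in> sq a (R/2)"
    then show "z \<in> K" using sn_bounds(3)[of "z - a"] by (simp add: sq_iff K_def dist_norm norm_minus_commute)
  qed
  show i: "integrable (lebesgue_on (sq a (R/2))) (\<lambda>z. b (f z) * ?D z)"
    by (rule lebesgue_on_subset_integrable[OF bD]) (auto intro!: compact_sets_lebesgue compact_sq K sqK)
  have grad: "(\<eta>x z)\<^sup>2 + (\<eta>y z)\<^sup>2 \<le> 16 * R^6" for z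
  proof -
    define s where "s = max 0 (R\<^sup>2 - (cmod (z - a))\<^sup>2)"
    have "(\<eta>x z)\<^sup>2 + (\<eta>y z)\<^sup>2 = 16 * (s\<^sup>2 * (cmod (z - a))\<^sup>2)"
    proof -
      have "(- 4 * s * X)\<^sup>2 + (- 4 * s * Y)\<^sup>2 = 16 * (s\<^sup>2 * (X\<^sup>2 + Y\<^sup>2))" for X Y :: real
        by (simp add: power_mult_distrib algebra_simps)
      moreover have "\<eta>x z = - 4 * s * Re (z - a)" "\<eta>y z = - 4 * s * Im (z - a)"
        by (simp_all only: \<eta>x_def \<eta>y_def s_def)
      ultimately show ?thesis by (simp only: cmod_power2[of "z - a"])
    qed
    also have "s\<^sup>2 * (cmod (z - a))\<^sup>2 \<le> (R\<^sup>2)\<^sup>2 * R\<^sup>2"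
    proof (cases "(cmod (z - a))\<^sup>2 \<le> R\<^sup>2")
      case True
      have "0 \<le> s" "s \<le> R\<^sup>2" by (auto simp: s_def)
      then have "s\<^sup>2 \<le> (R\<^sup>2)\<^sup>2" by (intro power_mono)
      then show ?thesis using True by (rule mult_mono) auto
    next
      case False
      then have "s = 0" by (simp add: s_def)
      then show ?thesis by simp
    qed
    finally show ?thesis by (simp add: power_mult[symmetric] power_add[symmetric])
  qed
  have low: "R^8 / 16 \<le> (\<eta> z)\<^sup>2" if "z \<in> sq a (R/2)" for z
  proof -
    have "(sn (z - a))\<^sup>2 \<le> (R/2)\<^sup>2"
      using that by (intro power_mono) (auto simp: sq_iff sn_def)
    then have "(cmod (z - a))\<^sup>2 \<le> R\<^sup>2 / 2" using sn_bounds(2)[of "z - a"] by (simp add: power_divide)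
    then have "R\<^sup>2 / 2 \<le> R\<^sup>2 - (cmod (z - a))\<^sup>2" by linarith
    then have "R\<^sup>2 / 2 \<le> max 0 (R\<^sup>2 - (cmod (z - a))\<^sup>2)" by (simp add: le_max_iff_disj)
    then have "(R\<^sup>2 / 2) ^ 4 \<le> (max 0 (R\<^sup>2 - (cmod (z - a))\<^sup>2)) ^ 4" by (intro power_mono) auto
    then show ?thesis by (simp add: \<eta>_def power_mult[symmetric] power_divide)
  qed
  have "(LINT z|lebesgue_on (sq a (R/2)). R^8 / 16 * (b (f z) * ?D z)) \<le> (LINT z|lebesgue_on (sq a (R/2)). (\<eta> z)\<^sup>2 * (b (f z) * ?D z))"
  proof (rule integral_mono)
    show "integrable (lebesgue_on (sq a (R/2))) (\<lambda>z. (\<eta> z)\<^sup>2 * (b (f z) * ?D z))"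
      by (rule lebesgue_on_subset_integrable[OF C2]) (auto intro!: compact_sets_lebesgue compact_sq K sqK)
    fix z assume "z \<in> space (lebesgue_on (sq a (R/2)))"
    then show "R^8 / 16 * (b (f z) * ?D z) \<le> (\<eta> z)\<^sup>2 * (b (f z) * ?D z)"
      using low[of z] bpos[of "f z"] by (intro mult_right_mono mult_nonneg_nonneg) auto
  qed (use i in auto)
  also have "\<dots> \<le> (LINT z|lebesgue_on K. (\<eta> z)\<^sup>2 * (b (f z) * ?D z))"
    using bpos by (intro lebesgue_on_subset_integral_le C2 compact_sets_lebesgue compact_sq K sqK mult_nonneg_nonneg) (auto intro: less_imp_le)
  also have "\<dots> \<le> 4 * L\<^sup>2 / (min 2 p)\<^sup>2 * (LINT z|lebesgue_on K. b (f z) * (cmod (f z))\<^sup>2 * ((\<eta>x z)\<^sup>2 + (\<eta>y z)\<^sup>2))"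
    by (rule C)
  also have "\<dots> \<le> 4 * L\<^sup>2 / (min 2 p)\<^sup>2 * (LINT z|lebesgue_on K. (1 + (cmod (f z))\<^sup>2) powr (p/2) * (16 * R^6))"
  proof (intro mult_left_mono integral_mono)
    fix z
    have "b (f z) * (cmod (f z))\<^sup>2 \<le> (1 + (cmod (f z))\<^sup>2) powr (p/2)" unfolding b_def by (rule bound_factor_le)
    then show "b (f z) * (cmod (f z))\<^sup>2 * ((\<eta>x z)\<^sup>2 + (\<eta>y z)\<^sup>2) \<le> (1 + (cmod (f z))\<^sup>2) powr (p/2) * (16 * R^6)"
      by (intro mult_mono grad) auto
  next
    show "integrable (lebesgue_on K) (\<lambda>z. b (f z) * (cmod (f z))\<^sup>2 * ((\<eta>x z)\<^sup>2 + (\<eta>y z)\<^sup>2))"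
      by (intro continuous_on_compact_integrable K continuous_intros bc fc C1p_continuous[OF \<eta>])
    show "integrable (lebesgue_on K) (\<lambda>z. (1 + (cmod (f z))\<^sup>2) powr (p/2) * (16 * R^6))"
      by (intro continuous_on_compact_integrable K continuous_intros continuous_on_compose2[OF pc fc]) simp
  qed auto
  also have "\<dots> \<le> 4 * L\<^sup>2 / (min 2 p)\<^sup>2 * (V * (16 * R^6))"
  proof (intro mult_left_mono)
    have "(LINT z|lebesgue_on K. (1 + (cmod (f z))\<^sup>2) powr (p/2) * (16 * R^6)) = (LINT z|lebesgue_on K. (1 + (cmod (f z))\<^sup>2) powr (p/2)) * (16 * R^6)"
      by simp
    then show "(LINT z|lebesgue_on K. (1 + (cmod (f z))\<^sup>2) powr (p/2) * (16 * R^6)) \<le> V * (16 * R^6)"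
      using V R by (simp only: K_def) (intro mult_right_mono, auto)
  qed auto
  finally have "R^8 / 16 * (LINT z|lebesgue_on (sq a (R/2)). b (f z) * ?D z) \<le> 4 * L\<^sup>2 / (min 2 p)\<^sup>2 * (V * (16 * R^6))"
    by simp
  also have "4 * L\<^sup>2 / (min 2 p)\<^sup>2 * (V * (16 * R^6)) = R^8 / 16 * (1024 * L\<^sup>2 / (R\<^sup>2 * (min 2 p)\<^sup>2) * V)"
    using R by (simp add: field_simps eval_nat_numeral)
  finally show "(LINT z|lebesgue_on (sq a (R/2)). b (f z) * ?D z) \<le> 1024 * L\<^sup>2 / (R\<^sup>2 * (min 2 p)\<^sup>2) * V"
    by (rule mult_left_le_imp_le) (use R in simp)
qed

text \<open>With \<open>\<Phi> w = (1 + (cmod w)\<^sup>2) powr (p/4)\<close>, the square estimate is applied to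
  \<open>\<Phi> (f z) (z - a)\<close> instead of \<open>\<Phi> (f z)\<close>: at antipodal points of a square its values do not
  cancel, so that its oscillation on the boundary controls the maximum of \<open>\<Phi> \<circ> f\<close>.\<close>

lemma sup_bound:
  fixes p L r V :: real
  assumes p: "p > 0" and L: "L > 0" and r: "r > 0"
  shows "\<exists>S. \<forall>\<Omega> f fx fy a. qr_data L \<Omega> f fx fy \<longrightarrow> cball a (4 * r) \<subseteq> \<Omega> \<longrightarrow>
           (LINT z|lebesgue_on (cball a (4 * r)). (1 + (cmod (f z))\<^sup>2) powr (p/2)) \<le> V \<longrightarrow>
           (\<forall>z\<in>sq a r. cmod (f z) \<le> S)"
proof -
  \<comment> \<open>The bound of \<open>energy_bound\<close> for radius 4r, valid on
    \<open>sq a (2 * r)\<close>, which contains the annulus of the square estimate.\<close>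
  define E where "E = 1024 * L\<^sup>2 / ((4 * r)\<^sup>2 * (min 2 p)\<^sup>2) * V"
  define B where "B = 4 * ((4 + 6 * r * (p/2)) * (16 * r\<^sup>2) + 4 * V + 6 * r * (p/2) * E)"
  \<comment> \<open>The power 4/p undoes \<Phi>: raised to it, \<Phi>(w) becomes 1 + |w|^2.\<close>
  define S where "S = (B / r\<^sup>2) powr (4/p)"
  have "cmod (f z0) \<le> S"
    if f: "qr_data L \<Omega> f fx fy" and \<Omega>: "cball a (4 * r) \<subseteq> \<Omega>"
      and V: "(LINT z|lebesgue_on (cball a (4 * r)). (1 + (cmod (f z))\<^sup>2) powr (p/2)) \<le> V" and z0: "z0 \<in> sq a r"
    for \<Omega> f fx fy a z0
  proof -
    define Q where "Q = sq a (2 * r)"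
    let ?M = "lebesgue_on Q"
    let ?D = "\<lambda>z. (norm (fx z))\<^sup>2 + (norm (fy z))\<^sup>2"
    define b where "b w = (1 + (cmod w)\<^sup>2) powr (p/2 - 1)" for w
    have R: "4 * r > 0" using r by simp
    have QK: "Q \<subseteq> cball a (4 * r)"
    proof
      fix z assume "z \<in> Q"
      then show "z \<in> cball a (4 * r)" using sn_bounds(3)[of "z - a"] by (simp add: Q_def sq_iff dist_norm norm_minus_commute)
    qed
    have Q: "compact Q" "Q \<subseteq> \<Omega>" using QK \<Omega> by (auto simp: Q_def compact_sq)
    have ap: "appr Q f fx fy" by (rule qr_dataD(1)[OF f Q])
    have apK: "appr (cball a (4 * r)) f fx fy" by (rule qr_dataD(1)[OF f _ \<Omega>]) simp
    have En: "(LINT z|?M. b (f z) * ?D z) \<le> E" and Ei: "integrable ?M (\<lambda>z. b (f z) * ?D z)"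
      using energy_bound[OF f p L R \<Omega> V] by (simp_all add: E_def Q_def b_def)
    define \<Phi> where "\<Phi> w = (1 + (cmod w)\<^sup>2) powr (p/4)" for w
    define \<Phi>u where "\<Phi>u w = p/4 * (1 + (cmod w)\<^sup>2) powr (p/4 - 1) * (2 * Re w)" for w
    define \<Phi>v where "\<Phi>v w = p/4 * (1 + (cmod w)\<^sup>2) powr (p/4 - 1) * (2 * Im w)" for w
    have \<Phi>: "C1p \<Phi> \<Phi>u \<Phi>v" unfolding \<Phi>_def \<Phi>u_def \<Phi>v_def by (rule C1p_powr_cmod)
    have x1: "1 + (cmod w)\<^sup>2 \<ge> 1" for w by simp
    have \<Phi>1: "\<Phi> w \<ge> 1" for w unfolding \<Phi>_def using p x1 by (intro ge_one_powr_ge_zero) auto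
    have \<Phi>sq: "(\<Phi> w)\<^sup>2 = (1 + (cmod w)\<^sup>2) powr (p/2)" for w
      unfolding \<Phi>_def power2_eq_square by (simp only: powr_add[symmetric]) simp
    \<comment> \<open>The exponent p/4 is chosen for this bound: the gradient of \<Phi> is at most
      (p/2) (1 + |w|^2)^(p/4 - 1/2), and the square of that power is the weight \<open>b\<close>.
      The term linear in \<xi> is traded for the energy by x <= 1 + x^2.\<close>
    have D\<Phi>: "\<bar>Re \<xi> * \<Phi>u w + Im \<xi> * \<Phi>v w\<bar> \<le> p/2 * (1 + b w * (cmod \<xi>)\<^sup>2)" for \<xi> w
    proof -
      define y where "y = 1 + (cmod w)\<^sup>2"
      have y: "y \<ge> 1" "y > 0" by (auto simp: y_def add_pos_nonneg)
      have "Re \<xi> * \<Phi>u w + Im \<xi> * \<Phi>v w = p/2 * (y powr (p/4 - 1) * Re (cnj w * \<xi>))"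
        by (simp add: \<Phi>u_def \<Phi>v_def y_def algebra_simps)
      also have "\<bar>\<dots>\<bar> \<le> p/2 * (y powr (p/4 - 1) * (cmod w * cmod \<xi>))"
        using p abs_Re_le_cmod[of "cnj w * \<xi>"] by (simp add: abs_mult norm_mult mult_left_mono)
      also have "\<dots> \<le> p/2 * (y powr (p/4 - 1) * (y powr (1/2) * cmod \<xi>))"
      proof -
        have "cmod w \<le> sqrt y" unfolding y_def by (rule real_le_rsqrt) simp
        then have "cmod w \<le> y powr (1/2)" using y by (simp add: powr_half_sqrt)
        then show ?thesis using p by (intro mult_left_mono mult_right_mono) auto
      qed
      also have "y powr (p/4 - 1) * (y powr (1/2) * cmod \<xi>) = y powr (p/4 - 1/2) * cmod \<xi>"
        by (simp add: mult.assoc[symmetric] powr_add[symmetric])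
      also have "p/2 * \<dots> \<le> p/2 * (1 + b w * (cmod \<xi>)\<^sup>2)"
      proof (intro mult_left_mono)
        define c where "c = y powr (p/4 - 1/2) * cmod \<xi>"
        have "c \<le> 1 + c\<^sup>2" by (rule le_one_plus_sq)
        moreover have "c\<^sup>2 = b w * (cmod \<xi>)\<^sup>2"
          unfolding c_def power_mult_distrib b_def y_def[symmetric] power2_eq_square[of "y powr _"] powr_add[symmetric] by simp
        ultimately show "y powr (p/4 - 1/2) * cmod \<xi> \<le> 1 + b w * (cmod \<xi>)\<^sup>2" by (simp add: c_def)
      qed (use p in auto)
      finally show ?thesis .
    qed
    obtain h hx hy where h: "\<And>n::nat. C2p (h n) (hx n) (hy n)" "uniform_limit Q h f sequentially"
       "L2lim ?M hx fx" "L2lim ?M hy fy"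
      using ap unfolding appr_def by blast
    note hc = C1p_continuous[OF C2p_C1p[OF h(1)]]
    have fin: "finite_measure ?M" by (rule finite_measure_lebesgue_on_compact[OF Q(1)])
    have uh: "uconv ?M h f" by (rule uconv_lebesgue_on[OF Q(1) _ h(2)]) (rule hc)
    have uc: "uconv ?M (\<lambda>_. u) u" if "continuous_on Q u" for u :: "complex \<Rightarrow> complex"
      by (rule uconv_lebesgue_on[OF Q(1)]) (use that in \<open>auto simp: uniform_limit_iff\<close>)
    have fc: "continuous_on Q f" by (rule appr_continuous[OF ap])
    define dd where "dd \<xi> w = Re \<xi> * \<Phi>u w + Im \<xi> * \<Phi>v w" for \<xi> w
    \<comment> \<open>Written with \<open>- a + z\<close> to match
      \<open>C1p_translate\<close>.\<close>
    define Gn where "Gn n z = \<Phi> (h n z) *\<^sub>R (- a + z)" for n z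
    define Gnx where "Gnx n z = dd (hx n z) (h n z) *\<^sub>R (- a + z) + \<Phi> (h n z) *\<^sub>R 1" for n z
    define Gny where "Gny n z = dd (hy n z) (h n z) *\<^sub>R (- a + z) + \<Phi> (h n z) *\<^sub>R \<i>" for n z
    have Gn: "C1p (Gn n) (Gnx n) (Gny n)" for n
      using C1p_scaleR[OF C1p_compose[OF \<Phi> C2p_C1p[OF h(1)[of n]]] C1p_translate[OF C1p_id, of "-a"]]
      unfolding Gn_def Gnx_def Gny_def dd_def by simp
    define G where "G z = \<Phi> (f z) *\<^sub>R (- a + z)" for z
    define Gx where "Gx z = dd (fx z) (f z) *\<^sub>R (- a + z) + \<Phi> (f z) *\<^sub>R 1" for z
    define Gy where "Gy z = dd (fy z) (f z) *\<^sub>R (- a + z) + \<Phi> (f z) *\<^sub>R \<i>" for z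
    note u\<Phi> = uconv_continuous_compose[OF uh C1p_continuous(1)[OF \<Phi>]]
      and uu = uconv_continuous_compose[OF uh C1p_continuous(2)[OF \<Phi>]]
      and uv = uconv_continuous_compose[OF uh C1p_continuous(3)[OF \<Phi>]]
    note m = L1lim_bilinear_uconv[OF bounded_bilinear_mult]
    have Ldd: "L1lim ?M (\<lambda>n z. dd (k n z) (h n z)) (\<lambda>z. dd (g z) (f z))" if k: "L2lim ?M k g" for k g
    proof -
      note R1 = L2lim_imp_L1lim[OF fin L2lim_linear[OF bounded_linear_Re k]]
        and I1 = L2lim_imp_L1lim[OF fin L2lim_linear[OF bounded_linear_Im k]]
      have "L1lim ?M (\<lambda>n z. \<Phi>u (h n z) * Re (k n z) + \<Phi>v (h n z) * Im (k n z)) (\<lambda>z. \<Phi>u (f z) * Re (g z) + \<Phi>v (f z) * Im (g z))"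
        by (intro L1lim_add m uu uv R1 I1)
      then show ?thesis by (simp add: dd_def mult.commute)
    qed
    have mz: "L1lim ?M (\<lambda>n z. s n z *\<^sub>R (- a + z)) (\<lambda>z. t z *\<^sub>R (- a + z))" if "L1lim ?M s t" for s t
      by (rule L1lim_bilinear_uconv[OF bounded_bilinear.flip[OF bounded_bilinear_scaleR] uc that]) (intro continuous_intros)
    have mc: "L1lim ?M (\<lambda>n z. \<Phi> (h n z) *\<^sub>R c) (\<lambda>z. \<Phi> (f z) *\<^sub>R c)" for c :: complex
      by (rule L1lim_bilinear_uconv[OF bounded_bilinear.flip[OF bounded_bilinear_scaleR] uc uconv_imp_L1lim[OF fin u\<Phi>]]) (intro continuous_intros)
    have LG: "L1lim ?M Gnx Gx" "L1lim ?M Gny Gy"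
      unfolding Gnx_def[abs_def] Gx_def[abs_def] Gny_def[abs_def] Gy_def[abs_def]
      by (intro L1lim_add mz mc Ldd h)+
    have ulim: "uniform_limit Q Gn G sequentially"
    proof -
      have "uniform_limit Q (\<lambda>n z. \<Phi> (h n z)) (\<lambda>z. \<Phi> (f z)) sequentially"
        using u\<Phi> by (simp add: uconv_def)
      then show ?thesis unfolding Gn_def[abs_def] G_def[abs_def]
        by (intro bounded_bilinear.bounded_uniform_limit[OF bounded_bilinear_scaleR] uniform_limit_const
            compact_imp_bounded compact_continuous_image Q continuous_intros
            continuous_on_compose2[OF C1p_continuous(1)[OF \<Phi>, of UNIV] fc]) simp_all
    qed
    \<comment> \<open>The lower bound for the oscillation is r \<Phi>(f z0): on the boundary of each
      square |x - a| >= r, and the maximum principle finds a boundary point x with |f x| >= |f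
      z0|.\<close>
    have key: "r * (r * \<Phi> (f z0)) \<le> 4 * (LINT z|?M. indicator (ann a r) z * (norm (Gx z) + norm (Gy z)))"
    proof (rule square_estimate_limit[OF Gn ulim LG r Q(1)])
      show "z \<in> Q" if "sn (z - a) < 2 * r" for z using that by (simp add: Q_def sq_iff)
      fix t assume t: "r \<le> t" "t < 2 * r"
      have st: "sq a t \<subseteq> Q" using t by (auto simp: Q_def sq_iff)
      then have "compact (sq a t)" "sq a t \<subseteq> \<Omega>" using Q compact_sq by auto
      note qt = qr_dataD[OF f this]
      have "z0 \<in> sq a t" using z0 t by (simp add: sq_iff)
      from osc_principle(2)[OF qt(1)[unfolded sq_def] L qt(2)[unfolded sq_def] this[unfolded sq_def] this[unfolded sq_def], folded sq_def]
      obtain x where x: "x \<in> sq a t - box (a - Complex t t) (a + Complex t t)" "norm (f z0) \<le> norm (f x)" by blast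
      have sx: "sn (x - a) = t" by (rule sq_boundary[OF x(1)])
      define y where "y = 2 * a - x"
      have sy: "sn (y - a) = t" using sx by (simp add: y_def sn_def abs_minus_commute)
      have "G x - G y = (\<Phi> (f x) + \<Phi> (f y)) *\<^sub>R (x - a)"
        by (simp add: G_def y_def algebra_simps scaleR_conv_of_real)
      then have "norm (G x - G y) = (\<Phi> (f x) + \<Phi> (f y)) * cmod (x - a)"
        using \<Phi>1[of "f x"] \<Phi>1[of "f y"] by simp
      moreover have "\<Phi> (f z0) \<le> \<Phi> (f x)"
        unfolding \<Phi>_def using x(2) p by (intro powr_mono2 add_left_mono power_mono) auto
      moreover have "r \<le> cmod (x - a)" using sn_bounds(1)[of "x - a"] sx t by simp
      ultimately have "r * \<Phi> (f z0) \<le> norm (G x - G y)"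
        using \<Phi>1[of "f z0"] \<Phi>1[of "f y"] r by (simp only: mult.commute[of r]) (intro mult_mono, auto)
      then show "\<exists>x y. sn (x - a) = t \<and> sn (y - a) = t \<and> r * \<Phi> (f z0) \<le> norm (G x - G y)" using sx sy by blast
    qed
    \<comment> \<open>The factor 3r bounds |z - a| on \<open>Q\<close>, whose half-diagonal is 2
      sqrt 2 times r.\<close>
    have ptx: "norm (dd \<xi> (f z) *\<^sub>R (- a + z) + \<Phi> (f z) *\<^sub>R c) \<le> 3 * r * (p/2) + 3 * r * (p/2) * (b (f z) * (cmod \<xi>)\<^sup>2) + (1 + (\<Phi> (f z))\<^sup>2)"
      if z: "z \<in> Q" and c: "norm c = 1" for z \<xi> c
    proof -
      have "(cmod (z - a))\<^sup>2 \<le> (3 * r)\<^sup>2"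
      proof -
        have "(sn (z - a))\<^sup>2 \<le> (2 * r)\<^sup>2" using z by (intro power_mono) (auto simp: Q_def sq_iff sn_def)
        then have "(cmod (z - a))\<^sup>2 \<le> 8 * r\<^sup>2" using sn_bounds(2)[of "z - a"] by (simp add: power_mult_distrib)
        moreover have "(3 * r)\<^sup>2 = 9 * r\<^sup>2" by (simp add: power_mult_distrib)
        ultimately show ?thesis using zero_le_power2[of r] by linarith
      qed
      then have za: "cmod (- a + z) \<le> 3 * r" using r power2_le_imp_le[of "cmod (z - a)" "3 * r"] by (simp add: add.commute)
      have "norm (dd \<xi> (f z) *\<^sub>R (- a + z) + \<Phi> (f z) *\<^sub>R c) \<le> \<bar>dd \<xi> (f z)\<bar> * cmod (- a + z) + \<bar>\<Phi> (f z)\<bar> * norm c"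
        by (rule order_trans[OF norm_triangle_ineq]) simp
      also have "\<dots> \<le> (p/2 * (1 + b (f z) * (cmod \<xi>)\<^sup>2)) * (3 * r) + \<Phi> (f z)"
      proof (intro add_mono mult_mono za)
        show "\<bar>dd \<xi> (f z)\<bar> \<le> p/2 * (1 + b (f z) * (cmod \<xi>)\<^sup>2)" unfolding dd_def by (rule D\<Phi>)
        show "0 \<le> p/2 * (1 + b (f z) * (cmod \<xi>)\<^sup>2)" using p by (intro mult_nonneg_nonneg add_nonneg_nonneg) (auto simp: b_def)
        show "\<bar>\<Phi> (f z)\<bar> * norm c \<le> \<Phi> (f z)" using \<Phi>1[of "f z"] c by simp
      qed auto
      also have "\<Phi> (f z) \<le> 1 + (\<Phi> (f z))\<^sup>2" by (rule le_one_plus_sq)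
      finally show ?thesis by (simp add: algebra_simps)
    qed
    have \<Phi>c: "continuous_on Q (\<lambda>z. (\<Phi> (f z))\<^sup>2)"
      by (intro continuous_intros continuous_on_compose2[OF C1p_continuous(1)[OF \<Phi>, of UNIV] fc]) simp
    have \<Phi>i: "integrable ?M (\<lambda>z. (\<Phi> (f z))\<^sup>2)" by (rule continuous_on_compact_integrable[OF Q(1) \<Phi>c])
    interpret finite_measure ?M by (rule fin)
    have iG: "integrable ?M (\<lambda>z. indicator (ann a r) z * (norm (Gx z) + norm (Gy z)))"
    proof (rule Bochner_Integration.integrable_bound)
      show i: "integrable ?M (\<lambda>z. norm (Gx z) + norm (Gy z))" using LG by (auto simp: L1lim_def)
      have "(indicator (ann a r) :: complex \<Rightarrow> real) \<in> borel_measurable ?M"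
        by (intro measurable_restrict_space1 measurable_completion) simp
      then show "(\<lambda>z. indicator (ann a r) z * (norm (Gx z) + norm (Gy z))) \<in> borel_measurable ?M"
        by (rule borel_measurable_times) (rule borel_measurable_integrable[OF i])
    qed (auto simp: indicator_def)
    define c where "c = 3 * r * (p/2)"
    have c0: "c \<ge> 0" using r p by (simp add: c_def)
    have "(LINT z|?M. indicator (ann a r) z * (norm (Gx z) + norm (Gy z)))
       \<le> (LINT z|?M. (2 * c + 2) + (c * (b (f z) * ?D z) + 2 * (\<Phi> (f z))\<^sup>2))"
    proof (rule integral_mono[OF iG])
      show "integrable ?M (\<lambda>z. (2 * c + 2) + (c * (b (f z) * ?D z) + 2 * (\<Phi> (f z))\<^sup>2))"
        by (intro Bochner_Integration.integrable_add integrable_const integrable_mult_right Ei \<Phi>i)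
      fix z assume "z \<in> space ?M"
      then have z: "z \<in> Q" by simp
      have "indicator (ann a r) z * (norm (Gx z) + norm (Gy z)) \<le> norm (Gx z) + norm (Gy z)"
        by (simp add: indicator_def)
      also have "\<dots> \<le> (c + c * (b (f z) * (cmod (fx z))\<^sup>2) + (1 + (\<Phi> (f z))\<^sup>2)) + (c + c * (b (f z) * (cmod (fy z))\<^sup>2) + (1 + (\<Phi> (f z))\<^sup>2))"
        unfolding Gx_def Gy_def c_def by (intro add_mono ptx z) auto
      finally show "indicator (ann a r) z * (norm (Gx z) + norm (Gy z)) \<le> (2 * c + 2) + (c * (b (f z) * ?D z) + 2 * (\<Phi> (f z))\<^sup>2)"
        by (simp add: algebra_simps)
    qed
    also have "\<dots> = (2 * c + 2) * measure lebesgue Q + (c * (LINT z|?M. b (f z) * ?D z) + 2 * (LINT z|?M. (\<Phi> (f z))\<^sup>2))"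
    proof -
      have "(LINT z|?M. (2 * c + 2)) = (2 * c + 2) * measure lebesgue Q"
        using compact_sets_lebesgue[OF Q(1)] by (simp add: measure_restrict_space)
      moreover have "(LINT z|?M. c * (b (f z) * ?D z) + 2 * (\<Phi> (f z))\<^sup>2) = c * (LINT z|?M. b (f z) * ?D z) + 2 * (LINT z|?M. (\<Phi> (f z))\<^sup>2)"
        using Ei \<Phi>i by (subst Bochner_Integration.integral_add) auto
      moreover have "(LINT z|?M. (2 * c + 2) + (c * (b (f z) * ?D z) + 2 * (\<Phi> (f z))\<^sup>2)) = (LINT z|?M. (2 * c + 2)) + (LINT z|?M. c * (b (f z) * ?D z) + 2 * (\<Phi> (f z))\<^sup>2)"
        by (intro Bochner_Integration.integral_add Bochner_Integration.integrable_add integrable_const integrable_mult_right Ei \<Phi>i)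
      ultimately show ?thesis by linarith
    qed
    also have "\<dots> \<le> (2 * c + 2) * (16 * r\<^sup>2) + (c * E + 2 * V)"
    proof (intro add_mono mult_left_mono)
      show "measure lebesgue Q \<le> 16 * r\<^sup>2" using r by (simp add: Q_def measure_sq)
      have "(LINT z|?M. (\<Phi> (f z))\<^sup>2) \<le> (LINT z|lebesgue_on (cball a (4 * r)). (\<Phi> (f z))\<^sup>2)"
      proof (rule lebesgue_on_subset_integral_le)
        have "continuous_on (cball a (4 * r)) (\<lambda>z. (\<Phi> (f z))\<^sup>2)"
          by (intro continuous_intros continuous_on_compose2[OF C1p_continuous(1)[OF \<Phi>, of UNIV] appr_continuous[OF apK]]) simp
        then show "integrable (lebesgue_on (cball a (4 * r))) (\<lambda>z. (\<Phi> (f z))\<^sup>2)"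
          by (rule continuous_on_compact_integrable[OF compact_cball])
      qed (auto intro!: compact_sets_lebesgue Q QK)
      then show "(LINT z|?M. (\<Phi> (f z))\<^sup>2) \<le> V" using V by (simp add: \<Phi>sq)
    qed (use c0 En in auto)
    finally have "4 * (LINT z|?M. indicator (ann a r) z * (norm (Gx z) + norm (Gy z))) \<le> 4 * ((2 * c + 2) * (16 * r\<^sup>2) + (c * E + 2 * V))"
      by simp
    with key have k2: "r\<^sup>2 * \<Phi> (f z0) \<le> 4 * ((2 * c + 2) * (16 * r\<^sup>2) + (c * E + 2 * V))"
      by (simp add: power2_eq_square mult.assoc)
    have En0: "0 \<le> E"
      by (rule order_trans[OF _ En]) (simp add: integral_nonneg_AE b_def)
    have V0: "0 \<le> V"
      by (rule order_trans[OF _ V]) (simp add: integral_nonneg_AE)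
    \<comment> \<open>Every entry of \<open>B\<close> dominates its counterpart. That V and E are
      nonnegative follows from their being upper bounds of integrals of nonnegative
      functions.\<close>
    have "4 * ((2 * c + 2) * (16 * r\<^sup>2) + (c * E + 2 * V)) \<le> B"
    proof -
      have "(2 * c + 2) * (16 * r\<^sup>2) \<le> (4 + 6 * r * (p/2)) * (16 * r\<^sup>2)"
        by (intro mult_right_mono) (auto simp: c_def)
      moreover have "c * E \<le> 6 * r * (p/2) * E" using En0 r p by (intro mult_right_mono) (auto simp: c_def)
      moreover have "4 * (x + (w + 2 * V)) \<le> 4 * (y + 4 * V + u)" if "x \<le> y" "w \<le> u" for x y w u :: real
        using that V0 by simp
      ultimately show ?thesis unfolding B_def by blast
    qed
    with k2 have "\<Phi> (f z0) \<le> B / r\<^sup>2" using r by (simp add: pos_le_divide_eq mult.commute)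
    then have "\<Phi> (f z0) powr (4/p) \<le> S"
      unfolding S_def using \<Phi>1[of "f z0"] p by (intro powr_mono2) auto
    moreover have "\<Phi> (f z0) powr (4/p) = 1 + (cmod (f z0))\<^sup>2"
    proof -
      have "\<Phi> (f z0) powr (4/p) = (1 + (cmod (f z0))\<^sup>2) powr (p/4 * (4/p))" by (simp add: \<Phi>_def powr_powr)
      also have "\<dots> = 1 + (cmod (f z0))\<^sup>2" using p x1[of "f z0"] by simp
      finally show ?thesis .
    qed
    moreover note le_one_plus_sq[of "cmod (f z0)"]
    ultimately show ?thesis by linarith
  qed
  then show ?thesis by blast
qed

text \<open>Courant--Lebesgue argument over the \<open>N\<close> disjoint dyadic square annuli around \<open>a\<close>.\<close>

lemma log_modulus:
  fixes L R E :: real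
  assumes f: "qr_data L \<Omega> f fx fy" and L: "L > 0" and R: "R > 0" "sq a R \<subseteq> \<Omega>"
    and E: "(LINT z|lebesgue_on (sq a R). (norm (fx z))\<^sup>2 + (norm (fy z))\<^sup>2) \<le> E"
    and z: "z \<in> sq a (R / 2 ^ N)"
  shows "real N * (norm (f z - f a))\<^sup>2 \<le> 512 * E"
proof -
  define Q where "Q = sq a R"
  have Q: "compact Q" "Q \<subseteq> \<Omega>" using R by (auto simp: Q_def compact_sq)
  let ?M = "lebesgue_on Q"
  let ?D = "\<lambda>z. (norm (fx z))\<^sup>2 + (norm (fy z))\<^sup>2"
  have ap: "appr Q f fx fy" by (rule qr_dataD(1)[OF f Q])
  have fin: "finite_measure ?M" by (rule finite_measure_lebesgue_on_compact[OF Q(1)])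
  interpret finite_measure ?M by (rule fin)
  obtain h hx hy where h: "\<And>n::nat. C2p (h n) (hx n) (hy n)" "uniform_limit Q h f sequentially"
     "L2lim ?M hx fx" "L2lim ?M hy fy"
    using ap unfolding appr_def by blast
  define m where "m = norm (f z - f a)"
  \<comment> \<open>The k-th annulus fills the radii from R/2^(k+1) up to R/2^k, so the annuli with
    k < N are disjoint and all surround the small square that contains z.\<close>
  define \<rho> where "\<rho> k = R / 2 ^ Suc k" for k :: nat
  have \<rho>: "\<rho> k > 0" "2 * \<rho> k = R / 2 ^ k" "2 * \<rho> k \<le> R" for k
    using R by (auto simp: \<rho>_def divide_le_eq)
  let ?i = "\<lambda>k. indicator (ann a (\<rho> k)) :: complex \<Rightarrow> real"
  have im: "?i k \<in> borel_measurable ?M" for k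
    by (intro measurable_restrict_space1 measurable_completion) simp
  have s1: "sqint ?M (?i k)" for k
  proof -
    have "integrable ?M (\<lambda>z. (norm (?i k z))\<^sup>2)"
    proof (rule integrable_const_bound[of _ 1])
      show "(\<lambda>z. (norm (?i k z))\<^sup>2) \<in> borel_measurable ?M"
        by (rule borel_measurable_power[OF measurable_compose[OF im borel_measurable_norm]])
    qed (auto simp: indicator_def)
    then show ?thesis using im by (simp add: sqint_def)
  qed
  have s2: "sqint ?M (\<lambda>z. norm (fx z) + norm (fy z))"
    by (intro sqint_add sqint_norm appr_sqint[OF ap])
  have s3: "sqint ?M (\<lambda>z. ?i k z * (norm (fx z) + norm (fy z)))" for k
  proof -
    have s2m: "(\<lambda>z. norm (fx z) + norm (fy z)) \<in> borel_measurable ?M" using s2 by (simp add: sqint_def)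
    have m3: "(\<lambda>z. ?i k z * (norm (fx z) + norm (fy z))) \<in> borel_measurable ?M"
      using im[of k] s2m by (rule borel_measurable_times)
    have "integrable ?M (\<lambda>z. (norm (norm (fx z) + norm (fy z)))\<^sup>2)" using s2 by (simp add: sqint_def)
    then have "integrable ?M (\<lambda>z. (norm (?i k z * (norm (fx z) + norm (fy z))))\<^sup>2)"
      by (rule Bochner_Integration.integrable_bound) (use m3 in \<open>auto simp: indicator_def\<close>)
    then show ?thesis using m3 by (simp add: sqint_def)
  qed
  have Di: "integrable ?M ?D" using appr_sqint[OF ap] by (auto simp: sqint_def)
  have iD: "integrable ?M (\<lambda>z. ?i k z * ?D z)" for k
  proof (rule Bochner_Integration.integrable_bound[OF Di])
    show "(\<lambda>z. ?i k z * ?D z) \<in> borel_measurable ?M"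
      by (intro borel_measurable_times im borel_measurable_integrable[OF Di])
  qed (auto simp: indicator_def)
  \<comment> \<open>512 = 16 * 16 * 2: the squared constant of the square estimate, the area 16
    \<rho>^2 of the enclosing square, and (x + y)^2 <= 2 x^2 + 2 y^2. That \<rho>^2 cancels reflects
    the scale invariance of the energy.\<close>
  have step: "m\<^sup>2 \<le> 512 * (LINT z|?M. ?i k z * ?D z)" if k: "k < N" for k
  proof -
    have "\<rho> k * m \<le> 4 * (LINT z|?M. ?i k z * (norm (fx z) + norm (fy z)))"
    proof (rule square_estimate_limit[OF C2p_C1p[OF h(1)] h(2) L2lim_imp_L1lim[OF fin h(3)] L2lim_imp_L1lim[OF fin h(4)] \<rho>(1) Q(1)])
      show "z \<in> Q" if "sn (z - a) < 2 * \<rho> k" for z using that \<rho>(3)[of k] by (simp add: Q_def sq_iff)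
      fix t assume t: "\<rho> k \<le> t" "t < 2 * \<rho> k"
      have "sq a t \<subseteq> \<Omega>" using t \<rho>(3)[of k] Q(2) by (auto simp: Q_def sq_iff subset_iff)
      note qt = qr_dataD[OF f compact_sq this]
      have "R / 2 ^ N \<le> \<rho> k"
        unfolding \<rho>_def using R k by (intro divide_left_mono power_increasing) auto
      then have zt: "z \<in> sq a t" "a \<in> sq a t" using z t \<rho>(1)[of k] by (auto simp: sq_iff sn_def)
      from osc_principle(1)[OF qt(1)[unfolded sq_def] L qt(2)[unfolded sq_def] this[unfolded sq_def], folded sq_def]
      obtain x y where "x \<in> sq a t - box (a - Complex t t) (a + Complex t t)" "y \<in> sq a t - box (a - Complex t t) (a + Complex t t)"
        "m \<le> norm (f x - f y)" unfolding m_def by blast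
      then show "\<exists>x y. sn (x - a) = t \<and> sn (y - a) = t \<and> m \<le> norm (f x - f y)"
        using sq_boundary by blast
    qed
    also have "\<dots> = 4 * (LINT z|?M. norm (?i k z) * norm (?i k z * (norm (fx z) + norm (fy z))))"
      by (intro arg_cong[where f="\<lambda>x. 4 * x"] Bochner_Integration.integral_cong refl) (simp add: indicator_def)
    finally have "(\<rho> k * m)\<^sup>2 \<le> (4 * (LINT z|?M. norm (?i k z) * norm (?i k z * (norm (fx z) + norm (fy z)))))\<^sup>2"
      using \<rho>(1)[of k] by (intro power_mono) (auto simp: m_def)
    also have "\<dots> = 16 * (LINT z|?M. norm (?i k z) * norm (?i k z * (norm (fx z) + norm (fy z))))\<^sup>2"
      by (simp add: power_mult_distrib)
    also have "\<dots> \<le> 16 * ((LINT z|?M. (norm (?i k z))\<^sup>2) * (LINT z|?M. (norm (?i k z * (norm (fx z) + norm (fy z))))\<^sup>2))"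
      by (intro mult_left_mono sqint_Cauchy_Schwarz s1 s3) simp
    also have "\<dots> \<le> 16 * ((16 * (\<rho> k)\<^sup>2) * (LINT z|?M. 2 * (?i k z * ?D z)))"
    proof (intro mult_left_mono mult_mono)
      have sub: "sq a (2 * \<rho> k) \<subseteq> Q" using \<rho>(3)[of k] by (auto simp: Q_def sq_iff)
      have ms: "indicator (sq a (2 * \<rho> k)) \<in> borel_measurable ?M"
        by (intro measurable_restrict_space1 borel_measurable_indicator compact_sets_lebesgue compact_sq)
      have "(LINT z|?M. (norm (?i k z))\<^sup>2) \<le> (LINT z|?M. indicator (sq a (2 * \<rho> k)) z)"
      proof (rule integral_mono)
        show "integrable ?M (\<lambda>z. (norm (?i k z))\<^sup>2)" using s1 by (simp add: sqint_def)
        show "integrable ?M (indicator (sq a (2 * \<rho> k)) :: complex \<Rightarrow> real)"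
          by (rule integrable_const_bound[of _ 1]) (use ms in \<open>auto simp: indicator_def\<close>)
      qed (auto simp: indicator_def ann_def sq_iff)
      also have "\<dots> = (LINT z|lebesgue_on (sq a (2 * \<rho> k)). 1)"
      proof -
        have "(LINT z|?M. indicator (sq a (2 * \<rho> k)) z :: real) = (LINT z|lebesgue. indicator (sq a (2 * \<rho> k)) z)"
          by (rule integral_lebesgue_on_vanishing) (use sub Q(1) in \<open>auto intro!: compact_sets_lebesgue simp: indicator_def\<close>)
        also have "\<dots> = (LINT z|lebesgue_on (sq a (2 * \<rho> k)). 1)"
          using compact_sets_lebesgue[OF compact_sq] by (subst integral_restrict_space) auto
        finally show ?thesis .
      qed
      also have "\<dots> = measure lebesgue (sq a (2 * \<rho> k))"
        using compact_sets_lebesgue[OF compact_sq] by (simp add: measure_restrict_space)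
      also have "\<dots> = 16 * (\<rho> k)\<^sup>2" using \<rho>(1)[of k] by (simp add: measure_sq power_mult_distrib)
      finally show "(LINT z|?M. (norm (?i k z))\<^sup>2) \<le> 16 * (\<rho> k)\<^sup>2" .
      show "(LINT z|?M. (norm (?i k z * (norm (fx z) + norm (fy z))))\<^sup>2) \<le> (LINT z|?M. 2 * (?i k z * ?D z))"
      proof (rule integral_mono)
        show "integrable ?M (\<lambda>z. (norm (?i k z * (norm (fx z) + norm (fy z))))\<^sup>2)" using s3 by (simp add: sqint_def)
        show "integrable ?M (\<lambda>z. 2 * (?i k z * ?D z))" using iD by simp
        fix z
        have "(norm (fx z) + norm (fy z))\<^sup>2 \<le> 2 * (norm (fx z))\<^sup>2 + 2 * (norm (fy z))\<^sup>2"
          using norm_add_sq_le[of "norm (fx z)" "norm (fy z)"] by simp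
        then show "(norm (?i k z * (norm (fx z) + norm (fy z))))\<^sup>2 \<le> 2 * (?i k z * ?D z)"
          by (auto simp: indicator_def)
      qed
    qed (auto intro!: integral_nonneg_AE)
    finally have "(\<rho> k)\<^sup>2 * m\<^sup>2 \<le> (\<rho> k)\<^sup>2 * (512 * (LINT z|?M. ?i k z * ?D z))"
      by (simp add: power_mult_distrib)
    then show ?thesis by (rule mult_left_le_imp_le) (use \<rho>(1)[of k] in simp)
  qed
  have "real N * m\<^sup>2 = (\<Sum>k<N. m\<^sup>2)" by simp
  also have "\<dots> \<le> (\<Sum>k<N. 512 * (LINT z|?M. ?i k z * ?D z))"
    by (intro sum_mono step) simp
  also have "\<dots> = 512 * (LINT z|?M. (\<Sum>k<N. ?i k z * ?D z))"
    using Bochner_Integration.integral_sum[of "{..<N}" ?M "\<lambda>k z. ?i k z * ?D z"] iD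
    by (simp only: sum_distrib_left)
  also have "\<dots> \<le> 512 * (LINT z|?M. ?D z)"
  proof (intro mult_left_mono integral_mono)
    show "integrable ?M (\<lambda>z. \<Sum>k<N. ?i k z * ?D z)"
      by (rule Bochner_Integration.integrable_sum) (rule iD)
    fix z
    have "disjoint_family_on (\<lambda>k. ann a (\<rho> k)) {..<N}"
    proof -
      have lt: "ann a (\<rho> j) \<inter> ann a (\<rho> k) = {}" if "j < k" for j k
      proof -
        have "2 ^ Suc j \<le> (2::real) ^ k" using that by (intro power_increasing) auto
        then have "2 * \<rho> k \<le> \<rho> j" using R \<rho>(2)[of k] by (simp add: \<rho>_def divide_left_mono)
        then show ?thesis by (auto simp: ann_def)
      qed
      show ?thesis unfolding disjoint_family_on_def
      proof (intro ballI impI)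
        fix j k :: nat assume "j \<noteq> k"
        then show "ann a (\<rho> j) \<inter> ann a (\<rho> k) = {}" using lt[of j k] lt[of k j] by (cases "j < k") auto
      qed
    qed
    then have "(\<Sum>k<N. ?i k z) = indicator (\<Union>k<N. ann a (\<rho> k)) z"
      by (subst indicator_UN_disjoint) auto
    then have "(\<Sum>k<N. ?i k z) \<le> 1" by (simp add: indicator_def)
    then have "(\<Sum>k<N. ?i k z) * ?D z \<le> 1 * ?D z" by (intro mult_right_mono) auto
    then show "(\<Sum>k<N. ?i k z * ?D z) \<le> ?D z" by (simp add: sum_distrib_right)
  qed (use Di in auto)
  also have "\<dots> \<le> 512 * E" using E by (simp add: Q_def)
  finally show ?thesis by (simp add: m_def)
qed

text \<open>The sup bound is fed back into \<open>energy_bound\<close> with exponent 2, where the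
  weight is identically 1. This yields the unweighted energy that \<open>log_modulus\<close> asks
  for.\<close>

lemma local_estimates:
  fixes p L r V :: real
  assumes p: "p > 0" and L: "L > 0" and r: "r > 0"
  shows "\<exists>S E. \<forall>\<Omega> f fx fy a. qr_data L \<Omega> f fx fy \<longrightarrow> cball a (4 * r) \<subseteq> \<Omega> \<longrightarrow>
           (LINT z|lebesgue_on (cball a (4 * r)). (1 + (cmod (f z))\<^sup>2) powr (p/2)) \<le> V \<longrightarrow>
           (\<forall>z\<in>sq a r. cmod (f z) \<le> S) \<and>
           (LINT z|lebesgue_on (sq a (r/2)). (norm (fx z))\<^sup>2 + (norm (fy z))\<^sup>2) \<le> E"
proof -
  obtain S where S0: "\<forall>\<Omega> f fx fy a. qr_data L \<Omega> f fx fy \<longrightarrow> cball a (4 * r) \<subseteq> \<Omega> \<longrightarrow>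
           (LINT z|lebesgue_on (cball a (4 * r)). (1 + (cmod (f z))\<^sup>2) powr (p/2)) \<le> V \<longrightarrow>
           (\<forall>z\<in>sq a r. cmod (f z) \<le> S)"
    by (rule exE[OF sup_bound[OF p L r, of V]])
  note S = S0[rule_format]
  \<comment> \<open>The instance of \<open>energy_bound\<close> with exponent 2 and radius r; the
    integral of 1 + |f|^2 is at most 1 + S^2 times the area 4 r^2 of the enclosing square.\<close>
  define E where "E = 1024 * L\<^sup>2 / (r\<^sup>2 * (min 2 2)\<^sup>2) * ((1 + S\<^sup>2) * (4 * r\<^sup>2))"
  have "(LINT z|lebesgue_on (sq a (r/2)). (norm (fx z))\<^sup>2 + (norm (fy z))\<^sup>2) \<le> E"
    if f: "qr_data L \<Omega> f fx fy" and \<Omega>: "cball a (4 * r) \<subseteq> \<Omega>"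
      and V: "(LINT z|lebesgue_on (cball a (4 * r)). (1 + (cmod (f z))\<^sup>2) powr (p/2)) \<le> V" for \<Omega> f fx fy a
  proof -
    have sub: "cball a r \<subseteq> \<Omega>" using \<Omega> r by auto
    have sqs: "cball a r \<subseteq> sq a r"
    proof
      fix z assume "z \<in> cball a r"
      then show "z \<in> sq a r" using sn_bounds(1)[of "z - a"] by (simp add: sq_iff dist_norm norm_minus_commute)
    qed
    have fc: "continuous_on (cball a r) f" by (rule appr_continuous[OF qr_dataD(1)[OF f compact_cball sub]])
    have p0: "1 + (cmod w)\<^sup>2 \<noteq> 0" for w using zero_le_power2[of "cmod w"] by linarith
    interpret finite_measure "lebesgue_on (cball a r)" by (rule finite_measure_lebesgue_on_compact) simp
    have "(LINT z|lebesgue_on (cball a r). (1 + (cmod (f z))\<^sup>2) powr (2/2)) \<le> (LINT z|lebesgue_on (cball a r). 1 + S\<^sup>2)"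
    proof (rule integral_mono)
      show "integrable (lebesgue_on (cball a r)) (\<lambda>z. (1 + (cmod (f z))\<^sup>2) powr (2/2))"
        by (intro continuous_on_compact_integrable continuous_intros fc) (use p0 in auto)
      fix z assume "z \<in> space (lebesgue_on (cball a r))"
      then have "cmod (f z) \<le> S" using S[OF f \<Omega> V] sqs by auto
      then show "(1 + (cmod (f z))\<^sup>2) powr (2/2) \<le> 1 + S\<^sup>2" using p0[of "f z"] by (simp add: power_mono)
    qed simp
    also have "\<dots> = (1 + S\<^sup>2) * measure lebesgue (cball a r)"
      by (simp add: measure_restrict_space compact_sets_lebesgue)
    also have "\<dots> \<le> (1 + S\<^sup>2) * (4 * r\<^sup>2)"
    proof (intro mult_left_mono)
      have "measure lebesgue (cball a r) \<le> measure lebesgue (sq a r)"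
        by (rule measure_mono_fmeasurable[OF sqs]) (auto simp: lmeasurable_compact compact_sq)
      then show "measure lebesgue (cball a r) \<le> 4 * r\<^sup>2" using r by (simp add: measure_sq)
    qed simp
    finally have "(LINT z|lebesgue_on (cball a r). (1 + (cmod (f z))\<^sup>2) powr (2/2)) \<le> (1 + S\<^sup>2) * (4 * r\<^sup>2)" .
    from energy_bound(1)[OF f _ L r sub this] show ?thesis
      using p0 by (simp add: E_def)
  qed
  then show ?thesis using S
    by (intro exI[of _ S] exI[of _ E] allI impI conjI ballI)
qed

section \<open>Closure under locally uniform limits\<close>

text \<open>Weak derivatives as seen from one compact set. The condition is linear in the triple of
  \<open>f\<close>, \<open>fx\<close>, \<open>fy\<close> and involves integrals over
  \<open>K\<close> only, so it is stable under midpoints and under the limits taken below.\<close>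

definition weakK :: "complex set \<Rightarrow> complex set \<Rightarrow> (complex \<Rightarrow> complex) \<Rightarrow> (complex \<Rightarrow> complex) \<Rightarrow> (complex \<Rightarrow> complex) \<Rightarrow> bool" where
  "weakK \<Omega> K f fx fy \<longleftrightarrow> (\<forall>\<phi> \<phi>x \<phi>y. C1p \<phi> \<phi>x \<phi>y \<longrightarrow> test_function \<Omega> \<phi> \<longrightarrow> (\<forall>z. z \<notin> K \<longrightarrow> \<phi> z = 0) \<longrightarrow>
     (LINT z|lebesgue_on K. \<phi>x z *\<^sub>R f z) = - (LINT z|lebesgue_on K. \<phi> z *\<^sub>R fx z) \<and>
     (LINT z|lebesgue_on K. \<phi>y z *\<^sub>R f z) = - (LINT z|lebesgue_on K. \<phi> z *\<^sub>R fy z))"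

lemma weakKD:
  assumes "weakK \<Omega> K f fx fy" "C1p \<phi> \<phi>x \<phi>y" "test_function \<Omega> \<phi>" "\<And>z. z \<notin> K \<Longrightarrow> \<phi> z = 0"
  shows "(LINT z|lebesgue_on K. \<phi>x z *\<^sub>R f z) = - (LINT z|lebesgue_on K. \<phi> z *\<^sub>R fx z)"
    and "(LINT z|lebesgue_on K. \<phi>y z *\<^sub>R f z) = - (LINT z|lebesgue_on K. \<phi> z *\<^sub>R fy z)"
  using assms unfolding weakK_def by blast+

lemma weak_deriv_weakK:
  assumes "weak_deriv \<Omega> 1 f fx" "weak_deriv \<Omega> \<i> f fy" "compact K" "K \<subseteq> \<Omega>"
  shows "weakK \<Omega> K f fx fy"
  unfolding weakK_def
proof (intro allI impI)
  fix \<phi> \<phi>x \<phi>y assume \<phi>: "C1p \<phi> \<phi>x \<phi>y" "test_function \<Omega> \<phi>" "\<forall>z. z \<notin> K \<longrightarrow> \<phi> z = 0"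
  then have out: "\<And>z. z \<notin> K \<Longrightarrow> \<phi> z = 0" by blast
  show "(LINT z|lebesgue_on K. \<phi>x z *\<^sub>R f z) = - (LINT z|lebesgue_on K. \<phi> z *\<^sub>R fx z) \<and>
     (LINT z|lebesgue_on K. \<phi>y z *\<^sub>R f z) = - (LINT z|lebesgue_on K. \<phi> z *\<^sub>R fy z)"
    using weak_deriv_test[OF assms(1) \<phi>(2,1) assms(3,4) out] weak_deriv_test[OF assms(2) \<phi>(2,1) assms(3,4) out] by simp
qed

text \<open>Midpoints of whole triples keep the weak derivative identity and the uniform
  convergence, and gain L2 convergence of the derivatives. The sequence \<open>Y\<close> is returned
  as well because \<open>qr_closure\<close> proves an inequality along it.\<close>

lemma closure_on_compact:
  fixes F :: "nat \<Rightarrow> complex \<Rightarrow> complex"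
  assumes K: "compact K"
    and c: "\<And>n. continuous_on K (F n)" and s: "\<And>n. sqint (lebesgue_on K) (Fx n)" "\<And>n. sqint (lebesgue_on K) (Fy n)"
    and w: "\<And>n. weakK \<Omega> K (F n) (Fx n) (Fy n)" and u: "uniform_limit K F h sequentially"
    and B: "\<And>n. (LINT z|lebesgue_on K. (norm (Fx n z))\<^sup>2 + (norm (Fy n z))\<^sup>2) \<le> B"
  shows "\<exists>Y Gx Gy. (\<forall>n. Y n \<in> mids (\<lambda>n z. (F n z, Fx n z, Fy n z)) n) \<and>
     L2lim (lebesgue_on K) (\<lambda>n z. fst (snd (Y n z))) Gx \<and> L2lim (lebesgue_on K) (\<lambda>n z. snd (snd (Y n z))) Gy \<and>
     weakK \<Omega> K h Gx Gy"
proof -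
  let ?M = "lebesgue_on K"
  define X where "X = (\<lambda>n z. (F n z, Fx n z, Fy n z))"
  have fin: "finite_measure ?M" by (rule finite_measure_lebesgue_on_compact[OF K])
  have sX: "sqint ?M (\<lambda>z. snd (X n z))" for n
    using sqint_Pair[OF s(1)[of n] s(2)[of n]] by (simp add: X_def)
  have BX: "(LINT z|?M. (norm (snd (X n z)))\<^sup>2) \<le> B" for n
    using B[of n] by (simp add: X_def norm_Pair)
  obtain Y G where Y: "\<And>n. Y n \<in> mids X n" and G: "L2lim ?M (\<lambda>n z. snd (Y n z)) G"
    using L2_midpoint_compactness[where X=X and P=snd, OF fin linear_snd sX BX] by blast
  have L: "L2lim ?M (\<lambda>n z. fst (snd (Y n z))) (\<lambda>z. fst (G z))" "L2lim ?M (\<lambda>n z. snd (snd (Y n z))) (\<lambda>z. snd (G z))"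
    using L2lim_linear[OF bounded_linear_fst G] L2lim_linear[OF bounded_linear_snd G] by auto
  have inv: "continuous_on K (\<lambda>z. fst (v z)) \<and> sqint ?M (\<lambda>z. fst (snd (v z))) \<and> sqint ?M (\<lambda>z. snd (snd (v z))) \<and>
     weakK \<Omega> K (\<lambda>z. fst (v z)) (\<lambda>z. fst (snd (v z))) (\<lambda>z. snd (snd (v z)))" if "v \<in> mids X n" for v n
    using that
  proof induction
    case (base k) then show ?case using c[of k] s(1)[of k] s(2)[of k] w[of k] by (simp add: X_def)
  next
    case (mid v1 v2)
    then have c1: "continuous_on K (\<lambda>z. fst (v1 z))" "continuous_on K (\<lambda>z. fst (v2 z))"
      and s1: "sqint ?M (\<lambda>z. fst (snd (v1 z)))" "sqint ?M (\<lambda>z. fst (snd (v2 z)))"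
        "sqint ?M (\<lambda>z. snd (snd (v1 z)))" "sqint ?M (\<lambda>z. snd (snd (v2 z)))"
      and w1: "weakK \<Omega> K (\<lambda>z. fst (v1 z)) (\<lambda>z. fst (snd (v1 z))) (\<lambda>z. snd (snd (v1 z)))"
       "weakK \<Omega> K (\<lambda>z. fst (v2 z)) (\<lambda>z. fst (snd (v2 z))) (\<lambda>z. snd (snd (v2 z)))" by blast+
    note i1 = s1[THEN L2lim_const, THEN L2lim_imp_L1lim[OF fin], unfolded L1lim_def, THEN conjunct2, THEN conjunct1]
    have "weakK \<Omega> K (\<lambda>z. (1/2) *\<^sub>R (fst (v1 z) + fst (v2 z))) (\<lambda>z. (1/2) *\<^sub>R (fst (snd (v1 z)) + fst (snd (v2 z)))) (\<lambda>z. (1/2) *\<^sub>R (snd (snd (v1 z)) + snd (snd (v2 z))))"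
      unfolding weakK_def
    proof (intro allI impI)
      fix \<phi> \<phi>x \<phi>y assume \<phi>: "C1p \<phi> \<phi>x \<phi>y" "test_function \<Omega> \<phi>" "\<forall>z. z \<notin> K \<longrightarrow> \<phi> z = 0"
      then have out: "\<And>z. z \<notin> K \<Longrightarrow> \<phi> z = 0" by blast
      have W1: "(LINT z|?M. \<phi>x z *\<^sub>R fst (v1 z)) = - (LINT z|?M. \<phi> z *\<^sub>R fst (snd (v1 z)))"
        "(LINT z|?M. \<phi>y z *\<^sub>R fst (v1 z)) = - (LINT z|?M. \<phi> z *\<^sub>R snd (snd (v1 z)))"
        by (rule weakKD[OF w1(1) \<phi>(1,2) out], assumption)+
      have W2: "(LINT z|?M. \<phi>x z *\<^sub>R fst (v2 z)) = - (LINT z|?M. \<phi> z *\<^sub>R fst (snd (v2 z)))"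
        "(LINT z|?M. \<phi>y z *\<^sub>R fst (v2 z)) = - (LINT z|?M. \<phi> z *\<^sub>R snd (snd (v2 z)))"
        by (rule weakKD[OF w1(2) \<phi>(1,2) out], assumption)+
      have lin: "(LINT z|?M. k z *\<^sub>R ((1/2) *\<^sub>R (g1 z + g2 z))) = (1/2) *\<^sub>R ((LINT z|?M. k z *\<^sub>R g1 z) + (LINT z|?M. k z *\<^sub>R g2 z))"
        if "continuous_on K k" "integrable ?M g1" "integrable ?M g2" for k :: "complex \<Rightarrow> real" and g1 g2 :: "complex \<Rightarrow> complex"
      proof -
        note j = integrable_continuous_scaleR[OF K that(1,2)] integrable_continuous_scaleR[OF K that(1,3)]
        have "(LINT z|?M. k z *\<^sub>R ((1/2) *\<^sub>R (g1 z + g2 z))) = (LINT z|?M. (1/2) *\<^sub>R (k z *\<^sub>R g1 z + k z *\<^sub>R g2 z))"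
          by (intro Bochner_Integration.integral_cong refl) (simp add: algebra_simps)
        also have "\<dots> = (1/2) *\<^sub>R (LINT z|?M. k z *\<^sub>R g1 z + k z *\<^sub>R g2 z)" by (rule integral_scaleR_right)
        also have "(LINT z|?M. k z *\<^sub>R g1 z + k z *\<^sub>R g2 z) = (LINT z|?M. k z *\<^sub>R g1 z) + (LINT z|?M. k z *\<^sub>R g2 z)"
          by (rule Bochner_Integration.integral_add[OF j])
        finally show ?thesis .
      qed
      note ci = continuous_on_compact_integrable[OF K c1(1)] continuous_on_compact_integrable[OF K c1(2)]
      note C = C1p_continuous[OF \<phi>(1), of K]
      show "(LINT z|?M. \<phi>x z *\<^sub>R ((1/2) *\<^sub>R (fst (v1 z) + fst (v2 z)))) = - (LINT z|?M. \<phi> z *\<^sub>R ((1/2) *\<^sub>R (fst (snd (v1 z)) + fst (snd (v2 z))))) \<and>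
       (LINT z|?M. \<phi>y z *\<^sub>R ((1/2) *\<^sub>R (fst (v1 z) + fst (v2 z)))) = - (LINT z|?M. \<phi> z *\<^sub>R ((1/2) *\<^sub>R (snd (snd (v1 z)) + snd (snd (v2 z)))))"
        unfolding lin[OF C(2) ci] lin[OF C(3) ci] lin[OF C(1) i1(1,2)] lin[OF C(1) i1(3,4)] W1 W2
        by (simp add: algebra_simps)
    qed
    moreover have "continuous_on K (\<lambda>z. (1/2) *\<^sub>R (fst (v1 z) + fst (v2 z)))" by (intro continuous_intros c1)
    moreover have "sqint ?M (\<lambda>z. (1/2) *\<^sub>R (fst (snd (v1 z)) + fst (snd (v2 z))))" "sqint ?M (\<lambda>z. (1/2) *\<^sub>R (snd (snd (v1 z)) + snd (snd (v2 z))))"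
      by (intro sqint_scaleR sqint_add s1)+
    ultimately show ?case by simp
  qed
  have unif: "uniform_limit K (\<lambda>n z. fst (Y n z)) h sequentially"
    unfolding uniform_limit_iff
  proof (intro allI impI)
    fix \<eta> :: real assume "\<eta> > 0"
    from uniform_limitD[OF u this] obtain N where N: "\<And>k z. k \<ge> N \<Longrightarrow> z \<in> K \<Longrightarrow> dist (F k z) (h z) < \<eta>"
      by (auto simp: eventually_sequentially)
    have "norm (fst (v z) - h z) < \<eta>" if "v \<in> mids X N" "z \<in> K" for v z
      using that
    proof induction
      case (base k) then show ?case using N by (simp add: X_def dist_norm)
    next
      case (mid v1 v2)
      have "fst ((1/2) *\<^sub>R (v1 z + v2 z)) - h z = (1/2) *\<^sub>R ((fst (v1 z) - h z) + (fst (v2 z) - h z))"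
        by (simp add: algebra_simps scaleR_2[symmetric])
      also have "norm \<dots> \<le> (1/2) * (norm (fst (v1 z) - h z) + norm (fst (v2 z) - h z))"
        using norm_triangle_ineq[of "fst (v1 z) - h z" "fst (v2 z) - h z"] by (simp only: norm_scaleR) simp
      also have "\<dots> < \<eta>" using mid by simp
      finally show ?case .
    qed
    then have "dist (fst (Y n z)) (h z) < \<eta>" if "N \<le> n" "z \<in> K" for n z
      using mids_mono[OF Y that(1)] that(2) by (simp add: dist_norm)
    then show "\<forall>\<^sub>F n in sequentially. \<forall>z\<in>K. dist (fst (Y n z)) (h z) < \<eta>"
      by (auto simp: eventually_sequentially)
  qed
  have "weakK \<Omega> K h (\<lambda>z. fst (G z)) (\<lambda>z. snd (G z))"
    unfolding weakK_def
  proof (intro allI impI)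
    fix \<phi> \<phi>x \<phi>y assume \<phi>: "C1p \<phi> \<phi>x \<phi>y" "test_function \<Omega> \<phi>" "\<forall>z. z \<notin> K \<longrightarrow> \<phi> z = 0"
    then have out: "\<And>z. z \<notin> K \<Longrightarrow> \<phi> z = 0" by blast
    have Yc: "continuous_on K (\<lambda>z. fst (Y n z))" and Yw: "weakK \<Omega> K (\<lambda>z. fst (Y n z)) (\<lambda>z. fst (snd (Y n z))) (\<lambda>z. snd (snd (Y n z)))" for n
      using inv[OF Y[of n]] by auto
    have W: "(LINT z|?M. \<phi>x z *\<^sub>R fst (Y n z)) = - (LINT z|?M. \<phi> z *\<^sub>R fst (snd (Y n z)))"
      "(LINT z|?M. \<phi>y z *\<^sub>R fst (Y n z)) = - (LINT z|?M. \<phi> z *\<^sub>R snd (snd (Y n z)))" for n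
      by (rule weakKD[OF Yw \<phi>(1,2) out], assumption)+
    have ub: "uconv ?M (\<lambda>_. k) k" if "continuous_on K k" for k :: "complex \<Rightarrow> real"
      by (rule uconv_lebesgue_on[OF K]) (use that in \<open>auto simp: uniform_limit_iff\<close>)
    have uY: "L1lim ?M (\<lambda>n z. fst (Y n z)) h"
      by (rule uconv_imp_L1lim[OF fin uconv_lebesgue_on[OF K Yc unif]])
    have lim: "(\<lambda>n. LINT z|?M. k z *\<^sub>R V n z) \<longlonglongrightarrow> (LINT z|?M. k z *\<^sub>R v z)"
      if "continuous_on K k" "L1lim ?M V v" for k :: "complex \<Rightarrow> real" and V :: "nat \<Rightarrow> complex \<Rightarrow> complex" and v
      by (rule L1lim_integral[OF L1lim_bilinear_uconv[OF bounded_bilinear_scaleR ub[OF that(1)] that(2)]])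
    note C = C1p_continuous[OF \<phi>(1), of K]
    show "(LINT z|?M. \<phi>x z *\<^sub>R h z) = - (LINT z|?M. \<phi> z *\<^sub>R fst (G z)) \<and> (LINT z|?M. \<phi>y z *\<^sub>R h z) = - (LINT z|?M. \<phi> z *\<^sub>R snd (G z))"
      using LIMSEQ_unique[OF lim[OF C(2) uY, unfolded W] tendsto_minus[OF lim[OF C(1) L2lim_imp_L1lim[OF fin L(1)]]]]
        LIMSEQ_unique[OF lim[OF C(3) uY, unfolded W] tendsto_minus[OF lim[OF C(1) L2lim_imp_L1lim[OF fin L(2)]]]] by simp
  qed
  then show ?thesis using Y L unfolding X_def
    by (intro exI[of _ Y] exI[of _ "\<lambda>z. fst (G z)"] exI[of _ "\<lambda>z. snd (G z)"] conjI allI)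
qed

section \<open>Exhaustion of the unit disc and gluing of weak derivatives\<close>

definition disc :: "nat \<Rightarrow> complex set" where "disc j = ball 0 (1 - 1 / real (j + 2))"
text \<open>The shift by 2 starts the radii at 1/2 instead of 0.\<close>

definition cdisc :: "nat \<Rightarrow> complex set" where "cdisc j = cball 0 (1 - 1 / real (j + 2))"

lemma disc_props: "compact (cdisc j)" "cdisc j \<subseteq> ball 0 1" "disc j \<subseteq> cdisc j" "open (disc j)"
  by (auto simp: disc_def cdisc_def subset_iff intro: le_less_trans)

lemma disc_mono: "i \<le> j \<Longrightarrow> disc i \<subseteq> disc j" "i \<le> j \<Longrightarrow> cdisc i \<subseteq> cdisc j"
proof -
  assume "i \<le> j"
  then have "1 / real (j + 2) \<le> 1 / real (i + 2)" by (intro divide_left_mono) auto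
  then show "disc i \<subseteq> disc j" "cdisc i \<subseteq> cdisc j" unfolding disc_def cdisc_def by (intro subset_ball subset_cball; simp)+
qed

lemma compact_subset_disc:
  assumes "compact S" "S \<subseteq> ball 0 1"
  shows "\<exists>j. S \<subseteq> disc j"
proof (cases "S = {}")
  case False
  obtain z0 where z0: "z0 \<in> S" "\<And>z. z \<in> S \<Longrightarrow> norm z \<le> norm z0"
    using continuous_attains_sup[OF assms(1) False, of norm] by (auto intro: continuous_intros)
  have "norm z0 < 1" using z0(1) assms(2) by auto
  then obtain j where j: "1 / real (Suc j) < 1 - norm z0" using nat_approx_posE[of "1 - norm z0"] by auto
  have "1 / real (j + 2) \<le> 1 / real (Suc j)" by (intro divide_left_mono) auto
  then have "S \<subseteq> disc j" using j z0(2) unfolding disc_def by fastforce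
  then show ?thesis by blast
qed auto

lemma test_function_support:
  assumes "test_function \<Omega> \<phi>"
  obtains S where "compact S" "S \<subseteq> \<Omega>" "\<And>z. z \<notin> S \<Longrightarrow> \<phi> z = 0"
  using assms closure_subset[of "{z. \<phi> z \<noteq> 0}"] unfolding test_function_def by blast

text \<open>The candidates \<open>Gx j\<close> come from separate midpoint sequences, one for each
  disc. Weak derivatives are unique almost everywhere, so the candidates agree on the smaller disc,
  and each point may use the first disc that contains it.\<close>

lemma glue_weak_derivatives:
  fixes h :: "complex \<Rightarrow> complex"
  assumes h: "continuous_on (ball 0 1) h"
    and s: "\<And>j. sqint (lebesgue_on (cdisc j)) (Gx j)" "\<And>j. sqint (lebesgue_on (cdisc j)) (Gy j)"
    and w: "\<And>j. weakK (ball 0 1) (cdisc j) h (Gx j) (Gy j)"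
  shows "\<exists>hx hy. W12_loc (ball 0 1) h hx hy \<and>
     (\<forall>j. AE z in lebesgue. z \<in> disc j \<longrightarrow> hx z = Gx j z \<and> hy z = Gy j z)"
proof -
  define \<Omega> where "\<Omega> = ball (0::complex) 1"
  have fin: "finite_measure (lebesgue_on (cdisc j))" for j by (rule finite_measure_lebesgue_on_compact[OF disc_props(1)])
  have intG: "integrable (lebesgue_on (cdisc j)) G" if "sqint (lebesgue_on (cdisc j)) G" for j and G :: "complex \<Rightarrow> complex"
    using L2lim_imp_L1lim[OF fin L2lim_const[OF that]] by (simp add: L1lim_def)
  define J where "J z = (LEAST j. z \<in> disc j)" for z
  have J: "z \<in> disc (J z)" "J z \<le> j" if "z \<in> disc j" for z j
    using that LeastI[of "\<lambda>j. z \<in> disc j" j] Least_le[of "\<lambda>j. z \<in> disc j" j] by (auto simp: J_def)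
  \<comment> \<open>Both partial derivatives are treated at once, with \<open>v\<close> equal to 1
    or \<i> selecting the direction.\<close>
  have "L2_loc \<Omega> (\<lambda>z. G (J z) z) \<and> (\<forall>j. AE z in lebesgue. z \<in> disc j \<longrightarrow> G (J z) z = G j z)"
    if sG: "\<And>j. sqint (lebesgue_on (cdisc j)) (G j)" and v: "v \<in> {1, \<i>}"
      and wG: "\<And>j \<phi> \<phi>x \<phi>y. C1p \<phi> \<phi>x \<phi>y \<Longrightarrow> test_function \<Omega> \<phi> \<Longrightarrow> (\<And>z. z \<notin> cdisc j \<Longrightarrow> \<phi> z = 0) \<Longrightarrow>
        (LINT z|lebesgue_on (cdisc j). (Re v * \<phi>x z + Im v * \<phi>y z) *\<^sub>R h z) = - (LINT z|lebesgue_on (cdisc j). \<phi> z *\<^sub>R G j z)"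
    for G :: "nat \<Rightarrow> complex \<Rightarrow> complex" and v
  proof -
    have uniq: "AE z in lebesgue. z \<in> disc i \<longrightarrow> G i z - G j z = 0" if "i \<le> j" for i j
    proof (rule AE_zero_of_test[OF disc_props(4)])
      have Gj: "integrable (lebesgue_on (cdisc i)) (G j)"
        by (rule lebesgue_on_subset_integrable[OF intG[OF sG]]) (use disc_props disc_mono that in \<open>auto intro: compact_sets_lebesgue\<close>)
      fix S assume S: "compact S" "S \<subseteq> disc i"
      have Si: "S \<subseteq> cdisc i" using S disc_props(3) by blast
      have iS: "integrable (lebesgue_on S) (G i)" "integrable (lebesgue_on S) (G j)"
        by (rule lebesgue_on_subset_integrable[OF intG[OF sG]] lebesgue_on_subset_integrable[OF Gj]; use S Si disc_props in \<open>auto intro: compact_sets_lebesgue\<close>)+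
      then show "integrable (lebesgue_on S) (\<lambda>z. G i z - G j z)" by simp
      fix \<phi> assume \<phi>: "\<phi> \<in> bump_alg" "\<And>z. z \<notin> S \<Longrightarrow> \<phi> z = 0"
      obtain \<phi>x \<phi>y where C: "C1p \<phi> \<phi>x \<phi>y" using bump_alg_C2[OF \<phi>(1)] by blast
      have t: "test_function \<Omega> \<phi>"
        by (rule test_functionI[OF \<phi>(1) S(1) _ \<phi>(2)]) (use Si disc_props(2) in \<open>auto simp: \<Omega>_def\<close>)
      note C0 = C1p_zero_outside[OF C compact_imp_closed[OF S(1)] \<phi>(2)]
      have red: "(LINT z|lebesgue_on (cdisc k). u z *\<^sub>R g z) = (LINT z|lebesgue_on S. u z *\<^sub>R g z)"
        if "\<And>z. z \<notin> S \<Longrightarrow> u z = 0" "i \<le> k" for u :: "complex \<Rightarrow> real" and g :: "complex \<Rightarrow> complex" and k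
      proof -
        have "S \<subseteq> cdisc k" using Si disc_mono(2)[OF that(2)] by blast
        then have "(LINT z|lebesgue_on (cdisc k). u z *\<^sub>R g z) = (LINT z|lebesgue. u z *\<^sub>R g z)"
          using that(1) by (intro integral_lebesgue_on_vanishing compact_sets_lebesgue disc_props) auto
        moreover have "(LINT z|lebesgue_on S. u z *\<^sub>R g z) = (LINT z|lebesgue. u z *\<^sub>R g z)"
          using that(1) by (intro integral_lebesgue_on_vanishing compact_sets_lebesgue S) auto
        ultimately show ?thesis by simp
      qed
      have e: "(LINT z|lebesgue_on S. (Re v * \<phi>x z + Im v * \<phi>y z) *\<^sub>R h z) = - (LINT z|lebesgue_on S. \<phi> z *\<^sub>R G k z)" if k: "i \<le> k" for k
      proof -
        have "\<phi> z = 0" if "z \<notin> cdisc k" for z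
          using \<phi>(2)[of z] Si disc_mono(2)[OF k] that by blast
        from wG[OF C t this] show ?thesis using red[OF _ k, of \<phi> "G k"] red[OF _ k, of "\<lambda>z. Re v * \<phi>x z + Im v * \<phi>y z" h] \<phi>(2) C0 by simp
      qed
      have ip: "integrable (lebesgue_on S) (\<lambda>z. \<phi> z *\<^sub>R g z)" if "integrable (lebesgue_on S) g" for g :: "complex \<Rightarrow> complex"
        by (rule integrable_continuous_scaleR[OF S(1) C1p_continuous(1)[OF C] that])
      show "(LINT z|lebesgue_on S. \<phi> z *\<^sub>R (G i z - G j z)) = 0"
        using e[of i] e[of j] \<open>i \<le> j\<close> ip[OF iS(1)] ip[OF iS(2)] by (simp add: scaleR_diff_right)
    qed
    have AEj: "AE z in lebesgue. z \<in> disc j \<longrightarrow> G (J z) z = G j z" for j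
    proof -
      have "AE z in lebesgue. \<forall>i\<in>{..j}. z \<in> disc i \<longrightarrow> G i z - G j z = 0"
        using uniq by (intro AE_finite_allI) auto
      then show ?thesis
      proof eventually_elim
        case (elim z)
        show ?case
        proof
          assume z: "z \<in> disc j"
          have "G (J z) z - G j z = 0"
            by (rule elim[rule_format]) (use J(1)[OF z] J(2)[OF z] in auto)
          then show "G (J z) z = G j z" by simp
        qed
      qed
    qed
    \<comment> \<open>On \<open>layer j\<close> the glued function is \<open>G j\<close>, and the
      layers partition \<Omega>; the glued function is therefore a pointwise limit of finite sums of
      measurable functions.\<close>
    define layer where "layer j = disc j - (\<Union>i<j. disc i)" for j
    have Jl: "z \<in> layer j \<longleftrightarrow> z \<in> disc j \<and> J z = j" for z j
    proof
      assume z: "z \<in> layer j"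
      then have zd: "z \<in> disc j" by (simp add: layer_def)
      have "\<not> J z < j" using z J(1)[OF zd] by (auto simp: layer_def)
      with J(2)[OF zd] zd show "z \<in> disc j \<and> J z = j" by simp
    next
      assume z: "z \<in> disc j \<and> J z = j"
      have "z \<notin> disc i" if "i < j" for i
        using J(2)[of z i] z that by auto
      then show "z \<in> layer j" using z by (simp add: layer_def)
    qed
    have meas: "(\<lambda>z. indicator (layer j) z *\<^sub>R G j z) \<in> borel_measurable lebesgue" for j
    proof -
      have "G j \<in> borel_measurable (lebesgue_on (cdisc j))" using sG by (simp add: sqint_def)
      then have m: "(\<lambda>z. indicator (cdisc j) z *\<^sub>R G j z) \<in> borel_measurable lebesgue"
        using compact_sets_lebesgue[OF disc_props(1)] by (subst (asm) borel_measurable_restrict_space_iff) auto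
      have "layer j \<in> sets lebesgue"
        unfolding layer_def using disc_props(4) by (intro sets.Diff sets.finite_UN) (auto intro!: sets_completionI_sets)
      then have "(indicator (layer j) :: complex \<Rightarrow> real) \<in> borel_measurable lebesgue" by simp
      then have "(\<lambda>z. indicator (layer j) z *\<^sub>R (indicator (cdisc j) z *\<^sub>R G j z)) \<in> borel_measurable lebesgue"
        using m by (rule borel_measurable_scaleR)
      moreover have "(\<lambda>z. indicator (layer j) z *\<^sub>R (indicator (cdisc j) z *\<^sub>R G j z)) = (\<lambda>z. indicator (layer j) z *\<^sub>R G j z)"
        using disc_props(3)[of j] by (auto simp: indicator_def layer_def fun_eq_iff)
      ultimately show ?thesis by simp
    qed
    have "(\<lambda>z. indicator \<Omega> z *\<^sub>R G (J z) z) \<in> borel_measurable lebesgue"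
    proof (rule borel_measurable_LIMSEQ_metric)
      show "(\<lambda>z. \<Sum>j\<le>n. indicator (layer j) z *\<^sub>R G j z) \<in> borel_measurable lebesgue" for n
        by (intro borel_measurable_sum meas)
      fix z
      show "(\<lambda>n. \<Sum>j\<le>n. indicator (layer j) z *\<^sub>R G j z) \<longlonglongrightarrow> indicator \<Omega> z *\<^sub>R G (J z) z"
      proof (cases "z \<in> \<Omega>")
        case True
        then obtain j where j: "z \<in> disc j" using compact_subset_disc[of "{z}"] by (auto simp: \<Omega>_def)
        have ind: "indicator (layer i) z *\<^sub>R G i z = (if i = J z then G (J z) z else 0)" for i
          using J(1)[OF j] Jl[of z i] by (auto simp: indicator_def)
        have "(\<Sum>i\<le>n. indicator (layer i) z *\<^sub>R G i z) = G (J z) z" if "n \<ge> J z" for n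
          unfolding ind using that by simp
        then have "\<forall>\<^sub>F n in sequentially. (\<Sum>j\<le>n. indicator (layer j) z *\<^sub>R G j z) = indicator \<Omega> z *\<^sub>R G (J z) z"
          using True by (auto simp: eventually_sequentially)
        then show ?thesis by (rule tendsto_eventually)
      next
        case False
        have "z \<notin> layer j" for j
          using False disc_props(2,3)[of j] unfolding layer_def \<Omega>_def by blast
        then show ?thesis using False by simp
      qed
    qed
    then have mL: "set_borel_measurable lebesgue \<Omega> (\<lambda>z. G (J z) z)" by (simp add: set_borel_measurable_def)
    moreover have "set_integrable lebesgue K (\<lambda>z. (norm (G (J z) z))\<^sup>2)" if K: "compact K" "K \<subseteq> \<Omega>" for K
    proof -
      obtain j where j: "K \<subseteq> disc j" using compact_subset_disc[OF K(1)] K(2) by (auto simp: \<Omega>_def)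
      have Kj: "K \<subseteq> cdisc j" using j disc_props(3) by blast
      have sK: "sqint (lebesgue_on K) (G j)"
        by (rule sqint_subset[OF sG _ _ Kj]) (auto intro!: compact_sets_lebesgue disc_props K)
      have "(\<lambda>z. indicator \<Omega> z *\<^sub>R G (J z) z) \<in> borel_measurable (lebesgue_on K)"
        using mL unfolding set_borel_measurable_def by (rule measurable_restrict_space1)
      then have mK: "(\<lambda>z. G (J z) z) \<in> borel_measurable (lebesgue_on K)"
        by (rule measurable_cong[THEN iffD1, rotated]) (use K(2) in auto)
      have "AE z in lebesgue. z \<in> K \<longrightarrow> G j z = G (J z) z"
        using AEj[of j] by eventually_elim (use j in auto)
      then have "AE z in lebesgue_on K. G j z = G (J z) z"
        using compact_sets_lebesgue[OF K(1)] by (subst AE_restrict_space_iff) auto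
      from sqint_cong_AE[OF sK mK this] show ?thesis
        using compact_sets_lebesgue[OF K(1)] by (simp add: sqint_def set_integrable_def integrable_restrict_space)
    qed
    ultimately show ?thesis using AEj by (auto simp: L2_loc_def)
  qed
  note main = this
  have hx: "L2_loc \<Omega> (\<lambda>z. Gx (J z) z) \<and> (\<forall>j. AE z in lebesgue. z \<in> disc j \<longrightarrow> Gx (J z) z = Gx j z)"
    by (rule main[OF s(1), of 1]) (use weakKD(1)[OF w] in \<open>auto simp: \<Omega>_def\<close>)
  have hy: "L2_loc \<Omega> (\<lambda>z. Gy (J z) z) \<and> (\<forall>j. AE z in lebesgue. z \<in> disc j \<longrightarrow> Gy (J z) z = Gy j z)"
    by (rule main[OF s(2), of \<i>]) (use weakKD(2)[OF w] in \<open>auto simp: \<Omega>_def\<close>)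
  have "L2_loc \<Omega> h"
    unfolding L2_loc_def
  proof (intro conjI allI impI)
    have "h \<in> borel_measurable (lebesgue_on \<Omega>)"
      using h by (intro continuous_imp_measurable_on_sets_lebesgue) (auto simp: \<Omega>_def)
    then show "set_borel_measurable lebesgue \<Omega> h"
      unfolding set_borel_measurable_def by (subst (asm) borel_measurable_restrict_space_iff) (auto simp: \<Omega>_def)
    fix K assume K: "compact K \<and> K \<subseteq> \<Omega>"
    then have "integrable (lebesgue_on K) (\<lambda>z. (norm (h z))\<^sup>2)"
      using h by (intro continuous_on_compact_integrable continuous_intros continuous_on_subset[OF h]) (auto simp: \<Omega>_def)
    then show "set_integrable lebesgue K (\<lambda>z. (norm (h z))\<^sup>2)"
      using K compact_sets_lebesgue[of K] by (simp add: set_integrable_def integrable_restrict_space)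
  qed
  moreover have "weak_deriv \<Omega> v h (\<lambda>z. G (J z) z)"
    if AEj: "\<forall>j. AE z in lebesgue. z \<in> disc j \<longrightarrow> G (J z) z = G j z" and v: "v \<in> {1, \<i>}"
      and sG: "\<And>j. sqint (lebesgue_on (cdisc j)) (G j)" and L2: "L2_loc \<Omega> (\<lambda>z. G (J z) z)"
      and wG: "\<And>j \<phi> \<phi>x \<phi>y. C1p \<phi> \<phi>x \<phi>y \<Longrightarrow> test_function \<Omega> \<phi> \<Longrightarrow> (\<And>z. z \<notin> cdisc j \<Longrightarrow> \<phi> z = 0) \<Longrightarrow>
        (LINT z|lebesgue_on (cdisc j). (Re v * \<phi>x z + Im v * \<phi>y z) *\<^sub>R h z) = - (LINT z|lebesgue_on (cdisc j). \<phi> z *\<^sub>R G j z)"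
    for v G
    unfolding weak_deriv_def
  proof (intro allI impI)
    fix \<phi> assume t: "test_function \<Omega> \<phi>"
    obtain S where S: "compact S" "S \<subseteq> \<Omega>" "\<And>z. z \<notin> S \<Longrightarrow> \<phi> z = 0" using test_function_support[OF t] by blast
    obtain j where j: "S \<subseteq> disc j" using compact_subset_disc[OF S(1)] S(2) by (auto simp: \<Omega>_def)
    have Sj: "S \<subseteq> cdisc j" using j disc_props(3) by blast
    have out: "\<phi> z = 0" if "z \<notin> cdisc j" for z using S(3) Sj that by blast
    note C = test_function_C1p[OF t]
    note 0 = C1p_zero_outside[OF C compact_imp_closed[OF disc_props(1)] out]
    have K\<Omega>: "cdisc j \<subseteq> \<Omega>" using disc_props(2) by (simp add: \<Omega>_def)
    note V = set_integral_vanishing[OF disc_props(1) K\<Omega>]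
    have "(LINT z:\<Omega>|lebesgue. frechet_derivative \<phi> (at z) v *\<^sub>R h z) = - (LINT z|lebesgue_on (cdisc j). \<phi> z *\<^sub>R G j z)"
      using wG[OF C t out] V[of "\<lambda>z. frechet_derivative \<phi> (at z) v" h] 0
      by (simp add: frechet_derivative_C1p[OF C, of _ v])
    also have "(LINT z|lebesgue_on (cdisc j). \<phi> z *\<^sub>R G j z) = (LINT z|lebesgue_on (cdisc j). \<phi> z *\<^sub>R G (J z) z)"
    proof (rule integral_cong_AE)
      have pm: "\<phi> \<in> borel_measurable (lebesgue_on (cdisc j))"
        by (rule continuous_on_compact_measurable[OF disc_props(1) C1p_continuous(1)[OF C]])
      have "G j \<in> borel_measurable (lebesgue_on (cdisc j))" "(\<lambda>z. G (J z) z) \<in> borel_measurable (lebesgue_on (cdisc j))"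
        using sG L2_loc_sqint[OF L2 disc_props(1) K\<Omega>] by (auto simp: sqint_def)
      then show "(\<lambda>z. \<phi> z *\<^sub>R G j z) \<in> borel_measurable (lebesgue_on (cdisc j))" "(\<lambda>z. \<phi> z *\<^sub>R G (J z) z) \<in> borel_measurable (lebesgue_on (cdisc j))"
        using pm by (auto intro: borel_measurable_scaleR)
      have "AE z in lebesgue. z \<in> cdisc j \<longrightarrow> \<phi> z *\<^sub>R G j z = \<phi> z *\<^sub>R G (J z) z"
        using AEj[rule_format, of j]
      proof eventually_elim
        case (elim z)
        then show ?case using S(3)[of z] j by (cases "z \<in> S") auto
      qed
      then show "AE z in lebesgue_on (cdisc j). \<phi> z *\<^sub>R G j z = \<phi> z *\<^sub>R G (J z) z"
        using compact_sets_lebesgue[OF disc_props(1)] by (subst AE_restrict_space_iff) auto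
    qed
    also have "\<dots> = (LINT z:\<Omega>|lebesgue. \<phi> z *\<^sub>R G (J z) z)" using V[of \<phi> "\<lambda>z. G (J z) z"] out by simp
    finally show "(LINT z:\<Omega>|lebesgue. frechet_derivative \<phi> (at z) v *\<^sub>R h z) = - (LINT z:\<Omega>|lebesgue. \<phi> z *\<^sub>R G (J z) z)" .
  qed
  note wd = this
  have "weak_deriv \<Omega> 1 h (\<lambda>z. Gx (J z) z)"
    by (rule wd[of Gx 1]) (use hx s(1) weakKD(1)[OF w] in \<open>auto simp: \<Omega>_def\<close>)
  moreover have "weak_deriv \<Omega> \<i> h (\<lambda>z. Gy (J z) z)"
    by (rule wd[of Gy \<i>]) (use hy s(2) weakKD(2)[OF w] in \<open>auto simp: \<Omega>_def\<close>)
  ultimately have "W12_loc \<Omega> h (\<lambda>z. Gx (J z) z) (\<lambda>z. Gy (J z) z)"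
    using hx hy by (simp add: W12_loc_def)
  moreover have "AE z in lebesgue. z \<in> disc j \<longrightarrow> Gx (J z) z = Gx j z \<and> Gy (J z) z = Gy j z" for j
    using hx[THEN conjunct2, rule_format, of j] hy[THEN conjunct2, rule_format, of j] by eventually_elim auto
  ultimately show ?thesis unfolding \<Omega>_def by blast
qed

text \<open>With S = |a|^2 + |b|^2 and J the Jacobian, |a + \<i> b|^2 = S - 2 J and |a - \<i> b|^2 =
  S + 2 J. Squaring and collecting leaves K S <= (K^2 + 1) J, which relates a convex energy to a
  null Lagrangian.\<close>

lemma distortion_iff:
  fixes K :: real
  assumes K: "K \<ge> 1"
  shows "norm ((a + \<i> * b) / 2) \<le> (K - 1) / (K + 1) * norm ((a - \<i> * b) / 2) \<longleftrightarrow>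
     (norm a)\<^sup>2 + (norm b)\<^sup>2 \<le> (K + 1 / K) * Jac a b"
proof -
  define S where "S = (norm a)\<^sup>2 + (norm b)\<^sup>2"
  define J where "J = Jac a b"
  have p: "(norm (a + \<i> * b))\<^sup>2 = S - 2 * J" and m: "(norm (a - \<i> * b))\<^sup>2 = S + 2 * J"
    by (simp_all add: S_def J_def Jac_def cmod_power2) (simp_all add: power2_eq_square algebra_simps)
  have "norm ((a + \<i> * b) / 2) \<le> (K - 1) / (K + 1) * norm ((a - \<i> * b) / 2) \<longleftrightarrow>
     (K + 1) * norm (a + \<i> * b) \<le> (K - 1) * norm (a - \<i> * b)"
  proof -
    have "(K - 1) / (K + 1) * norm ((a - \<i> * b) / 2) = ((K - 1) * norm (a - \<i> * b) / (K + 1)) / 2"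
      by (simp add: norm_divide)
    moreover have "norm ((a + \<i> * b) / 2) = norm (a + \<i> * b) / 2" by (simp add: norm_divide)
    moreover have "x / 2 \<le> y / 2 \<longleftrightarrow> x \<le> y" for x y :: real by simp
    ultimately have "norm ((a + \<i> * b) / 2) \<le> (K - 1) / (K + 1) * norm ((a - \<i> * b) / 2) \<longleftrightarrow>
        norm (a + \<i> * b) \<le> (K - 1) * norm (a - \<i> * b) / (K + 1)" by (simp only:)
    also have "\<dots> \<longleftrightarrow> (K + 1) * norm (a + \<i> * b) \<le> (K - 1) * norm (a - \<i> * b)"
      using K by (simp add: pos_le_divide_eq mult.commute)
    finally show ?thesis .
  qed
  also have "\<dots> \<longleftrightarrow> ((K + 1) * norm (a + \<i> * b))\<^sup>2 \<le> ((K - 1) * norm (a - \<i> * b))\<^sup>2"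
    using K by (subst power_mono_iff) auto
  also have "\<dots> \<longleftrightarrow> (K + 1)\<^sup>2 * (S - 2 * J) \<le> (K - 1)\<^sup>2 * (S + 2 * J)"
    by (simp only: power_mult_distrib p m)
  also have "\<dots> \<longleftrightarrow> 4 * (K * S) \<le> 4 * ((K\<^sup>2 + 1) * J)"
    by (simp add: power2_eq_square algebra_simps)
  also have "\<dots> \<longleftrightarrow> S \<le> (K + 1 / K) * J"
  proof -
    have "(K\<^sup>2 + 1) * J = K * ((K + 1 / K) * J)" using K by (simp add: field_simps power2_eq_square)
    moreover have "4 * (K * S) \<le> 4 * (K * ((K + 1 / K) * J)) \<longleftrightarrow> K * S \<le> K * ((K + 1 / K) * J)" by simp
    moreover have "K * S \<le> K * ((K + 1 / K) * J) \<longleftrightarrow> S \<le> (K + 1 / K) * J"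
      by (rule mult_le_cancel_left_pos) (use K in simp)
    ultimately show ?thesis by (simp only:)
  qed
  finally show ?thesis by (simp add: S_def J_def)
qed

lemma K_quasiregular_on_iff:
  assumes "K \<ge> 1"
  shows "K_quasiregular_on K \<Omega> f \<longleftrightarrow>
    open \<Omega> \<and> connected \<Omega> \<and> \<Omega> \<noteq> {} \<and> continuous_on \<Omega> f \<and> (\<exists>fx fy. W12_loc \<Omega> f fx fy \<and>
       (AE z in lebesgue. z \<in> \<Omega> \<longrightarrow> (norm (fx z))\<^sup>2 + (norm (fy z))\<^sup>2 \<le> (K + 1 / K) * Jac (fx z) (fy z)))"
  unfolding K_quasiregular_on_def distortion_iff[OF assms] ..

text \<open>After an integration by parts the integrated Jacobian pairs \<open>Re (F n)\<close> with an expression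
  linear in the gradient. Replacing \<open>Re (F n)\<close> by its uniform limit \<open>Re h\<close> makes the right-hand
  side affine and keeps the left-hand side convex, so the inequality survives midpoints.\<close>

lemma qr_closure:
  fixes F :: "nat \<Rightarrow> complex \<Rightarrow> complex" and L :: real
  defines "\<Omega> \<equiv> ball (0::complex) 1"
  assumes L: "L > 0" and q: "\<And>n. qr_data L \<Omega> (F n) (Fx n) (Fy n)" and W: "\<And>n. W12_loc \<Omega> (F n) (Fx n) (Fy n)"
    and u: "\<And>j. uniform_limit (cdisc j) F h sequentially"
    and E: "\<And>j. \<exists>B. \<forall>n. (LINT z|lebesgue_on (cdisc j). (norm (Fx n z))\<^sup>2 + (norm (Fy n z))\<^sup>2) \<le> B"
  shows "continuous_on \<Omega> h \<and> (\<exists>hx hy. W12_loc \<Omega> h hx hy \<and>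
     (AE z in lebesgue. z \<in> \<Omega> \<longrightarrow> (norm (hx z))\<^sup>2 + (norm (hy z))\<^sup>2 \<le> L * Jac (hx z) (hy z)))"
proof -
  have c\<Omega>: "cdisc j \<subseteq> \<Omega>" for j using disc_props(2) by (simp add: \<Omega>_def)
  note ap = qr_dataD[OF q disc_props(1) c\<Omega>]
  have hc: "continuous_on (cdisc j) h" for j
    by (rule uniform_limit_theorem[OF _ u]) (use appr_continuous[OF ap(1)] in auto)
  have h\<Omega>: "continuous_on \<Omega> h"
  proof (rule continuous_at_imp_continuous_on, rule ballI)
    fix z assume "z \<in> \<Omega>"
    then obtain j where "z \<in> disc j" using compact_subset_disc[of "{z}"] by (auto simp: \<Omega>_def)
    then show "isCont h z"
      using continuous_on_subset[OF hc disc_props(3)] continuous_on_eq_continuous_at[OF disc_props(4)] by blast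
  qed
  obtain B where B: "\<And>j n. (LINT z|lebesgue_on (cdisc j). (norm (Fx n z))\<^sup>2 + (norm (Fy n z))\<^sup>2) \<le> B j"
    using E by metis
  define X where "X = (\<lambda>n z. (F n z, Fx n z, Fy n z))"
  have "\<exists>Y Gx Gy. (\<forall>n. Y n \<in> mids X n) \<and>
     L2lim (lebesgue_on (cdisc j)) (\<lambda>n z. fst (snd (Y n z))) Gx \<and> L2lim (lebesgue_on (cdisc j)) (\<lambda>n z. snd (snd (Y n z))) Gy \<and>
     weakK \<Omega> (cdisc j) h Gx Gy" for j
    unfolding X_def
  proof (rule closure_on_compact[OF disc_props(1) appr_continuous[OF ap(1)] appr_sqint[OF ap(1)] _ u B])
    show "weakK \<Omega> (cdisc j) (F n) (Fx n) (Fy n)" for n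
      by (rule weak_deriv_weakK) (use W[of n] c\<Omega> disc_props(1) in \<open>auto simp: W12_loc_def\<close>)
  qed
  then obtain Y Gx Gy where Y: "\<And>j n. Y j n \<in> mids X n"
    and G: "\<And>j. L2lim (lebesgue_on (cdisc j)) (\<lambda>n z. fst (snd (Y j n z))) (Gx j)"
       "\<And>j. L2lim (lebesgue_on (cdisc j)) (\<lambda>n z. snd (snd (Y j n z))) (Gy j)"
    and w: "\<And>j. weakK \<Omega> (cdisc j) h (Gx j) (Gy j)"
    by metis
  have sG: "sqint (lebesgue_on (cdisc j)) (Gx j)" "sqint (lebesgue_on (cdisc j)) (Gy j)" for j
    using G[of j] by (auto simp: L2lim_def)
  obtain hx hy where H: "W12_loc \<Omega> h hx hy"
    and HG: "\<And>j. AE z in lebesgue. z \<in> disc j \<longrightarrow> hx z = Gx j z \<and> hy z = Gy j z"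
    using glue_weak_derivatives[OF h\<Omega>[unfolded \<Omega>_def] sG w[unfolded \<Omega>_def]] unfolding \<Omega>_def by blast
  have aph: "appr S h hx hy" if "compact S" "S \<subseteq> \<Omega>" for S
    by (rule W12_loc_appr[OF _ h\<Omega> H that]) (simp add: \<Omega>_def)
  let ?D = "\<lambda>z. (norm (hx z))\<^sup>2 + (norm (hy z))\<^sup>2"
  let ?J = "\<lambda>z. Jac (hx z) (hy z)"
  have iD: "integrable (lebesgue_on S) ?D" and iJ: "integrable (lebesgue_on S) ?J" if "compact S" "S \<subseteq> \<Omega>" for S
    using appr_sqint[OF aph[OF that]] integrable_bilinear_sqint[OF bounded_bilinear_Jac appr_sqint[OF aph[OF that]]]
    by (auto simp: sqint_def)
  have "AE z in lebesgue. z \<in> \<Omega> \<longrightarrow> 0 \<le> L * ?J z - ?D z"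
  proof (rule AE_nonneg_of_test)
    show "open \<Omega>" by (simp add: \<Omega>_def)
    show "integrable (lebesgue_on S) (\<lambda>z. L * ?J z - ?D z)" if "compact S" "S \<subseteq> \<Omega>" for S
      using iD[OF that] iJ[OF that] by simp
    fix \<phi> S assume \<phi>: "\<phi> \<in> bump_alg" "\<And>z. 0 \<le> \<phi> z" and S: "compact S" "S \<subseteq> \<Omega>" and out: "\<And>z. z \<notin> S \<Longrightarrow> \<phi> z = (0::real)"
    let ?M = "lebesgue_on S"
    have fin: "finite_measure ?M" by (rule finite_measure_lebesgue_on_compact[OF S(1)])
    interpret finite_measure ?M by (rule fin)
    obtain \<phi>x \<phi>y where C: "C1p \<phi> \<phi>x \<phi>y" using bump_alg_C2[OF \<phi>(1)] by blast
    note Cc = C1p_continuous[OF C, of S]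
    obtain j where j: "S \<subseteq> disc j" using compact_subset_disc[OF S(1)] S(2) by (auto simp: \<Omega>_def)
    have Sj: "S \<subseteq> cdisc j" using j disc_props(3) by blast
    have mS: "S \<in> sets lebesgue" and mj: "cdisc j \<in> sets lebesgue" using S disc_props by (auto intro: compact_sets_lebesgue)
    have aeS: "AE z in ?M. Gx j z = hx z" "AE z in ?M. Gy j z = hy z"
    proof -
      have "AE z in lebesgue. z \<in> S \<longrightarrow> Gx j z = hx z" "AE z in lebesgue. z \<in> S \<longrightarrow> Gy j z = hy z"
        using HG[of j] by (eventually_elim, use j in auto)+
      then show "AE z in ?M. Gx j z = hx z" "AE z in ?M. Gy j z = hy z"
        using mS by (simp_all add: AE_restrict_space_iff)
    qed
    have sh: "sqint ?M hx" "sqint ?M hy" using appr_sqint[OF aph[OF S]] by auto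
    have LY: "L2lim ?M (\<lambda>n z. fst (snd (Y j n z))) hx" "L2lim ?M (\<lambda>n z. snd (snd (Y j n z))) hy"
      by (rule L2lim_cong_AE[OF L2lim_subset[OF G(1) mj mS Sj] _ aeS(1)], use sh in \<open>simp add: sqint_def\<close>)
         (rule L2lim_cong_AE[OF L2lim_subset[OF G(2) mj mS Sj] _ aeS(2)], use sh in \<open>simp add: sqint_def\<close>)
    have apF: "appr S (F n) (Fx n) (Fy n)" and dF: "AE z in ?M. (norm (Fx n z))\<^sup>2 + (norm (Fy n z))\<^sup>2 \<le> L * Jac (Fx n z) (Fy n z)" for n
      using qr_dataD[OF q S] by auto
    have hS: "continuous_on S h" by (rule continuous_on_subset[OF h\<Omega> S(2)])
    \<comment> \<open>The factor that is paired with Re f when \<open>Jac_identity\<close> is used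
      with A = Re. It is linear in the derivatives, and therefore so is \<open>ln\<close>.\<close>
    define wt where "wt v z = \<phi>x z * Im (snd (snd (v z))) - \<phi>y z * Im (fst (snd (v z)))" for v :: "complex \<Rightarrow> complex \<times> complex \<times> complex" and z
    define qd where "qd v = (LINT z|?M. \<phi> z * ((norm (fst (snd (v z))))\<^sup>2 + (norm (snd (snd (v z))))\<^sup>2))" for v :: "complex \<Rightarrow> complex \<times> complex \<times> complex"
    define ln where "ln v = (LINT z|?M. Re (h z) * wt v z)" for v
    have inv: "sqint ?M (\<lambda>z. fst (snd (v z))) \<and> sqint ?M (\<lambda>z. snd (snd (v z)))" if "v \<in> mids X n" for v n
      using that
    proof induction
      case (base k) then show ?case using appr_sqint[OF apF[of k]] by (simp add: X_def)
    next
      case (mid v1 v2)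
      have "sqint ?M (\<lambda>z. (1/2) *\<^sub>R (fst (snd (v1 z)) + fst (snd (v2 z))))" "sqint ?M (\<lambda>z. (1/2) *\<^sub>R (snd (snd (v1 z)) + snd (snd (v2 z))))"
        by (intro sqint_scaleR sqint_add; use mid in blast)+
      then show ?case by simp
    qed
    have iq: "integrable ?M (\<lambda>z. \<phi> z * ((norm (fst (snd (v z))))\<^sup>2 + (norm (snd (snd (v z))))\<^sup>2))" if "v \<in> mids X n" for v n
      by (rule integrable_continuous_mult[OF S(1) Cc(1)]) (use inv[OF that] in \<open>auto simp: sqint_def\<close>)
    have iIm: "integrable ?M (\<lambda>z. Im (g z))" if "sqint ?M g" for g
      using L2lim_imp_L1lim[OF fin L2lim_const[OF sqint_linear[OF bounded_linear_Im that]]] by (simp add: L1lim_def)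
    have iw: "integrable ?M (wt v)" if "sqint ?M (\<lambda>z. fst (snd (v z)))" "sqint ?M (\<lambda>z. snd (snd (v z)))" for v
      unfolding wt_def[abs_def]
      by (intro Bochner_Integration.integrable_diff integrable_continuous_mult[OF S(1)] Cc iIm that)
    have Rh: "continuous_on S (\<lambda>z. Re (h z))" by (intro continuous_intros hS)
    have il: "integrable ?M (\<lambda>z. Re (h z) * wt v z)" if "sqint ?M (\<lambda>z. fst (snd (v z)))" "sqint ?M (\<lambda>z. snd (snd (v z)))" for v
      by (rule integrable_continuous_mult[OF S(1) Rh iw[OF that]])
    have "bounded (\<phi>x ` S)" "bounded (\<phi>y ` S)"
      using compact_imp_bounded[OF compact_continuous_image[OF Cc(2) S(1)]] compact_imp_bounded[OF compact_continuous_image[OF Cc(3) S(1)]] by auto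
    then obtain c1 c2 where "\<And>z. z \<in> S \<Longrightarrow> \<bar>\<phi>x z\<bar> \<le> c1" "\<And>z. z \<in> S \<Longrightarrow> \<bar>\<phi>y z\<bar> \<le> c2"
      by (fastforce simp: bounded_iff)
    then obtain c where c: "\<And>z. z \<in> S \<Longrightarrow> \<bar>\<phi>x z\<bar> \<le> c" "\<And>z. z \<in> S \<Longrightarrow> \<bar>\<phi>y z\<bar> \<le> c" "c \<ge> 0"
      using that[of "max (max c1 c2) 0"] by (auto simp: le_max_iff_disj)
    \<comment> \<open>Bounds the integral of |wt| for every \<open>F k\<close>: pointwise |wt| is at
      most c (|Fx| + |Fy|), and each modulus is at most 1 plus its square.\<close>
    define Ct where "Ct = c * (2 * measure lebesgue S + B j)"
    \<comment> \<open>For the maps themselves, trading Re (F k) for Re h costs L \<eta> Ct. This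
      error is the same for the whole tail, and \<open>qd\<close> is convex while \<open>ln\<close>
      is linear, so the inequality extends to all midpoints.\<close>
    have est: "qd v \<le> - L * ln v + L * \<eta> * Ct" if \<eta>: "\<eta> > 0" and N: "\<And>k z. N \<le> k \<Longrightarrow> z \<in> S \<Longrightarrow> norm (F k z - h z) \<le> \<eta>" and v: "v \<in> mids X N" for \<eta> N v
      using v
    proof induction
      case (base k)
      let ?DF = "\<lambda>z. (norm (Fx k z))\<^sup>2 + (norm (Fy k z))\<^sup>2"
      note JI = Jac_identity[OF S(1) apF[of k] C1p_Re C out]
      have sF: "sqint ?M (Fx k)" "sqint ?M (Fy k)" by (rule appr_sqint[OF apF])+
      have sX: "sqint ?M (\<lambda>z. fst (snd (X k z)))" "sqint ?M (\<lambda>z. snd (snd (X k z)))" using sF by (auto simp: X_def)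
      have iDF: "integrable ?M ?DF" using sF by (auto simp: sqint_def)
      have "qd (X k) = (LINT z|?M. \<phi> z * ?DF z)" by (simp add: qd_def X_def)
      also have "\<dots> \<le> (LINT z|?M. L * (\<phi> z * (1 * Jac (Fx k z) (Fy k z))))"
      proof (rule integral_mono_AE)
        show "AE z in ?M. \<phi> z * ?DF z \<le> L * (\<phi> z * (1 * Jac (Fx k z) (Fy k z)))"
          using dF[of k]
        proof eventually_elim
          case (elim z)
          from mult_left_mono[OF this \<phi>(2)[of z]] show ?case by (simp add: mult_ac)
        qed
      qed (use integrable_continuous_mult[OF S(1) Cc(1) iDF] JI(2) in auto)
      also have "\<dots> = (LINT z|?M. (- L) * (Re (F k z) * wt (X k) z))"
        using JI(1) by (simp add: wt_def X_def)
      also have "\<dots> \<le> (LINT z|?M. (- L) * (Re (h z) * wt (X k) z) + L * \<eta> * (c * (2 + ?DF z)))"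
      proof (rule integral_mono)
        show "integrable ?M (\<lambda>z. (- L) * (Re (F k z) * wt (X k) z))" using JI(3) by (simp add: wt_def X_def)
        show "integrable ?M (\<lambda>z. (- L) * (Re (h z) * wt (X k) z) + L * \<eta> * (c * (2 + ?DF z)))"
          using il[OF sX] iDF by auto
        fix z assume "z \<in> space ?M"
        then have z: "z \<in> S" by simp
        have le1: "norm e \<le> 1 + (norm e)\<^sup>2" for e :: complex by (rule le_one_plus_sq)
        have "\<bar>wt (X k) z\<bar> \<le> \<bar>\<phi>x z\<bar> * \<bar>Im (Fy k z)\<bar> + \<bar>\<phi>y z\<bar> * \<bar>Im (Fx k z)\<bar>"
          unfolding wt_def X_def by (simp add: abs_mult[symmetric])
        also have "\<dots> \<le> c * norm (Fy k z) + c * norm (Fx k z)"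
          using c z by (intro add_mono mult_mono abs_Im_le_cmod) auto
        also have "\<dots> = c * (norm (Fy k z) + norm (Fx k z))" by (simp add: algebra_simps)
        also have "\<dots> \<le> c * (2 + ?DF z)"
          using le1[of "Fx k z"] le1[of "Fy k z"] c(3) by (intro mult_left_mono) auto
        finally have wle: "\<bar>wt (X k) z\<bar> \<le> c * (2 + ?DF z)" .
        have Rle: "\<bar>Re (h z) - Re (F k z)\<bar> \<le> \<eta>"
          using N[OF base z] abs_Re_le_cmod[of "F k z - h z"] by (simp add: abs_minus_commute)
        have "(Re (h z) - Re (F k z)) * wt (X k) z \<le> \<bar>Re (h z) - Re (F k z)\<bar> * \<bar>wt (X k) z\<bar>"
          by (simp add: abs_mult[symmetric])
        also have "\<dots> \<le> \<eta> * (c * (2 + ?DF z))" using \<eta> by (intro mult_mono Rle wle) auto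
        finally have "L * ((Re (h z) - Re (F k z)) * wt (X k) z) \<le> L * (\<eta> * (c * (2 + ?DF z)))"
          using L by (intro mult_left_mono) auto
        then show "(- L) * (Re (F k z) * wt (X k) z) \<le> (- L) * (Re (h z) * wt (X k) z) + L * \<eta> * (c * (2 + ?DF z))"
          by (simp add: algebra_simps)
      qed
      also have "\<dots> = (- L) * ln (X k) + L * \<eta> * (c * (2 * measure lebesgue S + (LINT z|?M. ?DF z)))"
      proof -
        have i1: "integrable ?M (\<lambda>z. (- L) * (Re (h z) * wt (X k) z))" using il[OF sX] by simp
        have i2: "integrable ?M (\<lambda>z. L * \<eta> * (c * (2 + ?DF z)))" using iDF by simp
        have "(LINT z|?M. 2 + ?DF z) = 2 * measure lebesgue S + (LINT z|?M. ?DF z)"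
          using iDF mS by (subst Bochner_Integration.integral_add) (auto simp: measure_restrict_space)
        then have "(LINT z|?M. L * \<eta> * (c * (2 + ?DF z))) = L * \<eta> * (c * (2 * measure lebesgue S + (LINT z|?M. ?DF z)))"
          by (simp only: integral_mult_right_zero)
        moreover have "(LINT z|?M. (- L) * (Re (h z) * wt (X k) z)) = (- L) * ln (X k)"
          unfolding ln_def by (rule integral_mult_right_zero)
        ultimately show ?thesis using Bochner_Integration.integral_add[OF i1 i2] by (simp only:)
      qed
      also have "\<dots> \<le> (- L) * ln (X k) + L * \<eta> * Ct"
      proof -
        have "(LINT z|?M. ?DF z) \<le> (LINT z|lebesgue_on (cdisc j). ?DF z)"
        proof (rule lebesgue_on_subset_integral_le[OF _ mj mS Sj])
          have "appr (cdisc j) (F k) (Fx k) (Fy k)" by (rule ap(1))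
          from appr_sqint[OF this] show "integrable (lebesgue_on (cdisc j)) ?DF" by (auto simp: sqint_def)
        qed simp
        also have "\<dots> \<le> B j" by (rule B)
        finally show ?thesis using L \<eta> c(3) unfolding Ct_def by (intro add_left_mono mult_left_mono) auto
      qed
      finally show ?case .
    next
      case (mid v1 v2)
      let ?v = "\<lambda>z. (1/2) *\<^sub>R (v1 z + v2 z)"
      have "qd ?v \<le> (LINT z|?M. (1/2) * (\<phi> z * ((norm (fst (snd (v1 z))))\<^sup>2 + (norm (snd (snd (v1 z))))\<^sup>2)) + (1/2) * (\<phi> z * ((norm (fst (snd (v2 z))))\<^sup>2 + (norm (snd (snd (v2 z))))\<^sup>2)))"
        unfolding qd_def
      proof (rule integral_mono)
        show "integrable ?M (\<lambda>z. \<phi> z * ((norm (fst (snd (?v z))))\<^sup>2 + (norm (snd (snd (?v z))))\<^sup>2))"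
          by (rule iq[OF mids.mid[OF mid(1,2)]])
        show "integrable ?M (\<lambda>z. (1/2) * (\<phi> z * ((norm (fst (snd (v1 z))))\<^sup>2 + (norm (snd (snd (v1 z))))\<^sup>2)) + (1/2) * (\<phi> z * ((norm (fst (snd (v2 z))))\<^sup>2 + (norm (snd (snd (v2 z))))\<^sup>2)))"
          using iq[OF mid(1)] iq[OF mid(2)] by simp
        fix z
        have half: "(norm ((1/2) *\<^sub>R (e + e')))\<^sup>2 \<le> (1/2) * (norm e)\<^sup>2 + (1/2) * (norm e')\<^sup>2" for e e' :: complex
          using norm_add_sq_le[of e e'] by (simp add: power_divide)
        have "(norm (fst (snd (?v z))))\<^sup>2 + (norm (snd (snd (?v z))))\<^sup>2 \<le>
           ((1/2) * (norm (fst (snd (v1 z))))\<^sup>2 + (1/2) * (norm (fst (snd (v2 z))))\<^sup>2) + ((1/2) * (norm (snd (snd (v1 z))))\<^sup>2 + (1/2) * (norm (snd (snd (v2 z))))\<^sup>2)"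
          using half[of "fst (snd (v1 z))" "fst (snd (v2 z))"] half[of "snd (snd (v1 z))" "snd (snd (v2 z))"] by simp
        from mult_left_mono[OF this \<phi>(2)[of z]]
        show "\<phi> z * ((norm (fst (snd (?v z))))\<^sup>2 + (norm (snd (snd (?v z))))\<^sup>2) \<le>
          (1/2) * (\<phi> z * ((norm (fst (snd (v1 z))))\<^sup>2 + (norm (snd (snd (v1 z))))\<^sup>2)) + (1/2) * (\<phi> z * ((norm (fst (snd (v2 z))))\<^sup>2 + (norm (snd (snd (v2 z))))\<^sup>2))"
          by (simp add: algebra_simps)
      qed
      also have "\<dots> = (1/2) * qd v1 + (1/2) * qd v2"
        using iq[OF mid(1)] iq[OF mid(2)] by (simp add: qd_def)
      also have "\<dots> \<le> (1/2) * (- L * ln v1 + L * \<eta> * Ct) + (1/2) * (- L * ln v2 + L * \<eta> * Ct)"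
        using mid by (intro add_mono mult_left_mono) auto
      also have "\<dots> = - L * ((1/2) * ln v1 + (1/2) * ln v2) + L * \<eta> * Ct" by (simp add: algebra_simps)
      also have "(1/2) * ln v1 + (1/2) * ln v2 = ln ?v"
      proof -
        have "ln ?v = (LINT z|?M. (1/2) * (Re (h z) * wt v1 z) + (1/2) * (Re (h z) * wt v2 z))"
          unfolding ln_def by (intro Bochner_Integration.integral_cong refl) (simp add: wt_def algebra_simps add_divide_distrib)
        also have "\<dots> = (1/2) * ln v1 + (1/2) * ln v2"
          using il[of v1] il[of v2] inv[OF mid(1)] inv[OF mid(2)] by (simp add: ln_def)
        finally show ?thesis by simp
      qed
      finally show ?case .
    qed
    note m = L1lim_bilinear_uconv[OF bounded_bilinear_mult]
    have uc: "uconv ?M (\<lambda>_. k) k" if "continuous_on S k" for k :: "complex \<Rightarrow> real"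
      by (rule uconv_lebesgue_on[OF S(1)]) (use that in \<open>auto simp: uniform_limit_iff\<close>)
    have limq: "(\<lambda>n. qd (Y j n)) \<longlonglongrightarrow> (LINT z|?M. \<phi> z * ?D z)"
    proof -
      have inn: "L1lim ?M (\<lambda>n z. V n z \<bullet> V n z) (\<lambda>z. g z \<bullet> g z)" if "L2lim ?M V g" for V and g :: "complex \<Rightarrow> complex"
        by (rule L1lim_bilinear_L2lim[OF bounded_bilinear_inner that that])
      have "L1lim ?M (\<lambda>n z. \<phi> z * ((norm (fst (snd (Y j n z))))\<^sup>2 + (norm (snd (snd (Y j n z))))\<^sup>2)) (\<lambda>z. \<phi> z * ?D z)"
        unfolding power2_norm_eq_inner by (intro m uc Cc L1lim_add inn[OF LY(1)] inn[OF LY(2)])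
      then show ?thesis unfolding qd_def by (rule L1lim_integral)
    qed
    have liml: "(\<lambda>n. ln (Y j n)) \<longlonglongrightarrow> (LINT z|?M. Re (h z) * (\<phi>x z * Im (hy z) - \<phi>y z * Im (hx z)))"
    proof -
      note I1 = L2lim_imp_L1lim[OF fin L2lim_linear[OF bounded_linear_Im LY(1)]]
        and I2 = L2lim_imp_L1lim[OF fin L2lim_linear[OF bounded_linear_Im LY(2)]]
      have "L1lim ?M (\<lambda>n z. Re (h z) * (\<phi>x z * Im (snd (snd (Y j n z))) + (- \<phi>y z) * Im (fst (snd (Y j n z)))))
          (\<lambda>z. Re (h z) * (\<phi>x z * Im (hy z) + (- \<phi>y z) * Im (hx z)))"
        by (intro m uc Rh Cc L1lim_add I1 I2 continuous_intros)
      from L1lim_integral[OF this] show ?thesis by (simp add: ln_def wt_def)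
    qed
    note JH = Jac_identity[OF S(1) aph[OF S] C1p_Re C out]
    \<comment> \<open>The way back from the linear expression to the Jacobian: \<open>h\<close> has
      smooth approximations of its own, so \<open>Jac_identity\<close> applies to it.\<close>
    have lnJ: "- (LINT z|?M. Re (h z) * (\<phi>x z * Im (hy z) - \<phi>y z * Im (hx z))) = (LINT z|?M. \<phi> z * ?J z)"
      using JH(1) by simp
    \<comment> \<open>Here the limit along the midpoints is taken with \<eta> fixed; \<eta> is made
      small afterwards.\<close>
    have fin_est: "(LINT z|?M. \<phi> z * ?D z) \<le> L * (LINT z|?M. \<phi> z * ?J z) + L * \<eta> * Ct" if \<eta>: "\<eta> > 0" for \<eta>
    proof -
      obtain N where N: "\<And>k z. k \<ge> N \<Longrightarrow> z \<in> S \<Longrightarrow> norm (F k z - h z) \<le> \<eta>"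
        using uniform_limitD[OF u[of j] \<eta>] Sj by (fastforce simp: eventually_sequentially dist_norm)
      have "qd (Y j n) \<le> - L * ln (Y j n) + L * \<eta> * Ct" if "n \<ge> N" for n
        by (rule est[OF \<eta> N mids_mono[OF Y that]])
      then have ev: "\<forall>\<^sub>F n in sequentially. qd (Y j n) \<le> - L * ln (Y j n) + L * \<eta> * Ct"
        by (auto simp: eventually_sequentially)
      have "(LINT z|?M. \<phi> z * ?D z) \<le> - L * (LINT z|?M. Re (h z) * (\<phi>x z * Im (hy z) - \<phi>y z * Im (hx z))) + L * \<eta> * Ct"
        by (rule tendsto_le[OF _ _ limq ev]) (auto intro!: tendsto_intros liml)
      moreover have "- L * (LINT z|?M. Re (h z) * (\<phi>x z * Im (hy z) - \<phi>y z * Im (hx z))) = L * (LINT z|?M. \<phi> z * ?J z)"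
        unfolding lnJ[symmetric] by simp
      ultimately show ?thesis by linarith
    qed
    have "(LINT z|?M. \<phi> z * ?D z) \<le> L * (LINT z|?M. \<phi> z * ?J z)"
    proof (rule field_le_epsilon)
      fix e :: real assume e: "e > 0"
      have "L * (e / (L * (\<bar>Ct\<bar> + 1))) * Ct \<le> e"
      proof -
        have "L * (e / (L * (\<bar>Ct\<bar> + 1))) * Ct = e / (\<bar>Ct\<bar> + 1) * Ct" using L by simp
        also have "\<dots> \<le> e / (\<bar>Ct\<bar> + 1) * (\<bar>Ct\<bar> + 1)" using e by (intro mult_left_mono) auto
        also have "\<dots> = e" by (simp add: add_nonneg_eq_0_iff)
        finally show ?thesis .
      qed
      moreover have "e / (L * (\<bar>Ct\<bar> + 1)) > 0" using e L by simp
      ultimately show "(LINT z|?M. \<phi> z * ?D z) \<le> L * (LINT z|?M. \<phi> z * ?J z) + e"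
        using fin_est[of "e / (L * (\<bar>Ct\<bar> + 1))"] by linarith
    qed
    moreover have "(LINT z|?M. \<phi> z * (L * ?J z - ?D z)) = L * (LINT z|?M. \<phi> z * ?J z) - (LINT z|?M. \<phi> z * ?D z)"
    proof -
      have "(LINT z|?M. \<phi> z * (L * ?J z - ?D z)) = (LINT z|?M. L * (\<phi> z * ?J z) - \<phi> z * ?D z)"
        by (intro Bochner_Integration.integral_cong refl) (simp add: algebra_simps)
      also have "\<dots> = (LINT z|?M. L * (\<phi> z * ?J z)) - (LINT z|?M. \<phi> z * ?D z)"
        by (intro Bochner_Integration.integral_diff integrable_mult_right integrable_continuous_mult[OF S(1) Cc(1)] iD[OF S] iJ[OF S])
      finally show ?thesis by simp
    qed
    ultimately show "0 \<le> (LINT z|?M. \<phi> z * (L * ?J z - ?D z))" by simp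
  qed
  then have "AE z in lebesgue. z \<in> \<Omega> \<longrightarrow> ?D z \<le> L * ?J z" by eventually_elim auto
  then show ?thesis using h\<Omega> H by blast
qed

section \<open>Compactness\<close>

lemma integral_finite_cover_le:
  fixes g :: "complex \<Rightarrow> real"
  assumes A: "finite A" and K: "compact K" "K \<subseteq> (\<Union>a\<in>A. Q a)" and Q: "\<And>a. a \<in> A \<Longrightarrow> compact (Q a)"
    and g: "integrable (lebesgue_on K) g" "\<And>a. a \<in> A \<Longrightarrow> integrable (lebesgue_on (Q a)) g" "\<And>z. 0 \<le> g z"
  shows "(LINT z|lebesgue_on K. g z) \<le> (\<Sum>a\<in>A. LINT z|lebesgue_on (Q a). g z)"
proof -
  note s = compact_sets_lebesgue
  have "(LINT z|lebesgue_on K. g z) = (LINT z|lebesgue. indicat_real K z *\<^sub>R g z)"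
    using s[OF K(1)] by (simp add: integral_restrict_space)
  also have "\<dots> \<le> (LINT z|lebesgue. (\<Sum>a\<in>A. indicat_real (Q a) z *\<^sub>R g z))"
  proof (rule integral_mono)
    show "integrable lebesgue (\<lambda>z. indicat_real K z *\<^sub>R g z)" using g(1) s[OF K(1)] by (simp add: integrable_restrict_space)
    show "integrable lebesgue (\<lambda>z. \<Sum>a\<in>A. indicat_real (Q a) z *\<^sub>R g z)"
      using g(2) s[OF Q] by (intro Bochner_Integration.integrable_sum) (simp add: integrable_restrict_space)
    fix z
    have *: "0 \<le> indicat_real (Q a) z *\<^sub>R g z" for a using g(3)[of z] by simp
    show "indicat_real K z *\<^sub>R g z \<le> (\<Sum>a\<in>A. indicat_real (Q a) z *\<^sub>R g z)"
    proof (cases "z \<in> K")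
      case True
      then obtain a where a: "a \<in> A" "z \<in> Q a" using K(2) by blast
      have "indicat_real (Q a) z *\<^sub>R g z \<le> (\<Sum>a\<in>A. indicat_real (Q a) z *\<^sub>R g z)"
        by (rule member_le_sum[OF a(1) _ A]) (use * in auto)
      then show ?thesis using True a by simp
    qed (simp add: * sum_nonneg g)
  qed
  also have "\<dots> = (\<Sum>a\<in>A. LINT z|lebesgue. indicat_real (Q a) z *\<^sub>R g z)"
    using g(2) s[OF Q] by (intro Bochner_Integration.integral_sum) (simp add: integrable_restrict_space)
  also have "\<dots> = (\<Sum>a\<in>A. LINT z|lebesgue_on (Q a). g z)"
    by (intro sum.cong refl) (use s[OF Q] in \<open>simp add: integral_restrict_space\<close>)
  finally show ?thesis .
qed

text \<open>Finitely many squares cover \<open>cdisc j\<close>, which turns the estimates near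
  single points into estimates on the disc with constants depending on p, L, V and j only. The
  larger disc \<open>cdisc (Suc j)\<close> leaves room for the balls.\<close>

lemma disc_estimates:
  fixes p L V :: real
  assumes p: "p > 0" and L: "L > 0"
  shows "\<exists>S E r. r > 0 \<and> (\<forall>f fx fy. qr_data L (ball 0 1) f fx fy \<longrightarrow>
      (LINT z|lebesgue_on (cdisc (Suc j)). (1 + (cmod (f z))\<^sup>2) powr (p/2)) \<le> V \<longrightarrow>
      (\<forall>z\<in>cdisc j. cmod (f z) \<le> S) \<and>
      (LINT z|lebesgue_on (cdisc j). (norm (fx z))\<^sup>2 + (norm (fy z))\<^sup>2) \<le> E \<and>
      (\<forall>a\<in>cdisc j. \<forall>N. \<forall>z\<in>sq a (r / 2 ^ N). real N * (cmod (f z - f a))\<^sup>2 \<le> E))"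
proof -
  \<comment> \<open>A quarter of the gap between the radii of \<open>cdisc j\<close> and
    \<open>cdisc (Suc j)\<close>, so that balls of radius 4r around points of the former stay in the
    latter.\<close>
  define r where "r = (1 / real (j + 2) - 1 / real (j + 3)) / 4"
  have r: "r > 0" unfolding r_def by (auto intro!: frac_less2)
  have big: "cball a (4 * r) \<subseteq> cdisc (Suc j)" if "a \<in> cdisc j" for a
  proof
    fix z assume "z \<in> cball a (4 * r)"
    then have "cmod z \<le> cmod a + 4 * r" using norm_triangle_ineq2[of z a] by (simp add: dist_norm norm_minus_commute)
    moreover have "cmod a \<le> 1 - 1 / real (j + 2)" using that by (simp add: cdisc_def)
    moreover have "4 * r = 1 / real (j + 2) - 1 / real (j + 3)"
    proof -
      have "4 * (x / 4) = x" for x :: real by simp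
      then show ?thesis by (simp only: r_def)
    qed
    ultimately have "cmod z \<le> 1 - 1 / real (j + 3)" by linarith
    then show "z \<in> cdisc (Suc j)" by (simp add: cdisc_def algebra_simps)
  qed
  have big1: "cball a (4 * r) \<subseteq> ball 0 1" if "a \<in> cdisc j" for a
    using big[OF that] disc_props(2)[of "Suc j"] by blast
  have sqsub: "sq a t \<subseteq> cball a (2 * t)" for a t
  proof
    fix z assume "z \<in> sq a t"
    then show "z \<in> cball a (2 * t)" using sn_bounds(3)[of "z - a"] by (simp add: sq_iff dist_norm norm_minus_commute)
  qed
  have sq1: "sq a (r/2) \<subseteq> ball 0 1" if "a \<in> cdisc j" for a
  proof -
    have "cball a (2 * (r/2)) \<subseteq> cball a (4 * r)" by (rule subset_cball) (use r in simp)
    then show ?thesis using sqsub[of a "r/2"] big1[OF that] by blast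
  qed
  have bsq: "ball a t \<subseteq> sq a t" for a t
  proof
    fix z assume "z \<in> ball a t"
    then show "z \<in> sq a t" using sn_bounds(1)[of "z - a"] by (simp add: sq_iff dist_norm norm_minus_commute)
  qed
  obtain S0 where "\<exists>E. \<forall>\<Omega> f fx fy a. qr_data L \<Omega> f fx fy \<longrightarrow> cball a (4 * r) \<subseteq> \<Omega> \<longrightarrow>
           (LINT z|lebesgue_on (cball a (4 * r)). (1 + (cmod (f z))\<^sup>2) powr (p/2)) \<le> V \<longrightarrow>
           (\<forall>z\<in>sq a r. cmod (f z) \<le> S0) \<and>
           (LINT z|lebesgue_on (sq a (r/2)). (norm (fx z))\<^sup>2 + (norm (fy z))\<^sup>2) \<le> E"
    by (rule exE[OF local_estimates[OF p L r, of V]])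
  then obtain E0 where E0: "\<forall>\<Omega> f fx fy a. qr_data L \<Omega> f fx fy \<longrightarrow> cball a (4 * r) \<subseteq> \<Omega> \<longrightarrow>
           (LINT z|lebesgue_on (cball a (4 * r)). (1 + (cmod (f z))\<^sup>2) powr (p/2)) \<le> V \<longrightarrow>
           (\<forall>z\<in>sq a r. cmod (f z) \<le> S0) \<and>
           (LINT z|lebesgue_on (sq a (r/2)). (norm (fx z))\<^sup>2 + (norm (fy z))\<^sup>2) \<le> E0"
    by (rule exE)
  note loc = E0[rule_format]
  obtain A where A: "A \<subseteq> cdisc j" "finite A" "cdisc j \<subseteq> (\<Union>a\<in>A. ball a (r/2))"
  proof (rule compactE_image[OF disc_props(1)[of j], of "cdisc j" "\<lambda>a. ball a (r/2)"])
    have "a \<in> ball a (r/2)" for a using r by simp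
    then show "cdisc j \<subseteq> (\<Union>a\<in>cdisc j. ball a (r/2))" by blast
  qed auto
  \<comment> \<open>One constant for two conclusions: the sum of the energies over the cover, and
    the right-hand side of \<open>log_modulus\<close>.\<close>
  define E where "E = max (real (card A) * E0) (512 * E0)"
  have main: "(\<forall>z\<in>cdisc j. cmod (f z) \<le> S0) \<and>
      (LINT z|lebesgue_on (cdisc j). (norm (fx z))\<^sup>2 + (norm (fy z))\<^sup>2) \<le> E \<and>
      (\<forall>a\<in>cdisc j. \<forall>N. \<forall>z\<in>sq a (r/2 / 2 ^ N). real N * (cmod (f z - f a))\<^sup>2 \<le> E)"
    if f: "qr_data L (ball 0 1) f fx fy" and V: "(LINT z|lebesgue_on (cdisc (Suc j)). (1 + (cmod (f z))\<^sup>2) powr (p/2)) \<le> V"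
    for f fx fy
  proof -
    let ?D = "\<lambda>z. (norm (fx z))\<^sup>2 + (norm (fy z))\<^sup>2"
    have Dint: "integrable (lebesgue_on K) ?D" if "compact K" "K \<subseteq> ball 0 1" for K
      using appr_sqint[OF qr_dataD(1)[OF f that]] by (auto simp: sqint_def)
    have p0: "1 + (cmod w)\<^sup>2 \<noteq> 0" for w using zero_le_power2[of "cmod w"] by linarith
    have fc: "continuous_on (cdisc (Suc j)) f" by (rule appr_continuous[OF qr_dataD(1)[OF f disc_props(1,2)]])
    have V': "(LINT z|lebesgue_on (cball a (4 * r)). (1 + (cmod (f z))\<^sup>2) powr (p/2)) \<le> V" if "a \<in> cdisc j" for a
    proof -
      have "(LINT z|lebesgue_on (cball a (4 * r)). (1 + (cmod (f z))\<^sup>2) powr (p/2)) \<le> (LINT z|lebesgue_on (cdisc (Suc j)). (1 + (cmod (f z))\<^sup>2) powr (p/2))"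
        by (intro lebesgue_on_subset_integral_le continuous_on_compact_integrable compact_sets_lebesgue disc_props big that compact_cball
            continuous_intros fc) (use p0 in auto)
      with V show ?thesis by simp
    qed
    have l: "(\<forall>z\<in>sq a r. cmod (f z) \<le> S0) \<and> (LINT z|lebesgue_on (sq a (r/2)). ?D z) \<le> E0" if "a \<in> cdisc j" for a
      by (rule loc[OF f big1[OF that] V'[OF that]])
    have "a \<in> sq a r" for a using r by (simp add: sq_iff sn_def)
    then have 1: "\<forall>z\<in>cdisc j. cmod (f z) \<le> S0" using l by auto
    have "(LINT z|lebesgue_on (cdisc j). ?D z) \<le> (\<Sum>a\<in>A. LINT z|lebesgue_on (sq a (r/2)). ?D z)"
    proof (rule integral_finite_cover_le[OF A(2) disc_props(1)])
      show "cdisc j \<subseteq> (\<Union>a\<in>A. sq a (r/2))" using A(3) bsq by blast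
    qed (use A(1) in \<open>auto intro!: Dint compact_sq disc_props(1,2) sq1\<close>)
    also have "\<dots> \<le> (\<Sum>a\<in>A. E0)" by (rule sum_mono) (use A(1) l in auto)
    also have "\<dots> \<le> E" by (simp add: E_def)
    finally have 2: "(LINT z|lebesgue_on (cdisc j). ?D z) \<le> E" .
    have 3: "real N * (cmod (f z - f a))\<^sup>2 \<le> E" if a: "a \<in> cdisc j" and z: "z \<in> sq a (r/2 / 2 ^ N)" for a N z
    proof -
      have "real N * (cmod (f z - f a))\<^sup>2 \<le> 512 * E0"
        by (rule log_modulus[OF f L _ sq1[OF a] conjunct2[OF l[OF a]] z]) (use r in simp)
      then show ?thesis by (simp add: E_def)
    qed
    show ?thesis by (intro conjI 1 2 ballI allI 3)
  qed
  show ?thesis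
  proof (rule exI[of _ S0], rule exI[of _ E], rule exI[of _ "r/2"], rule conjI)
    show "r/2 > 0" using r by simp
  qed (intro allI impI, rule main)
qed

text \<open>Diagonal extraction over the discs. The limits on different discs fit together because
  each of them is the pointwise limit of the diagonal sequence.\<close>

lemma locally_uniform_subsequence:
  fixes F :: "nat \<Rightarrow> complex \<Rightarrow> complex"
  assumes sub: "\<And>j s. strict_mono (s :: nat \<Rightarrow> nat) \<Longrightarrow>
     \<exists>k::nat \<Rightarrow> nat. strict_mono k \<and> (\<exists>g. uniform_limit (cdisc j) (\<lambda>n. F (s (k n))) g sequentially)"
  shows "\<exists>(d::nat \<Rightarrow> nat) h. strict_mono d \<and> (\<forall>j. uniform_limit (cdisc j) (\<lambda>n. F (d n)) h sequentially)"
proof -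
  define P where "P j s \<longleftrightarrow> (\<exists>g. uniform_limit (cdisc j) (\<lambda>n. F (s n)) g sequentially)" for j and s :: "nat \<Rightarrow> nat"
  interpret subseqs P
    by unfold_locales (use sub in \<open>simp add: P_def o_def\<close>)
  have "\<exists>g. uniform_limit (cdisc j) (\<lambda>n. F (diagseq n)) g sequentially" for j
  proof -
    \<comment> \<open>The diagonal sequence is guaranteed to be a subsequence of the j-th extracted
      one only from index \<open>Suc j\<close> on; convergence ignores the initial terms, so the
      shift is removed below.\<close>
    have "P j (diagseq \<circ> ((+) (Suc j)))"
    proof (rule diagseq_holds)
      fix r s :: "nat \<Rightarrow> nat" and n assume "strict_mono r" "P n s"
      then show "P n (s \<circ> r)" unfolding P_def o_def
        by (auto intro: filterlim_compose[OF _ filterlim_subseq])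
    qed
    then obtain g where "uniform_limit (cdisc j) (\<lambda>n. F (diagseq (Suc j + n))) g sequentially"
      unfolding P_def o_def by (rule exE)
    then have "uniform_limit (cdisc j) (\<lambda>n. F (diagseq (n + Suc j))) g sequentially"
      by (simp only: add.commute)
    then have "uniform_limit (cdisc j) (\<lambda>n. F (diagseq n)) g sequentially"
      unfolding uniform_limit_iff
      using eventually_sequentially_seg[of "\<lambda>n. \<forall>x\<in>cdisc j. dist (F (diagseq n) x) (g x) < e" "Suc j" for e] by simp
    then show ?thesis by blast
  qed
  then obtain g where g: "\<And>j. uniform_limit (cdisc j) (\<lambda>n. F (diagseq n)) (g j) sequentially" by metis
  define h where "h z = lim (\<lambda>n. F (diagseq n) z)" for z
  have "h z = g j z" if "z \<in> cdisc j" for z j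
    unfolding h_def by (rule limI[OF tendsto_uniform_limitI[OF g that]])
  then have "uniform_limit (cdisc j) (\<lambda>n. F (diagseq n)) h sequentially" for j
    using g[of j] by (subst uniform_limit_cong'[of _ _ "\<lambda>n. F (diagseq n)" _ "g j"]) auto
  then show ?thesis using subseq_diagseq by blast
qed

lemma qr_compactness:
  fixes F :: "nat \<Rightarrow> complex \<Rightarrow> complex" and L p :: real
  assumes p: "p > 0" and L: "L > 0" and q: "\<And>n. qr_data L (ball 0 1) (F n) (Fx n) (Fy n)"
    and W: "\<And>n. W12_loc (ball 0 1) (F n) (Fx n) (Fy n)"
    and V: "\<And>j. \<exists>V. \<forall>n. (LINT z|lebesgue_on (cdisc j). (1 + (cmod (F n z))\<^sup>2) powr (p/2)) \<le> V"
  shows "\<exists>(d::nat \<Rightarrow> nat) h. strict_mono d \<and> (\<forall>j. uniform_limit (cdisc j) (\<lambda>n. F (d n)) h sequentially) \<and>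
     continuous_on (ball 0 1) h \<and> (\<exists>hx hy. W12_loc (ball 0 1) h hx hy \<and>
     (AE z in lebesgue. z \<in> ball 0 1 \<longrightarrow> (norm (hx z))\<^sup>2 + (norm (hy z))\<^sup>2 \<le> L * Jac (hx z) (hy z)))"
proof -
  have est: "\<exists>S E r. r > 0 \<and> (\<forall>n. (\<forall>z\<in>cdisc j. cmod (F n z) \<le> S) \<and>
      (LINT z|lebesgue_on (cdisc j). (norm (Fx n z))\<^sup>2 + (norm (Fy n z))\<^sup>2) \<le> E \<and>
      (\<forall>a\<in>cdisc j. \<forall>N. \<forall>z\<in>sq a (r / 2 ^ N). real N * (cmod (F n z - F n a))\<^sup>2 \<le> E))" for j
  proof -
    obtain V0 where V0: "\<forall>n. (LINT z|lebesgue_on (cdisc (Suc j)). (1 + (cmod (F n z))\<^sup>2) powr (p/2)) \<le> V0"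
      by (rule exE[OF V[of "Suc j"]])
    obtain S E r where r: "r > 0" and e: "\<forall>f fx fy. qr_data L (ball 0 1) f fx fy \<longrightarrow>
      (LINT z|lebesgue_on (cdisc (Suc j)). (1 + (cmod (f z))\<^sup>2) powr (p/2)) \<le> V0 \<longrightarrow>
      (\<forall>z\<in>cdisc j. cmod (f z) \<le> S) \<and>
      (LINT z|lebesgue_on (cdisc j). (norm (fx z))\<^sup>2 + (norm (fy z))\<^sup>2) \<le> E \<and>
      (\<forall>a\<in>cdisc j. \<forall>N. \<forall>z\<in>sq a (r / 2 ^ N). real N * (cmod (f z - f a))\<^sup>2 \<le> E)"
      using disc_estimates[OF p L, of j V0] by (elim exE conjE)
    show ?thesis
      by (rule exI[of _ S], rule exI[of _ E], rule exI[of _ r], rule conjI[OF r], rule allI,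
          rule e[rule_format, OF q V0[rule_format]])
  qed
  have sub: "\<exists>k::nat \<Rightarrow> nat. strict_mono k \<and> (\<exists>g. uniform_limit (cdisc j) (\<lambda>n. F (s (k n))) g sequentially)"
    for j and s :: "nat \<Rightarrow> nat"
  proof -
    obtain S E r where r: "r > 0" and e: "\<forall>n. (\<forall>z\<in>cdisc j. cmod (F n z) \<le> S) \<and>
      (LINT z|lebesgue_on (cdisc j). (norm (Fx n z))\<^sup>2 + (norm (Fy n z))\<^sup>2) \<le> E \<and>
      (\<forall>a\<in>cdisc j. \<forall>N. \<forall>z\<in>sq a (r / 2 ^ N). real N * (cmod (F n z - F n a))\<^sup>2 \<le> E)"
      using est[of j] by (elim exE conjE)
    have eq: "\<exists>d>0. \<forall>n y. y \<in> cdisc j \<and> cmod (x - y) < d \<longrightarrow> cmod (F (s n) x - F (s n) y) < \<epsilon>"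
      if x: "x \<in> cdisc j" and \<epsilon>: "0 < \<epsilon>" for x \<epsilon>
    proof -
      have "0 < \<epsilon>\<^sup>2" using \<epsilon> by simp
      from reals_Archimedean3[OF this] have "\<exists>N. E < real N * \<epsilon>\<^sup>2" by (rule spec)
      \<comment> \<open>The logarithmic modulus read as equicontinuity: \<open>N\<close> depends on
        \<open>E\<close> and \<epsilon> but not on n, and r / 2^N serves as the distance.\<close>
      then obtain N where N: "E < real N * \<epsilon>\<^sup>2" by (rule exE)
      have "cmod (F (s n) x - F (s n) y) < \<epsilon>" if "cmod (x - y) < r / 2 ^ N" for n y
      proof -
        have "y \<in> sq x (r / 2 ^ N)" using that sn_bounds(1)[of "y - x"] by (simp add: sq_iff norm_minus_commute)
        then have "real N * (cmod (F (s n) y - F (s n) x))\<^sup>2 \<le> E"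
          by (rule e[THEN spec, THEN conjunct2, THEN conjunct2, THEN bspec, OF x, THEN spec, THEN bspec])
        then have "real N * (cmod (F (s n) y - F (s n) x))\<^sup>2 < real N * \<epsilon>\<^sup>2" using N by (rule le_less_trans)
        then have "(cmod (F (s n) y - F (s n) x))\<^sup>2 < \<epsilon>\<^sup>2" by (rule mult_left_less_imp_less) simp
        then show ?thesis using \<epsilon> by (simp add: power_less_imp_less_base norm_minus_commute)
      qed
      then show ?thesis using r by (intro exI[of _ "r / 2 ^ N"]) auto
    qed
    have bd: "cmod (F (s n) x) \<le> S" if "x \<in> cdisc j" for n x
      by (rule e[THEN spec, THEN conjunct1, THEN bspec, OF that])
    show ?thesis
    proof (rule Arzela_Ascoli[OF disc_props(1)[of j], of "\<lambda>n. F (s n)" S])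
      fix g and k :: "nat \<Rightarrow> nat" assume k: "strict_mono k"
        and g: "\<And>e. 0 < e \<Longrightarrow> \<exists>N. \<forall>n x. n \<ge> N \<and> x \<in> cdisc j \<longrightarrow> cmod (F (s (k n)) x - g x) < e"
      have "uniform_limit (cdisc j) (\<lambda>n. F (s (k n))) g sequentially"
        unfolding uniform_limit_iff eventually_sequentially dist_norm
      proof (intro allI impI)
        fix e :: real assume "e > 0"
        from g[OF this] show "\<exists>N. \<forall>n\<ge>N. \<forall>x\<in>cdisc j. cmod (F (s (k n)) x - g x) < e" by auto
      qed
      with k show ?thesis by (intro exI[of _ k] conjI exI[of _ g])
    next
      fix n x assume "x \<in> cdisc j"
      then show "cmod (F (s n) x) \<le> S" by (rule bd)
    next
      fix x and \<epsilon> :: real assume "x \<in> cdisc j" "0 < \<epsilon>"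
      then show "\<exists>d>0. \<forall>n y. y \<in> cdisc j \<and> cmod (x - y) < d \<longrightarrow> cmod (F (s n) x - F (s n) y) < \<epsilon>" by (rule eq)
    qed
  qed
  have "\<exists>(d::nat \<Rightarrow> nat) h. strict_mono d \<and> (\<forall>j. uniform_limit (cdisc j) (\<lambda>n. F (d n)) h sequentially)"
    by (rule locally_uniform_subsequence[of F]) (rule sub)
  then obtain d :: "nat \<Rightarrow> nat" and h where d: "strict_mono d"
    and h0: "\<forall>j. uniform_limit (cdisc j) (\<lambda>n. F (d n)) h sequentially" by (elim exE conjE)
  note h = h0[rule_format]
  have en: "\<exists>B. \<forall>n. (LINT z|lebesgue_on (cdisc j). (norm (Fx (d n) z))\<^sup>2 + (norm (Fy (d n) z))\<^sup>2) \<le> B" for j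
  proof -
    obtain S E r where e: "\<forall>n. (\<forall>z\<in>cdisc j. cmod (F n z) \<le> S) \<and>
      (LINT z|lebesgue_on (cdisc j). (norm (Fx n z))\<^sup>2 + (norm (Fy n z))\<^sup>2) \<le> E \<and>
      (\<forall>a\<in>cdisc j. \<forall>N. \<forall>z\<in>sq a (r / 2 ^ N). real N * (cmod (F n z - F n a))\<^sup>2 \<le> E)"
      using est[of j] by (elim exE conjE)
    show ?thesis by (rule exI[of _ E], rule allI) (rule e[THEN spec, THEN conjunct2, THEN conjunct1])
  qed
  show ?thesis
    by (rule exI[of _ d], rule exI[of _ h], rule conjI[OF d], rule conjI[OF h0])
      (rule qr_closure[of L "\<lambda>n. F (d n)" "\<lambda>n. Fx (d n)" "\<lambda>n. Fy (d n)", OF L q W h en])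
qed

section \<open>Complex rescaling\<close>

lemma nn_integral_translate:
  fixes h :: "'a::euclidean_space \<Rightarrow> ennreal"
  assumes [measurable]: "h \<in> borel_measurable borel"
  shows "(\<integral>\<^sup>+x. h (a + x) \<partial>lborel) = (\<integral>\<^sup>+x. h x \<partial>lborel)"
proof -
  have "(\<integral>\<^sup>+x. h x \<partial>lborel) = (\<integral>\<^sup>+x. h x \<partial>distr lborel borel ((+) a))" by (simp add: lborel_distr_plus)
  also have "\<dots> = (\<integral>\<^sup>+x. h (a + x) \<partial>lborel)" by (rule nn_integral_distr) auto
  finally show ?thesis by simp
qed

text \<open>Translation invariance suffices: evaluate the double integral of
  \<open>indicator (ball 0 1) x * indicator A (x + c * z)\<close> in both orders.\<close>

lemma emeasure_vimage_mult_complex: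
  fixes c :: complex
  assumes c: "c \<noteq> 0" and A: "A \<in> sets borel"
  shows "emeasure lborel ((\<lambda>z. c * z) -` A) = ennreal (1 / (cmod c)\<^sup>2) * emeasure lborel A"
proof -
  define B where "B = ball (0::complex) 1"
  define b where "b x = (indicator B x :: ennreal)" for x
  define u where "u x = (indicator A x :: ennreal)" for x
  have [measurable]: "b \<in> borel_measurable borel" "u \<in> borel_measurable borel"
    using A by (auto simp: b_def[abs_def] u_def[abs_def] B_def intro!: borel_measurable_indicator)
  have bn: "(\<integral>\<^sup>+x. b x \<partial>lborel) = emeasure lborel B" by (simp add: b_def B_def)
  have T [measurable]: "(\<lambda>z. c * z) \<in> borel_measurable borel" by (intro borel_measurable_continuous_onI continuous_intros)
  have [measurable]: "(\<lambda>z. c * z) -` A \<in> sets borel" using measurable_sets[OF T A] by simp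
  have I: "(\<integral>\<^sup>+z. u (c * z) \<partial>lborel) = emeasure lborel ((\<lambda>z. c * z) -` A)"
  proof -
    have "(\<integral>\<^sup>+z. u (c * z) \<partial>lborel) = (\<integral>\<^sup>+z. indicator ((\<lambda>z. c * z) -` A) z \<partial>lborel)"
      by (intro nn_integral_cong) (simp add: u_def indicator_def)
    then show ?thesis by simp
  qed
  have "emeasure lborel B * (\<integral>\<^sup>+z. u (c * z) \<partial>lborel) = (\<integral>\<^sup>+x. b x * (\<integral>\<^sup>+z. u (c * z) \<partial>lborel) \<partial>lborel)"
    by (simp add: nn_integral_multc bn)
  also have "\<dots> = (\<integral>\<^sup>+x. b x * (\<integral>\<^sup>+z. u (x + c * z) \<partial>lborel) \<partial>lborel)"
  proof (rule nn_integral_cong)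
    fix x
    have "(\<integral>\<^sup>+z. u (c * (x / c + z)) \<partial>lborel) = (\<integral>\<^sup>+z. u (c * z) \<partial>lborel)"
      by (rule nn_integral_translate) measurable
    then show "b x * (\<integral>\<^sup>+z. u (c * z) \<partial>lborel) = b x * (\<integral>\<^sup>+z. u (x + c * z) \<partial>lborel)"
      using c by (simp add: distrib_left)
  qed
  also have "\<dots> = (\<integral>\<^sup>+x. \<integral>\<^sup>+z. b x * u (x + c * z) \<partial>lborel \<partial>lborel)"
    by (intro nn_integral_cong nn_integral_cmult[symmetric]) measurable
  also have "\<dots> = (\<integral>\<^sup>+z. \<integral>\<^sup>+x. b x * u (x + c * z) \<partial>lborel \<partial>lborel)"
    by (rule lborel_pair.Fubini') measurable
  also have "\<dots> = (\<integral>\<^sup>+z. \<integral>\<^sup>+x. b (x - c * z) * u x \<partial>lborel \<partial>lborel)"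
  proof (rule nn_integral_cong)
    fix z
    have "(\<integral>\<^sup>+x. b ((c * z + x) - c * z) * u (c * z + x) \<partial>lborel) = (\<integral>\<^sup>+x. b (x - c * z) * u x \<partial>lborel)"
      by (rule nn_integral_translate) measurable
    then show "(\<integral>\<^sup>+x. b x * u (x + c * z) \<partial>lborel) = (\<integral>\<^sup>+x. b (x - c * z) * u x \<partial>lborel)"
      by (simp add: add.commute)
  qed
  also have "\<dots> = (\<integral>\<^sup>+x. \<integral>\<^sup>+z. b (x - c * z) * u x \<partial>lborel \<partial>lborel)"
    by (rule lborel_pair.Fubini'[symmetric]) measurable
  also have "\<dots> = (\<integral>\<^sup>+x. emeasure lborel B * ennreal (1 / (cmod c)\<^sup>2) * u x \<partial>lborel)"
  proof (rule nn_integral_cong)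
    fix x
    \<comment> \<open>As a function of z this is the indicator of a disc of radius 1/|c|, whose area
      supplies the factor 1/|c|^2.\<close>
    have "b (x - c * z) = indicator (ball (x / c) (1 / cmod c)) z" for z
    proof -
      have "x - c * z = c * (x / c - z)" using c by (simp add: right_diff_distrib)
      then have "cmod (x - c * z) = cmod c * cmod (x / c - z)" by (simp only: norm_mult)
      then have "cmod (x - c * z) < 1 \<longleftrightarrow> cmod (x / c - z) < 1 / cmod c" using c by (simp add: field_simps)
      moreover have "b (x - c * z) = (if cmod (x - c * z) < 1 then 1 else 0)"
        using norm_minus_commute[of x "c * z"] by (simp add: b_def B_def dist_norm)
      ultimately show ?thesis by (simp add: indicator_def dist_norm)
    qed
    then have "(\<integral>\<^sup>+z. b (x - c * z) * u x \<partial>lborel) = emeasure lborel (ball (x / c) (1 / cmod c)) * u x"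
      by (simp only:) (subst nn_integral_multc, auto intro!: borel_measurable_indicator)
    also have "emeasure lborel (ball (x / c) (1 / cmod c)) = emeasure lborel B * ennreal (1 / (cmod c)\<^sup>2)"
      using unit_ball_vol_nonneg[of 2] by (simp add: B_def emeasure_ball power_divide ennreal_mult[symmetric])
    finally show "(\<integral>\<^sup>+z. b (x - c * z) * u x \<partial>lborel) = emeasure lborel B * ennreal (1 / (cmod c)\<^sup>2) * u x" .
  qed
  also have "\<dots> = emeasure lborel B * (ennreal (1 / (cmod c)\<^sup>2) * emeasure lborel A)"
    using A by (simp add: nn_integral_cmult u_def mult.assoc)
  finally have "emeasure lborel B * emeasure lborel ((\<lambda>z. c * z) -` A) = emeasure lborel B * (ennreal (1 / (cmod c)\<^sup>2) * emeasure lborel A)"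
    unfolding I .
  moreover have "emeasure lborel B \<noteq> 0" "emeasure lborel B \<noteq> top"
    using less_imp_neq[OF unit_ball_vol_pos[of 2]] by (auto simp: B_def emeasure_ball)
  ultimately show ?thesis by (simp add: ennreal_mult_cancel_left)
qed

lemma
  fixes c :: complex
  assumes c: "c \<noteq> 0"
  defines "T \<equiv> \<lambda>z. c * z"
  shows lebesgue_mult_complex: "lebesgue = density (distr lebesgue lebesgue T) (\<lambda>_. ennreal ((cmod c)\<^sup>2))"
    and measurable_mult_complex: "T \<in> lebesgue \<rightarrow>\<^sub>M lebesgue"
proof -
  have T [measurable]: "T \<in> borel \<rightarrow>\<^sub>M borel"
    unfolding T_def by (intro borel_measurable_continuous_onI continuous_intros)
  have em: "emeasure (distr lborel borel T) A = ennreal (1 / (cmod c)\<^sup>2) * emeasure lborel A" if "A \<in> sets borel" for A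
    using emeasure_vimage_mult_complex[OF c that] that by (simp add: emeasure_distr T_def)
  have lb: "lborel = density (distr lborel borel T) (\<lambda>_. ennreal ((cmod c)\<^sup>2))"
  proof (rule measure_eqI)
    fix A assume "A \<in> sets (lborel :: complex measure)"
    then have A: "A \<in> sets borel" by simp
    then have "emeasure (density (distr lborel borel T) (\<lambda>_. ennreal ((cmod c)\<^sup>2))) A = ennreal ((cmod c)\<^sup>2) * (ennreal (1 / (cmod c)\<^sup>2) * emeasure lborel A)"
      by (simp add: emeasure_density nn_integral_cmult em)
    also have "\<dots> = emeasure lborel A"
      using c by (simp add: mult.assoc[symmetric] ennreal_mult[symmetric])
    finally show "emeasure lborel A = emeasure (density (distr lborel borel T) (\<lambda>_. ennreal ((cmod c)\<^sup>2))) A" by simp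
  qed simp
  have "emeasure lborel A = 0 \<longleftrightarrow> emeasure (distr lebesgue lborel T) A = 0" if "A \<in> sets borel" for A
    using em[OF that] c by (simp add: distr_completion cong: distr_cong)
  \<comment> \<open>Measurability between the completed measures needs more than Borel
    measurability: preimages of null sets must be null, and the scaling of the measure provides
    this.\<close>
  then have eq: "null_sets lborel = null_sets (distr lebesgue lborel T)"
    by (auto simp: null_sets_def)
  show "T \<in> lebesgue \<rightarrow>\<^sub>M lebesgue"
    by (simp add: completion.measurable_completion2 eq measurable_completion)
  have "lebesgue = completion (density (distr lborel borel T) (\<lambda>_. ennreal ((cmod c)\<^sup>2)))"
    by (subst lb) simp
  also have "\<dots> = density (completion (distr lebesgue lborel T)) (\<lambda>_. ennreal ((cmod c)\<^sup>2))"
    using c by (auto intro!: always_eventually completion_density_eq simp: distr_completion cong: distr_cong)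
  also have "\<dots> = density (distr lebesgue lebesgue T) (\<lambda>_. ennreal ((cmod c)\<^sup>2))"
    by (subst completion.completion_distr_eq) (auto simp: eq measurable_completion)
  finally show "lebesgue = density (distr lebesgue lebesgue T) (\<lambda>_. ennreal ((cmod c)\<^sup>2))" .
qed

lemma AE_mult_complex:
  fixes c :: complex
  assumes c: "c \<noteq> 0" and P: "AE w in lebesgue. P w"
  shows "AE z in lebesgue. P (c * z)"
proof -
  have "AE w in density (distr lebesgue lebesgue (\<lambda>z. c * z)) (\<lambda>_. ennreal ((cmod c)\<^sup>2)). P w"
    using P by (simp only: lebesgue_mult_complex[OF c, symmetric])
  then have "AE w in distr lebesgue lebesgue (\<lambda>z. c * z). P w"
    using c by (simp add: AE_density)
  then show ?thesis by (rule AE_distrD[OF measurable_mult_complex[OF c]])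
qed

lemma
  fixes c :: complex and h :: "complex \<Rightarrow> 'a::euclidean_space"
  assumes c: "c \<noteq> 0" and h [measurable]: "h \<in> borel_measurable lebesgue"
  shows integral_mult_complex: "(LINT w|lebesgue. h w) = (cmod c)\<^sup>2 *\<^sub>R (LINT z|lebesgue. h (c * z))"
    and integrable_mult_complex: "integrable lebesgue h \<longleftrightarrow> integrable lebesgue (\<lambda>z. h (c * z))"
proof -
  let ?D = "distr lebesgue lebesgue (\<lambda>z. c * z)"
  have hD: "h \<in> borel_measurable ?D" using h by simp
  have "(LINT w|lebesgue. h w) = (LINT w|density ?D (\<lambda>_. ennreal ((cmod c)\<^sup>2)). h w)"
    using lebesgue_mult_complex[OF c] by simp
  also have "\<dots> = (LINT w|?D. (cmod c)\<^sup>2 *\<^sub>R h w)" by (rule integral_density) (use hD in auto)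
  also have "\<dots> = (cmod c)\<^sup>2 *\<^sub>R (LINT w|?D. h w)" by (rule integral_scaleR_right)
  also have "(LINT w|?D. h w) = (LINT z|lebesgue. h (c * z))"
    by (rule integral_distr[OF measurable_mult_complex[OF c] h])
  finally show "(LINT w|lebesgue. h w) = (cmod c)\<^sup>2 *\<^sub>R (LINT z|lebesgue. h (c * z))" .
  have "integrable lebesgue h \<longleftrightarrow> integrable (density ?D (\<lambda>_. ennreal ((cmod c)\<^sup>2))) h"
    using lebesgue_mult_complex[OF c] by simp
  also have "\<dots> \<longleftrightarrow> integrable ?D (\<lambda>w. (cmod c)\<^sup>2 *\<^sub>R h w)" by (rule integrable_density) (use hD in auto)
  also have "\<dots> \<longleftrightarrow> integrable ?D h"
  proof
    assume "integrable ?D (\<lambda>w. (cmod c)\<^sup>2 *\<^sub>R h w)"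
    then have "integrable ?D (\<lambda>w. inverse ((cmod c)\<^sup>2) *\<^sub>R ((cmod c)\<^sup>2 *\<^sub>R h w))" by (rule integrable_scaleR_right)
    then show "integrable ?D h" using c by simp
  qed (rule integrable_scaleR_right)
  also have "\<dots> \<longleftrightarrow> integrable lebesgue (\<lambda>z. h (c * z))"
    by (rule integrable_distr_eq[OF measurable_mult_complex[OF c] h])
  finally show "integrable lebesgue h \<longleftrightarrow> integrable lebesgue (\<lambda>z. h (c * z))" .
qed

section \<open>Test functions and weak derivatives under rescaling\<close>

lemma times_cont_diff_mult:
  fixes c :: complex
  shows "times_cont_diff k \<phi> \<Longrightarrow> times_cont_diff k (\<lambda>z. \<phi> (c * z))"
proof (induction k arbitrary: \<phi>)
  case 0
  then show ?case by (auto intro: continuous_on_compose2[of UNIV \<phi>] continuous_intros)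
next
  case (Suc k)
  have D: "((\<lambda>z. \<phi> (c * z)) has_derivative (\<lambda>v. frechet_derivative \<phi> (at (c * z)) (c * v))) (at z)" for z
  proof -
    have "(\<phi> has_derivative frechet_derivative \<phi> (at (c * z))) (at (c * z))"
      using Suc.prems by (simp add: frechet_derivative_works[symmetric])
    moreover have "((\<lambda>z. c * z) has_derivative (\<lambda>v. c * v)) (at z)" by (auto intro!: derivative_eq_intros)
    ultimately show ?thesis using has_derivative_compose[of "\<lambda>z. c * z" "\<lambda>v. c * v" z UNIV \<phi>] by simp
  qed
  have "times_cont_diff k (\<lambda>z. frechet_derivative \<phi> (at (c * z)) (c * v))" for v
    using Suc.IH[of "\<lambda>z. frechet_derivative \<phi> (at z) (c * v)"] Suc.prems by simp
  moreover have "frechet_derivative (\<lambda>z. \<phi> (c * z)) (at z) v = frechet_derivative \<phi> (at (c * z)) (c * v)" for z v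
    using frechet_derivative_at[OF D] by metis
  moreover have "(\<lambda>z. \<phi> (c * z)) differentiable (at z)" for z by (rule differentiableI[OF D])
  ultimately show ?case by simp
qed

lemma test_function_mult:
  fixes c :: complex
  assumes c: "c \<noteq> 0" and \<phi>: "test_function \<Omega> \<phi>" and \<Omega>: "\<And>z. z \<in> \<Omega> \<Longrightarrow> c * z \<in> \<Omega>'"
  shows "test_function \<Omega>' (\<lambda>w. \<phi> (w / c))"
proof -
  obtain S where S: "compact S" "S \<subseteq> \<Omega>" "\<And>z. z \<notin> S \<Longrightarrow> \<phi> z = 0" using test_function_support[OF \<phi>] by blast
  define S' where "S' = (\<lambda>z. c * z) ` S"
  have S': "compact S'" unfolding S'_def by (intro compact_continuous_image continuous_intros S)
  have "w \<in> S'" if "\<phi> (w / c) \<noteq> 0" for w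
    using S(3)[of "w / c"] that c by (auto simp: S'_def image_iff intro!: bexI[of _ "w / c"])
  then have cl: "closure {w. \<phi> (w / c) \<noteq> 0} \<subseteq> S'"
    by (intro closure_minimal compact_imp_closed[OF S']) auto
  then have "compact (closure {w. \<phi> (w / c) \<noteq> 0})"
    using S' bounded_subset[OF compact_imp_bounded[OF S']] by (simp add: compact_eq_bounded_closed)
  moreover have "S' \<subseteq> \<Omega>'" using S(2) \<Omega> by (auto simp: S'_def)
  moreover have "times_cont_diff k (\<lambda>w. \<phi> (w / c))" for k
  proof -
    have "times_cont_diff k \<phi>" using \<phi> by (simp add: test_function_def)
    from times_cont_diff_mult[OF this, of "1 / c"] show ?thesis by simp
  qed
  ultimately show ?thesis using cl unfolding test_function_def by blast
qed

lemma L2_loc_add: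
  assumes "L2_loc \<Omega> u" "L2_loc \<Omega> v"
  shows "L2_loc \<Omega> (\<lambda>z. a * u z + b * v z)"
  unfolding L2_loc_def
proof (intro conjI allI impI)
  have [measurable]: "(\<lambda>z. indicat_real \<Omega> z *\<^sub>R u z) \<in> borel_measurable lebesgue" "(\<lambda>z. indicat_real \<Omega> z *\<^sub>R v z) \<in> borel_measurable lebesgue"
    using assms by (auto simp: L2_loc_def set_borel_measurable_def)
  have "(\<lambda>z. a * (indicat_real \<Omega> z *\<^sub>R u z) + b * (indicat_real \<Omega> z *\<^sub>R v z)) \<in> borel_measurable lebesgue" by measurable
  also have "(\<lambda>z. a * (indicat_real \<Omega> z *\<^sub>R u z) + b * (indicat_real \<Omega> z *\<^sub>R v z)) = (\<lambda>z. indicat_real \<Omega> z *\<^sub>R (a * u z + b * v z))"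
    by (simp add: fun_eq_iff scaleR_add_right)
  finally show "set_borel_measurable lebesgue \<Omega> (\<lambda>z. a * u z + b * v z)" by (simp add: set_borel_measurable_def)
  fix K assume K: "compact K \<and> K \<subseteq> \<Omega>"
  note s = L2_loc_sqint[OF assms(1) conjunct1[OF K] conjunct2[OF K]] L2_loc_sqint[OF assms(2) conjunct1[OF K] conjunct2[OF K]]
  have "sqint (lebesgue_on K) (\<lambda>z. a * u z + b * v z)"
    by (intro sqint_add sqint_linear[OF bounded_linear_mult_right] s)
  then show "set_integrable lebesgue K (\<lambda>z. (norm (a * u z + b * v z))\<^sup>2)"
    using compact_sets_lebesgue[of K] K by (simp add: sqint_def set_integrable_def integrable_restrict_space)
qed

lemma L2_loc_mult:
  fixes c :: complex
  assumes c: "c \<noteq> 0" and u: "L2_loc \<Omega>' u" and \<Omega>: "\<Omega> \<in> sets lebesgue" "\<And>z. z \<in> \<Omega> \<Longrightarrow> c * z \<in> \<Omega>'"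
  shows "L2_loc \<Omega> (\<lambda>z. u (c * z))"
  unfolding L2_loc_def
proof (intro conjI allI impI)
  note T = measurable_mult_complex[OF c]
  have m: "(\<lambda>z. indicat_real \<Omega>' z *\<^sub>R u z) \<in> borel_measurable lebesgue"
    using u by (auto simp: L2_loc_def set_borel_measurable_def)
  have "(\<lambda>z. indicat_real \<Omega> z *\<^sub>R (indicat_real \<Omega>' (c * z) *\<^sub>R u (c * z))) \<in> borel_measurable lebesgue"
    by (rule borel_measurable_scaleR[OF borel_measurable_indicator[OF \<Omega>(1)] measurable_compose[OF T m]])
  also have "(\<lambda>z. indicat_real \<Omega> z *\<^sub>R (indicat_real \<Omega>' (c * z) *\<^sub>R u (c * z))) = (\<lambda>z. indicat_real \<Omega> z *\<^sub>R u (c * z))"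
    using \<Omega>(2) by (auto simp: fun_eq_iff indicator_def)
  finally show "set_borel_measurable lebesgue \<Omega> (\<lambda>z. u (c * z))" by (simp add: set_borel_measurable_def)
  fix K assume K: "compact K \<and> K \<subseteq> \<Omega>"
  define K' where "K' = (\<lambda>z. c * z) ` K"
  have K': "compact K'" "K' \<subseteq> \<Omega>'" using K \<Omega>(2) unfolding K'_def by (auto intro!: compact_continuous_image continuous_intros)
  have "integrable lebesgue (\<lambda>z. indicat_real K' z *\<^sub>R (norm (u z))\<^sup>2)"
    using u K' by (auto simp: L2_loc_def set_integrable_def)
  then have "integrable lebesgue (\<lambda>z. indicat_real K' (c * z) *\<^sub>R (norm (u (c * z)))\<^sup>2)"
    by (subst (asm) integrable_mult_complex[OF c]) (use borel_measurable_integrable[OF \<open>integrable lebesgue _\<close>] in auto)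
  moreover have "indicat_real K' (c * z) = indicat_real K z" for z using c by (auto simp: K'_def indicator_def)
  ultimately show "set_integrable lebesgue K (\<lambda>z. (norm (u (c * z)))\<^sup>2)" by (simp add: set_integrable_def)
qed

lemma L2_loc_continuous:
  assumes "open \<Omega>" "continuous_on \<Omega> h"
  shows "L2_loc \<Omega> h"
  unfolding L2_loc_def
proof (intro conjI allI impI)
  have "h \<in> borel_measurable (lebesgue_on \<Omega>)"
    by (rule continuous_imp_measurable_on_sets_lebesgue) (use assms in auto)
  then show "set_borel_measurable lebesgue \<Omega> h"
    using assms(1) by (simp add: set_borel_measurable_def borel_measurable_restrict_space_iff)
  fix K assume K: "compact K \<and> K \<subseteq> \<Omega>"
  then have "sqint (lebesgue_on K) h" using continuous_on_subset[OF assms(2)] by (intro continuous_on_compact_sqint) auto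
  then show "set_integrable lebesgue K (\<lambda>z. (norm (h z))\<^sup>2)"
    using compact_sets_lebesgue[of K] K by (simp add: sqint_def set_integrable_def integrable_restrict_space)
qed

text \<open>The derivative of f(c z) in direction v is that of f in direction c v, taken at c z. The
  test function is transported to \<psi>(w) = \<phi>(w / c), and the change of variables puts the
  same factor |c|^(-2) on both sides.\<close>

lemma weak_deriv_mult:
  fixes c d :: complex
  assumes c: "c \<noteq> 0" and \<Omega>: "\<And>z. z \<in> \<Omega> \<Longrightarrow> c * z \<in> \<Omega>'"
    and f: "L2_loc \<Omega>' f" "L2_loc \<Omega>' fx" "L2_loc \<Omega>' fy"
    and W: "weak_deriv \<Omega>' 1 f fx" "weak_deriv \<Omega>' \<i> f fy"
    and g: "g = (\<lambda>z. d * (Re (c * v) *\<^sub>R fx (c * z) + Im (c * v) *\<^sub>R fy (c * z)))"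
  shows "weak_deriv \<Omega> v (\<lambda>z. d * f (c * z)) g"
  unfolding weak_deriv_def
proof (intro allI impI)
  fix \<phi> assume \<phi>: "test_function \<Omega> \<phi>"
  define \<psi> where "\<psi> w = \<phi> (w / c)" for w
  have \<psi>: "test_function \<Omega>' \<psi>" unfolding \<psi>_def by (rule test_function_mult[OF c \<phi> \<Omega>])
  note C\<phi> = test_function_C1p[OF \<phi>]
  define \<psi>x where "\<psi>x w = frechet_derivative \<psi> (at w) 1" for w
  define \<psi>y where "\<psi>y w = frechet_derivative \<psi> (at w) \<i>" for w
  have C: "C1p \<psi> \<psi>x \<psi>y" using test_function_C1p[OF \<psi>] by (simp add: \<psi>x_def[abs_def] \<psi>y_def[abs_def])
  have D: "frechet_derivative \<phi> (at z) v = Re (c * v) *\<^sub>R \<psi>x (c * z) + Im (c * v) *\<^sub>R \<psi>y (c * z)" for z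
  proof -
    have "((\<lambda>z. \<psi> (c * z)) has_derivative (\<lambda>h. Re (c * h) *\<^sub>R \<psi>x (c * z) + Im (c * h) *\<^sub>R \<psi>y (c * z))) (at z)"
    proof -
      have "((\<lambda>z. c * z) has_derivative (\<lambda>v. c * v)) (at z)" by (auto intro!: derivative_eq_intros)
      from has_derivative_compose[OF this C1p_D[OF C]] show ?thesis by simp
    qed
    moreover have "(\<lambda>z. \<psi> (c * z)) = \<phi>" using c by (simp add: \<psi>_def fun_eq_iff)
    ultimately have "(\<phi> has_derivative (\<lambda>h. Re (c * h) *\<^sub>R \<psi>x (c * z) + Im (c * h) *\<^sub>R \<psi>y (c * z))) (at z)" by simp
    from frechet_derivative_at[OF this] show ?thesis by metis
  qed
  obtain S where S: "compact S" "S \<subseteq> \<Omega>'" "\<And>z. z \<notin> S \<Longrightarrow> \<psi> z = 0" using test_function_support[OF \<psi>] by blast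
  let ?M = "lebesgue_on S"
  have out: "\<psi>x z = 0" "\<psi>y z = 0" if "z \<notin> S" for z
    using C1p_zero_outside[OF C compact_imp_closed[OF S(1)] S(3) that] by auto
  obtain S0 where S0: "compact S0" "S0 \<subseteq> \<Omega>" "\<And>z. z \<notin> S0 \<Longrightarrow> \<phi> z = 0" using test_function_support[OF \<phi>] by blast
  have fin: "finite_measure ?M" by (rule finite_measure_lebesgue_on_compact[OF S(1)])
  have i: "integrable ?M u" if "L2_loc \<Omega>' u" for u
    using L2lim_imp_L1lim[OF fin L2lim_const[OF L2_loc_sqint[OF that S(1,2)]]] by (simp add: L1lim_def)
  \<comment> \<open>One change of variables for both sides of the identity: it is applied to the
    derivative of the test function and to the test function itself.\<close>
  have cov: "(LINT z:\<Omega>|lebesgue. k (c * z) *\<^sub>R (d * u (c * z))) = inverse ((cmod c)\<^sup>2) *\<^sub>R (d * (LINT w|?M. k w *\<^sub>R u w))"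
    if k: "continuous_on S k" "\<And>w. w \<notin> S \<Longrightarrow> k w = 0" "\<And>z. z \<notin> \<Omega> \<Longrightarrow> k (c * z) = 0" and u: "integrable ?M u"
    for k :: "complex \<Rightarrow> real" and u :: "complex \<Rightarrow> complex"
  proof -
    have "integrable ?M (\<lambda>w. k w *\<^sub>R u w)" by (rule integrable_continuous_scaleR[OF S(1) k(1) u])
    then have "integrable lebesgue (\<lambda>w. indicat_real S w *\<^sub>R (k w *\<^sub>R u w))"
      using compact_sets_lebesgue[OF S(1)] by (simp add: integrable_restrict_space)
    also have "(\<lambda>w. indicat_real S w *\<^sub>R (k w *\<^sub>R u w)) = (\<lambda>w. k w *\<^sub>R u w)"
      using k(2) by (auto simp: fun_eq_iff indicator_def)
    finally have m: "(\<lambda>w. k w *\<^sub>R u w) \<in> borel_measurable lebesgue" by (rule borel_measurable_integrable)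
    have "(LINT z:\<Omega>|lebesgue. k (c * z) *\<^sub>R (d * u (c * z))) = (LINT z|lebesgue. d * (k (c * z) *\<^sub>R u (c * z)))"
      unfolding set_lebesgue_integral_def
      by (intro Bochner_Integration.integral_cong refl) (use k(3) in \<open>auto simp: indicator_def\<close>)
    also have "\<dots> = d * (LINT z|lebesgue. k (c * z) *\<^sub>R u (c * z))" by (rule integral_mult_right_zero)
    also have "(LINT z|lebesgue. k (c * z) *\<^sub>R u (c * z)) = inverse ((cmod c)\<^sup>2) *\<^sub>R (LINT w|lebesgue. k w *\<^sub>R u w)"
      unfolding integral_mult_complex[OF c m] using c by simp
    also have "(LINT w|lebesgue. k w *\<^sub>R u w) = (LINT w|?M. k w *\<^sub>R u w)"
      by (rule integral_lebesgue_on_vanishing[symmetric]) (use S k compact_sets_lebesgue in auto)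
    finally show ?thesis by simp
  qed
  have outz: "\<psi> (c * z) = 0" "frechet_derivative \<phi> (at z) v = 0" if "z \<notin> \<Omega>" for z
  proof -
    have z: "z \<notin> S0" using that S0(2) by blast
    show "\<psi> (c * z) = 0" using S0(3)[OF z] c by (simp add: \<psi>_def)
    show "frechet_derivative \<phi> (at z) v = 0"
      using frechet_derivative_C1p[OF C\<phi>, of z v] C1p_zero_outside[OF C\<phi> compact_imp_closed[OF S0(1)] S0(3) z] by simp
  qed
  define k where "k w = Re (c * v) *\<^sub>R \<psi>x w + Im (c * v) *\<^sub>R \<psi>y w" for w
  note cC = C1p_continuous[OF C, of S]
  have kc: "continuous_on S k" unfolding k_def[abs_def] by (intro continuous_intros cC)
  have k0: "k w = 0" if "w \<notin> S" for w using out[OF that] by (simp add: k_def)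
  have Dk: "frechet_derivative \<phi> (at z) v = k (c * z)" for z by (simp only: D k_def)
  have k0': "k (c * z) = 0" if "z \<notin> \<Omega>" for z using outz(2)[OF that] by (simp add: Dk)
  define u where "u w = Re (c * v) *\<^sub>R fx w + Im (c * v) *\<^sub>R fy w" for w
  have iu: "integrable ?M u" unfolding u_def[abs_def]
    by (intro Bochner_Integration.integrable_add integrable_scaleR_right i f)
  note ij = integrable_continuous_scaleR[OF S(1)]
  have wk: "(LINT w|?M. k w *\<^sub>R f w) = - (LINT w|?M. \<psi> w *\<^sub>R u w)"
  proof -
    have wK: "(LINT w|?M. \<psi>x w *\<^sub>R f w) = - (LINT w|?M. \<psi> w *\<^sub>R fx w)"
      "(LINT w|?M. \<psi>y w *\<^sub>R f w) = - (LINT w|?M. \<psi> w *\<^sub>R fy w)"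
      by (rule weakKD[OF weak_deriv_weakK[OF W S(1,2)] C \<psi> S(3)], assumption)+
    have "(LINT w|?M. k w *\<^sub>R f w) = (LINT w|?M. Re (c * v) *\<^sub>R (\<psi>x w *\<^sub>R f w) + Im (c * v) *\<^sub>R (\<psi>y w *\<^sub>R f w))"
      by (intro Bochner_Integration.integral_cong refl) (simp add: k_def algebra_simps)
    also have "\<dots> = (LINT w|?M. Re (c * v) *\<^sub>R (\<psi>x w *\<^sub>R f w)) + (LINT w|?M. Im (c * v) *\<^sub>R (\<psi>y w *\<^sub>R f w))"
      by (intro Bochner_Integration.integral_add integrable_scaleR_right ij cC i f)
    also have "\<dots> = Re (c * v) *\<^sub>R (- (LINT w|?M. \<psi> w *\<^sub>R fx w)) + Im (c * v) *\<^sub>R (- (LINT w|?M. \<psi> w *\<^sub>R fy w))"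
      by (simp only: integral_scaleR_right wK)
    also have "\<dots> = - ((LINT w|?M. Re (c * v) *\<^sub>R (\<psi> w *\<^sub>R fx w)) + (LINT w|?M. Im (c * v) *\<^sub>R (\<psi> w *\<^sub>R fy w)))"
      by (simp only: integral_scaleR_right) simp
    also have "\<dots> = - (LINT w|?M. Re (c * v) *\<^sub>R (\<psi> w *\<^sub>R fx w) + Im (c * v) *\<^sub>R (\<psi> w *\<^sub>R fy w))"
      by (intro arg_cong[of _ _ uminus] Bochner_Integration.integral_add[symmetric] integrable_scaleR_right ij cC i f)
    also have "(LINT w|?M. Re (c * v) *\<^sub>R (\<psi> w *\<^sub>R fx w) + Im (c * v) *\<^sub>R (\<psi> w *\<^sub>R fy w)) = (LINT w|?M. \<psi> w *\<^sub>R u w)"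
      by (intro Bochner_Integration.integral_cong refl) (simp add: u_def algebra_simps)
    finally show ?thesis .
  qed
  have "(LINT z:\<Omega>|lebesgue. frechet_derivative \<phi> (at z) v *\<^sub>R (d * f (c * z))) = inverse ((cmod c)\<^sup>2) *\<^sub>R (d * (LINT w|?M. k w *\<^sub>R f w))"
    unfolding Dk by (rule cov[OF kc k0 k0' i[OF f(1)]])
  also have "\<dots> = - (inverse ((cmod c)\<^sup>2) *\<^sub>R (d * (LINT w|?M. \<psi> w *\<^sub>R u w)))" by (simp add: wk)
  also have "inverse ((cmod c)\<^sup>2) *\<^sub>R (d * (LINT w|?M. \<psi> w *\<^sub>R u w)) = (LINT z:\<Omega>|lebesgue. \<psi> (c * z) *\<^sub>R (d * u (c * z)))"
    by (rule cov[OF cC(1) S(3) outz(1) iu, symmetric])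
  also have "(\<lambda>z. \<psi> (c * z) *\<^sub>R (d * u (c * z))) = (\<lambda>z. \<phi> z *\<^sub>R g z)"
    using c by (simp add: fun_eq_iff \<psi>_def u_def g)
  finally show "(LINT z:\<Omega>|lebesgue. frechet_derivative \<phi> (at z) v *\<^sub>R (d * f (c * z))) = - (LINT z:\<Omega>|lebesgue. \<phi> z *\<^sub>R g z)" .
qed

text \<open>Precomposition with z -> c z and multiplication by d are conformal or, for d = 0,
  trivial: both sides of the distortion inequality get multiplied by |c d|^2, so K is
  unchanged.\<close>

lemma K_quasiregular_on_mult:
  fixes c d :: complex
  assumes K: "K \<ge> 1" and f: "K_quasiregular_on K \<Omega>' f" and c: "c \<noteq> 0"
    and \<Omega>: "open \<Omega>" "connected \<Omega>" "\<Omega> \<noteq> {}" "\<And>z. z \<in> \<Omega> \<Longrightarrow> c * z \<in> \<Omega>'"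
  shows "K_quasiregular_on K \<Omega> (\<lambda>z. d * f (c * z))"
proof -
  obtain fx fy where fc: "continuous_on \<Omega>' f" and W: "W12_loc \<Omega>' f fx fy"
    and ae: "AE z in lebesgue. z \<in> \<Omega>' \<longrightarrow> (norm (fx z))\<^sup>2 + (norm (fy z))\<^sup>2 \<le> (K + 1 / K) * Jac (fx z) (fy z)"
    using f unfolding K_quasiregular_on_iff[OF K] by (elim conjE exE)
  have L: "L2_loc \<Omega>' f" "L2_loc \<Omega>' fx" "L2_loc \<Omega>' fy" and wd: "weak_deriv \<Omega>' 1 f fx" "weak_deriv \<Omega>' \<i> f fy"
    using W by (auto simp: W12_loc_def)
  have m\<Omega>: "\<Omega> \<in> sets lebesgue" using \<Omega>(1) by auto
  define gx where "gx z = d * (Re c *\<^sub>R fx (c * z) + Im c *\<^sub>R fy (c * z))" for z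
  define gy where "gy z = d * ((- Im c) *\<^sub>R fx (c * z) + Re c *\<^sub>R fy (c * z))" for z
  have gc: "continuous_on \<Omega> (\<lambda>z. d * f (c * z))"
    by (intro continuous_intros continuous_on_compose2[OF fc]) (use \<Omega>(4) in auto)
  have Lu: "L2_loc \<Omega> (\<lambda>z. fx (c * z))" "L2_loc \<Omega> (\<lambda>z. fy (c * z))"
    using L2_loc_mult[OF c L(2) m\<Omega> \<Omega>(4)] L2_loc_mult[OF c L(3) m\<Omega> \<Omega>(4)] by auto
  have "L2_loc \<Omega> gx"
    using L2_loc_add[OF Lu, of "d * of_real (Re c)" "d * of_real (Im c)"]
    by (simp add: gx_def[abs_def] scaleR_conv_of_real algebra_simps)
  moreover have "L2_loc \<Omega> gy"
    using L2_loc_add[OF Lu, of "d * of_real (- Im c)" "d * of_real (Re c)"]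
    by (simp add: gy_def[abs_def] scaleR_conv_of_real algebra_simps)
  moreover have "weak_deriv \<Omega> 1 (\<lambda>z. d * f (c * z)) gx"
    by (rule weak_deriv_mult[OF c \<Omega>(4) L wd]) (simp_all add: gx_def[abs_def])
  moreover have "weak_deriv \<Omega> \<i> (\<lambda>z. d * f (c * z)) gy"
    by (rule weak_deriv_mult[OF c \<Omega>(4) L wd]) (simp_all add: gy_def[abs_def])
  ultimately have "W12_loc \<Omega> (\<lambda>z. d * f (c * z)) gx gy"
    using L2_loc_continuous[OF \<Omega>(1) gc] by (simp add: W12_loc_def)
  moreover have "AE z in lebesgue. z \<in> \<Omega> \<longrightarrow> (norm (gx z))\<^sup>2 + (norm (gy z))\<^sup>2 \<le> (K + 1 / K) * Jac (gx z) (gy z)"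
    using AE_mult_complex[OF c ae]
  proof eventually_elim
    case (elim z)
    \<comment> \<open>The new gradient is the old one times the matrix of c, a rotation scaled by
      |c|, and then times d; \<open>N\<close> and \<open>J\<close> are the corresponding identities
      for the energy and the Jacobian.\<close>
    have N: "(norm (d * (s *\<^sub>R a + t *\<^sub>R b)))\<^sup>2 + (norm (d * ((- t) *\<^sub>R a + s *\<^sub>R b)))\<^sup>2 = (norm d)\<^sup>2 * (s\<^sup>2 + t\<^sup>2) * ((norm a)\<^sup>2 + (norm b)\<^sup>2)"
      for a b :: complex and s t :: real
      unfolding norm_mult power_mult_distrib cmod_power2[of "_ + _"] cmod_power2[of a] cmod_power2[of b]
      by (simp add: power2_eq_square) algebra
    have J: "Jac (d * (s *\<^sub>R a + t *\<^sub>R b)) (d * ((- t) *\<^sub>R a + s *\<^sub>R b)) = (norm d)\<^sup>2 * (s\<^sup>2 + t\<^sup>2) * Jac a b"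
      for a b :: complex and s t :: real
      unfolding Jac_def cmod_power2 by (simp add: power2_eq_square) algebra
    show ?case
    proof
      assume "z \<in> \<Omega>"
      then have "(norm (fx (c * z)))\<^sup>2 + (norm (fy (c * z)))\<^sup>2 \<le> (K + 1 / K) * Jac (fx (c * z)) (fy (c * z))"
        using elim \<Omega>(4) by auto
      then have "(norm d)\<^sup>2 * ((Re c)\<^sup>2 + (Im c)\<^sup>2) * ((norm (fx (c * z)))\<^sup>2 + (norm (fy (c * z)))\<^sup>2) \<le>
         (norm d)\<^sup>2 * ((Re c)\<^sup>2 + (Im c)\<^sup>2) * ((K + 1 / K) * Jac (fx (c * z)) (fy (c * z)))"
        by (rule mult_left_mono) simp
      then show "(norm (gx z))\<^sup>2 + (norm (gy z))\<^sup>2 \<le> (K + 1 / K) * Jac (gx z) (gy z)"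
        unfolding gx_def gy_def N J by (simp only: mult_ac)
    qed
  qed
  ultimately show ?thesis unfolding K_quasiregular_on_iff[OF K] using \<Omega> gc by blast
qed

section \<open>The rescaled family\<close>

text \<open>The exponent is real, so the modulus of a power depends only on the real part of the
  logarithm, which all choices share.\<close>

lemma cmod_cpow_values:
  assumes "w \<in> cpow_values z a"
  shows "cmod w = cmod z powr a"
proof -
  obtain u where u: "w = exp (of_real a * u)" "exp u = z" using assms by (auto simp: cpow_values_def)
  have "cmod z powr a = exp (a * Re u)" unfolding u(2)[symmetric] by (simp add: powr_def)
  then show ?thesis by (simp add: u(1))
qed

text \<open>Compares the weight of the interior estimates with the pure power in the growth
  hypothesis.\<close>

lemma one_plus_sq_powr_le:
  fixes t p :: real
  assumes p: "p > 0" and t: "t \<ge> 0"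
  shows "(1 + t\<^sup>2) powr (p/2) \<le> 2 powr (p/2) * (1 + t powr p)"
proof (cases "t \<le> 1")
  case True
  then have "t\<^sup>2 \<le> 1" using t by (simp add: power_le_one)
  then have "(1 + t\<^sup>2) powr (p/2) \<le> 2 powr (p/2)" using p by (intro powr_mono2) auto
  also have "\<dots> * 1 \<le> 2 powr (p/2) * (1 + t powr p)" by (intro mult_left_mono) auto
  finally show ?thesis by simp
next
  case False
  then have "1 \<le> t\<^sup>2" using t by simp
  then have "(1 + t\<^sup>2) powr (p/2) \<le> (2 * t\<^sup>2) powr (p/2)" using p by (intro powr_mono2) auto
  also have "\<dots> = 2 powr (p/2) * (t powr 2) powr (p/2)" using False by (simp add: powr_mult)
  also have "(t powr 2) powr (p/2) = t powr p" by (simp only: powr_powr) simp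
  also have "2 powr (p/2) * t powr p \<le> 2 powr (p/2) * (1 + t powr p)" by (intro mult_left_mono) auto
  finally show ?thesis .
qed

text \<open>For small l the scaling factors cancel: |d|^p = |l|^(-q), the area contributes |l|^(-2),
  and the hypothesis gives |l|^(2+q). The other l are bounded away from 0, and l z stays in a
  compact disc on which f is bounded.\<close>

lemma rescaled_integral_bound:
  fixes f :: "complex \<Rightarrow> complex" and p q C :: real
  assumes f: "continuous_on (ball 0 1) f" and p: "p > 0" and q: "q > 0"
    and small: "\<forall>\<^sub>F \<epsilon> in at_right 0. (LINT z:ball 0 \<epsilon>|lebesgue. norm (f z) powr p) \<le> C * \<epsilon> powr (2 + q)"
  shows "\<exists>V. \<forall>l d. l \<in> ball 0 1 - {0} \<longrightarrow> cmod d = cmod l powr (- (q / p)) \<longrightarrow>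
     (LINT z|lebesgue_on (cdisc j). (1 + (cmod (d * f (l * z)))\<^sup>2) powr (p/2)) \<le> V"
proof -
  obtain \<delta> where \<delta>: "0 < \<delta>" and C: "\<And>\<epsilon>. 0 < \<epsilon> \<Longrightarrow> \<epsilon> < \<delta> \<Longrightarrow>
      (LINT z:ball 0 \<epsilon>|lebesgue. norm (f z) powr p) \<le> C * \<epsilon> powr (2 + q)"
    using small unfolding eventually_at_right_field by auto
  let ?K = "cdisc j"
  note K = disc_props(1)[of j] and K1 = disc_props(2)[of j]
  have mK: "?K \<in> sets lebesgue" by (rule compact_sets_lebesgue[OF K])
  interpret finite_measure "lebesgue_on ?K" by (rule finite_measure_lebesgue_on_compact[OF K])
  define m where "m = measure lebesgue ?K"
  have "compact (f ` ?K)" by (intro compact_continuous_image K continuous_on_subset[OF f K1])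
  then obtain M where M: "\<And>z. z \<in> ?K \<Longrightarrow> cmod (f z) \<le> M"
    using compact_imp_bounded bounded_iff by (metis imageI)
  \<comment> \<open>The first entry serves |l| < \<delta>, the second one |l| >= \<delta>.\<close>
  define B where "B = max C (m * (\<delta> powr (- q) * \<bar>M\<bar> powr p))"
  have pc: "continuous_on S (\<lambda>z. cmod (g z) powr p)" if "continuous_on S g" for S and g :: "complex \<Rightarrow> complex"
    using p by (intro continuous_on_powr' continuous_intros that) auto
  have "(LINT z|lebesgue_on ?K. (1 + (cmod (d * f (l * z)))\<^sup>2) powr (p/2)) \<le> 2 powr (p/2) * (m + B)"
    if l: "l \<in> ball 0 1 - {0}" and d: "cmod d = cmod l powr (- (q / p))" for l d
  proof -
    have l0: "0 < cmod l" "cmod l < 1" using l by auto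
    have dp: "cmod d powr p = cmod l powr (- q)" using p by (simp add: d powr_powr)
    have lz: "l * z \<in> ?K" if "z \<in> ?K" for z
    proof -
      have "cmod l * cmod z \<le> 1 * cmod z" using l0 by (intro mult_right_mono) auto
      then show ?thesis using that by (simp add: cdisc_def norm_mult)
    qed
    have gc: "continuous_on ?K (\<lambda>z. d * f (l * z))"
      by (intro continuous_intros continuous_on_compose2[OF f]) (use lz K1 in auto)
    have p0: "1 + (cmod w)\<^sup>2 \<noteq> 0" for w using zero_le_power2[of "cmod w"] by linarith
    have ig: "integrable (lebesgue_on ?K) (\<lambda>z. cmod (d * f (l * z)) powr p)"
      by (rule continuous_on_compact_integrable[OF K pc[OF gc]])
    have split: "cmod (d * f (l * z)) powr p = cmod l powr (- q) * cmod (f (l * z)) powr p" for z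
      by (simp add: norm_mult powr_mult dp)
    have main: "(LINT z|lebesgue_on ?K. cmod (d * f (l * z)) powr p) \<le> B"
    proof (cases "cmod l < \<delta>")
      case True
      \<comment> \<open>The cut is made at radius |l| because l z lies in that ball for every z in
        \<open>cdisc j\<close>, and the growth hypothesis is used with this radius.\<close>
      define h where "h w = indicat_real (ball 0 (cmod l)) w *\<^sub>R (cmod (f w) powr p)" for w
      have "integrable (lebesgue_on (cball 0 (cmod l))) (\<lambda>w. cmod (f w) powr p)"
        by (intro continuous_on_compact_integrable pc continuous_on_subset[OF f]) (use l0 in auto)
      then have "integrable (lebesgue_on (ball 0 (cmod l))) (\<lambda>w. cmod (f w) powr p)"
        by (rule lebesgue_on_subset_integrable) auto
      then have ih: "integrable lebesgue h"
        unfolding h_def[abs_def] by (simp add: integrable_restrict_space)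
      have l': "l \<noteq> 0" using l by simp
      note hm = borel_measurable_integrable[OF ih]
      have ihl: "integrable lebesgue (\<lambda>z. h (l * z))" using ih unfolding integrable_mult_complex[OF l' hm] .
      have ik: "integrable lebesgue (\<lambda>z. indicat_real ?K z *\<^sub>R (cmod (f (l * z)) powr p))"
      proof -
        have "continuous_on ?K (\<lambda>z. f (l * z))"
          by (intro continuous_intros continuous_on_compose2[OF f]) (use lz K1 in auto)
        from continuous_on_compact_integrable[OF K pc[OF this]] show ?thesis
          using mK by (simp add: integrable_restrict_space)
      qed
      have "(LINT z|lebesgue_on ?K. cmod (f (l * z)) powr p) = (LINT z|lebesgue. indicat_real ?K z *\<^sub>R (cmod (f (l * z)) powr p))"
        using mK by (simp add: integral_restrict_space)
      also have "\<dots> \<le> (LINT z|lebesgue. h (l * z))"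
      proof (rule integral_mono[OF ik ihl])
        fix z
        show "indicat_real ?K z *\<^sub>R (cmod (f (l * z)) powr p) \<le> h (l * z)"
        proof (cases "z \<in> ?K")
          case True
          then have "cmod z < 1" using K1 by auto
          then have "l * z \<in> ball 0 (cmod l)" using l0 by (simp add: norm_mult)
          then show ?thesis by (simp add: h_def indicator_def)
        qed (simp add: h_def)
      qed
      also have "\<dots> = (LINT w|lebesgue. h w) / (cmod l)\<^sup>2"
        using integral_mult_complex[OF l' hm] l' by simp
      also have "(LINT w|lebesgue. h w) = (LINT z:ball 0 (cmod l)|lebesgue. norm (f z) powr p)"
        by (simp add: h_def[abs_def] set_lebesgue_integral_def)
      also have "\<dots> / (cmod l)\<^sup>2 \<le> C * cmod l powr (2 + q) / (cmod l)\<^sup>2"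
        by (intro divide_right_mono C) (use l0 True in auto)
      also have "\<dots> = C * cmod l powr q" using l0 by (simp add: powr_add)
      finally have "cmod l powr (- q) * (LINT z|lebesgue_on ?K. cmod (f (l * z)) powr p) \<le> cmod l powr (- q) * (C * cmod l powr q)"
        by (intro mult_left_mono) auto
      also have "\<dots> = C" using l0 by (simp add: powr_minus)
      also have "\<dots> \<le> B" by (simp add: B_def)
      finally show ?thesis unfolding split by simp
    next
      case False
      have "(LINT z|lebesgue_on ?K. cmod (d * f (l * z)) powr p) \<le> (LINT z|lebesgue_on ?K. (\<delta> powr (- q) * \<bar>M\<bar> powr p))"
      proof (rule integral_mono[OF ig])
        fix z assume "z \<in> space (lebesgue_on ?K)"
        then have z: "l * z \<in> ?K" using lz by simp
        have "cmod l powr (- q) \<le> \<delta> powr (- q)" using False \<delta> q by (intro powr_mono2') auto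
        moreover have "cmod (f (l * z)) powr p \<le> \<bar>M\<bar> powr p" using M[OF z] p by (intro powr_mono2) auto
        ultimately show "cmod (d * f (l * z)) powr p \<le> (\<delta> powr (- q) * \<bar>M\<bar> powr p)"
          unfolding split by (simp add: mult_mono)
      qed simp
      also have "\<dots> = m * (\<delta> powr (- q) * \<bar>M\<bar> powr p)" using mK by (simp add: m_def measure_restrict_space)
      also have "\<dots> \<le> B" by (simp add: B_def)
      finally show ?thesis .
    qed
    have "(LINT z|lebesgue_on ?K. (1 + (cmod (d * f (l * z)))\<^sup>2) powr (p/2)) \<le>
       (LINT z|lebesgue_on ?K. 2 powr (p/2) * (1 + cmod (d * f (l * z)) powr p))"
      by (intro integral_mono one_plus_sq_powr_le p integrable_mult_right Bochner_Integration.integrable_add ig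
          continuous_on_compact_integrable K continuous_intros gc) (use p0 in auto)
    also have "\<dots> = 2 powr (p/2) * (m + (LINT z|lebesgue_on ?K. cmod (d * f (l * z)) powr p))"
      using ig mK by (simp add: m_def measure_restrict_space)
    also have "\<dots> \<le> 2 powr (p/2) * (m + B)" using main by (intro mult_left_mono add_left_mono) auto
    finally show ?thesis .
  qed
  then show ?thesis by blast
qed

theorem theorem3:
  fixes f pw :: "complex \<Rightarrow> complex" and p q C :: real
  assumes "quasiregular_on (ball 0 1) f"
    and "f 0 = 0"
    and "p > 0" and "q > 0"
    and "\<forall>\<^sub>F \<epsilon> in at_right 0.
           (LINT z:ball 0 \<epsilon>|lebesgue. norm (f z) powr p) \<le> C * \<epsilon> powr (2 + q)"
    and "\<And>l. l \<in> ball 0 1 - {0} \<Longrightarrow> pw l \<in> cpow_values l (q / p)"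
  defines "\<F> \<equiv> {(\<lambda>z. 1 / pw l * f (l * z)) | l. l \<in> ball 0 1 - {0}}"
  shows "(\<forall>g\<in>\<F>. quasiregular_on (ball 0 1) g) \<and>
         precompact_quasiregular (ball 0 1) \<F>"
proof -
  obtain K where K: "K \<ge> 1" and fK: "K_quasiregular_on K (ball 0 1) f"
    using assms(1) by (auto simp: quasiregular_on_def)
  have fc: "continuous_on (ball 0 1) f" using fK by (simp add: K_quasiregular_on_def)
  \<comment> \<open>The constant of the Jacobian form of K-quasiregularity; rescaling keeps K, so it
    is common to the whole family.\<close>
  define L where "L = K + 1 / K"
  have L: "L > 0" using K by (simp add: L_def add_pos_pos)
  have gK: "K_quasiregular_on K (ball 0 1) (\<lambda>z. 1 / pw l * f (l * z))" if "l \<in> ball 0 1 - {0}" for l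
  proof (rule K_quasiregular_on_mult[OF K fK])
    fix z :: complex assume "z \<in> ball 0 1"
    then have "cmod l * cmod z < 1 * 1" using that by (intro mult_strict_mono') auto
    then show "l * z \<in> ball 0 1" by (simp add: norm_mult)
  qed (use that in auto)
  have mem: "\<exists>l \<in> ball 0 1 - {0}. g = (\<lambda>z. 1 / pw l * f (l * z))" if "g \<in> \<F>" for g
    using that by (auto simp: \<F>_def)
  have gq: "quasiregular_on (ball 0 1) g" if "g \<in> \<F>" for g
    using mem[OF that] gK K by (auto simp: quasiregular_on_def)
  \<comment> \<open>Only the modulus of \<open>pw l\<close> enters, so the bound is independent of
    which value of the power was chosen.\<close>
  have bound: "\<exists>V. \<forall>g\<in>\<F>. (LINT z|lebesgue_on (cdisc j). (1 + (cmod (g z))\<^sup>2) powr (p/2)) \<le> V" for j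
  proof -
    obtain V where V: "\<forall>l d. l \<in> ball 0 1 - {0} \<longrightarrow> cmod d = cmod l powr (- (q / p)) \<longrightarrow>
       (LINT z|lebesgue_on (cdisc j). (1 + (cmod (d * f (l * z)))\<^sup>2) powr (p/2)) \<le> V"
      by (rule exE[OF rescaled_integral_bound[OF fc assms(3,4,5), of j]])
    have "(LINT z|lebesgue_on (cdisc j). (1 + (cmod (g z))\<^sup>2) powr (p/2)) \<le> V" if gF: "g \<in> \<F>" for g
    proof -
      obtain l where l: "l \<in> ball 0 1 - {0}" and g: "g = (\<lambda>z. 1 / pw l * f (l * z))"
        using mem[OF gF] by blast
      have "cmod (1 / pw l) = cmod l powr (- (q / p))"
        using cmod_cpow_values[OF assms(6)[OF l]] by (simp add: norm_divide powr_minus_divide)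
      from V[rule_format, OF l this] show ?thesis unfolding g .
    qed
    then show ?thesis by blast
  qed
  \<comment> \<open>The first alternative of \<open>precompact_quasiregular\<close> is established
    for every sequence: the limit satisfies the distortion inequality with the same K, and a
    constant limit does so with zero derivatives.\<close>
  have "\<exists>r::nat \<Rightarrow> nat. strict_mono r \<and> (\<exists>h. quasiregular_on (ball 0 1) h \<and> locally_uniform_limit (ball 0 1) (F \<circ> r) h)"
    if F: "\<And>n. F n \<in> \<F>" for F :: "nat \<Rightarrow> complex \<Rightarrow> complex"
  proof -
    have "\<exists>fx fy. W12_loc (ball 0 1) (F n) fx fy \<and>
       (AE z in lebesgue. z \<in> ball 0 1 \<longrightarrow> (norm (fx z))\<^sup>2 + (norm (fy z))\<^sup>2 \<le> L * Jac (fx z) (fy z))" for n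
    proof -
      have "K_quasiregular_on K (ball 0 1) (F n)" using mem[OF F[of n]] gK by metis
      then show ?thesis unfolding K_quasiregular_on_iff[OF K] L_def by (elim conjE)
    qed
    then have "\<forall>n. \<exists>fx fy. W12_loc (ball 0 1) (F n) fx fy \<and>
       (AE z in lebesgue. z \<in> ball 0 1 \<longrightarrow> (norm (fx z))\<^sup>2 + (norm (fy z))\<^sup>2 \<le> L * Jac (fx z) (fy z))" by (rule allI)
    then obtain Fx Fy where FF: "\<forall>n. W12_loc (ball 0 1) (F n) (Fx n) (Fy n) \<and>
       (AE z in lebesgue. z \<in> ball 0 1 \<longrightarrow> (norm (Fx n z))\<^sup>2 + (norm (Fy n z))\<^sup>2 \<le> L * Jac (Fx n z) (Fy n z))"
      unfolding choice_iff by (elim exE)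
    have W: "W12_loc (ball 0 1) (F n) (Fx n) (Fy n)" for n by (rule FF[rule_format, THEN conjunct1])
    have Fc: "continuous_on (ball 0 1) (F n)" for n
      using gq[OF F[of n]] by (auto simp: quasiregular_on_def K_quasiregular_on_def)
    have q: "qr_data L (ball 0 1) (F n) (Fx n) (Fy n)" for n
      unfolding qr_data_def
    proof (intro conjI allI impI)
      fix S :: "complex set" assume "compact S" "S \<subseteq> ball 0 1"
      then show "appr S (F n) (Fx n) (Fy n)" by (intro W12_loc_appr[OF open_ball Fc W])
    qed (use FF[rule_format, THEN conjunct2] in blast)
    have V: "\<exists>V. \<forall>n. (LINT z|lebesgue_on (cdisc j). (1 + (cmod (F n z))\<^sup>2) powr (p/2)) \<le> V" for j
    proof -
      obtain V where V: "\<forall>g\<in>\<F>. (LINT z|lebesgue_on (cdisc j). (1 + (cmod (g z))\<^sup>2) powr (p/2)) \<le> V"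
        by (rule exE[OF bound])
      show ?thesis by (rule exI[of _ V], rule allI, rule V[THEN bspec, OF F])
    qed
    obtain r :: "nat \<Rightarrow> nat" and h where r: "strict_mono r"
      and u: "\<forall>j. uniform_limit (cdisc j) (\<lambda>n. F (r n)) h sequentially" and hc: "continuous_on (ball 0 1) h"
      and hW: "\<exists>hx hy. W12_loc (ball 0 1) h hx hy \<and>
       (AE z in lebesgue. z \<in> ball 0 1 \<longrightarrow> (norm (hx z))\<^sup>2 + (norm (hy z))\<^sup>2 \<le> L * Jac (hx z) (hy z))"
      using qr_compactness[OF assms(3) L q W V] by (elim exE conjE) (rule that, assumption+, intro exI conjI)
    have "K_quasiregular_on K (ball 0 1) h"
      unfolding K_quasiregular_on_iff[OF K] using hc hW by (simp add: L_def)
    then have "quasiregular_on (ball 0 1) h" using K by (auto simp: quasiregular_on_def)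
    moreover have "locally_uniform_limit (ball 0 1) (F \<circ> r) h"
      unfolding locally_uniform_limit_def
    proof (intro allI impI)
      fix S :: "complex set" assume S: "compact S \<and> S \<subseteq> ball 0 1"
      obtain j where "S \<subseteq> disc j" using compact_subset_disc S by blast
      then have "S \<subseteq> cdisc j" using disc_props(3)[of j] by blast
      with u show "uniform_limit S (F \<circ> r) h sequentially"
        unfolding o_def using uniform_limit_on_subset by blast
    qed
    ultimately show ?thesis using r by blast
  qed
  then have "precompact_quasiregular (ball 0 1) \<F>"
    unfolding precompact_quasiregular_def by blast
  with gq show ?thesis by blast
qed

end
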